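(* Let $\Omega\subset\mathbb{R}^n$ be an irreducible symmetric cone of rank $r\ge 2$. Let $1\le p,q\le\infty$. Then $\mathbf{1}_\Omega$ is a local $(p,q)$-Fourier multiplier if and only if $1\le q\le 2\le p\le\infty$.
   Context: A symmetric cone $\Omega$ in $\mathbb{R}^n$ is an open convex cone that is self-dual with respect to the Euclidean inner product and homogeneous (the group of linear automorphisms of $\mathbb{R}^n$ preserving $\Omega$ acts transitively on $\Omega$); it is irreducible if it is not linearly equivalent to a product of two lower-dimensional symmetric cones. $V=\mathbb{R}^n$ then carries a structure of Euclidean Jordan algebra for which $\Omega$ is the interior of the set of squares; the rank $r$ of $\Omega$ is the rank of this algebra, i.e. the number of elements in any Jordan frame (complete system of orthogonal primitive idempotents). Let $S$ be the operator $Sf=\mathcal{F}^{-1}[\mathbf{1}_\Omega\,\widehat f\,]$, bounded on $L^2(\mathbb{R}^n)$, where $\widehat f(\xi)=\int_{\mathbb{R}^n}f(y)e^{-2\pi i\langle y,\xi\rangle}dy$. One says that $\mathbf{1}_\Omega$ is a local $(p,q)$-Fourier multiplier if for every bounded (measurable) set $B\subset\mathbb{R}^n$ the operator $S^B f:=\mathbf{1}_B\,S(f\,\mathbf{1}_B)$ maps $L^p(\mathbb{R}^n)$ to $L^q(\mathbb{R}^n)$ boundedly, i.e. there is a constant $C_B$ such that $\|S^Bf\|_{L^q}\le C_B\|f\|_{L^p}$ for all $f\in L^p(\mathbb{R}^n)$ with $f\mathbf{1}_B\in L^2(\mathbb{R}^n)$. (It is equivalent to require, for one fixed ball $\mathbb{B}$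 centered at the origin, that $\|Sf\|_{L^q(\mathbb{B})}\le C\|f\|_{L^p(\mathbb{B})}$ for all $f\in C_c^\infty(\mathbb{B})$.) *)

theory Defs
  imports "HOL-Analysis.Analysis" "HOL-Probability.Essential_Supremum"
begin

text \<open>
  Scaling is by positive factors only: the library predicate \<open>cone\<close> also allows the factor 0
  and would force \<open>0 \<in> \<Omega>\<close>, which fails for the open cones considered here.
  All notions are relative to a linear subspace \<open>V\<close>, so that cones of different dimensions
  can be compared within one type; every Euclidean space of dimension \<open>k \<le> n\<close> is isometric
  to a subspace of an \<open>n\<close>-dimensional one.
\<close>

definition open_convex_cone_in :: "'a::euclidean_space set \<Rightarrow> 'a set \<Rightarrow> bool" where
  "open_convex_cone_in V \<Omega> \<longleftrightarrow>
     openin (top_of_set V) \<Omega> \<and> convex \<Omega> \<and> (\<forall>x\<in>\<Omega>. \<forall>c>0. c *\<^sub>R x \<in> \<Omega>)"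

definition open_dual_cone_in :: "'a::euclidean_space set \<Rightarrow> 'a set \<Rightarrow> 'a set" where
  "open_dual_cone_in V \<Omega> = {y \<in> V. \<forall>x \<in> closure \<Omega> - {0}. x \<bullet> y > 0}"

definition homogeneous_in :: "'a::euclidean_space set \<Rightarrow> 'a set \<Rightarrow> bool" where
  "homogeneous_in V \<Omega> \<longleftrightarrow>
     (\<forall>x\<in>\<Omega>. \<forall>y\<in>\<Omega>. \<exists>g. linear g \<and> bij_betw g V V \<and> g ` \<Omega> = \<Omega> \<and> g x = y)"

text \<open>Self-duality excludes the empty set, whose dual is \<open>V\<close>.\<close>

definition symmetric_cone_in :: "'a::euclidean_space set \<Rightarrow> 'a set \<Rightarrow> bool" where
  "symmetric_cone_in V \<Omega> \<longleftrightarrow>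
     subspace V \<and> open_convex_cone_in V \<Omega> \<and> open_dual_cone_in V \<Omega> = \<Omega> \<and> homogeneous_in V \<Omega>"

definition symmetric_cone :: "'a::euclidean_space set \<Rightarrow> bool" where
  "symmetric_cone \<Omega> \<longleftrightarrow> symmetric_cone_in UNIV \<Omega>"

definition irreducible_cone :: "'a::euclidean_space set \<Rightarrow> bool" where
  "irreducible_cone \<Omega> \<longleftrightarrow>
     \<not> (\<exists>V1 V2 \<Omega>1 \<Omega>2 (T :: 'a \<times> 'a \<Rightarrow> 'a).
          symmetric_cone_in V1 \<Omega>1 \<and> dim V1 < DIM('a) \<and>
          symmetric_cone_in V2 \<Omega>2 \<and> dim V2 < DIM('a) \<and>
          linear T \<and> bij_betw T (V1 \<times> V2) UNIV \<and> T ` (\<Omega>1 \<times> \<Omega>2) = \<Omega>)"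

text \<open>
  \<open>J\<close> is the product and \<open>e\<close> the unit. The associative inner product \<open>B\<close> need not be the
  ambient one.
\<close>

definition euclidean_jordan_algebra :: "('a::euclidean_space \<Rightarrow> 'a \<Rightarrow> 'a) \<Rightarrow> 'a \<Rightarrow> bool" where
  "euclidean_jordan_algebra J e \<longleftrightarrow>
     bilinear J \<and>
     (\<forall>x y. J x y = J y x) \<and>
     (\<forall>x y. J x (J (J x x) y) = J (J x x) (J x y)) \<and>
     (\<forall>x. J e x = x) \<and>
     (\<exists>B :: 'a \<Rightarrow> 'a \<Rightarrow> real.
        bilinear B \<and> (\<forall>x y. B x y = B y x) \<and> (\<forall>x. x \<noteq> 0 \<longrightarrow> B x x > 0) \<and>
        (\<forall>x y z. B (J x y) z = B y (J x z)))"

definition idempotent :: "('a::euclidean_space \<Rightarrow> 'a \<Rightarrow> 'a) \<Rightarrow> 'a \<Rightarrow> bool" where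
  "idempotent J c \<longleftrightarrow> J c c = c"

definition primitive_idempotent :: "('a::euclidean_space \<Rightarrow> 'a \<Rightarrow> 'a) \<Rightarrow> 'a \<Rightarrow> bool" where
  "primitive_idempotent J c \<longleftrightarrow>
     idempotent J c \<and> c \<noteq> 0 \<and>
     \<not> (\<exists>a b. idempotent J a \<and> idempotent J b \<and> a \<noteq> 0 \<and> b \<noteq> 0 \<and> J a b = 0 \<and> c = a + b)"

definition jordan_frame :: "('a::euclidean_space \<Rightarrow> 'a \<Rightarrow> 'a) \<Rightarrow> 'a \<Rightarrow> 'a set \<Rightarrow> bool" where
  "jordan_frame J e C \<longleftrightarrow>
     finite C \<and> (\<forall>c\<in>C. primitive_idempotent J c) \<and>
     (\<forall>c\<in>C. \<forall>d\<in>C. c \<noteq> d \<longrightarrow> J c d = 0) \<and> \<Sum>C = e"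

text \<open>
  All Jordan frames of a Euclidean Jordan algebra have the same cardinality, and two such algebras
  with the same cone of squares are isomorphic, so at most one \<open>r\<close> satisfies this relation.
\<close>

definition has_cone_rank :: "'a::euclidean_space set \<Rightarrow> nat \<Rightarrow> bool" where
  "has_cone_rank \<Omega> r \<longleftrightarrow>
     (\<exists>J e C. euclidean_jordan_algebra J e \<and> \<Omega> = interior (range (\<lambda>x. J x x)) \<and>
              jordan_frame J e C \<and> card C = r)"

definition Lp_norm :: "ennreal \<Rightarrow> ('a::euclidean_space \<Rightarrow> complex) \<Rightarrow> ennreal" where
  "Lp_norm p f =
     (if p = \<infinity> then esssup lebesgue (\<lambda>x. ennreal (norm (f x)))
      else let I = (\<integral>\<^sup>+x. ennreal (norm (f x) powr enn2real p) \<partial>lebesgue)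
           in if I = \<infinity> then \<infinity> else ennreal (enn2real I powr (1 / enn2real p)))"

definition Lp_space :: "ennreal \<Rightarrow> ('a::euclidean_space \<Rightarrow> complex) set" where
  "Lp_space p = {f \<in> borel_measurable lebesgue. Lp_norm p f < \<infinity>}"

definition fourier_integral :: "('a::euclidean_space \<Rightarrow> complex) \<Rightarrow> 'a \<Rightarrow> complex" where
  "fourier_integral f \<xi> =
     (LINT y|lebesgue. f y * exp (- 2 * complex_of_real pi * \<i> * complex_of_real (y \<bullet> \<xi>)))"

text \<open>
  \<open>g\<close> is the Plancherel transform of \<open>f\<close>: the extension by continuity of the Fourier integral
  from \<open>L\<^sup>1 \<inter> L\<^sup>2\<close> to \<open>L\<^sup>2\<close>. By Plancherel's theorem this relation is the graph of a unitary
  operator of \<open>L\<^sup>2\<close>, so the choices below are determined up to null sets.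
\<close>

definition has_fourier_L2 ::
    "('a::euclidean_space \<Rightarrow> complex) \<Rightarrow> ('a \<Rightarrow> complex) \<Rightarrow> bool" where
  "has_fourier_L2 f g \<longleftrightarrow>
     f \<in> Lp_space 2 \<and> g \<in> Lp_space 2 \<and>
     (\<exists>u :: nat \<Rightarrow> 'a \<Rightarrow> complex.
        (\<forall>k. u k \<in> Lp_space 1 \<inter> Lp_space 2) \<and>
        (\<lambda>k. Lp_norm 2 (\<lambda>x. u k x - f x)) \<longlonglongrightarrow> 0 \<and>
        (\<lambda>k. Lp_norm 2 (\<lambda>\<xi>. fourier_integral (u k) \<xi> - g \<xi>)) \<longlonglongrightarrow> 0)"

definition fourier_L2 :: "('a::euclidean_space \<Rightarrow> complex) \<Rightarrow> 'a \<Rightarrow> complex" where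
  "fourier_L2 f = (SOME g. has_fourier_L2 f g)"

definition inv_fourier_L2 :: "('a::euclidean_space \<Rightarrow> complex) \<Rightarrow> 'a \<Rightarrow> complex" where
  "inv_fourier_L2 g = (SOME f. has_fourier_L2 f g)"

definition set_multiplier ::
    "'a::euclidean_space set \<Rightarrow> ('a \<Rightarrow> complex) \<Rightarrow> 'a \<Rightarrow> complex" where
  "set_multiplier \<Omega> f = inv_fourier_L2 (\<lambda>\<xi>. indicator \<Omega> \<xi> * fourier_L2 f \<xi>)"

definition localized_multiplier ::
    "'a::euclidean_space set \<Rightarrow> 'a set \<Rightarrow> ('a \<Rightarrow> complex) \<Rightarrow> 'a \<Rightarrow> complex" where
  "localized_multiplier \<Omega> B f =
     (\<lambda>x. indicator B x * set_multiplier \<Omega> (\<lambda>y. f y * indicator B y) x)"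

definition local_fourier_multiplier ::
    "ennreal \<Rightarrow> ennreal \<Rightarrow> 'a::euclidean_space set \<Rightarrow> bool" where
  "local_fourier_multiplier p q \<Omega> \<longleftrightarrow>
     (\<forall>B. bounded B \<and> B \<in> sets lebesgue \<longrightarrow>
        (\<exists>C::real. C \<ge> 0 \<and>
           (\<forall>f \<in> Lp_space p. (\<lambda>y. f y * indicator B y) \<in> Lp_space 2 \<longrightarrow>
              Lp_norm q (localized_multiplier \<Omega> B f) \<le> ennreal C * Lp_norm p f)))"

end

theory Submission
  imports Defs "HOL-Probability.Sinc_Integral" "HOL-Probability.Characteristic_Functions"
begin

text \<open>
  For \<open>q \<le> 2 \<le> p\<close> the claim is Plancherel's theorem combined with Hoelder's inequality on \<open>B\<close>.

  For the converse, some idempotent of a Jordan frame has a nonzero Peirce space for the eigenvalue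
  \<open>1/2\<close>, since otherwise the cone would be an orthant. Hence a primitive idempotent
  is moved by a derivation \<open>[L a, L b]\<close> of the Jordan algebra, where \<open>L\<close> is multiplication; it
  generates a one-parameter group of automorphisms and thereby a curve \<open>c\<close> of primitive idempotents. At \<open>e - c\<close> the cone is tangent to the half-space
  \<open>{\<eta>. \<eta> \<bullet> v > 0}\<close> with \<open>v\<close> on the ray dual to \<open>c\<close>, so modulating test functions by \<open>n (e - c)\<close>
  turns the cone multiplier into a half-space multiplier, which shifts a positive proportion of mass
  along \<open>v\<close>. The directions \<open>v\<close> project onto an interval of slopes in a plane, where a Kakeya
  compression places the shifted tubes into a set \<open>E\<close> of small measure although the original tubes are
  disjoint. Signs chosen greedily preserve the sum of the squared norms, which yields bounded \<open>f\<close> with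
  \<open>S f\<close> of norm bounded below on \<open>E\<close>. By Hoelder's inequality this contradicts \<open>q > 2\<close> as \<open>E\<close> shrinks,
  and since \<open>S\<close> is self-adjoint, testing \<open>S\<close> on \<open>1\<^sub>E S f\<close> contradicts \<open>p < 2\<close>.
\<close>

subsection \<open>Square integrable functions\<close>

text \<open>For a simplicial cone the multiplier is, after a linear change of variables, a product
  of one-dimensional half-line projections, which are bounded on L^p for 1 < p < \<infinity>.
  Necessity must therefore come from the curvature of the boundary, and the Peirce space for 1/2 is
  where the algebra shows it. Localisation does not weaken the obstruction: modulation pushes the
  point of tangency to infinity while all test functions stay in one ball. The only quantity to
  control is the squared norm of \<open>S f\<close> on \<open>E\<close>. It stays above a fixed
  \<kappa> although |f| \<le> 1 and \<open>E\<close> is arbitrarily small, so q > 2 and p < 2 are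
  refuted separately, whatever the other exponent is. The kernel 1/s of a half-space multiplier is
  integrable neither at 0 nor at \<infinity>; it is only tested between tubes over
  \<open>{2..3}\<close> and over \<open>{0..1}\<close>, where 1 \<le> s \<le> 3 and hence 1/s \<ge>
  1/3. This fixes the two intervals and the constant 6 pi. Signs matter because the images of
  different tubes overlap in \<open>E\<close> and could cancel there.\<close>

definition L2 :: "'a measure \<Rightarrow> ('a \<Rightarrow> complex) set" where
  "L2 M = {f \<in> borel_measurable M. integrable M (\<lambda>x. (norm (f x))\<^sup>2)}"

definition sqnorm :: "'a measure \<Rightarrow> ('a \<Rightarrow> complex) \<Rightarrow> real" where
  "sqnorm M f = (LINT x|M. (norm (f x))\<^sup>2)"

definition ip :: "'a measure \<Rightarrow> ('a \<Rightarrow> complex) \<Rightarrow> ('a \<Rightarrow> complex) \<Rightarrow> complex" where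
  "ip M f g = (LINT x|M. f x * cnj (g x))"

definition norm2 :: "'a measure \<Rightarrow> ('a \<Rightarrow> complex) \<Rightarrow> real" where
  "norm2 M f = sqrt (sqnorm M f)"

lemma L2_meas [measurable_dest]: "f \<in> L2 M \<Longrightarrow> f \<in> borel_measurable M"
  by (simp add: L2_def)

lemma L2_integrable: "f \<in> L2 M \<Longrightarrow> integrable M (\<lambda>x. (norm (f x))\<^sup>2)"
  by (simp add: L2_def)

lemma sqnorm_nonneg [simp]: "0 \<le> sqnorm M f"
  by (simp add: sqnorm_def)

lemma norm2_nonneg [simp]: "0 \<le> norm2 M f"
  by (simp add: norm2_def)

lemma norm2_power2: "(norm2 M f)\<^sup>2 = sqnorm M f"
  by (simp add: norm2_def)

lemma nn_integral_L2: "f \<in> L2 M \<Longrightarrow> (\<integral>\<^sup>+x. ennreal ((norm (f x))\<^sup>2) \<partial>M) = ennreal (sqnorm M f)"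
  unfolding sqnorm_def by (rule nn_integral_eq_integral) (auto simp: L2_def)

lemma L2_iff_nn_integral:
  "f \<in> borel_measurable M \<Longrightarrow> f \<in> L2 M \<longleftrightarrow> (\<integral>\<^sup>+x. ennreal ((norm (f x))\<^sup>2) \<partial>M) < \<infinity>"
  unfolding L2_def by (auto simp: integrable_iff_bounded)

lemma L2_bound:
  assumes "g \<in> L2 M" "f \<in> borel_measurable M" "AE x in M. norm (f x) \<le> norm (g x)"
  shows "f \<in> L2 M"
proof -
  have "integrable M (\<lambda>x. (norm (f x))\<^sup>2)"
    by (rule Bochner_Integration.integrable_bound[OF L2_integrable[OF assms(1)]])
       (use assms in \<open>auto intro: power_mono elim!: eventually_mono\<close>)
  with assms show ?thesis by (simp add: L2_def)
qed

lemma sqnorm_mono: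
  assumes "g \<in> L2 M" "f \<in> borel_measurable M" "AE x in M. norm (f x) \<le> norm (g x)"
  shows "sqnorm M f \<le> sqnorm M g"
  unfolding sqnorm_def
  by (rule integral_mono_AE) (use assms L2_bound[OF assms] in \<open>auto simp: L2_def intro: power_mono elim!: eventually_mono\<close>)

lemma norm_sum_sq: "(norm (a + b :: complex))\<^sup>2 \<le> 2 * (norm a)\<^sup>2 + 2 * (norm b)\<^sup>2"
proof -
  have "(norm (a + b))\<^sup>2 \<le> (norm a + norm b)\<^sup>2"
    by (intro power_mono norm_triangle_ineq) auto
  also have "\<dots> \<le> 2 * (norm a)\<^sup>2 + 2 * (norm b)\<^sup>2"
    using sum_squares_bound[of "norm a" "norm b"] by (simp add: power2_sum)
  finally show ?thesis .
qed

lemma L2_add [intro]: 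
  assumes "f \<in> L2 M" "g \<in> L2 M" shows "(\<lambda>x. f x + g x) \<in> L2 M"
proof -
  have [measurable]: "f \<in> borel_measurable M" "g \<in> borel_measurable M" using assms by (auto simp: L2_def)
  have "integrable M (\<lambda>x. (norm (f x + g x))\<^sup>2)"
    by (rule Bochner_Integration.integrable_bound
         [where f="\<lambda>x. 2 * (norm (f x))\<^sup>2 + 2 * (norm (g x))\<^sup>2"])
       (use assms in \<open>auto simp: L2_def norm_sum_sq\<close>)
  then show ?thesis by (simp add: L2_def)
qed

lemma L2_cmult [intro]: "f \<in> L2 M \<Longrightarrow> (\<lambda>x. c * f x) \<in> L2 M"
  by (auto simp: L2_def norm_mult power_mult_distrib)

lemma L2_zero [simp, intro]: "(\<lambda>x. 0) \<in> L2 M"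
  by (auto simp: L2_def)

lemma L2_minus [intro]: "f \<in> L2 M \<Longrightarrow> (\<lambda>x. - f x) \<in> L2 M"
  by (auto simp: L2_def)

lemma L2_diff [intro]: "f \<in> L2 M \<Longrightarrow> g \<in> L2 M \<Longrightarrow> (\<lambda>x. f x - g x) \<in> L2 M"
  using L2_add[of f M "\<lambda>x. - g x"] by auto

lemma borel_measurable_cnj [measurable]: "cnj \<in> borel_measurable borel"
  by (intro borel_measurable_continuous_onI continuous_intros)

lemma L2_cnj [intro]: "f \<in> L2 M \<Longrightarrow> (\<lambda>x. cnj (f x)) \<in> L2 M"
  by (auto simp: L2_def intro: measurable_compose[OF _ borel_measurable_cnj])

lemma L2_sum [intro]: "(\<And>i. i \<in> I \<Longrightarrow> f i \<in> L2 M) \<Longrightarrow> (\<lambda>x. \<Sum>i\<in>I. f i x) \<in> L2 M"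
  by (induction I rule: infinite_finite_induct) auto

lemma L2_bounded_mult [intro]:
  assumes "f \<in> L2 M" "m \<in> borel_measurable M" "\<And>x. norm (m x) \<le> 1"
  shows "(\<lambda>x. m x * f x) \<in> L2 M"
  by (rule L2_bound[OF assms(1)]) (use assms in \<open>auto simp: L2_def norm_mult mult_left_le_one_le\<close>)

lemma L2_indicator_mult [intro]:
  "f \<in> L2 M \<Longrightarrow> A \<in> sets M \<Longrightarrow> (\<lambda>x. indicator A x * f x) \<in> L2 M"
  by (rule L2_bounded_mult) (auto simp: indicator_def)

lemma L2_indicator [intro]:
  "A \<in> sets M \<Longrightarrow> emeasure M A < \<infinity> \<Longrightarrow> (indicator A :: _ \<Rightarrow> complex) \<in> L2 M"
proof -
  assume A: "A \<in> sets M" "emeasure M A < \<infinity>"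
  have "integrable M (\<lambda>x. (norm (indicator A x :: complex))\<^sup>2) = integrable M (indicator A :: _ \<Rightarrow> real)"
    by (rule Bochner_Integration.integrable_cong) (auto simp: indicator_def)
  with A show ?thesis by (simp add: L2_def)
qed

lemma sqnorm_indicator: "A \<in> sets M \<Longrightarrow> sqnorm M (indicator A) = measure M A"
proof -
  assume A: "A \<in> sets M"
  have "sqnorm M (indicator A) = (LINT x|M. indicator A x)"
    unfolding sqnorm_def by (rule Bochner_Integration.integral_cong) (auto simp: indicator_def)
  with A show ?thesis by simp
qed

lemma L2_prod_integrable:
  assumes "f \<in> L2 M" "g \<in> L2 M" shows "integrable M (\<lambda>x. f x * g x)"
proof -
  have [measurable]: "f \<in> borel_measurable M" "g \<in> borel_measurable M" using assms by (auto simp: L2_def)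
  have "norm (f x * g x) \<le> (norm (f x))\<^sup>2 + (norm (g x))\<^sup>2" for x
  proof -
    have "2 * norm (f x) * norm (g x) \<le> (norm (f x))\<^sup>2 + (norm (g x))\<^sup>2" by (rule sum_squares_bound)
    moreover have "0 \<le> norm (f x) * norm (g x)" by simp
    ultimately show ?thesis unfolding norm_mult mult.assoc by linarith
  qed
  then have le: "norm (f x * g x) \<le> norm ((norm (f x))\<^sup>2 + (norm (g x))\<^sup>2)" for x
    by (metis abs_of_nonneg add_nonneg_nonneg real_norm_def zero_le_power2)
  have "integrable M (\<lambda>x. (norm (f x))\<^sup>2 + (norm (g x))\<^sup>2)"
    using assms by (simp add: L2_def)
  then show ?thesis
    by (rule Bochner_Integration.integrable_bound) (measurable, rule AE_I2[OF le])
qed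

lemma ip_integrable: "f \<in> L2 M \<Longrightarrow> g \<in> L2 M \<Longrightarrow> integrable M (\<lambda>x. f x * cnj (g x))"
  by (rule L2_prod_integrable) auto

lemma ip_add_left: "f \<in> L2 M \<Longrightarrow> g \<in> L2 M \<Longrightarrow> h \<in> L2 M \<Longrightarrow>
    ip M (\<lambda>x. f x + g x) h = ip M f h + ip M g h"
  unfolding ip_def by (subst Bochner_Integration.integral_add[symmetric])
    (auto simp: ip_integrable algebra_simps)

lemma ip_cmult_left: "ip M (\<lambda>x. c * f x) h = c * ip M f h"
  unfolding ip_def by (simp add: mult.assoc)

lemma ip_minus_left: "ip M (\<lambda>x. - f x) h = - ip M f h"
  using ip_cmult_left[of M "-1" f h] by simp

lemma ip_diff_left: "f \<in> L2 M \<Longrightarrow> g \<in> L2 M \<Longrightarrow> h \<in> L2 M \<Longrightarrow>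
    ip M (\<lambda>x. f x - g x) h = ip M f h - ip M g h"
  using ip_add_left[of f M "\<lambda>x. - g x" h] by (auto simp: ip_minus_left)

lemma ip_commute: "ip M g f = cnj (ip M f g)"
proof -
  have "cnj (ip M f g) = (LINT x|M. cnj (f x * cnj (g x)))"
    unfolding ip_def by (rule Bochner_Integration.integral_cnj[symmetric])
  also have "\<dots> = ip M g f" unfolding ip_def by (simp add: mult.commute)
  finally show ?thesis by simp
qed

lemma ip_add_right: "f \<in> L2 M \<Longrightarrow> g \<in> L2 M \<Longrightarrow> h \<in> L2 M \<Longrightarrow>
    ip M h (\<lambda>x. f x + g x) = ip M h f + ip M h g"
  by (simp add: ip_commute[of M h] ip_add_left)

lemma ip_diff_right: "f \<in> L2 M \<Longrightarrow> g \<in> L2 M \<Longrightarrow> h \<in> L2 M \<Longrightarrow>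
    ip M h (\<lambda>x. f x - g x) = ip M h f - ip M h g"
  by (simp add: ip_commute[of M h] ip_diff_left)

lemma ip_cmult_right: "ip M h (\<lambda>x. c * f x) = cnj c * ip M h f"
  by (simp add: ip_commute[of M h] ip_cmult_left)

lemma ip_self: "ip M f f = of_real (sqnorm M f)"
  unfolding ip_def sqnorm_def integral_complex_of_real[symmetric]
  by (rule Bochner_Integration.integral_cong) (auto simp: complex_norm_square[symmetric])

lemma sqnorm_add: 
  assumes "f \<in> L2 M" "g \<in> L2 M"
  shows "sqnorm M (\<lambda>x. f x + g x) = sqnorm M f + sqnorm M g + 2 * Re (ip M f g)"
proof -
  have "complex_of_real (sqnorm M (\<lambda>x. f x + g x)) = ip M f f + ip M g g + (ip M f g + ip M g f)"
    by (simp add: ip_self[symmetric] ip_add_left ip_add_right assms L2_add)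
  also have "ip M f g + ip M g f = of_real (2 * Re (ip M f g))"
    by (subst ip_commute[of M g f]) (simp add: complex_add_cnj)
  finally show ?thesis
    by (simp only: ip_self of_real_add[symmetric] of_real_eq_iff)
qed

lemma sqnorm_cmult: "sqnorm M (\<lambda>x. c * f x) = (norm c)\<^sup>2 * sqnorm M f"
  by (simp add: sqnorm_def norm_mult power_mult_distrib)

lemma sqnorm_minus [simp]: "sqnorm M (\<lambda>x. - f x) = sqnorm M f"
  by (simp add: sqnorm_def)

lemma sqnorm_diff: 
  assumes "f \<in> L2 M" "g \<in> L2 M"
  shows "sqnorm M (\<lambda>x. f x - g x) = sqnorm M f + sqnorm M g - 2 * Re (ip M f g)"
  using sqnorm_add[OF assms(1) L2_minus[OF assms(2)]] ip_cmult_right[of M f "-1" g] by simp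

lemma sqnorm_zero_AE: "f \<in> L2 M \<Longrightarrow> sqnorm M f = 0 \<longleftrightarrow> (AE x in M. f x = 0)"
  unfolding sqnorm_def by (subst integral_nonneg_eq_0_iff_AE) (auto simp: L2_def)

lemma L2_cong_AE:
  assumes "f \<in> L2 M" "g \<in> borel_measurable M" "AE x in M. f x = g x" shows "g \<in> L2 M"
  by (rule L2_bound[OF assms(1,2)]) (use assms(3) in \<open>auto elim!: eventually_mono\<close>)

lemma ip_cong_AE:
  assumes "f \<in> borel_measurable M" "f' \<in> borel_measurable M" "AE x in M. f x = f' x"
    and "g \<in> borel_measurable M" "g' \<in> borel_measurable M" "AE x in M. g x = g' x"
  shows "ip M f g = ip M f' g'"
proof -
  note [measurable] = assms(1,2,4,5)
  show ?thesis unfolding ip_def by (rule integral_cong_AE) (use assms in auto)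
qed

lemma sqnorm_cong_AE:
  assumes "f \<in> borel_measurable M" "f' \<in> borel_measurable M" "AE x in M. f x = f' x"
  shows "sqnorm M f = sqnorm M f'"
  unfolding sqnorm_def by (rule integral_cong_AE) (use assms in auto)

lemma Cauchy_Schwarz:
  assumes f: "f \<in> L2 M" and g: "g \<in> L2 M"
  shows "norm (ip M f g) \<le> norm2 M f * norm2 M g"
proof (cases "sqnorm M g = 0")
  case True
  then have "AE x in M. g x = 0" using sqnorm_zero_AE[OF g] by simp
  then have "ip M f g = ip M f (\<lambda>x. 0)"
    by (intro ip_cong_AE) (use f g in \<open>auto simp: L2_def\<close>)
  then show ?thesis by (simp add: ip_def)
next
  case False
  define s where "s = sqnorm M g"
  \<comment> \<open>The coefficient of the orthogonal projection of \<open>f\<close> onto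
    \<open>g\<close>; expanding the squared norm of the remainder gives the inequality.\<close>
  define c where "c = ip M f g / of_real s"
  have s: "s > 0" using False sqnorm_nonneg[of M g] unfolding s_def by linarith
  have "0 \<le> sqnorm M (\<lambda>x. f x - c * g x)" by simp
  also have "\<dots> = sqnorm M f + (norm c)\<^sup>2 * s - 2 * Re (cnj c * ip M f g)"
    by (subst sqnorm_diff) (use f g in \<open>auto simp: sqnorm_cmult ip_cmult_right s_def\<close>)
  also have "cnj c * ip M f g = of_real ((norm (ip M f g))\<^sup>2 / s)"
    using complex_norm_square[of "ip M f g"] by (simp add: c_def mult.commute)
  also have "(norm c)\<^sup>2 * s = (norm (ip M f g))\<^sup>2 / s"
    using s by (simp add: c_def norm_divide power_divide power2_eq_square)
  finally have "(norm (ip M f g))\<^sup>2 / s \<le> sqnorm M f" by simp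
  then have "(norm (ip M f g))\<^sup>2 \<le> sqnorm M f * s" using s by (simp add: divide_le_eq)
  then have "sqrt ((norm (ip M f g))\<^sup>2) \<le> sqrt (sqnorm M f * s)" by (rule real_sqrt_le_mono)
  then show ?thesis by (simp add: norm2_def s_def real_sqrt_mult)
qed

lemma norm2_triangle:
  assumes f: "f \<in> L2 M" and g: "g \<in> L2 M"
  shows "norm2 M (\<lambda>x. f x + g x) \<le> norm2 M f + norm2 M g"
proof (rule power2_le_imp_le)
  have "(norm2 M (\<lambda>x. f x + g x))\<^sup>2 = sqnorm M f + sqnorm M g + 2 * Re (ip M f g)"
    by (simp add: norm2_power2 sqnorm_add assms)
  also have "Re (ip M f g) \<le> norm2 M f * norm2 M g"
    using Cauchy_Schwarz[OF assms] complex_Re_le_cmod[of "ip M f g"] by linarith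
  finally show "(norm2 M (\<lambda>x. f x + g x))\<^sup>2 \<le> (norm2 M f + norm2 M g)\<^sup>2"
    by (simp add: power2_sum norm2_power2)
qed simp

lemma norm2_diff_commute: "norm2 M (\<lambda>x. f x - g x) = norm2 M (\<lambda>x. g x - f x)"
  by (simp add: norm2_def sqnorm_def norm_minus_commute)

lemma norm2_diff_triangle:
  assumes "f \<in> L2 M" "g \<in> L2 M" "h \<in> L2 M"
  shows "norm2 M (\<lambda>x. f x - h x) \<le> norm2 M (\<lambda>x. f x - g x) + norm2 M (\<lambda>x. g x - h x)"
  using norm2_triangle[of "\<lambda>x. f x - g x" M "\<lambda>x. g x - h x"] assms by auto

lemma norm2_le_diff:
  assumes "f \<in> L2 M" "g \<in> L2 M"
  shows "norm2 M f \<le> norm2 M (\<lambda>x. f x - g x) + norm2 M g"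
  using norm2_triangle[of "\<lambda>x. f x - g x" M g] assms by auto

lemma tendsto_norm2_0_iff: "((\<lambda>k. norm2 M (f k)) \<longlongrightarrow> 0) F \<longleftrightarrow> ((\<lambda>k. sqnorm M (f k)) \<longlongrightarrow> 0) F"
proof
  assume "((\<lambda>k. norm2 M (f k)) \<longlongrightarrow> 0) F"
  from tendsto_power[OF this, of 2] show "((\<lambda>k. sqnorm M (f k)) \<longlongrightarrow> 0) F"
    by (simp add: norm2_power2)
next
  assume "((\<lambda>k. sqnorm M (f k)) \<longlongrightarrow> 0) F"
  from tendsto_real_sqrt[OF this] show "((\<lambda>k. norm2 M (f k)) \<longlongrightarrow> 0) F"
    by (simp add: norm2_def)
qed

lemma tendsto_norm2:
  assumes "\<And>k. f k \<in> L2 M" "g \<in> L2 M" "((\<lambda>k. norm2 M (\<lambda>x. f k x - g x)) \<longlongrightarrow> 0) F"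
  shows "((\<lambda>k. norm2 M (f k)) \<longlongrightarrow> norm2 M g) F"
proof (rule Lim_null[THEN iffD2, OF Lim_null_comparison[OF _ assms(3)]], intro always_eventually allI)
  fix k
  have "norm2 M (f k) \<le> norm2 M (\<lambda>x. f k x - g x) + norm2 M g"
    by (rule norm2_le_diff) (use assms in auto)
  moreover have "norm2 M g \<le> norm2 M (\<lambda>x. f k x - g x) + norm2 M (f k)"
    by (subst norm2_diff_commute, rule norm2_le_diff) (use assms in auto)
  ultimately show "norm (norm2 M (f k) - norm2 M g) \<le> norm2 M (\<lambda>x. f k x - g x)"
    by (simp add: abs_le_iff)
qed

lemma tendsto_ip:
  assumes "\<And>k. f k \<in> L2 M" "f' \<in> L2 M" "((\<lambda>k. norm2 M (\<lambda>x. f k x - f' x)) \<longlongrightarrow> 0) F"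
    and "\<And>k. g k \<in> L2 M" "g' \<in> L2 M" "((\<lambda>k. norm2 M (\<lambda>x. g k x - g' x)) \<longlongrightarrow> 0) F"
  shows "((\<lambda>k. ip M (f k) (g k)) \<longlongrightarrow> ip M f' g') F"
proof (rule Lim_null[THEN iffD2, OF Lim_null_comparison])
  let ?b = "\<lambda>k. norm2 M (\<lambda>x. f k x - f' x) * norm2 M (g k) + norm2 M f' * norm2 M (\<lambda>x. g k x - g' x)"
  have "(?b \<longlongrightarrow> 0 * norm2 M g' + norm2 M f' * 0) F"
    by (intro tendsto_add tendsto_mult tendsto_const assms tendsto_norm2)
  then show "(?b \<longlongrightarrow> 0) F" by simp
  show "\<forall>\<^sub>F k in F. norm (ip M (f k) (g k) - ip M f' g') \<le> ?b k"
  proof (intro always_eventually allI)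
    fix k
    have "ip M (f k) (g k) - ip M f' g' = ip M (\<lambda>x. f k x - f' x) (g k) + ip M f' (\<lambda>x. g k x - g' x)"
      by (simp add: ip_diff_left ip_diff_right assms)
    also have "norm \<dots> \<le> ?b k"
      by (intro norm_triangle_le add_mono Cauchy_Schwarz) (use assms in auto)
    finally show "norm (ip M (f k) (g k) - ip M f' g') \<le> ?b k" .
  qed
qed

text \<open>Along a subsequence with increments of squared norm at most \<open>8\<^sup>-\<^sup>k\<close>, the bound
  \<open>2 a \<le> 2\<^sup>-\<^sup>k + 2\<^sup>k a\<^sup>2\<close> replaces Minkowski's inequality for infinite sums.\<close>

lemma Riesz_Fischer:
  assumes f: "\<And>k. f k \<in> L2 M"
    and Cauchy: "\<And>e. e > 0 \<Longrightarrow> \<exists>N. \<forall>m\<ge>N. \<forall>n\<ge>N. sqnorm M (\<lambda>x. f m x - f n x) < e"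
  shows "\<exists>g\<in>L2 M. (\<lambda>k. norm2 M (\<lambda>x. f k x - g x)) \<longlonglongrightarrow> 0"
proof -
  have [measurable]: "f k \<in> borel_measurable M" for k using f by (auto simp: L2_def)
  have "\<forall>k. \<exists>N. \<forall>m\<ge>N. \<forall>n\<ge>N. sqnorm M (\<lambda>x. f m x - f n x) < (1/8)^k"
    using Cauchy by simp
  then obtain N where N: "\<And>k m n. m \<ge> N k \<Longrightarrow> n \<ge> N k \<Longrightarrow> sqnorm M (\<lambda>x. f m x - f n x) < (1/8)^k"
    by metis
  define r where "r = rec_nat (N 0) (\<lambda>k p. max (Suc p) (N (Suc k)))"
  have r_Suc: "r (Suc k) = max (Suc (r k)) (N (Suc k))" for k by (simp add: r_def)
  have rN: "r k \<ge> N k" for k by (cases k) (auto simp: r_def)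
  have r: "strict_mono r" by (rule strict_monoI_Suc) (simp add: r_Suc)
  define a where "a k x = norm (f (r (Suc k)) x - f (r k) x)" for k x
  have [measurable]: "a k \<in> borel_measurable M" for k unfolding a_def by measurable
  have a0: "a k x \<ge> 0" for k x by (simp add: a_def)
  have int: "(\<integral>\<^sup>+x. ennreal (2^k * (a k x)\<^sup>2) \<partial>M) \<le> ennreal ((1/4)^k)" for k
  proof -
    have "(\<integral>\<^sup>+x. ennreal (2^k * (a k x)\<^sup>2) \<partial>M) = ennreal (2^k) * (\<integral>\<^sup>+x. ennreal ((a k x)\<^sup>2) \<partial>M)"
      by (subst nn_integral_cmult[symmetric]) (auto simp: ennreal_mult)
    also have "(\<integral>\<^sup>+x. ennreal ((a k x)\<^sup>2) \<partial>M) = ennreal (sqnorm M (\<lambda>x. f (r (Suc k)) x - f (r k) x))"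
      unfolding a_def by (rule nn_integral_L2) (use f in auto)
    also have "sqnorm M (\<lambda>x. f (r (Suc k)) x - f (r k) x) \<le> (1/8)^k"
      using N[of k "r (Suc k)" "r k"] rN[of k] strict_monoD[OF r, of k "Suc k"] by simp
    finally have "(\<integral>\<^sup>+x. ennreal (2^k * (a k x)\<^sup>2) \<partial>M) \<le> ennreal (2^k) * ennreal ((1/8)^k)"
      by (simp add: ennreal_leI mult_left_mono)
    also have "\<dots> = ennreal ((1/4)^k)"
      by (simp add: ennreal_mult[symmetric] power_mult_distrib[symmetric])
    finally show ?thesis .
  qed
  have "(\<integral>\<^sup>+x. (\<Sum>k. ennreal (2^k * (a k x)\<^sup>2)) \<partial>M) = (\<Sum>k. \<integral>\<^sup>+x. ennreal (2^k * (a k x)\<^sup>2) \<partial>M)"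
    by (rule nn_integral_suminf) auto
  also have "\<dots> \<le> (\<Sum>k. ennreal ((1/4)^k))"
    by (intro suminf_le int) auto
  also have "\<dots> = ennreal (\<Sum>k. (1/4)^k)"
    by (rule suminf_ennreal2) (auto intro: summable_geometric)
  also have "\<dots> < \<infinity>" by simp
  finally have "AE x in M. (\<Sum>k. ennreal (2^k * (a k x)\<^sup>2)) \<noteq> \<infinity>"
    by (intro nn_integral_PInf_AE) auto
  then have conv: "AE x in M. convergent (\<lambda>k. f (r k) x)"
  proof eventually_elim
    case (elim x)
    have s: "summable (\<lambda>k. 2^k * (a k x)\<^sup>2)"
      by (rule summable_suminf_not_top) (use elim in \<open>auto simp: infinity_ennreal_def\<close>)
    have "summable (\<lambda>k. a k x)"
    proof (rule summable_comparison_test'[OF summable_add[OF s summable_geometric[of "1/2::real"]]])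
      fix k
      have "(sqrt (2^k) * a k x) * sqrt ((1/2)^k) * 2 \<le> (sqrt (2^k) * a k x)\<^sup>2 + (sqrt ((1/2)^k))\<^sup>2"
        using sum_squares_bound[of "sqrt (2^k) * a k x" "sqrt ((1/2)^k)"] by (simp add: mult_ac)
      moreover have "sqrt (2^k) * sqrt ((1/2)^k) = (1::real)"
        by (simp add: real_sqrt_mult[symmetric] power_mult_distrib[symmetric])
      then have "(sqrt (2^k) * a k x) * sqrt ((1/2)^k) = a k x"
        by (metis mult.assoc mult.commute mult_1)
      ultimately have "a k x * 2 \<le> 2^k * (a k x)\<^sup>2 + (1/2)^k"
        by (simp add: power_mult_distrib)
      then show "norm (a k x) \<le> 2^k * (a k x)\<^sup>2 + (1/2)^k" using a0[of k x] by simp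
    qed simp
    then have "summable (\<lambda>k. f (r (Suc k)) x - f (r k) x)"
      unfolding a_def by (rule summable_norm_cancel)
    then have "convergent (\<lambda>n. \<Sum>k<n. f (r (Suc k)) x - f (r k) x)"
      by (simp add: summable_iff_convergent)
    then have "convergent (\<lambda>n. f (r n) x - f (r 0) x)"
      using sum_lessThan_telescope[of "\<lambda>k. f (r k) x"] by simp
    from convergent_add[OF this convergent_const[of "f (r 0) x"]] show ?case by simp
  qed
  define g where "g x = lim (\<lambda>k. f (r k) x)" for x
  have [measurable]: "g \<in> borel_measurable M" unfolding g_def by measurable
  have lim: "AE x in M. (\<lambda>k. f (r k) x) \<longlonglongrightarrow> g x"
    using conv by eventually_elim (simp add: g_def convergent_LIMSEQ_iff)
  \<comment> \<open>Fatou's lemma for \<open>f m - f (r j)\<close> as j grows: the Cauchy estimate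
    passes to the limit for every \<open>f m\<close>, not only along the subsequence.\<close>
  have bnd: "(\<integral>\<^sup>+x. ennreal ((norm (f m x - g x))\<^sup>2) \<partial>M) \<le> ennreal ((1/8)^k)" if m: "m \<ge> N k" for m k
  proof -
    have "(\<integral>\<^sup>+x. ennreal ((norm (f m x - g x))\<^sup>2) \<partial>M)
        = (\<integral>\<^sup>+x. liminf (\<lambda>j. ennreal ((norm (f m x - f (r j) x))\<^sup>2)) \<partial>M)"
    proof (rule nn_integral_cong_AE, use lim in eventually_elim)
      case (elim x)
      then have "(\<lambda>j. ennreal ((norm (f m x - f (r j) x))\<^sup>2)) \<longlonglongrightarrow> ennreal ((norm (f m x - g x))\<^sup>2)"
        by (intro tendsto_ennrealI tendsto_intros)
      then show ?case by (intro lim_imp_Liminf[symmetric]) auto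
    qed
    also have "\<dots> \<le> liminf (\<lambda>j. \<integral>\<^sup>+x. ennreal ((norm (f m x - f (r j) x))\<^sup>2) \<partial>M)"
      by (rule nn_integral_liminf) auto
    also have "\<dots> \<le> ennreal ((1/8)^k)"
    proof (rule Liminf_le)
      show "\<forall>\<^sub>F j in sequentially. (\<integral>\<^sup>+x. ennreal ((norm (f m x - f (r j) x))\<^sup>2) \<partial>M) \<le> ennreal ((1/8)^k)"
      proof (rule eventually_sequentiallyI[of "N k"])
        fix j assume "N k \<le> j"
        then have "N k \<le> r j" using strict_mono_imp_increasing[OF r, of j] by linarith
        with N[OF m, of "r j"] show "(\<integral>\<^sup>+x. ennreal ((norm (f m x - f (r j) x))\<^sup>2) \<partial>M) \<le> ennreal ((1/8)^k)"
          by (subst nn_integral_L2) (use f in \<open>auto intro: ennreal_leI\<close>)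
      qed
    qed simp
    finally show ?thesis .
  qed
  have "(\<lambda>x. f (N 0) x - g x) \<in> L2 M"
    using bnd[of 0 "N 0"] by (subst L2_iff_nn_integral) (auto intro: le_less_trans)
  from L2_diff[OF f[of "N 0"] this] have g: "g \<in> L2 M" by simp
  have "(\<lambda>k. sqnorm M (\<lambda>x. f k x - g x)) \<longlonglongrightarrow> 0"
  proof (rule LIMSEQ_I)
    fix e :: real assume e: "e > 0"
    obtain k where k: "(1/8::real)^k < e" using real_arch_pow_inv[OF e, of "1/8"] by auto
    show "\<exists>n0. \<forall>n\<ge>n0. norm (sqnorm M (\<lambda>x. f n x - g x) - 0) < e"
    proof (intro exI allI impI)
      fix n assume "n \<ge> N k"
      from bnd[OF this] have "sqnorm M (\<lambda>x. f n x - g x) \<le> (1/8)^k"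
        by (subst (asm) nn_integral_L2) (use f g in auto)
      with k show "norm (sqnorm M (\<lambda>x. f n x - g x) - 0) < e" by simp
    qed
  qed
  with g show ?thesis by (auto simp: tendsto_norm2_0_iff)
qed

section \<open>Translations and dilations of Lebesgue measure\<close>

lemma lborel_translate:
  fixes c :: "'a::euclidean_space"
  shows nn_integral_lborel_translate: "g \<in> borel_measurable borel \<Longrightarrow>
      (\<integral>\<^sup>+x. g (c + x) \<partial>lborel) = (\<integral>\<^sup>+x. g x \<partial>lborel)"
    and integrable_lborel_translate: "integrable lborel f \<Longrightarrow> integrable lborel (\<lambda>x. f (c + x))"
    and integral_lborel_translate: "f \<in> borel_measurable borel \<Longrightarrow>
      (LINT x|lborel. f (c + x)) = (LINT x|lborel. (f x :: 'b::{banach, second_countable_topology}))"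
proof -
  show "g \<in> borel_measurable borel \<Longrightarrow> (\<integral>\<^sup>+x. g (c + x) \<partial>lborel) = (\<integral>\<^sup>+x. g x \<partial>lborel)" for g
    by (subst (2) lborel_distr_plus[of c, symmetric], subst nn_integral_distr) auto
  show "f \<in> borel_measurable borel \<Longrightarrow> (LINT x|lborel. f (c + x)) = (LINT x|lborel. f x)"
    by (subst (2) lborel_distr_plus[of c, symmetric], subst integral_distr) auto
  assume f: "integrable lborel f"
  then have [measurable]: "f \<in> borel_measurable borel" by auto
  from f have "integrable (distr lborel borel ((+) c)) f" by (simp add: lborel_distr_plus)
  then show "integrable lborel (\<lambda>x. f (c + x))" by (subst (asm) integrable_distr_eq) auto
qed

lemma integral_lborel_scale:
  fixes f :: "'a::euclidean_space \<Rightarrow> 'b::{banach, second_countable_topology}"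
  assumes [measurable]: "f \<in> borel_measurable borel" and c: "c > 0"
  shows "(LINT x|lborel. f x) = c ^ DIM('a) *\<^sub>R (LINT x|lborel. f (c *\<^sub>R x))"
proof -
  have "(LINT x|lborel. f x) = (LINT x|density (distr lborel borel (\<lambda>x. 0 + c *\<^sub>R x)) (\<lambda>_. \<bar>c\<bar>^DIM('a)). f x)"
    using lborel_affine[of c "0::'a"] c by simp
  also have "\<dots> = (LINT x|distr lborel borel (\<lambda>x. 0 + c *\<^sub>R x). c ^ DIM('a) *\<^sub>R f x)"
    by (subst integral_density) (use c in auto)
  also have "\<dots> = c ^ DIM('a) *\<^sub>R (LINT x|lborel. f (c *\<^sub>R x))"
    by (subst integral_distr) auto
  finally show ?thesis .
qed

lemma integrable_lborel_scale:
  fixes f :: "'a::euclidean_space \<Rightarrow> 'b::{banach, second_countable_topology}"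
  assumes f: "integrable lborel f" and c: "c > 0"
  shows "integrable lborel (\<lambda>x. f (c *\<^sub>R x))"
proof -
  have [measurable]: "f \<in> borel_measurable borel" using f by auto
  have "integrable (density (distr lborel borel (\<lambda>x. 0 + c *\<^sub>R x)) (\<lambda>_. \<bar>c\<bar>^DIM('a))) f"
    using lborel_affine[of c "0::'a"] c f by simp
  then have "integrable (distr lborel borel (\<lambda>x. 0 + c *\<^sub>R x)) (\<lambda>x. c ^ DIM('a) *\<^sub>R f x)"
    by (subst (asm) integrable_density) (use c in auto)
  then have "integrable lborel (\<lambda>x. c ^ DIM('a) *\<^sub>R f (c *\<^sub>R x))"
    by (subst (asm) integrable_distr_eq) auto
  then have "integrable lborel (\<lambda>x. (1 / c ^ DIM('a)) *\<^sub>R (c ^ DIM('a) *\<^sub>R f (c *\<^sub>R x)))"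
    by - (rule integrable_scaleR_right)
  then show ?thesis using c by simp
qed

subsection \<open>Continuity of translations in the quadratic mean\<close>

lemma L2_translate:
  fixes f :: "'a::euclidean_space \<Rightarrow> complex"
  assumes "f \<in> L2 lborel" shows "(\<lambda>x. f (h + x)) \<in> L2 lborel"
    and "norm2 lborel (\<lambda>x. f (h + x)) = norm2 lborel f"
proof -
  have [measurable]: "f \<in> borel_measurable borel" using assms by (simp add: L2_def)
  show "(\<lambda>x. f (h + x)) \<in> L2 lborel"
    using assms integrable_lborel_translate[of "\<lambda>x. (norm (f x))\<^sup>2" h] by (simp add: L2_def)
  show "norm2 lborel (\<lambda>x. f (h + x)) = norm2 lborel f"
    using integral_lborel_translate[of "\<lambda>x. (norm (f x))\<^sup>2" h] by (simp add: norm2_def sqnorm_def)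
qed

text \<open>Null sequences rather than a filter at 0, since both the proof for open sets and the use
  in \<open>Plancherel_lborel\<close> go through dominated convergence along sequences.\<close>

definition translation_continuous :: "('a::euclidean_space \<Rightarrow> complex) \<Rightarrow> bool" where
  "translation_continuous f \<longleftrightarrow> f \<in> L2 lborel \<and>
     (\<forall>h. h \<longlonglongrightarrow> 0 \<longrightarrow> (\<lambda>k::nat. norm2 lborel (\<lambda>x. f (h k + x) - f x)) \<longlonglongrightarrow> 0)"

text \<open>The e/3 argument: translation is an isometry, so the error of the approximation is the
  same before and after the shift.\<close>

lemma translation_continuous_closed:
  assumes f: "f \<in> L2 lborel"
    and approx: "\<And>e. e > 0 \<Longrightarrow> \<exists>g. translation_continuous g \<and> norm2 lborel (\<lambda>x. f x - g x) < e"
  shows "translation_continuous f"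
  unfolding translation_continuous_def
proof (intro conjI allI impI f LIMSEQ_I)
  fix h :: "nat \<Rightarrow> 'a" and e :: real assume h: "h \<longlonglongrightarrow> 0" and e: "0 < e"
  then obtain g where g: "translation_continuous g" and fg: "norm2 lborel (\<lambda>x. f x - g x) < e/3"
    using approx[of "e/3"] by auto
  have gL: "g \<in> L2 lborel" using g by (simp add: translation_continuous_def)
  have "(\<lambda>k. norm2 lborel (\<lambda>x. g (h k + x) - g x)) \<longlonglongrightarrow> 0"
    using g h by (simp add: translation_continuous_def)
  then obtain n0 where n0: "\<And>k. k \<ge> n0 \<Longrightarrow> norm2 lborel (\<lambda>x. g (h k + x) - g x) < e/3"
    using LIMSEQ_D[of _ 0 "e/3"] e by fastforce
  show "\<exists>n0. \<forall>k\<ge>n0. norm (norm2 lborel (\<lambda>x. f (h k + x) - f x) - 0) < e"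
  proof (intro exI allI impI)
    fix k assume k: "k \<ge> n0"
    have "norm2 lborel (\<lambda>x. f (h k + x) - f x) \<le>
        norm2 lborel (\<lambda>x. f (h k + x) - g (h k + x)) + norm2 lborel (\<lambda>x. g (h k + x) - f x)"
      by (rule norm2_diff_triangle) (auto intro: L2_translate f gL)
    also have "norm2 lborel (\<lambda>x. f (h k + x) - g (h k + x)) = norm2 lborel (\<lambda>x. f x - g x)"
      by (rule L2_translate(2)[of "\<lambda>x. f x - g x"]) (use f gL in auto)
    also have "norm2 lborel (\<lambda>x. g (h k + x) - f x) \<le>
        norm2 lborel (\<lambda>x. g (h k + x) - g x) + norm2 lborel (\<lambda>x. g x - f x)"
      by (rule norm2_diff_triangle) (auto intro: L2_translate f gL)
    also have "norm2 lborel (\<lambda>x. g x - f x) = norm2 lborel (\<lambda>x. f x - g x)"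
      by (rule norm2_diff_commute)
    finally show "norm (norm2 lborel (\<lambda>x. f (h k + x) - f x) - 0) < e"
      using fg n0[OF k] by simp
  qed
qed

lemma translation_continuous_add:
  assumes "translation_continuous f" "translation_continuous g"
  shows "translation_continuous (\<lambda>x. f x + g x)"
  unfolding translation_continuous_def
proof (intro conjI allI impI)
  have L: "f \<in> L2 lborel" "g \<in> L2 lborel" using assms by (auto simp: translation_continuous_def)
  then show "(\<lambda>x. f x + g x) \<in> L2 lborel" by auto
  fix h :: "nat \<Rightarrow> 'a" assume h: "h \<longlonglongrightarrow> 0"
  show "(\<lambda>k. norm2 lborel (\<lambda>x. f (h k + x) + g (h k + x) - (f x + g x))) \<longlonglongrightarrow> 0"
  proof (rule Lim_null_comparison)
    show "(\<lambda>k. norm2 lborel (\<lambda>x. f (h k + x) - f x) + norm2 lborel (\<lambda>x. g (h k + x) - g x)) \<longlonglongrightarrow> 0"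
      using assms h by (intro tendsto_add_zero) (auto simp: translation_continuous_def)
    have "norm2 lborel (\<lambda>x. (f (h k + x) - f x) + (g (h k + x) - g x)) \<le>
        norm2 lborel (\<lambda>x. f (h k + x) - f x) + norm2 lborel (\<lambda>x. g (h k + x) - g x)" for k
      by (rule norm2_triangle) (intro L2_diff L2_translate L)+
    then show "\<forall>\<^sub>F k in sequentially. norm (norm2 lborel (\<lambda>x. f (h k + x) + g (h k + x) - (f x + g x))) \<le>
        norm2 lborel (\<lambda>x. f (h k + x) - f x) + norm2 lborel (\<lambda>x. g (h k + x) - g x)"
      by (intro always_eventually allI) (simp add: algebra_simps)
  qed
qed

lemma translation_continuous_cmult:
  assumes "translation_continuous f"
  shows "translation_continuous (\<lambda>x. c * f x)"
  unfolding translation_continuous_def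
proof (intro conjI allI impI)
  show "(\<lambda>x. c * f x) \<in> L2 lborel" using assms by (auto simp: translation_continuous_def)
  fix h :: "nat \<Rightarrow> 'a" assume h: "h \<longlonglongrightarrow> 0"
  have "norm2 lborel (\<lambda>x. c * f (h k + x) - c * f x) = norm c * norm2 lborel (\<lambda>x. f (h k + x) - f x)" for k
    unfolding right_diff_distrib[symmetric] norm2_def sqnorm_cmult by (simp add: real_sqrt_mult)
  then show "(\<lambda>k. norm2 lborel (\<lambda>x. c * f (h k + x) - c * f x)) \<longlonglongrightarrow> 0"
    using assms h by (simp add: translation_continuous_def tendsto_mult_right_zero)
qed

text \<open>For open \<open>U\<close> the indicators \<open>indicator U (h + x)\<close> converge at every point of \<open>U\<close>,
  which is all that the expansion of the squared norm of the difference requires.\<close>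

lemma translation_continuous_open:
  fixes U :: "'a::euclidean_space set"
  assumes U: "open U" and fin: "emeasure lborel U < \<infinity>"
  shows "translation_continuous (indicator U)"
  unfolding translation_continuous_def
proof (intro conjI allI impI)
  have [measurable]: "U \<in> sets borel" using U by auto
  show L: "(indicator U :: 'a \<Rightarrow> complex) \<in> L2 lborel" using fin by auto
  fix h :: "nat \<Rightarrow> 'a" assume h: "h \<longlonglongrightarrow> 0"
  let ?I = "indicator U :: 'a \<Rightarrow> complex"
  have "(\<lambda>k. ip lborel (\<lambda>x. ?I (h k + x)) ?I) \<longlonglongrightarrow> ip lborel ?I ?I"
    unfolding ip_def
  proof (rule integral_dominated_convergence[where w="indicator U"])
    show "integrable lborel (indicat_real U)" using fin by simp
    show "AE x in lborel. (\<lambda>k. ?I (h k + x) * cnj (?I x)) \<longlonglongrightarrow> ?I x * cnj (?I x)"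
    proof (rule AE_I2)
      fix x
      show "(\<lambda>k. ?I (h k + x) * cnj (?I x)) \<longlonglongrightarrow> ?I x * cnj (?I x)"
      proof (cases "x \<in> U")
        case True
        have "(\<lambda>k. h k + x) \<longlonglongrightarrow> 0 + x" by (intro tendsto_intros h)
        then have "\<forall>\<^sub>F k in sequentially. h k + x \<in> U"
          using U True by (simp add: tendsto_def)
        then have "\<forall>\<^sub>F k in sequentially. ?I (h k + x) * cnj (?I x) = ?I x * cnj (?I x)"
          by eventually_elim (use True in auto)
        then show ?thesis by (rule tendsto_eventually)
      qed auto
    qed
    show "AE x in lborel. norm (?I (h k + x) * cnj (?I x)) \<le> indicat_real U x" for k
      by (rule AE_I2) (auto simp: indicator_def)
  qed auto
  then have "(\<lambda>k. 2 * sqnorm lborel ?I - 2 * Re (ip lborel (\<lambda>x. ?I (h k + x)) ?I)) \<longlonglongrightarrow>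
      2 * sqnorm lborel ?I - 2 * Re (ip lborel ?I ?I)"
    by (intro tendsto_intros)
  moreover have "sqnorm lborel (\<lambda>x. ?I (h k + x) - ?I x) =
      2 * sqnorm lborel ?I - 2 * Re (ip lborel (\<lambda>x. ?I (h k + x)) ?I)" for k
    using norm2_power2[of lborel "\<lambda>x. ?I (h k + x)"] norm2_power2[of lborel ?I]
    by (simp add: sqnorm_diff L2_translate L)
  ultimately show "(\<lambda>k. norm2 lborel (\<lambda>x. ?I (h k + x) - ?I x)) \<longlonglongrightarrow> 0"
    by (simp add: tendsto_norm2_0_iff ip_self)
qed

text \<open>Outer regularity: an open superset \<open>U\<close> with \<open>U - A\<close> of measure
  below e^2 is within e of \<open>A\<close> in the quadratic mean, because the squared norm of an
  indicator is a measure.\<close>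

lemma translation_continuous_indicator:
  fixes A :: "'a::euclidean_space set"
  assumes [measurable]: "A \<in> sets borel" and fin: "emeasure lborel A < \<infinity>"
  shows "translation_continuous (indicator A)"
proof (rule translation_continuous_closed)
  show "(indicator A :: 'a \<Rightarrow> complex) \<in> L2 lborel" using fin by auto
  fix e :: real assume e: "e > 0"
  have AL: "A \<in> sets lebesgue" by (simp add: assms(1) sets_completionI_sets)
  obtain U where U: "open U" "A \<subseteq> U" "emeasure lebesgue (U - A) < ennreal (e\<^sup>2)"
    using sets_lebesgue_outer_open[OF AL, of "e\<^sup>2"] e by auto
  have [measurable]: "U \<in> sets borel" using U by auto
  have UA: "emeasure lborel (U - A) < ennreal (e\<^sup>2)" using U(3) by simp
  have "emeasure lborel U \<le> emeasure lborel A + emeasure lborel (U - A)"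
    using emeasure_subadditive[of A lborel "U - A"] U(2) by (simp add: Un_absorb1)
  also have "\<dots> < \<infinity>" using fin UA by (auto simp: less_top[symmetric])
  finally have Ufin: "emeasure lborel U < \<infinity>" .
  have "sqnorm lborel (\<lambda>x. indicator A x - indicator U x) = sqnorm lborel (indicator (U - A))"
    unfolding sqnorm_def by (rule Bochner_Integration.integral_cong) (use U(2) in \<open>auto simp: indicator_def\<close>)
  also have "\<dots> = measure lborel (U - A)" by (rule sqnorm_indicator) auto
  also have "\<dots> < e\<^sup>2"
    using UA e less_trans[OF UA ennreal_less_top]
    by (subst (asm) emeasure_eq_ennreal_measure) (auto simp: ennreal_less_iff)
  finally have "norm2 lborel (\<lambda>x. indicator A x - indicator U x) < e"
    using e by (simp add: norm2_def real_less_lsqrt)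
  then show "\<exists>g. translation_continuous g \<and> norm2 lborel (\<lambda>x. indicator A x - g x) < e"
    using translation_continuous_open[OF U(1) Ufin] by blast
qed

lemma translation_continuous_sum:
  "(\<And>i. i \<in> I \<Longrightarrow> translation_continuous (f i)) \<Longrightarrow> translation_continuous (\<lambda>x. \<Sum>i\<in>I. f i x)"
proof (induction I rule: infinite_finite_induct)
  case (insert i I)
  then show ?case by (auto intro: translation_continuous_add)
qed (auto simp: translation_continuous_def norm2_def sqnorm_def)

lemma translation_continuous_L2:
  fixes f :: "'a::euclidean_space \<Rightarrow> complex"
  assumes f: "f \<in> L2 lborel"
  shows "translation_continuous f"
proof -
  have [measurable]: "f \<in> borel_measurable lborel" using f by (simp add: L2_def)
  obtain F where F: "\<And>i. simple_function lborel (F i)"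
      "\<And>x. (\<lambda>i. F i x) \<longlonglongrightarrow> f x" "\<And>i x. norm (F i x) \<le> 2 * norm (f x)"
    using borel_measurable_implies_sequence_metric[of f lborel 0] by (force simp: dist_norm)
  have Fm[measurable]: "F i \<in> borel_measurable lborel" for i by (rule borel_measurable_simple_function[OF F(1)])
  have FL: "F i \<in> L2 lborel" for i
    by (rule L2_bound[of "\<lambda>x. 2 * f x"]) (use f F in \<open>auto simp: norm_mult\<close>)
  have tc: "translation_continuous (F i)" for i
  proof -
    have "F i = (\<lambda>x. \<Sum>c\<in>F i ` UNIV. c * indicator (F i -` {c}) x)"
    proof
      fix x
      have fin: "finite (F i ` UNIV)" using F(1)[of i] by (simp add: simple_function_def)
      have "(\<Sum>c\<in>F i ` UNIV. c * indicator (F i -` {c}) x) = (\<Sum>c\<in>F i ` UNIV. if c = F i x then c else 0)"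
        by (rule sum.cong) (auto simp: indicator_def)
      also have "\<dots> = F i x" using fin by simp
      finally show "F i x = (\<Sum>c\<in>F i ` UNIV. c * indicator (F i -` {c}) x)" by simp
    qed
    moreover have "translation_continuous (\<lambda>x. \<Sum>c\<in>F i ` UNIV. c * indicator (F i -` {c}) x)"
    proof (rule translation_continuous_sum)
      fix c
      show "translation_continuous (\<lambda>x. c * indicator (F i -` {c}) x)"
      proof (cases "c = 0")
        case True
        then show ?thesis by (simp add: translation_continuous_def norm2_def sqnorm_def)
      next
        case False
        have m: "F i -` {c} \<in> sets borel" using measurable_sets[OF Fm[of i], of "{c}"] by simp
        \<comment> \<open>On the level set of a value c \<noteq> 0 the indicator equals
          \<open>F i / c\<close>, so square integrability of \<open>F i\<close> makes the measure of
          the set finite.\<close>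
        have "(indicator (F i -` {c}) :: 'a \<Rightarrow> complex) \<in> L2 lborel"
          by (rule L2_bound[OF L2_cmult[OF FL[of i], of "1/c"]]) (use FL m False in \<open>auto simp: indicator_def\<close>)
        then have "integrable lborel (\<lambda>x. (norm (indicator (F i -` {c}) x :: complex))\<^sup>2)" by (simp add: L2_def)
        also have "(\<lambda>x. (norm (indicator (F i -` {c}) x :: complex))\<^sup>2) = indicat_real (F i -` {c})"
          by (auto simp: indicator_def)
        finally have "emeasure lborel (F i -` {c}) < \<infinity>"
          using m by (simp add: integrable_indicator_iff)
        from translation_continuous_cmult[OF translation_continuous_indicator[OF m this]] show ?thesis .
      qed
    qed
    ultimately show ?thesis by simp
  qed
  have "(\<lambda>i. sqnorm lborel (\<lambda>x. f x - F i x)) \<longlonglongrightarrow> (LINT x::'a|lborel. 0)"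
    unfolding sqnorm_def
  proof (rule integral_dominated_convergence[where w="\<lambda>x. 9 * (norm (f x))\<^sup>2"])
    show "integrable lborel (\<lambda>x. 9 * (norm (f x))\<^sup>2)" using f by (simp add: L2_def)
    show "AE x in lborel. (\<lambda>i. (norm (f x - F i x))\<^sup>2) \<longlonglongrightarrow> 0"
    proof (rule AE_I2)
      fix x
      have "(\<lambda>i. (norm (f x - F i x))\<^sup>2) \<longlonglongrightarrow> (norm (f x - f x))\<^sup>2" by (intro tendsto_intros F)
      then show "(\<lambda>i. (norm (f x - F i x))\<^sup>2) \<longlonglongrightarrow> 0" by simp
    qed
    show "AE x in lborel. norm ((norm (f x - F i x))\<^sup>2) \<le> 9 * (norm (f x))\<^sup>2" for i
    proof (rule AE_I2)
      fix x
      have "norm (f x - F i x) \<le> 3 * norm (f x)"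
        using norm_triangle_ineq4[of "f x" "F i x"] F(3)[of i x] by linarith
      then have "(norm (f x - F i x))\<^sup>2 \<le> (3 * norm (f x))\<^sup>2" by (intro power_mono) auto
      then show "norm ((norm (f x - F i x))\<^sup>2) \<le> 9 * (norm (f x))\<^sup>2" by (simp add: power_mult_distrib)
    qed
  qed auto
  then have lim: "(\<lambda>i. norm2 lborel (\<lambda>x. f x - F i x)) \<longlonglongrightarrow> 0" by (simp add: tendsto_norm2_0_iff)
  show ?thesis
  proof (rule translation_continuous_closed[OF f])
    fix e :: real assume "e > 0"
    from LIMSEQ_D[OF lim this] obtain i where "norm2 lborel (\<lambda>x. f x - F i x) < e" by fastforce
    then show "\<exists>g. translation_continuous g \<and> norm2 lborel (\<lambda>x. f x - g x) < e" using tc by blast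
  qed
qed

subsection \<open>Plancherel's theorem\<close>

text \<open>Justifies the interchanges of integrals with an oscillating factor; \<open>k\<close>
  will be \<open>cis\<close> or \<open>sin\<close> of a multiple of an inner product.\<close>

lemma integrable_tensor:
  fixes u :: "'a::euclidean_space \<Rightarrow> complex" and v :: "'b::euclidean_space \<Rightarrow> complex"
  assumes u: "integrable lborel u" and v: "integrable lborel v"
    and [measurable]: "(\<lambda>(x, y). k x y) \<in> borel_measurable (lborel \<Otimes>\<^sub>M lborel)"
    and k: "\<And>x y. norm (k x y) \<le> 1"
  shows "integrable (lborel \<Otimes>\<^sub>M lborel) (\<lambda>(x, y). u x * v y * k x y)"
proof -
  have [measurable]: "u \<in> borel_measurable borel" "v \<in> borel_measurable borel" using u v by auto
  have uv: "integrable (lborel \<Otimes>\<^sub>M lborel) (\<lambda>(x, y). u x * v y)"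
  proof (rule lborel_pair.Fubini_integrable)
    show "integrable lborel (\<lambda>x. LINT y|lborel. norm (case (x, y) of (x, y) \<Rightarrow> u x * v y))"
      using u by (simp add: norm_mult)
    show "AE x in lborel. integrable lborel (\<lambda>y. case (x, y) of (x, y) \<Rightarrow> u x * v y)"
      using v by simp
  qed auto
  show ?thesis
  proof (rule Bochner_Integration.integrable_bound[OF uv])
    show "AE z in lborel \<Otimes>\<^sub>M lborel. norm (case z of (x, y) \<Rightarrow> u x * v y * k x y) \<le> norm (case z of (x, y) \<Rightarrow> u x * v y)"
      by (intro AE_I2) (auto simp: norm_mult mult_left_le k split: prod.split)
  qed auto
qed

lemma borel_measurable_cis [measurable]: "cis \<in> borel_measurable borel"
  by (intro borel_measurable_continuous_onI continuous_intros)

lemma integrable_cis_mult: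
  fixes f :: "'a::euclidean_space \<Rightarrow> complex"
  assumes "integrable lborel f" "g \<in> borel_measurable borel"
  shows "integrable lborel (\<lambda>y. f y * cis (g y))"
  by (rule Bochner_Integration.integrable_bound[OF assms(1)]) (use assms in \<open>auto simp: norm_mult\<close>)

text \<open>The counterpart of \<open>fourier_integral\<close> over \<open>lborel\<close>. Fubini
  and translation invariance are applied to Borel functions, and the results are carried over to
  \<open>lebesgue\<close> through Borel representatives.\<close>

definition fi :: "('a::euclidean_space \<Rightarrow> complex) \<Rightarrow> 'a \<Rightarrow> complex" where
  "fi f \<xi> = (LINT y|lborel. f y * cis (- (2 * pi * (y \<bullet> \<xi>))))"

lemma fi_measurable [measurable]:
  assumes [measurable]: "f \<in> borel_measurable borel" shows "fi f \<in> borel_measurable borel"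
  unfolding fi_def by measurable

lemma fi_shift_formula:
  fixes f g :: "'a::euclidean_space \<Rightarrow> complex"
  assumes f: "integrable lborel f" and g: "integrable lborel g"
  shows "(LINT \<xi>|lborel. fi f \<xi> * g \<xi>) = (LINT y|lborel. f y * fi g y)"
proof -
  have [measurable]: "f \<in> borel_measurable borel" "g \<in> borel_measurable borel" using f g by auto
  have "(LINT \<xi>|lborel. LINT y|lborel. f y * g \<xi> * cis (- (2 * pi * (y \<bullet> \<xi>))))
      = (LINT y|lborel. LINT \<xi>|lborel. f y * g \<xi> * cis (- (2 * pi * (y \<bullet> \<xi>))))"
    by (rule lborel_pair.Fubini_integral, rule integrable_tensor[OF f g]) auto
  moreover have "(LINT y|lborel. f y * g \<xi> * cis (- (2 * pi * (y \<bullet> \<xi>)))) = fi f \<xi> * g \<xi>" for \<xi>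
    unfolding fi_def by (subst integral_mult_left_zero[symmetric]) (simp add: mult_ac)
  moreover have "(LINT \<xi>|lborel. f y * g \<xi> * cis (- (2 * pi * (y \<bullet> \<xi>)))) = f y * fi g y" for y
    unfolding fi_def by (subst integral_mult_right_zero[symmetric]) (simp add: mult_ac inner_commute)
  ultimately show ?thesis by simp
qed

text \<open>Fubini and translation invariance factor the double integral into the integral of
  \<open>u\<close> times its conjugate. Applied to a modulated function this yields
  \<open>norm_fi_square\<close>.\<close>

lemma autocorrelation:
  fixes u :: "'a::euclidean_space \<Rightarrow> complex"
  assumes u: "integrable lborel u"
  shows integrable_autocorrelation: "integrable lborel (\<lambda>h. LINT y|lborel. u (h + y) * cnj (u y))"
    and integral_autocorrelation: "(LINT h|lborel. LINT y|lborel. u (h + y) * cnj (u y))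
      = of_real ((norm (LINT y|lborel. u y))\<^sup>2)"
proof -
  have [measurable]: "u \<in> borel_measurable borel" using u by auto
  have *: "(LINT h|lborel. g (h + y)) = (LINT h|lborel. g h)" if "g \<in> borel_measurable borel"
    for g :: "'a \<Rightarrow> 'b::{banach, second_countable_topology}" and y
    using integral_lborel_translate[of g y] that by (simp add: add.commute)
  have int: "integrable (lborel \<Otimes>\<^sub>M lborel) (\<lambda>(y, h). u (h + y) * cnj (u y))"
  proof (rule lborel_pair.Fubini_integrable)
    have "(LINT h|lborel. norm (u (h + y) * cnj (u y))) = (LINT h|lborel. norm (u h)) * norm (u y)" for y
      using *[of "\<lambda>h. norm (u h)" y] by (simp add: norm_mult)
    then show "integrable lborel (\<lambda>y. LINT h|lborel. norm (case (y, h) of (y, h) \<Rightarrow> u (h + y) * cnj (u y)))"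
      using u by simp
    show "AE y in lborel. integrable lborel (\<lambda>h. case (y, h) of (y, h) \<Rightarrow> u (h + y) * cnj (u y))"
      using integrable_lborel_translate[OF u] by (simp add: add.commute)
  qed auto
  show "integrable lborel (\<lambda>h. LINT y|lborel. u (h + y) * cnj (u y))"
    using lborel_pair.integrable_snd[OF int] .
  have "(LINT h|lborel. LINT y|lborel. u (h + y) * cnj (u y)) = (LINT y|lborel. LINT h|lborel. u (h + y) * cnj (u y))"
    by (rule lborel_pair.Fubini_integral[OF int])
  also have "\<dots> = (LINT y|lborel. (LINT h|lborel. u h) * cnj (u y))"
    using *[of u] by simp
  also have "\<dots> = (LINT h|lborel. u h) * cnj (LINT h|lborel. u h)" by simp
  finally show "(LINT h|lborel. LINT y|lborel. u (h + y) * cnj (u y)) = of_real ((norm (LINT y|lborel. u y))\<^sup>2)"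
    by (simp add: complex_norm_square[symmetric])
qed

text \<open>Absorbing the character into \<open>u\<close> turns \<open>fi f \<xi>\<close> into a
  plain integral; in the autocorrelation of \<open>u\<close> the phases at h + y and y combine to
  the character at h alone.\<close>

lemma norm_fi_square:
  fixes f :: "'a::euclidean_space \<Rightarrow> complex"
  assumes f: "integrable lborel f"
  shows "of_real ((norm (fi f \<xi>))\<^sup>2)
    = (LINT h|lborel. (LINT y|lborel. f (h + y) * cnj (f y)) * cis (- (2 * pi * (h \<bullet> \<xi>))))"
proof -
  define u where "u y = f y * cis (- (2 * pi * (y \<bullet> \<xi>)))" for y
  have u: "integrable lborel u" unfolding u_def by (rule integrable_cis_mult[OF f]) auto
  have "u (h + y) * cnj (u y) = f (h + y) * cnj (f y) * cis (- (2 * pi * (h \<bullet> \<xi>)))" for h y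
  proof -
    have "cis (- (2 * pi * ((h + y) \<bullet> \<xi>))) * cnj (cis (- (2 * pi * (y \<bullet> \<xi>)))) = cis (- (2 * pi * (h \<bullet> \<xi>)))"
      by (simp add: cis_cnj cis_mult inner_add_left algebra_simps)
    then show ?thesis unfolding u_def by (simp add: mult_ac)
  qed
  note eq = this
  have "of_real ((norm (fi f \<xi>))\<^sup>2) = (LINT h|lborel. LINT y|lborel. u (h + y) * cnj (u y))"
    unfolding integral_autocorrelation[OF u] unfolding fi_def u_def ..
  then show ?thesis unfolding eq by simp
qed

text \<open>Up to the factor sqrt (2 pi) this is the characteristic function of the standard normal
  distribution.\<close>

lemma gauss_FT_real:
  fixes t :: real
  shows "integrable lborel (\<lambda>x. complex_of_real (exp (- x\<^sup>2 / 2)) * cis (x * t))"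
    and "(LINT x|lborel. complex_of_real (exp (- x\<^sup>2 / 2)) * cis (x * t)) = of_real (sqrt (2 * pi) * exp (- t\<^sup>2 / 2))"
proof -
  have e: "exp (- x\<^sup>2 / 2) = sqrt (2 * pi) * std_normal_density x" for x :: real
    by (simp add: std_normal_density_def)
  have "integrable lborel (\<lambda>x. complex_of_real (exp (- x\<^sup>2 / 2)))"
    unfolding e using integrable_normal_density[of 1 0] by (intro integrable_of_real integrable_mult_right) auto
  then show "integrable lborel (\<lambda>x. complex_of_real (exp (- x\<^sup>2 / 2)) * cis (x * t))"
    by (rule integrable_cis_mult) auto
  have "of_real (exp (- t\<^sup>2 / 2)) = char std_normal_distribution t"
    by (simp add: char_std_normal_distribution)
  also have "\<dots> = (LINT x|lborel. std_normal_density x *\<^sub>R iexp (t * x))"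
    unfolding char_def by (subst integral_density) (auto simp: normal_density_nonneg)
  finally have *: "(LINT x|lborel. std_normal_density x *\<^sub>R iexp (t * x)) = of_real (exp (- t\<^sup>2 / 2))" ..
  have "(LINT x|lborel. complex_of_real (exp (- x\<^sup>2 / 2)) * cis (x * t))
      = (LINT x|lborel. of_real (sqrt (2 * pi)) * (std_normal_density x *\<^sub>R iexp (t * x)))"
    unfolding e by (rule Bochner_Integration.integral_cong) (auto simp: cis_conv_exp scaleR_conv_of_real mult_ac)
  also have "\<dots> = of_real (sqrt (2 * pi)) * of_real (exp (- t\<^sup>2 / 2))"
    unfolding *[symmetric] by (rule Bochner_Integration.integral_mult_right_zero)
  finally show "(LINT x|lborel. complex_of_real (exp (- x\<^sup>2 / 2)) * cis (x * t)) = of_real (sqrt (2 * pi) * exp (- t\<^sup>2 / 2))"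
    by simp
qed

lemma lborel_integral_prod:
  fixes f :: "'a::euclidean_space \<Rightarrow> real \<Rightarrow> complex"
  assumes f: "\<And>b. b \<in> Basis \<Longrightarrow> integrable lborel (f b)"
  shows "(LINT x|lborel. (\<Prod>b\<in>Basis. f b (x \<bullet> b))) = (\<Prod>b\<in>Basis. (LINT x|lborel. f b x))"
    and "integrable lborel (\<lambda>x. \<Prod>b\<in>Basis. f b (x \<bullet> b))"
proof -
  interpret product_sigma_finite "\<lambda>_::'a. lborel :: real measure" ..
  have [measurable]: "\<And>b. b \<in> Basis \<Longrightarrow> f b \<in> borel_measurable borel" using f by auto
  have inner: "(\<Sum>b'\<in>Basis. g b' *\<^sub>R b') \<bullet> b = g b" if "b \<in> Basis" for b :: 'a and g :: "'a \<Rightarrow> real"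
    using that by simp
  have "(LINT x|lborel. (\<Prod>b\<in>Basis. f b (x \<bullet> b))) =
      (LINT g|(\<Pi>\<^sub>M b\<in>Basis. lborel). (\<Prod>b\<in>Basis. f b ((\<Sum>b'\<in>Basis. g b' *\<^sub>R b') \<bullet> b)))"
    by (subst lborel_eq, subst integral_distr) auto
  also have "\<dots> = (LINT g|(\<Pi>\<^sub>M b\<in>Basis. lborel). (\<Prod>b\<in>Basis. f b (g b)))"
    using inner by (intro Bochner_Integration.integral_cong prod.cong) auto
  also have "\<dots> = (\<Prod>b\<in>Basis. (LINT x|lborel. f b x))"
    by (rule product_integral_prod) (auto intro: f)
  finally show "(LINT x|lborel. (\<Prod>b\<in>Basis. f b (x \<bullet> b))) = (\<Prod>b\<in>Basis. (LINT x|lborel. f b x))" .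
  have "integrable (\<Pi>\<^sub>M b\<in>Basis. lborel) (\<lambda>g. \<Prod>b\<in>Basis. f b (g b))"
    by (rule product_integrable_prod) (auto intro: f)
  also have "(\<lambda>g. \<Prod>b\<in>Basis. f b (g b)) = (\<lambda>g. \<Prod>b\<in>Basis. f b ((\<Sum>b'\<in>Basis. g b' *\<^sub>R b') \<bullet> b))"
    using inner by (intro ext prod.cong) auto
  finally show "integrable lborel (\<lambda>x. \<Prod>b\<in>Basis. f b (x \<bullet> b))"
    by (subst lborel_eq, subst integrable_distr_eq) auto
qed

lemma gauss_FT:
  fixes x :: "'a::euclidean_space"
  shows "integrable lborel (\<lambda>z::'a. complex_of_real (exp (- (norm z)\<^sup>2 / 2)) * cis (z \<bullet> x))"
    and "(LINT z::'a|lborel. complex_of_real (exp (- (norm z)\<^sup>2 / 2)) * cis (z \<bullet> x))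
       = of_real (sqrt (2 * pi) ^ DIM('a) * exp (- (norm x)\<^sup>2 / 2))"
proof -
  have nrm: "(norm z)\<^sup>2 = (\<Sum>b\<in>Basis. (z \<bullet> b)\<^sup>2)" for z :: 'a
    unfolding power2_norm_eq_inner by (subst euclidean_inner) (simp add: power2_eq_square)
  have eq: "complex_of_real (exp (- (norm z)\<^sup>2 / 2)) * cis (z \<bullet> x)
     = (\<Prod>b\<in>Basis. complex_of_real (exp (- (z \<bullet> b)\<^sup>2 / 2)) * cis ((z \<bullet> b) * (x \<bullet> b)))" for z :: 'a
  proof -
    have "exp (- (norm z)\<^sup>2 / 2) = (\<Prod>b\<in>Basis. exp (- (z \<bullet> b)\<^sup>2 / 2))"
      unfolding nrm by (subst exp_sum[symmetric]) (auto simp: sum_negf sum_divide_distrib)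
    moreover have "cis (z \<bullet> x) = (\<Prod>b\<in>Basis. cis ((z \<bullet> b) * (x \<bullet> b)))"
      unfolding cis_conv_exp by (subst euclidean_inner, subst exp_sum[symmetric]) (auto simp: sum_distrib_left)
    ultimately show ?thesis by (simp add: prod.distrib)
  qed
  show "integrable lborel (\<lambda>z::'a. complex_of_real (exp (- (norm z)\<^sup>2 / 2)) * cis (z \<bullet> x))"
    unfolding eq by (rule lborel_integral_prod(2)) (rule gauss_FT_real)
  have "(LINT z::'a|lborel. complex_of_real (exp (- (norm z)\<^sup>2 / 2)) * cis (z \<bullet> x))
     = (\<Prod>b\<in>Basis. (LINT s|lborel. complex_of_real (exp (- s\<^sup>2 / 2)) * cis (s * (x \<bullet> b))))"
    unfolding eq by (rule lborel_integral_prod(1)) (rule gauss_FT_real)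
  also have "\<dots> = of_real (\<Prod>b\<in>Basis. sqrt (2 * pi) * exp (- (x \<bullet> b)\<^sup>2 / 2))"
    by (simp only: gauss_FT_real of_real_prod)
  also have "(\<Prod>b\<in>Basis. sqrt (2 * pi) * exp (- (x \<bullet> b)\<^sup>2 / 2)) = sqrt (2 * pi) ^ DIM('a) * exp (- (norm x)\<^sup>2 / 2)"
    unfolding nrm prod.distrib by (subst exp_sum[symmetric]) (auto simp: sum_negf sum_divide_distrib)
  finally show "(LINT z::'a|lborel. complex_of_real (exp (- (norm z)\<^sup>2 / 2)) * cis (z \<bullet> x))
       = of_real (sqrt (2 * pi) ^ DIM('a) * exp (- (norm x)\<^sup>2 / 2))" .
qed

text \<open>The Gaussian makes the frequency integral converge before \<open>fi f\<close> is known
  to be square integrable. Fubini moves the transform onto the Gaussian, where it has width of order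
  1/(2 pi m) in h; the substitution z = 2 pi m h then leaves \<open>m\<close> only in the argument
  of the autocorrelation.\<close>

lemma damped_Plancherel:
  fixes f :: "'a::euclidean_space \<Rightarrow> complex" and m :: real
  assumes f: "integrable lborel f" and m: "m > 0"
  shows "integrable lborel (\<lambda>\<xi>. exp (- (norm ((1/m) *\<^sub>R \<xi>))\<^sup>2 / 2) * (norm (fi f \<xi>))\<^sup>2)" (is ?thesis1)
    and "of_real (LINT \<xi>|lborel. exp (- (norm ((1/m) *\<^sub>R \<xi>))\<^sup>2 / 2) * (norm (fi f \<xi>))\<^sup>2)
      = of_real (1 / sqrt (2 * pi) ^ DIM('a)) *
        (LINT z|lborel. (LINT y|lborel. f ((1 / (2 * pi * m)) *\<^sub>R z + y) * cnj (f y)) * of_real (exp (- (norm z)\<^sup>2 / 2)))"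
      (is ?thesis2)
proof -
  define g :: "'a \<Rightarrow> complex" where "g z = of_real (exp (- (norm z)\<^sup>2 / 2))" for z
  define A where "A h = (LINT y|lborel. f (h + y) * cnj (f y))" for h
  have [measurable]: "f \<in> borel_measurable borel" using f by auto
  have [measurable]: "A \<in> borel_measurable borel" "g \<in> borel_measurable borel"
    unfolding A_def g_def by measurable
  have A: "integrable lborel A" unfolding A_def by (rule integrable_autocorrelation[OF f])
  have g: "integrable lborel g" using gauss_FT(1)[of "0::'a"] unfolding g_def[abs_def] by simp
  have gm: "integrable lborel (\<lambda>\<xi>. g ((1/m) *\<^sub>R \<xi>))" by (rule integrable_lborel_scale[OF g]) (use m in auto)
  have tens: "integrable (lborel \<Otimes>\<^sub>M lborel) (\<lambda>(h, \<xi>). A h * g ((1/m) *\<^sub>R \<xi>) * cis (- (2 * pi * (h \<bullet> \<xi>))))"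
    by (rule integrable_tensor[OF A gm]) auto
  have eq1: "(LINT h|lborel. A h * g ((1/m) *\<^sub>R \<xi>) * cis (- (2 * pi * (h \<bullet> \<xi>))))
      = of_real (exp (- (norm ((1/m) *\<^sub>R \<xi>))\<^sup>2 / 2) * (norm (fi f \<xi>))\<^sup>2)" for \<xi>
    using norm_fi_square[OF f, of \<xi>] unfolding A_def[symmetric]
    by (simp add: g_def mult_ac flip: integral_mult_right_zero)
  have "integrable lborel (\<lambda>\<xi>. complex_of_real (exp (- (norm ((1/m) *\<^sub>R \<xi>))\<^sup>2 / 2) * (norm (fi f \<xi>))\<^sup>2))"
    using lborel_pair.integrable_snd[OF tens] unfolding eq1 .
  then show ?thesis1 using complex_of_real_integrable_eq by blast
  define c where "c = sqrt (2 * pi) ^ DIM('a)"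
  have c: "c > 0" by (simp add: c_def)
  have eq2: "(LINT \<xi>|lborel. A h * g ((1/m) *\<^sub>R \<xi>) * cis (- (2 * pi * (h \<bullet> \<xi>))))
     = A h * of_real (m ^ DIM('a) * c) * g ((2 * pi * m) *\<^sub>R h)" for h
  proof -
    have "(LINT \<xi>|lborel. g ((1/m) *\<^sub>R \<xi>) * cis (- (2 * pi * (h \<bullet> \<xi>))))
      = m ^ DIM('a) *\<^sub>R (LINT \<xi>|lborel. g ((1/m) *\<^sub>R m *\<^sub>R \<xi>) * cis (- (2 * pi * (h \<bullet> (m *\<^sub>R \<xi>)))))"
      by (rule integral_lborel_scale) (use m in auto)
    also have "(\<lambda>\<xi>. g ((1/m) *\<^sub>R m *\<^sub>R \<xi>) * cis (- (2 * pi * (h \<bullet> (m *\<^sub>R \<xi>))))) =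
        (\<lambda>\<xi>. of_real (exp (- (norm \<xi>)\<^sup>2 / 2)) * cis (\<xi> \<bullet> (- (2 * pi * m) *\<^sub>R h)))"
      using m by (auto simp: g_def inner_commute mult_ac)
    also have "(LINT \<xi>|lborel. of_real (exp (- (norm \<xi>)\<^sup>2 / 2)) * cis (\<xi> \<bullet> (- (2 * pi * m) *\<^sub>R h)))
        = of_real c * g ((2 * pi * m) *\<^sub>R h)"
      unfolding gauss_FT c_def g_def by (simp add: power_mult_distrib)
    finally show ?thesis by (simp add: mult.assoc scaleR_conv_of_real)
  qed
  have "of_real (LINT \<xi>|lborel. exp (- (norm ((1/m) *\<^sub>R \<xi>))\<^sup>2 / 2) * (norm (fi f \<xi>))\<^sup>2)
      = (LINT \<xi>|lborel. LINT h|lborel. A h * g ((1/m) *\<^sub>R \<xi>) * cis (- (2 * pi * (h \<bullet> \<xi>))))"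
    unfolding eq1 by (rule integral_complex_of_real[symmetric])
  also have "\<dots> = (LINT h|lborel. A h * of_real (m ^ DIM('a) * c) * g ((2 * pi * m) *\<^sub>R h))"
    unfolding eq2[symmetric] by (rule lborel_pair.Fubini_integral[OF tens])
  also have "\<dots> = (1 / (2 * pi * m)) ^ DIM('a) *\<^sub>R (LINT z|lborel. A ((1 / (2 * pi * m)) *\<^sub>R z) *
      of_real (m ^ DIM('a) * c) * g ((2 * pi * m) *\<^sub>R (1 / (2 * pi * m)) *\<^sub>R z))"
    by (rule integral_lborel_scale) (use m in auto)
  also have "(\<lambda>z. A ((1 / (2 * pi * m)) *\<^sub>R z) * of_real (m ^ DIM('a) * c) * g ((2 * pi * m) *\<^sub>R (1 / (2 * pi * m)) *\<^sub>R z))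
     = (\<lambda>z. of_real (m ^ DIM('a) * c) * (A ((1 / (2 * pi * m)) *\<^sub>R z) * g z))"
    using m by (auto simp: mult_ac)
  also have "(1 / (2 * pi * m)) ^ DIM('a) *\<^sub>R (LINT z|lborel. of_real (m ^ DIM('a) * c) * (A ((1 / (2 * pi * m)) *\<^sub>R z) * g z))
     = of_real ((1 / (2 * pi * m)) ^ DIM('a) * (m ^ DIM('a) * c)) * (LINT z|lborel. A ((1 / (2 * pi * m)) *\<^sub>R z) * g z)"
    by (simp add: scaleR_conv_of_real)
  \<comment> \<open>The powers of \<open>m\<close> from the two dilations cancel, and (2 pi)^n is
    the square of \<open>c\<close>.\<close>
  also have "(1 / (2 * pi * m)) ^ DIM('a) * (m ^ DIM('a) * c) = 1 / c"
  proof -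
    have "(2 * pi) ^ DIM('a) = c * c"
      unfolding c_def power_mult_distrib[symmetric] by simp
    then show ?thesis using m c by (simp add: power_divide power_mult_distrib)
  qed
  finally show ?thesis2 by (simp add: c_def A_def g_def)
qed

text \<open>As the damping is removed, the frequency side increases to the squared norm of
  \<open>fi f\<close> by monotone convergence. The other side tends, by dominated convergence and
  continuity of translations, to the autocorrelation at 0, which is the squared norm of
  \<open>f\<close>.\<close>

lemma Plancherel_lborel:
  fixes f :: "'a::euclidean_space \<Rightarrow> complex"
  assumes f: "integrable lborel f" and f2: "f \<in> L2 lborel"
  shows "fi f \<in> L2 lborel" and "sqnorm lborel (fi f) = sqnorm lborel f"
proof -
  define A where "A h = (LINT y|lborel. f (h + y) * cnj (f y))" for h
  \<comment> \<open>Starting at 1 keeps every damping parameter positive.\<close>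
  define d where "d m = real m + 1" for m
  define I where "I m = (LINT \<xi>|lborel. exp (- (norm ((1/d m) *\<^sub>R \<xi>))\<^sup>2 / 2) * (norm (fi f \<xi>))\<^sup>2)" for m
  have d: "d m > 0" for m by (simp add: d_def)
  have [measurable]: "f \<in> borel_measurable borel" using f by auto
  have [measurable]: "A \<in> borel_measurable borel" unfolding A_def by measurable
  have A_ip: "A h = ip lborel (\<lambda>x. f (h + x)) f" for h by (simp add: A_def ip_def)
  have A_le: "norm (A h) \<le> sqnorm lborel f" for h
    using Cauchy_Schwarz[OF L2_translate(1)[OF f2, of h] f2] L2_translate(2)[OF f2, of h]
    by (simp add: A_ip norm2_power2[symmetric] power2_eq_square)
  have A_lim: "(\<lambda>k. A (h k)) \<longlonglongrightarrow> A 0" if h: "h \<longlonglongrightarrow> 0" for h :: "nat \<Rightarrow> 'a"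
  proof -
    have "(\<lambda>k. norm2 lborel (\<lambda>x. f (h k + x) - f x)) \<longlonglongrightarrow> 0"
      using translation_continuous_L2[OF f2] h by (simp add: translation_continuous_def)
    then have "(\<lambda>k. ip lborel (\<lambda>x. f (h k + x)) f) \<longlonglongrightarrow> ip lborel f f"
      by (intro tendsto_ip) (auto intro: L2_translate f2 simp: norm2_def sqnorm_def)
    then show ?thesis by (simp add: A_ip)
  qed
  have gi: "integrable lborel (\<lambda>z::'a. exp (- (norm z)\<^sup>2 / 2))"
    using gauss_FT(1)[of "0::'a"] by (simp flip: complex_of_real_integrable_eq)
  have "(\<lambda>m. LINT z|lborel. A ((1 / (2 * pi * d m)) *\<^sub>R z) * of_real (exp (- (norm z)\<^sup>2 / 2)))
     \<longlonglongrightarrow> (LINT z|lborel. A 0 * of_real (exp (- (norm (z::'a))\<^sup>2 / 2)))"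
  proof (rule integral_dominated_convergence[where w="\<lambda>z. sqnorm lborel f * exp (- (norm z)\<^sup>2 / 2)"])
    show "AE z in lborel. (\<lambda>m. A ((1 / (2 * pi * d m)) *\<^sub>R z) * of_real (exp (- (norm z)\<^sup>2 / 2)))
        \<longlonglongrightarrow> A 0 * of_real (exp (- (norm z)\<^sup>2 / 2))"
    proof (intro AE_I2 tendsto_mult tendsto_const A_lim)
      fix z :: 'a
      have "(\<lambda>m. 1 / (2 * pi * d m)) \<longlonglongrightarrow> 0"
      proof -
        have "(\<lambda>m. inverse (2 * pi) * inverse (real (Suc m))) \<longlonglongrightarrow> inverse (2 * pi) * 0"
          by (intro tendsto_intros LIMSEQ_inverse_real_of_nat)
        then show ?thesis by (simp add: d_def field_simps)
      qed
      then have "(\<lambda>m. (1 / (2 * pi * d m)) *\<^sub>R z) \<longlonglongrightarrow> 0 *\<^sub>R z" by (intro tendsto_intros)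
      then show "(\<lambda>m. (1 / (2 * pi * d m)) *\<^sub>R z) \<longlonglongrightarrow> 0" by simp
    qed
  qed (use gi A_le in \<open>auto simp: norm_mult intro!: mult_right_mono\<close>)
  also have "(LINT z|lborel. A 0 * of_real (exp (- (norm (z::'a))\<^sup>2 / 2))) = A 0 * of_real (sqrt (2 * pi) ^ DIM('a))"
    using gauss_FT(2)[of "0::'a"] by simp
  finally have "(\<lambda>m. of_real (1 / sqrt (2 * pi) ^ DIM('a)) *
      (LINT z|lborel. A ((1 / (2 * pi * d m)) *\<^sub>R z) * of_real (exp (- (norm z)\<^sup>2 / 2))))
     \<longlonglongrightarrow> of_real (1 / sqrt (2 * pi) ^ DIM('a)) * (A 0 * of_real (sqrt (2 * pi) ^ DIM('a)))"
    by (intro tendsto_intros)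
  also have "(\<lambda>m. of_real (1 / sqrt (2 * pi) ^ DIM('a)) *
      (LINT z|lborel. A ((1 / (2 * pi * d m)) *\<^sub>R z) * of_real (exp (- (norm z)\<^sup>2 / 2)))) = (\<lambda>m. complex_of_real (I m))"
    unfolding I_def A_def by (intro ext damped_Plancherel(2)[OF f d, symmetric])
  also have "of_real (1 / sqrt (2 * pi) ^ DIM('a)) * (A 0 * of_real (sqrt (2 * pi) ^ DIM('a))) = A 0" by simp
  also have "A 0 = of_real (sqnorm lborel f)" by (simp add: A_ip ip_self)
  finally have I: "I \<longlonglongrightarrow> sqnorm lborel f" by (simp only: tendsto_of_real_iff)
  have "(\<lambda>m. \<integral>\<^sup>+\<xi>. ennreal (exp (- (norm ((1/d m) *\<^sub>R \<xi>))\<^sup>2 / 2) * (norm (fi f \<xi>))\<^sup>2) \<partial>lborel)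
      \<longlonglongrightarrow> (\<integral>\<^sup>+\<xi>. ennreal ((norm (fi f \<xi>))\<^sup>2) \<partial>lborel)"
  proof (rule nn_integral_LIMSEQ)
    show "incseq (\<lambda>m \<xi>. ennreal (exp (- (norm ((1/d m) *\<^sub>R \<xi>))\<^sup>2 / 2) * (norm (fi f \<xi>))\<^sup>2))"
    proof (rule incseq_SucI, rule le_funI, intro ennreal_leI mult_right_mono)
      fix m and \<xi> :: 'a
      have "norm ((1/d (Suc m)) *\<^sub>R \<xi>) \<le> norm ((1/d m) *\<^sub>R \<xi>)"
        by (auto simp: d_def intro!: mult_right_mono divide_left_mono simp flip: divide_inverse)
      then have "(norm ((1/d (Suc m)) *\<^sub>R \<xi>))\<^sup>2 \<le> (norm ((1/d m) *\<^sub>R \<xi>))\<^sup>2"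
        by (intro power_mono) auto
      then show "exp (- (norm ((1/d m) *\<^sub>R \<xi>))\<^sup>2 / 2) \<le> exp (- (norm ((1/d (Suc m)) *\<^sub>R \<xi>))\<^sup>2 / 2)" by simp
    qed simp
    show "(\<lambda>m. ennreal (exp (- (norm ((1/d m) *\<^sub>R \<xi>))\<^sup>2 / 2) * (norm (fi f \<xi>))\<^sup>2)) \<longlonglongrightarrow> ennreal ((norm (fi f \<xi>))\<^sup>2)" for \<xi>
    proof (rule tendsto_ennrealI)
      have "(\<lambda>m. inverse (real (Suc m))) \<longlonglongrightarrow> 0" by (rule LIMSEQ_inverse_real_of_nat)
      then have "(\<lambda>m. 1/d m) \<longlonglongrightarrow> 0" by (simp add: d_def field_simps)
      then have "(\<lambda>m. exp (- (norm ((1/d m) *\<^sub>R \<xi>))\<^sup>2 / 2) * (norm (fi f \<xi>))\<^sup>2)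
         \<longlonglongrightarrow> exp (- (norm (0 *\<^sub>R \<xi>))\<^sup>2 / 2) * (norm (fi f \<xi>))\<^sup>2"
        by (intro tendsto_intros) auto
      then show "(\<lambda>m. exp (- (norm ((1/d m) *\<^sub>R \<xi>))\<^sup>2 / 2) * (norm (fi f \<xi>))\<^sup>2) \<longlonglongrightarrow> (norm (fi f \<xi>))\<^sup>2" by simp
    qed
  qed auto
  moreover have "(\<integral>\<^sup>+\<xi>. ennreal (exp (- (norm ((1/d m) *\<^sub>R \<xi>))\<^sup>2 / 2) * (norm (fi f \<xi>))\<^sup>2) \<partial>lborel) = ennreal (I m)" for m
    unfolding I_def by (rule nn_integral_eq_integral[OF damped_Plancherel(1)[OF f d]]) auto
  ultimately have eq: "(\<integral>\<^sup>+\<xi>. ennreal ((norm (fi f \<xi>))\<^sup>2) \<partial>lborel) = ennreal (sqnorm lborel f)"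
    using tendsto_ennrealI[OF I] by (simp add: LIMSEQ_unique)
  then show *: "fi f \<in> L2 lborel" by (subst L2_iff_nn_integral) auto
  show "sqnorm lborel (fi f) = sqnorm lborel f"
    using eq nn_integral_L2[OF *] by simp
qed

subsection \<open>The Fourier transform on square integrable functions\<close>

lemma AE_lebesgue_iff: "(AE x in lebesgue. P x) \<longleftrightarrow> (AE x in lborel. P x)"
  by (rule AE_completion_iff)

lemma lebesgue_measurable_borel_rep:
  fixes f :: "'a::euclidean_space \<Rightarrow> complex"
  assumes f: "f \<in> borel_measurable lebesgue"
  obtains f' where "f' \<in> borel_measurable borel" "AE x in lebesgue. f x = f' x"
proof -
  have "(\<lambda>x. Re (f x)) \<in> borel_measurable lebesgue" "(\<lambda>x. Im (f x)) \<in> borel_measurable lebesgue"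
    using f by auto
  then obtain r i where [measurable]: "r \<in> borel_measurable lborel" "i \<in> borel_measurable lborel"
    and r: "AE x in lborel. Re (f x) = r x" and i: "AE x in lborel. Im (f x) = i x"
    by (blast dest!: completion_ex_borel_measurable_real)
  show ?thesis
  proof (rule that)
    show "(\<lambda>x. Complex (r x) (i x)) \<in> borel_measurable borel"
      unfolding Complex_eq by measurable
    show "AE x in lebesgue. f x = Complex (r x) (i x)"
      unfolding AE_lebesgue_iff using r i by eventually_elim (simp add: complex_eq_iff)
  qed
qed

lemma borel_imp_lebesgue: "f \<in> borel_measurable borel \<Longrightarrow> f \<in> borel_measurable lebesgue"
  by (simp add: measurable_completion)

lemma L2_lebesgue_borel_iff:
  assumes "f \<in> borel_measurable borel" shows "f \<in> L2 lebesgue \<longleftrightarrow> f \<in> L2 lborel"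
  using assms by (auto simp: L2_def integrable_completion borel_imp_lebesgue)

lemma sqnorm_lebesgue_borel: "f \<in> borel_measurable borel \<Longrightarrow> sqnorm lebesgue f = sqnorm lborel f"
  unfolding sqnorm_def by (rule integral_completion) auto

lemma fourier_integral_borel:
  assumes [measurable]: "f \<in> borel_measurable borel" shows "fourier_integral f = fi f"
proof
  fix \<xi>
  have "fourier_integral f \<xi> = (LINT y|lebesgue. f y * cis (- (2 * pi * (y \<bullet> \<xi>))))"
    unfolding fourier_integral_def by (simp add: cis_conv_exp mult_ac)
  also have "\<dots> = fi f \<xi>" unfolding fi_def by (rule integral_completion) auto
  finally show "fourier_integral f \<xi> = fi f \<xi>" .
qed

lemma measurable_fourier_kernel:
  "f \<in> borel_measurable lebesgue \<Longrightarrow>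
    (\<lambda>y. f y * exp (- 2 * complex_of_real pi * \<i> * complex_of_real (y \<bullet> \<xi>))) \<in> borel_measurable lebesgue"
proof -
  assume "f \<in> borel_measurable lebesgue"
  moreover have "(\<lambda>y. exp (- 2 * complex_of_real pi * \<i> * complex_of_real (y \<bullet> \<xi>))) \<in> borel_measurable lebesgue"
    by (rule borel_imp_lebesgue) measurable
  ultimately show ?thesis by (rule borel_measurable_times)
qed

lemma fourier_integral_cong_AE:
  assumes "f \<in> borel_measurable lebesgue" "g \<in> borel_measurable lebesgue" "AE x in lebesgue. f x = g x"
  shows "fourier_integral f = fourier_integral g"
  unfolding fourier_integral_def
  by (intro ext integral_cong_AE measurable_fourier_kernel assms) (use assms(3) in \<open>auto elim!: eventually_mono\<close>)

lemma fourier_integral_diff: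
  assumes "integrable lebesgue f" "integrable lebesgue g"
  shows "fourier_integral (\<lambda>x. f x - g x) \<xi> = fourier_integral f \<xi> - fourier_integral g \<xi>"
proof -
  have "integrable lebesgue (\<lambda>y. h y * exp (- 2 * complex_of_real pi * \<i> * complex_of_real (y \<bullet> \<xi>)))"
    if "integrable lebesgue h" for h
    by (rule Bochner_Integration.integrable_bound[OF that], rule measurable_fourier_kernel)
       (use that in \<open>auto simp: norm_mult\<close>)
  then show ?thesis using assms unfolding fourier_integral_def by (simp add: left_diff_distrib)
qed

lemma Plancherel:
  fixes f :: "'a::euclidean_space \<Rightarrow> complex"
  assumes f: "integrable lebesgue f" and f2: "f \<in> L2 lebesgue"
  shows Plancherel_L2: "fourier_integral f \<in> L2 lebesgue"
    and Plancherel_norm2: "norm2 lebesgue (fourier_integral f) = norm2 lebesgue f"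
proof -
  have fm: "f \<in> borel_measurable lebesgue" using f by auto
  obtain f' where f'm[measurable]: "f' \<in> borel_measurable borel" and ae: "AE x in lebesgue. f x = f' x"
    using lebesgue_measurable_borel_rep[OF fm] .
  have f'L: "f' \<in> borel_measurable lebesgue" by (rule borel_imp_lebesgue) auto
  have eq: "fourier_integral f = fi f'"
    using fourier_integral_cong_AE[OF fm f'L ae] fourier_integral_borel[OF f'm] by simp
  have "integrable lebesgue f'" using f integrable_cong_AE[OF fm f'L ae] by simp
  then have i: "integrable lborel f'" by (simp add: integrable_completion)
  have "f' \<in> L2 lebesgue" by (rule L2_cong_AE[OF f2 f'L ae])
  then have 2: "f' \<in> L2 lborel" by (simp add: L2_lebesgue_borel_iff)
  show "fourier_integral f \<in> L2 lebesgue"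
    unfolding eq using Plancherel_lborel(1)[OF i 2] by (simp add: L2_lebesgue_borel_iff)
  show "norm2 lebesgue (fourier_integral f) = norm2 lebesgue f"
    unfolding eq norm2_def sqnorm_cong_AE[OF fm f'L ae]
    using Plancherel_lborel(2)[OF i 2] by (simp add: sqnorm_lebesgue_borel)
qed

text \<open>The multiplication formula; the conjugations write the bilinear pairing of two functions
  through the sesquilinear \<open>ip\<close>.\<close>

lemma fourier_shift_formula:
  fixes f g :: "'a::euclidean_space \<Rightarrow> complex"
  assumes f: "integrable lebesgue f" and g: "integrable lebesgue g"
  shows "ip lebesgue (fourier_integral f) (\<lambda>x. cnj (g x)) = ip lebesgue f (\<lambda>x. cnj (fourier_integral g x))"
proof -
  have fm: "f \<in> borel_measurable lebesgue" and gm: "g \<in> borel_measurable lebesgue" using f g by auto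
  obtain f' where f'm[measurable]: "f' \<in> borel_measurable borel" and fae: "AE x in lebesgue. f x = f' x"
    using lebesgue_measurable_borel_rep[OF fm] .
  obtain g' where g'm[measurable]: "g' \<in> borel_measurable borel" and gae: "AE x in lebesgue. g x = g' x"
    using lebesgue_measurable_borel_rep[OF gm] .
  have f'L: "f' \<in> borel_measurable lebesgue" by (rule borel_imp_lebesgue) auto
  have g'L: "g' \<in> borel_measurable lebesgue" by (rule borel_imp_lebesgue) auto
  have feq: "fourier_integral f = fi f'"
    using fourier_integral_cong_AE[OF fm f'L fae] fourier_integral_borel[OF f'm] by simp
  have geq: "fourier_integral g = fi g'"
    using fourier_integral_cong_AE[OF gm g'L gae] fourier_integral_borel[OF g'm] by simp
  have "integrable lebesgue f'" "integrable lebesgue g'"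
    using f integrable_cong_AE[OF fm f'L fae] g integrable_cong_AE[OF gm g'L gae] by simp_all
  then have i: "integrable lborel f'" "integrable lborel g'" by (simp_all add: integrable_completion)
  have fiL: "fi f' \<in> borel_measurable lebesgue" "fi g' \<in> borel_measurable lebesgue"
    by (auto intro!: borel_imp_lebesgue)
  have "ip lebesgue (fourier_integral f) (\<lambda>x. cnj (g x)) = (LINT x|lebesgue. fi f' x * g' x)"
    unfolding ip_def feq complex_cnj_cnj
    by (rule integral_cong_AE[OF borel_measurable_times[OF fiL(1) gm] borel_measurable_times[OF fiL(1) g'L]])
       (use gae in \<open>auto elim!: eventually_mono\<close>)
  also have "\<dots> = (LINT x|lborel. fi f' x * g' x)" by (rule integral_completion) auto
  also have "\<dots> = (LINT x|lborel. f' x * fi g' x)" by (rule fi_shift_formula[OF i])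
  also have "\<dots> = (LINT x|lebesgue. f' x * fi g' x)" by (rule integral_completion[symmetric]) auto
  also have "\<dots> = ip lebesgue f (\<lambda>x. cnj (fourier_integral g x))"
    unfolding ip_def geq complex_cnj_cnj
    by (rule integral_cong_AE[OF borel_measurable_times[OF f'L fiL(2)] borel_measurable_times[OF fm fiL(2)]])
       (use fae in \<open>auto elim!: eventually_mono\<close>)
  finally show ?thesis .
qed

section \<open>The Plancherel transform as a relation between square integrable functions\<close>

lemma Lp_norm_2_nn:
  "Lp_norm 2 f = (let I = (\<integral>\<^sup>+x. ennreal ((norm (f x))\<^sup>2) \<partial>lebesgue) in if I = \<infinity> then \<infinity> else ennreal (sqrt (enn2real I)))"
proof -
  have "(norm (f x)) powr 2 = (norm (f x))\<^sup>2" for x by simp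
  moreover have "enn2real 2 = 2" by simp
  moreover have "(2::ennreal) \<noteq> \<infinity>" by simp
  ultimately show ?thesis unfolding Lp_norm_def Let_def by (simp add: powr_half_sqrt)
qed

lemma Lp_space_2: "Lp_space 2 = L2 lebesgue"
proof (intro set_eqI iffI)
  fix f :: "'a \<Rightarrow> complex"
  assume "f \<in> Lp_space 2"
  then show "f \<in> L2 lebesgue"
    by (auto simp: Lp_space_def Lp_norm_2_nn Let_def L2_iff_nn_integral less_top split: if_splits)
next
  fix f :: "'a \<Rightarrow> complex"
  assume f: "f \<in> L2 lebesgue"
  then show "f \<in> Lp_space 2"
    by (auto simp: Lp_space_def Lp_norm_2_nn Let_def nn_integral_L2 L2_meas)
qed

lemma Lp_norm_2: "f \<in> L2 lebesgue \<Longrightarrow> Lp_norm 2 f = ennreal (norm2 lebesgue f)"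
  by (simp add: Lp_norm_2_nn nn_integral_L2 norm2_def)

lemma Lp_space_1: "Lp_space 1 = {f. integrable lebesgue f}"
proof -
  have "(Lp_norm 1 f < \<infinity>) = ((\<integral>\<^sup>+x. ennreal (norm (f x)) \<partial>lebesgue) < \<infinity>)" for f :: "'a \<Rightarrow> complex"
    by (simp add: Lp_norm_def Let_def less_top[symmetric])
  then show ?thesis by (auto simp: Lp_space_def integrable_iff_bounded)
qed

lemma has_fourier_L2_iff:
  "has_fourier_L2 f g \<longleftrightarrow> f \<in> L2 lebesgue \<and> g \<in> L2 lebesgue \<and>
     (\<exists>u. (\<forall>k. integrable lebesgue (u k) \<and> u k \<in> L2 lebesgue) \<and>
       (\<lambda>k::nat. norm2 lebesgue (\<lambda>x. u k x - f x)) \<longlonglongrightarrow> 0 \<and>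
       (\<lambda>k. norm2 lebesgue (\<lambda>\<xi>. fourier_integral (u k) \<xi> - g \<xi>)) \<longlonglongrightarrow> 0)"
proof -
  have *: "(\<lambda>k. Lp_norm 2 (h k)) \<longlonglongrightarrow> 0 \<longleftrightarrow> (\<lambda>k. norm2 lebesgue (h k)) \<longlonglongrightarrow> 0"
    if "\<And>k. h k \<in> L2 lebesgue" for h :: "nat \<Rightarrow> 'b::euclidean_space \<Rightarrow> complex"
    using that by (simp add: Lp_norm_2 flip: ennreal_0)
  show ?thesis
    unfolding has_fourier_L2_def Lp_space_2 Lp_space_1
    by (intro conj_cong refl ex_cong1) (auto simp: * L2_diff Plancherel_L2)
qed

lemma has_fourier_L2_D:
  "has_fourier_L2 f g \<Longrightarrow> f \<in> L2 lebesgue" "has_fourier_L2 f g \<Longrightarrow> g \<in> L2 lebesgue"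
  by (auto simp: has_fourier_L2_iff)

lemma has_fourier_L2_integrable:
  "integrable lebesgue f \<Longrightarrow> f \<in> L2 lebesgue \<Longrightarrow> has_fourier_L2 f (fourier_integral f)"
  unfolding has_fourier_L2_iff
  by (auto simp: Plancherel_L2 norm2_def sqnorm_def intro!: exI[of _ "\<lambda>_. f"])

lemma has_fourier_L2_norm2:
  assumes "has_fourier_L2 f g" shows "norm2 lebesgue g = norm2 lebesgue f"
proof -
  obtain u where u: "\<And>k. integrable lebesgue (u k)" "\<And>k. u k \<in> L2 lebesgue"
    and uf: "(\<lambda>k::nat. norm2 lebesgue (\<lambda>x. u k x - f x)) \<longlonglongrightarrow> 0"
    and ug: "(\<lambda>k. norm2 lebesgue (\<lambda>\<xi>. fourier_integral (u k) \<xi> - g \<xi>)) \<longlonglongrightarrow> 0"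
    using assms unfolding has_fourier_L2_iff by blast
  have "(\<lambda>k. norm2 lebesgue (u k)) \<longlonglongrightarrow> norm2 lebesgue f"
    by (rule tendsto_norm2[OF u(2) _ uf]) (use assms has_fourier_L2_D in auto)
  moreover have "(\<lambda>k. norm2 lebesgue (fourier_integral (u k))) \<longlonglongrightarrow> norm2 lebesgue g"
    by (rule tendsto_norm2[OF Plancherel_L2[OF u] _ ug]) (use assms has_fourier_L2_D in auto)
  ultimately show ?thesis by (simp add: Plancherel_norm2 u LIMSEQ_unique)
qed

lemma has_fourier_L2_diff:
  assumes fg: "has_fourier_L2 f g" and fg': "has_fourier_L2 f' g'"
  shows "has_fourier_L2 (\<lambda>x. f x - f' x) (\<lambda>x. g x - g' x)"
proof -
  obtain u where u: "\<And>k. integrable lebesgue (u k)" "\<And>k. u k \<in> L2 lebesgue"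
    and uf: "(\<lambda>k::nat. norm2 lebesgue (\<lambda>x. u k x - f x)) \<longlonglongrightarrow> 0"
    and ug: "(\<lambda>k. norm2 lebesgue (\<lambda>\<xi>. fourier_integral (u k) \<xi> - g \<xi>)) \<longlonglongrightarrow> 0"
    using fg unfolding has_fourier_L2_iff by blast
  obtain u' where u': "\<And>k. integrable lebesgue (u' k)" "\<And>k. u' k \<in> L2 lebesgue"
    and uf': "(\<lambda>k::nat. norm2 lebesgue (\<lambda>x. u' k x - f' x)) \<longlonglongrightarrow> 0"
    and ug': "(\<lambda>k. norm2 lebesgue (\<lambda>\<xi>. fourier_integral (u' k) \<xi> - g' \<xi>)) \<longlonglongrightarrow> 0"
    using fg' unfolding has_fourier_L2_iff by blast
  note L = has_fourier_L2_D[OF fg] has_fourier_L2_D[OF fg']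
  have lim: "(\<lambda>k. norm2 lebesgue (\<lambda>x. (a k x - a' k x) - (b x - b' x))) \<longlonglongrightarrow> 0"
    if "\<And>k. a k \<in> L2 lebesgue" "\<And>k. a' k \<in> L2 lebesgue" "b \<in> L2 lebesgue" "b' \<in> L2 lebesgue"
      "(\<lambda>k::nat. norm2 lebesgue (\<lambda>x. a k x - b x)) \<longlonglongrightarrow> 0" "(\<lambda>k. norm2 lebesgue (\<lambda>x. a' k x - b' x)) \<longlonglongrightarrow> 0"
    for a a' b b'
  proof (rule Lim_null_comparison)
    show "(\<lambda>k. norm2 lebesgue (\<lambda>x. a k x - b x) + norm2 lebesgue (\<lambda>x. a' k x - b' x)) \<longlonglongrightarrow> 0"
      using that by (intro tendsto_add_zero)
    have "norm2 lebesgue (\<lambda>x. (a k x - b x) + (b' x - a' k x)) \<le>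
        norm2 lebesgue (\<lambda>x. a k x - b x) + norm2 lebesgue (\<lambda>x. b' x - a' k x)" for k
      by (rule norm2_triangle) (intro L2_diff that)+
    moreover have "(\<lambda>x. (a k x - b x) + (b' x - a' k x)) = (\<lambda>x. (a k x - a' k x) - (b x - b' x))" for k
      by auto
    ultimately have "norm2 lebesgue (\<lambda>x. (a k x - a' k x) - (b x - b' x)) \<le>
        norm2 lebesgue (\<lambda>x. a k x - b x) + norm2 lebesgue (\<lambda>x. a' k x - b' x)" for k
      by (metis norm2_diff_commute)
    then show "\<forall>\<^sub>F k in sequentially. norm (norm2 lebesgue (\<lambda>x. (a k x - a' k x) - (b x - b' x))) \<le>
        norm2 lebesgue (\<lambda>x. a k x - b x) + norm2 lebesgue (\<lambda>x. a' k x - b' x)"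
      by (intro always_eventually allI) simp
  qed
  show ?thesis
    unfolding has_fourier_L2_iff
  proof (intro conjI exI[of _ "\<lambda>k x. u k x - u' k x"] allI)
    show "(\<lambda>k. norm2 lebesgue (\<lambda>x. u k x - u' k x - (f x - f' x))) \<longlonglongrightarrow> 0"
      by (rule lim) (use u u' L uf uf' in auto)
    show "(\<lambda>k. norm2 lebesgue (\<lambda>\<xi>. fourier_integral (\<lambda>x. u k x - u' k x) \<xi> - (g \<xi> - g' \<xi>))) \<longlonglongrightarrow> 0"
      unfolding fourier_integral_diff[OF u(1) u'(1)]
      by (rule lim) (use u u' L ug ug' in \<open>auto intro: Plancherel_L2\<close>)
  qed (use L u u' in auto)
qed

lemma has_fourier_L2_cmult:
  assumes "has_fourier_L2 f g" shows "has_fourier_L2 (\<lambda>x. c * f x) (\<lambda>x. c * g x)"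
proof -
  obtain u where u: "\<And>k. integrable lebesgue (u k)" "\<And>k. u k \<in> L2 lebesgue"
    and uf: "(\<lambda>k::nat. norm2 lebesgue (\<lambda>x. u k x - f x)) \<longlonglongrightarrow> 0"
    and ug: "(\<lambda>k. norm2 lebesgue (\<lambda>\<xi>. fourier_integral (u k) \<xi> - g \<xi>)) \<longlonglongrightarrow> 0"
    using assms unfolding has_fourier_L2_iff by blast
  have n: "norm2 lebesgue (\<lambda>x. c * a x - c * b x) = norm c * norm2 lebesgue (\<lambda>x. a x - b x)"
    for a b :: "'a \<Rightarrow> complex"
    unfolding right_diff_distrib[symmetric] norm2_def sqnorm_cmult by (simp add: real_sqrt_mult)
  have fc: "fourier_integral (\<lambda>x. c * u k x) \<xi> = c * fourier_integral (u k) \<xi>" for k \<xi>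
    unfolding fourier_integral_def by (simp add: mult.assoc)
  show ?thesis
    unfolding has_fourier_L2_iff
  proof (intro conjI exI[of _ "\<lambda>k x. c * u k x"] allI)
    show "(\<lambda>k. norm2 lebesgue (\<lambda>x. c * u k x - c * f x)) \<longlonglongrightarrow> 0"
      unfolding n by (rule tendsto_mult_right_zero[OF uf])
    show "(\<lambda>k. norm2 lebesgue (\<lambda>\<xi>. fourier_integral (\<lambda>x. c * u k x) \<xi> - c * g \<xi>)) \<longlonglongrightarrow> 0"
      unfolding fc n by (rule tendsto_mult_right_zero[OF ug])
  qed (use u has_fourier_L2_D[OF assms] in auto)
qed

lemma has_fourier_L2_add:
  assumes "has_fourier_L2 f g" "has_fourier_L2 f' g'"
  shows "has_fourier_L2 (\<lambda>x. f x + f' x) (\<lambda>x. g x + g' x)"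
  using has_fourier_L2_diff[OF assms(1) has_fourier_L2_cmult[OF assms(2), of "-1"]] by simp

lemma has_fourier_L2_zero: "has_fourier_L2 (\<lambda>x. 0) (\<lambda>x. 0)"
  using has_fourier_L2_integrable[of "\<lambda>x. 0"] by (simp add: fourier_integral_def[abs_def])

lemma has_fourier_L2_sum:
  assumes "\<And>i. i \<in> I \<Longrightarrow> has_fourier_L2 (f i) (g i)"
  shows "has_fourier_L2 (\<lambda>x. \<Sum>i\<in>I. f i x) (\<lambda>x. \<Sum>i\<in>I. g i x)"
  using assms
  by (induction I rule: infinite_finite_induct) (auto intro: has_fourier_L2_add has_fourier_L2_zero)

text \<open>Polarisation: equality of norms for sums gives the real part, and multiplying one
  argument by \<i> gives the imaginary part.\<close>

lemma has_fourier_L2_ip: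
  assumes fg: "has_fourier_L2 f g" and fg': "has_fourier_L2 f' g'"
  shows "ip lebesgue g g' = ip lebesgue f f'"
proof -
  have Re: "Re (ip lebesgue g h') = Re (ip lebesgue f h)" if h: "has_fourier_L2 h h'" for h h'
  proof -
    have "sqnorm lebesgue (\<lambda>x. g x + h' x) = sqnorm lebesgue (\<lambda>x. f x + h x)"
      "sqnorm lebesgue g = sqnorm lebesgue f" "sqnorm lebesgue h' = sqnorm lebesgue h"
      using has_fourier_L2_norm2[OF has_fourier_L2_add[OF fg h]] has_fourier_L2_norm2[OF fg]
        has_fourier_L2_norm2[OF h] by (auto simp: norm2_def)
    then show ?thesis using has_fourier_L2_D[OF fg] has_fourier_L2_D[OF h] by (simp add: sqnorm_add)
  qed
  show ?thesis
  proof (rule complex_eqI)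
    show "Re (ip lebesgue g g') = Re (ip lebesgue f f')" by (rule Re[OF fg'])
    show "Im (ip lebesgue g g') = Im (ip lebesgue f f')"
      using Re[OF has_fourier_L2_cmult[OF fg', of \<i>]] by (simp add: ip_cmult_right)
  qed
qed

lemma has_fourier_L2_cong:
  assumes "has_fourier_L2 f g" "f' \<in> borel_measurable lebesgue" "AE x in lebesgue. f x = f' x"
    "g' \<in> borel_measurable lebesgue" "AE x in lebesgue. g x = g' x"
  shows "has_fourier_L2 f' g'"
proof -
  have n: "norm2 lebesgue (\<lambda>x. a x - b x) = norm2 lebesgue (\<lambda>x. a x - b' x)"
    if "a \<in> borel_measurable lebesgue" "b \<in> borel_measurable lebesgue" "b' \<in> borel_measurable lebesgue" "AE x in lebesgue. b x = b' x"
    for a b b' :: "'a \<Rightarrow> complex"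
    unfolding norm2_def by (rule arg_cong[OF sqnorm_cong_AE]) (use that in \<open>auto elim!: eventually_mono\<close>)
  note L = has_fourier_L2_D[OF assms(1)]
  obtain u where u: "\<And>k. integrable lebesgue (u k)" "\<And>k. u k \<in> L2 lebesgue"
    and uf: "(\<lambda>k::nat. norm2 lebesgue (\<lambda>x. u k x - f x)) \<longlonglongrightarrow> 0"
    and ug: "(\<lambda>k. norm2 lebesgue (\<lambda>\<xi>. fourier_integral (u k) \<xi> - g \<xi>)) \<longlonglongrightarrow> 0"
    using assms(1) unfolding has_fourier_L2_iff by blast
  have "(\<lambda>k. norm2 lebesgue (\<lambda>x. u k x - f' x)) \<longlonglongrightarrow> 0"
  proof -
    have "norm2 lebesgue (\<lambda>x. u k x - f x) = norm2 lebesgue (\<lambda>x. u k x - f' x)" for k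
      by (rule n) (use u L assms in \<open>auto intro: L2_meas\<close>)
    then show ?thesis using uf by simp
  qed
  moreover have "(\<lambda>k. norm2 lebesgue (\<lambda>x. fourier_integral (u k) x - g' x)) \<longlonglongrightarrow> 0"
  proof -
    have "norm2 lebesgue (\<lambda>x. fourier_integral (u k) x - g x) = norm2 lebesgue (\<lambda>x. fourier_integral (u k) x - g' x)" for k
      by (rule n) (use u L assms Plancherel_L2 in \<open>auto intro: L2_meas\<close>)
    then show ?thesis using ug by simp
  qed
  ultimately show ?thesis
    using L2_cong_AE[OF L(1) assms(2,3)] L2_cong_AE[OF L(2) assms(4,5)] u
    unfolding has_fourier_L2_iff by blast
qed

text \<open>Truncations to balls are integrable and square integrable; their Fourier integrals form
  a Cauchy sequence by Plancherel, and completeness supplies the limit.\<close>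

lemma has_fourier_L2_exists:
  assumes f: "f \<in> L2 lebesgue" shows "\<exists>g. has_fourier_L2 f g"
proof -
  define u where "u k x = indicator (ball 0 (real k)) x * f x" for k :: nat and x
  have B: "ball 0 (real k) \<in> sets lebesgue" for k by simp
  have u2: "u k \<in> L2 lebesgue" for k unfolding u_def by (rule L2_indicator_mult[OF f B])
  have u1: "integrable lebesgue (u k)" for k
    unfolding u_def
    by (rule L2_prod_integrable[OF L2_indicator f]) (use emeasure_bounded_finite[OF bounded_ball[of "0::'a" "real k"]] in auto)
  have "(\<lambda>k. sqnorm lebesgue (\<lambda>x. u k x - f x)) \<longlonglongrightarrow> (LINT x::'a|lebesgue. 0)"
    unfolding sqnorm_def
  proof (rule integral_dominated_convergence[where w="\<lambda>x. (norm (f x))\<^sup>2"])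
    show "AE x in lebesgue. (\<lambda>k. (norm (u k x - f x))\<^sup>2) \<longlonglongrightarrow> 0"
    proof (rule AE_I2)
      fix x :: 'a
      obtain n :: nat where "norm x < real n" using reals_Archimedean2 by blast
      then have "u k x = f x" if "k \<ge> n" for k using that by (auto simp: u_def indicator_def)
      then have "\<forall>\<^sub>F k in sequentially. (norm (u k x - f x))\<^sup>2 = 0"
        by (intro eventually_sequentiallyI[of n]) simp
      then show "(\<lambda>k. (norm (u k x - f x))\<^sup>2) \<longlonglongrightarrow> 0" by (rule tendsto_eventually)
    qed
    show "(\<lambda>x. (norm (u k x - f x))\<^sup>2) \<in> borel_measurable lebesgue" for k
      using L2_integrable[OF L2_diff[OF u2 f]] by auto
    show "AE x in lebesgue. norm ((norm (u k x - f x))\<^sup>2) \<le> (norm (f x))\<^sup>2" for k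
      by (rule AE_I2) (auto simp: u_def indicator_def)
  qed (use f in \<open>auto simp: L2_def\<close>)
  then have uf: "(\<lambda>k. norm2 lebesgue (\<lambda>x. u k x - f x)) \<longlonglongrightarrow> 0" by (simp add: tendsto_norm2_0_iff)
  have "\<exists>g\<in>L2 lebesgue. (\<lambda>k. norm2 lebesgue (\<lambda>x. fourier_integral (u k) x - g x)) \<longlonglongrightarrow> 0"
  proof (rule Riesz_Fischer)
    show "fourier_integral (u k) \<in> L2 lebesgue" for k by (rule Plancherel_L2[OF u1 u2])
    fix e :: real assume e: "e > 0"
    then obtain N where N: "\<And>n. n \<ge> N \<Longrightarrow> norm2 lebesgue (\<lambda>x. u n x - f x) < sqrt e / 2"
      using LIMSEQ_D[OF uf, of "sqrt e / 2"] by auto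
    show "\<exists>N. \<forall>m\<ge>N. \<forall>n\<ge>N. sqnorm lebesgue (\<lambda>x. fourier_integral (u m) x - fourier_integral (u n) x) < e"
    proof (intro exI[of _ N] allI impI)
      fix m n assume "m \<ge> N" "n \<ge> N"
      have "norm2 lebesgue (\<lambda>x. fourier_integral (u m) x - fourier_integral (u n) x) = norm2 lebesgue (\<lambda>x. u m x - u n x)"
      proof -
        have "fourier_integral (\<lambda>x. u m x - u n x) = (\<lambda>x. fourier_integral (u m) x - fourier_integral (u n) x)"
          by (rule ext) (rule fourier_integral_diff[OF u1 u1])
        then show ?thesis
          using Plancherel_norm2[of "\<lambda>x. u m x - u n x"] u1 u2 by (simp add: L2_diff)
      qed
      also have "\<dots> \<le> norm2 lebesgue (\<lambda>x. u m x - f x) + norm2 lebesgue (\<lambda>x. f x - u n x)"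
        by (rule norm2_diff_triangle[OF u2 f u2])
      also have "\<dots> < sqrt e / 2 + sqrt e / 2"
        unfolding norm2_diff_commute[of _ f] by (intro add_strict_mono N \<open>m \<ge> N\<close> \<open>n \<ge> N\<close>)
      finally show "sqnorm lebesgue (\<lambda>x. fourier_integral (u m) x - fourier_integral (u n) x) < e"
        by (simp add: norm2_def)
    qed
  qed
  then show ?thesis unfolding has_fourier_L2_iff using f u1 u2 uf by blast
qed

text \<open>The multiplication formula extends from the approximating sequences by continuity of
  \<open>ip\<close>; it is the tool for surjectivity.\<close>

lemma has_fourier_L2_shift:
  assumes fg: "has_fourier_L2 f f'" and fg': "has_fourier_L2 g g'"
  shows "ip lebesgue f' (\<lambda>x. cnj (g x)) = ip lebesgue f (\<lambda>x. cnj (g' x))"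
proof -
  obtain u where u: "\<And>k. integrable lebesgue (u k)" "\<And>k. u k \<in> L2 lebesgue"
    and uf: "(\<lambda>k::nat. norm2 lebesgue (\<lambda>x. u k x - f x)) \<longlonglongrightarrow> 0"
    and ug: "(\<lambda>k. norm2 lebesgue (\<lambda>\<xi>. fourier_integral (u k) \<xi> - f' \<xi>)) \<longlonglongrightarrow> 0"
    using fg unfolding has_fourier_L2_iff by blast
  obtain v where v: "\<And>k. integrable lebesgue (v k)" "\<And>k. v k \<in> L2 lebesgue"
    and vf: "(\<lambda>k::nat. norm2 lebesgue (\<lambda>x. v k x - g x)) \<longlonglongrightarrow> 0"
    and vg: "(\<lambda>k. norm2 lebesgue (\<lambda>\<xi>. fourier_integral (v k) \<xi> - g' \<xi>)) \<longlonglongrightarrow> 0"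
    using fg' unfolding has_fourier_L2_iff by blast
  note L = has_fourier_L2_D[OF fg] has_fourier_L2_D[OF fg']
  have c: "norm2 lebesgue (\<lambda>x. cnj (a x) - cnj (b x)) = norm2 lebesgue (\<lambda>x. a x - b x)" for a b :: "'a \<Rightarrow> complex"
    unfolding complex_cnj_diff[symmetric] by (simp add: norm2_def sqnorm_def del: complex_cnj_diff)
  have "(\<lambda>k. ip lebesgue (fourier_integral (u k)) (\<lambda>x. cnj (v k x))) \<longlonglongrightarrow> ip lebesgue f' (\<lambda>x. cnj (g x))"
    by (rule tendsto_ip) (use u v L ug vf in \<open>auto simp: c intro: Plancherel_L2\<close>)
  moreover have "(\<lambda>k. ip lebesgue (u k) (\<lambda>x. cnj (fourier_integral (v k) x))) \<longlonglongrightarrow> ip lebesgue f (\<lambda>x. cnj (g' x))"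
    by (rule tendsto_ip) (use u v L uf vg in \<open>auto simp: c intro!: L2_cnj Plancherel_L2\<close>)
  ultimately show ?thesis by (simp add: fourier_shift_formula u v LIMSEQ_unique)
qed

text \<open>The inverse transform is conjugation, transform, conjugation. If \<open>b\<close> is the
  transform of this candidate \<open>h\<close>, the multiplication formula gives
  \<open>ip lebesgue b g\<close> = \<open>sqnorm lebesgue g\<close>; as \<open>b\<close> and
  \<open>g\<close> have equal norms, the squared norm of \<open>b - g\<close> expands to 0.\<close>

lemma has_fourier_L2_surj:
  assumes g: "g \<in> L2 lebesgue" shows "\<exists>f. has_fourier_L2 f g"
proof -
  obtain a where a: "has_fourier_L2 (\<lambda>x. cnj (g x)) a" using has_fourier_L2_exists[OF L2_cnj[OF g]] ..
  define h where "h x = cnj (a x)" for x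
  have aL: "a \<in> L2 lebesgue" using a by (rule has_fourier_L2_D)
  have hL: "h \<in> L2 lebesgue" unfolding h_def using aL by auto
  obtain b where b: "has_fourier_L2 h b" using has_fourier_L2_exists[OF hL] ..
  have bL: "b \<in> L2 lebesgue" using b by (rule has_fourier_L2_D)
  have "sqnorm lebesgue b = sqnorm lebesgue h" "sqnorm lebesgue a = sqnorm lebesgue (\<lambda>x. cnj (g x))"
    using has_fourier_L2_norm2[OF b] has_fourier_L2_norm2[OF a] by (auto simp: norm2_def)
  then have n: "sqnorm lebesgue b = sqnorm lebesgue g" "sqnorm lebesgue a = sqnorm lebesgue g"
    by (auto simp: sqnorm_def h_def)
  have "ip lebesgue b g = ip lebesgue h (\<lambda>x. cnj (a x))"
    using has_fourier_L2_shift[OF b a] by simp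
  also have "\<dots> = ip lebesgue h h" unfolding h_def ..
  also have "\<dots> = of_real (sqnorm lebesgue g)" using n by (simp add: ip_self h_def sqnorm_def)
  finally have "sqnorm lebesgue (\<lambda>x. b x - g x) = 0"
    using n by (simp add: sqnorm_diff bL g)
  then have ae: "AE x in lebesgue. b x = g x"
    using sqnorm_zero_AE[OF L2_diff[OF bL g]] by simp
  have "has_fourier_L2 h g"
    by (rule has_fourier_L2_cong[OF b _ _ _ ae]) (use hL g in \<open>auto intro: L2_meas\<close>)
  then show ?thesis by blast
qed

text \<open>One direction says that the transform is well defined, the other that it is injective;
  together they make the choices in \<open>fourier_L2\<close> and \<open>inv_fourier_L2\<close>
  immaterial up to null sets. Both come from equality of norms for the difference.\<close>

lemma has_fourier_L2_unique:
  assumes "has_fourier_L2 f g" "has_fourier_L2 f' g'"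
  shows "(AE x in lebesgue. f x = f' x) \<longleftrightarrow> (AE x in lebesgue. g x = g' x)"
proof -
  note L = has_fourier_L2_D[OF assms(1)] has_fourier_L2_D[OF assms(2)]
  have "(AE x in lebesgue. f x - f' x = 0) \<longleftrightarrow> (AE x in lebesgue. g x - g' x = 0)"
    using sqnorm_zero_AE[OF L2_diff[OF L(1,3)]] sqnorm_zero_AE[OF L2_diff[OF L(2,4)]]
      has_fourier_L2_norm2[OF has_fourier_L2_diff[OF assms]] by (simp add: norm2_def)
  then show ?thesis by simp
qed

subsection \<open>Multipliers given by a measurable set\<close>

context
  fixes \<Omega> :: "'a::euclidean_space set"
  assumes \<Omega>: "\<Omega> \<in> sets lebesgue"
begin

text \<open>Eliminates both choice operators: whichever transform \<open>F\<close> of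
  \<open>f\<close> is known explicitly may stand in for \<open>fourier_L2 f\<close>.\<close>

lemma has_fourier_set_multiplier:
  assumes fF: "has_fourier_L2 f F"
  shows "has_fourier_L2 (set_multiplier \<Omega> f) (\<lambda>\<xi>. indicator \<Omega> \<xi> * F \<xi>)"
proof -
  have F': "has_fourier_L2 f (fourier_L2 f)"
    unfolding fourier_L2_def using fF by (rule someI[of "has_fourier_L2 f"])
  then have 1: "has_fourier_L2 (set_multiplier \<Omega> f) (\<lambda>\<xi>. indicator \<Omega> \<xi> * fourier_L2 f \<xi>)"
    unfolding set_multiplier_def inv_fourier_L2_def
    by (intro someI_ex[OF has_fourier_L2_surj] L2_indicator_mult \<Omega> has_fourier_L2_D)
  have "AE x in lebesgue. fourier_L2 f x = F x"
    using has_fourier_L2_unique[OF F' fF] by simp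
  then have "AE x in lebesgue. indicator \<Omega> x * fourier_L2 f x = indicator \<Omega> x * F x"
    by eventually_elim simp
  from has_fourier_L2_cong[OF 1 _ _ _ this] show ?thesis
    using has_fourier_L2_D[OF fF] has_fourier_L2_D[OF 1] \<Omega> by (auto intro!: L2_meas L2_indicator_mult)
qed

lemma set_multiplier_L2: "f \<in> L2 lebesgue \<Longrightarrow> set_multiplier \<Omega> f \<in> L2 lebesgue"
  using has_fourier_L2_exists has_fourier_set_multiplier has_fourier_L2_D by blast

lemma norm2_set_multiplier: 
  assumes "f \<in> L2 lebesgue" shows "norm2 lebesgue (set_multiplier \<Omega> f) \<le> norm2 lebesgue f"
proof -
  obtain F where F: "has_fourier_L2 f F" using has_fourier_L2_exists[OF assms] ..
  have "norm2 lebesgue (\<lambda>\<xi>. indicator \<Omega> \<xi> * F \<xi>) \<le> norm2 lebesgue F"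
    unfolding norm2_def
    by (intro real_sqrt_le_mono sqnorm_mono has_fourier_L2_D[OF F] L2_meas[OF L2_indicator_mult[OF has_fourier_L2_D(2)[OF F] \<Omega>]])
       (auto simp: indicator_def)
  then show ?thesis
    using has_fourier_L2_norm2[OF F] has_fourier_L2_norm2[OF has_fourier_set_multiplier[OF F]] by simp
qed

lemma ip_set_multiplier:
  assumes "has_fourier_L2 f F" "has_fourier_L2 g G"
  shows "ip lebesgue (set_multiplier \<Omega> f) g = ip lebesgue (\<lambda>\<xi>. indicator \<Omega> \<xi> * F \<xi>) G"
  using has_fourier_L2_ip[OF has_fourier_set_multiplier[OF assms(1)] assms(2)] by simp

lemma set_multiplier_selfadjoint:
  assumes "f \<in> L2 lebesgue" "g \<in> L2 lebesgue"
  shows "ip lebesgue (set_multiplier \<Omega> f) g = ip lebesgue f (set_multiplier \<Omega> g)"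
proof -
  obtain F where F: "has_fourier_L2 f F" using has_fourier_L2_exists[OF assms(1)] ..
  obtain G where G: "has_fourier_L2 g G" using has_fourier_L2_exists[OF assms(2)] ..
  have "ip lebesgue (set_multiplier \<Omega> f) g = ip lebesgue (\<lambda>\<xi>. indicator \<Omega> \<xi> * F \<xi>) G"
    by (rule ip_set_multiplier[OF F G])
  also have "\<dots> = ip lebesgue F (\<lambda>\<xi>. indicator \<Omega> \<xi> * G \<xi>)"
    unfolding ip_def by (rule Bochner_Integration.integral_cong) (auto simp: indicator_def)
  also have "\<dots> = ip lebesgue f (set_multiplier \<Omega> g)"
    by (rule has_fourier_L2_ip[OF F has_fourier_set_multiplier[OF G]])
  finally show ?thesis .
qed

text \<open>Each value of \<open>set_multiplier\<close> is a representative picked on its own, so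
  linearity is available only almost everywhere.\<close>

lemma set_multiplier_sum_AE:
  assumes "\<And>i. i \<in> I \<Longrightarrow> f i \<in> L2 lebesgue"
  shows "AE x in lebesgue. set_multiplier \<Omega> (\<lambda>x. \<Sum>i\<in>I. c i * f i x) x = (\<Sum>i\<in>I. c i * set_multiplier \<Omega> (f i) x)"
proof -
  obtain F where F: "\<And>i. i \<in> I \<Longrightarrow> has_fourier_L2 (f i) (F i)"
    using has_fourier_L2_exists[OF assms] by metis
  have "has_fourier_L2 (\<lambda>x. \<Sum>i\<in>I. c i * f i x) (\<lambda>x. \<Sum>i\<in>I. c i * F i x)"
    by (intro has_fourier_L2_sum has_fourier_L2_cmult F)
  from has_fourier_set_multiplier[OF this]
  have 1: "has_fourier_L2 (set_multiplier \<Omega> (\<lambda>x. \<Sum>i\<in>I. c i * f i x)) (\<lambda>\<xi>. indicator \<Omega> \<xi> * (\<Sum>i\<in>I. c i * F i \<xi>))" .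
  have 2: "has_fourier_L2 (\<lambda>x. \<Sum>i\<in>I. c i * set_multiplier \<Omega> (f i) x) (\<lambda>\<xi>. \<Sum>i\<in>I. c i * (indicator \<Omega> \<xi> * F i \<xi>))"
    by (intro has_fourier_L2_sum has_fourier_L2_cmult has_fourier_set_multiplier F)
  show ?thesis
    by (subst has_fourier_L2_unique[OF 1 2]) (rule AE_I2, simp add: sum_distrib_left mult_ac)
qed

end

subsection \<open>One-parameter groups of linear maps\<close>

text \<open>The operator exponential of t D, summed on a fixed vector; each coordinate is then a
  power series in t.\<close>

definition exp_linear :: "('a::euclidean_space \<Rightarrow> 'a) \<Rightarrow> real \<Rightarrow> 'a \<Rightarrow> 'a" where
  "exp_linear D t y = (\<Sum>k. (t ^ k / fact k) *\<^sub>R (D ^^ k) y)"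

context
  fixes D :: "'a::euclidean_space \<Rightarrow> 'a"
  assumes D: "linear D"
begin

lemma linear_funpow: "linear (D ^^ k)"
proof (induction k)
  case 0 then show ?case by (simp add: linear_id[unfolded id_def])
next
  case (Suc k) then show ?case using linear_compose[OF Suc D] by (simp add: o_def)
qed

lemma summable_exp_linear: "summable (\<lambda>k. (t ^ k / fact k) *\<^sub>R (D ^^ k) y)"
proof -
  obtain K where K: "K > 0" "\<And>x. norm (D x) \<le> K * norm x"
    using linear_bounded_pos[OF D] by auto
  have pow: "norm ((D ^^ k) y) \<le> K ^ k * norm y" for k
  proof (induction k)
    case (Suc k)
    have "norm ((D ^^ Suc k) y) \<le> K * norm ((D ^^ k) y)" using K by simp
    also have "\<dots> \<le> K * (K ^ k * norm y)" using K Suc by (intro mult_left_mono) auto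
    finally show ?case by (simp add: mult_ac)
  qed simp
  have "summable (\<lambda>k. (\<bar>t\<bar> * K) ^ k /\<^sub>R fact k * norm y)"
    by (intro summable_mult2 summable_exp_generic)
  then show ?thesis
  proof (rule summable_comparison_test'[where N=0])
    fix k
    have "norm ((t ^ k / fact k) *\<^sub>R (D ^^ k) y) = \<bar>t\<bar> ^ k / fact k * norm ((D ^^ k) y)"
      by (simp add: power_abs)
    also have "\<dots> \<le> \<bar>t\<bar> ^ k / fact k * (K ^ k * norm y)"
      by (intro mult_left_mono pow) auto
    finally show "norm ((t ^ k / fact k) *\<^sub>R (D ^^ k) y) \<le> (\<bar>t\<bar> * K) ^ k /\<^sub>R fact k * norm y"
      by (simp add: power_mult_distrib field_simps)
  qed
qed

lemma exp_linear_0 [simp]: "exp_linear D 0 y = y"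
proof -
  have "exp_linear D 0 y = (\<Sum>k\<in>{0}. (0 ^ k / fact k) *\<^sub>R (D ^^ k) y)"
    unfolding exp_linear_def by (rule suminf_finite) auto
  then show ?thesis by simp
qed

lemma linear_exp_linear: "linear (exp_linear D t)"
proof (rule linearI)
  fix x y and c :: real
  show "exp_linear D t (x + y) = exp_linear D t x + exp_linear D t y"
    unfolding exp_linear_def
    by (simp add: suminf_add summable_exp_linear linear_add[OF linear_funpow] scaleR_add_right)
  show "exp_linear D t (c *\<^sub>R x) = c *\<^sub>R exp_linear D t x"
    unfolding exp_linear_def
    by (subst suminf_scaleR_right[OF summable_exp_linear]) (simp add: linear_scale[OF linear_funpow] mult.commute)
qed

lemma exp_linear_commute: "D (exp_linear D t y) = exp_linear D t (D y)"
proof -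
  have "bounded_linear D" using D by (simp add: linear_conv_bounded_linear)
  from bounded_linear.suminf[OF this summable_exp_linear[of t y]]
  show ?thesis unfolding exp_linear_def by (simp add: linear_scale[OF D] funpow_swap1)
qed

text \<open>Coordinate by coordinate an everywhere convergent power series is differentiated term by
  term; the new coefficients are those belonging to \<open>D y\<close>.\<close>

lemma exp_linear_has_vector_derivative:
  "((\<lambda>t. exp_linear D t y) has_vector_derivative D (exp_linear D t y)) (at t)"
  unfolding has_vector_derivative_def
proof (rule has_derivative_componentwise_within[THEN iffD2], rule ballI)
  fix b :: 'a assume "b \<in> Basis"
  define c where "c k = ((D ^^ k) y \<bullet> b) / fact k" for k
  have comp: "((t ^ k / fact k) *\<^sub>R z) \<bullet> b = (z \<bullet> b) / fact k * t ^ k" for t :: real and k and z :: 'a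
    by simp
  have inner: "(\<Sum>k. (t ^ k / fact k) *\<^sub>R (D ^^ k) y) \<bullet> b = (\<Sum>k. ((D ^^ k) y \<bullet> b) / fact k * t ^ k)" for t y
    using bounded_linear.suminf[OF bounded_linear_inner_left[of b] summable_exp_linear[of t y]] by (simp only: comp)
  have sm: "summable (\<lambda>k. c k * t ^ k)" for t
    using bounded_linear.summable[OF bounded_linear_inner_left[of b] summable_exp_linear[of t y]]
    by (simp only: comp c_def)
  have "((\<lambda>t. \<Sum>k. c k * t ^ k) has_field_derivative (\<Sum>k. diffs c k * t ^ k)) (at t)"
    by (rule termdiffs_strong_converges_everywhere[OF sm])
  moreover have "diffs c k = ((D ^^ k) (D y) \<bullet> b) / fact k" for k
    by (simp add: diffs_def c_def funpow_swap1 del: of_nat_Suc)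
  moreover have "exp_linear D t y \<bullet> b = (\<Sum>k. c k * t ^ k)" for t
    by (simp only: exp_linear_def inner c_def)
  moreover have "exp_linear D t (D y) \<bullet> b = (\<Sum>k. ((D ^^ k) (D y) \<bullet> b) / fact k * t ^ k)"
    unfolding exp_linear_def
    using bounded_linear.suminf[OF bounded_linear_inner_left[of b] summable_exp_linear[of t "D y"]] by (simp only: comp)
  ultimately have "((\<lambda>t. exp_linear D t y \<bullet> b) has_field_derivative (exp_linear D t (D y) \<bullet> b)) (at t)"
    by (simp only:)
  then show "((\<lambda>t. exp_linear D t y \<bullet> b) has_derivative (\<lambda>h. (h *\<^sub>R D (exp_linear D t y)) \<bullet> b)) (at t)"
    unfolding has_field_derivative_def inner_scaleR_left exp_linear_commute
    by (rule has_derivative_eq_rhs) (rule ext, rule mult.commute)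
qed

end

subsection \<open>Euclidean Jordan algebras\<close>

text \<open>Fixes one of the associative forms whose existence
  \<open>euclidean_jordan_algebra\<close> asserts; adjoints and positivity refer to this
  \<open>B\<close>, not to the ambient inner product.\<close>

locale euclidean_jordan =
  fixes J :: "'a::euclidean_space \<Rightarrow> 'a \<Rightarrow> 'a" (infixl "\<odot>" 70) and e :: 'a and B :: "'a \<Rightarrow> 'a \<Rightarrow> real"
  assumes bilinear_J: "bilinear J" and J_commute: "x \<odot> y = y \<odot> x"
    and jordan: "x \<odot> ((x \<odot> x) \<odot> y) = (x \<odot> x) \<odot> (x \<odot> y)"
    and unit_left: "e \<odot> x = x"
    and bilinear_B: "bilinear B" and B_commute: "B x y = B y x" and B_pos: "x \<noteq> 0 \<Longrightarrow> B x x > 0"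
    and B_assoc: "B (x \<odot> y) z = B y (x \<odot> z)"
begin

lemmas J_simps = bilinear_ladd[OF bilinear_J] bilinear_radd[OF bilinear_J] bilinear_lmul[OF bilinear_J]
  bilinear_rmul[OF bilinear_J] bilinear_lsub[OF bilinear_J] bilinear_rsub[OF bilinear_J]
  bilinear_lneg[OF bilinear_J] bilinear_rneg[OF bilinear_J]
  bilinear_lzero[OF bilinear_J] bilinear_rzero[OF bilinear_J]

lemmas B_simps = bilinear_ladd[OF bilinear_B] bilinear_radd[OF bilinear_B] bilinear_lmul[OF bilinear_B]
  bilinear_rmul[OF bilinear_B] bilinear_lsub[OF bilinear_B] bilinear_rsub[OF bilinear_B]
  bilinear_lneg[OF bilinear_B] bilinear_rneg[OF bilinear_B]
  bilinear_lzero[OF bilinear_B] bilinear_rzero[OF bilinear_B]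

lemma unit_right: "x \<odot> e = x"
  using unit_left[of x] by (simp add: J_commute)

lemma B_self_nonneg: "B x x \<ge> 0"
  using B_pos[of x] by (cases "x = 0") (auto simp: B_simps)

lemma B_self_eq_0: "B x x = 0 \<longleftrightarrow> x = 0"
  using B_pos[of x] by (cases "x = 0") (auto simp: B_simps)

lemma B_ext: assumes "\<And>z. B x z = B y z" shows "x = y"
proof -
  have "B (x - y) (x - y) = 0" using assms[of "x - y"] by (simp add: B_simps)
  then show ?thesis by (simp add: B_self_eq_0)
qed

text \<open>Polarisation: inserting x + z and x - z into the Jordan identity and subtracting keeps
  the terms of odd degree in z, and the identity for z itself removes the cubic one. Passing to
  coordinates leaves linear arithmetic.\<close>

lemma jordan_linear1:
  "z \<odot> ((x \<odot> x) \<odot> y) + 2 *\<^sub>R (x \<odot> ((x \<odot> z) \<odot> y)) = 2 *\<^sub>R ((x \<odot> z) \<odot> (x \<odot> y)) + (x \<odot> x) \<odot> (z \<odot> y)"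
proof (rule euclidean_eqI)
  fix b
  have zx: "z \<odot> x = x \<odot> z" by (rule J_commute)
  have 1: "((x + z) \<odot> (((x + z) \<odot> (x + z)) \<odot> y)) \<bullet> b = (((x + z) \<odot> (x + z)) \<odot> ((x + z) \<odot> y)) \<bullet> b"
    by (simp only: jordan)
  have 2: "((x - z) \<odot> (((x - z) \<odot> (x - z)) \<odot> y)) \<bullet> b = (((x - z) \<odot> (x - z)) \<odot> ((x - z) \<odot> y)) \<bullet> b"
    by (simp only: jordan)
  have 3: "(z \<odot> ((z \<odot> z) \<odot> y)) \<bullet> b = ((z \<odot> z) \<odot> (z \<odot> y)) \<bullet> b" by (simp only: jordan)
  show "(z \<odot> ((x \<odot> x) \<odot> y) + 2 *\<^sub>R (x \<odot> ((x \<odot> z) \<odot> y))) \<bullet> b =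
     (2 *\<^sub>R ((x \<odot> z) \<odot> (x \<odot> y)) + (x \<odot> x) \<odot> (z \<odot> y)) \<bullet> b"
    using 1 2 3 unfolding J_simps inner_simps zx by linarith
qed

text \<open>A second polarisation in x: the value at x + w minus the values at x and at w.\<close>

lemma jordan_linear2:
  "z \<odot> ((x \<odot> w) \<odot> y) + x \<odot> ((w \<odot> z) \<odot> y) + w \<odot> ((x \<odot> z) \<odot> y) =
   (x \<odot> z) \<odot> (w \<odot> y) + (w \<odot> z) \<odot> (x \<odot> y) + (x \<odot> w) \<odot> (z \<odot> y)"
proof (rule euclidean_eqI)
  fix b
  have wx: "w \<odot> x = x \<odot> w" by (rule J_commute)
  note 1 = arg_cong[OF jordan_linear1[of z "x + w" y], of "\<lambda>u. u \<bullet> b"]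
  note 2 = arg_cong[OF jordan_linear1[of z x y], of "\<lambda>u. u \<bullet> b"]
  note 3 = arg_cong[OF jordan_linear1[of z w y], of "\<lambda>u. u \<bullet> b"]
  show "(z \<odot> ((x \<odot> w) \<odot> y) + x \<odot> ((w \<odot> z) \<odot> y) + w \<odot> ((x \<odot> z) \<odot> y)) \<bullet> b =
    ((x \<odot> z) \<odot> (w \<odot> y) + (w \<odot> z) \<odot> (x \<odot> y) + (x \<odot> w) \<odot> (z \<odot> y)) \<bullet> b"
    using 1 2 3 unfolding J_simps inner_simps wx scaleR_add_right by linarith
qed

text \<open>The right-hand side of \<open>jordan_linear2\<close> is symmetric in all four arguments; comparing the
  left-hand sides for two orders of the arguments gives the Leibniz rule.\<close>

lemma commutator_derivation:
  defines "D \<equiv> \<lambda>a b y. a \<odot> (b \<odot> y) - b \<odot> (a \<odot> y)"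
  shows "D a b (y \<odot> z) = D a b y \<odot> z + y \<odot> D a b z"
proof (rule euclidean_eqI)
  fix i
  note 1 = arg_cong[OF jordan_linear2[of a y z b], of "\<lambda>u. u \<bullet> i"]
  note 2 = arg_cong[OF jordan_linear2[of b y z a], of "\<lambda>u. u \<bullet> i"]
  have c: "z \<odot> y = y \<odot> z" "y \<odot> a = a \<odot> y" "y \<odot> b = b \<odot> y" "z \<odot> a = a \<odot> z" "z \<odot> b = b \<odot> z"
    "(a \<odot> y) \<odot> b = b \<odot> (a \<odot> y)" "(b \<odot> y) \<odot> a = a \<odot> (b \<odot> y)" "(y \<odot> z) \<odot> b = b \<odot> (y \<odot> z)" 
    "(y \<odot> z) \<odot> a = a \<odot> (y \<odot> z)" "(a \<odot> z) \<odot> b = b \<odot> (a \<odot> z)" "(b \<odot> z) \<odot> a = a \<odot> (b \<odot> z)"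
    "(b \<odot> y) \<odot> (a \<odot> z) = (a \<odot> z) \<odot> (b \<odot> y)" "(b \<odot> z) \<odot> (a \<odot> y) = (a \<odot> y) \<odot> (b \<odot> z)" "b \<odot> a = a \<odot> b"
    "(y \<odot> z) \<odot> (a \<odot> b) = (a \<odot> b) \<odot> (y \<odot> z)"
    "a \<odot> (b \<odot> y) \<odot> z = z \<odot> (a \<odot> (b \<odot> y))" "b \<odot> (a \<odot> y) \<odot> z = z \<odot> (b \<odot> (a \<odot> y))"
    by (rule J_commute)+
  show "D a b (y \<odot> z) \<bullet> i = (D a b y \<odot> z + y \<odot> D a b z) \<bullet> i"
    using 1 2 unfolding D_def J_simps inner_simps c by linarith
qed

text \<open>Peirce's equation for multiplication by \<open>c\<close>: the polynomial t (t - 1) (2 t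
  - 1) has the roots 0, 1/2 and 1. It is the fully polarised identity with three arguments equal to
  \<open>c\<close>.\<close>

lemma idempotent_cubic:
  assumes c: "c \<odot> c = c"
  shows "2 *\<^sub>R (c \<odot> (c \<odot> (c \<odot> v))) = 3 *\<^sub>R (c \<odot> (c \<odot> v)) - c \<odot> v"
proof (rule euclidean_eqI)
  fix i
  note 1 = arg_cong[OF jordan_linear2[of v c c c], of "\<lambda>u. u \<bullet> i"]
  have s: "v \<odot> c = c \<odot> v" "(c \<odot> v) \<odot> c = c \<odot> (c \<odot> v)" by (rule J_commute)+
  show "(2 *\<^sub>R (c \<odot> (c \<odot> (c \<odot> v)))) \<bullet> i = (3 *\<^sub>R (c \<odot> (c \<odot> v)) - c \<odot> v) \<bullet> i"
    using 1 unfolding c s inner_simps by linarith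
qed

text \<open>The polarised identity with \<open>c\<close> in two places. The resulting subalgebra is
  where the variational argument of \<open>primitive_Peirce1\<close> takes place.\<close>

lemma Peirce1_mult:
  assumes c: "c \<odot> c = c" and y: "c \<odot> y = y" and z: "c \<odot> z = z"
  shows "c \<odot> (y \<odot> z) = y \<odot> z"
proof (rule euclidean_eqI)
  fix i
  note 1 = arg_cong[OF jordan_linear2[of y c c z], of "\<lambda>u. u \<bullet> i"]
  show "(c \<odot> (y \<odot> z)) \<bullet> i = (y \<odot> z) \<bullet> i"
    using 1 unfolding c y z inner_simps by linarith
qed

text \<open>On the possible eigenvalues 0, 1/2 and 1 of multiplication by \<open>c\<close>, the
  polynomial t agrees with t^2 + 4 (t - t^2)^2. Since that operator is self-adjoint for
  \<open>B\<close>, the value is a sum of two squares.\<close>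

lemma idempotent_psd:
  assumes c: "c \<odot> c = c" shows "B (y \<odot> y) c \<ge> 0"
proof -
  define L where "L = J c"
  have lin: "L (x + y) = L x + L y" "L (x - y) = L x - L y" "L (r *\<^sub>R x) = r *\<^sub>R L x" for x y r
    by (simp_all add: L_def J_simps)
  have sa: "B (L x) y = B x (L y)" for x y by (simp add: L_def B_assoc)
  have cub: "L (L (L x)) = (3/2) *\<^sub>R L (L x) - (1/2) *\<^sub>R L x" for x
    using arg_cong[OF idempotent_cubic[OF c, of x], of "\<lambda>u. (1/2) *\<^sub>R u"]
    by (simp add: L_def scaleR_diff_right)
  have "B (y \<odot> y) c = B y (L y)" unfolding B_assoc L_def by (simp add: J_commute)
  also have "\<dots> = B (L y) (L y) + 4 * B (L y - L (L y)) (L y - L (L y))"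
  proof -
    have "B (L y) (L y) = B y (L (L y))" "B (L y) (L (L y)) = B y (L (L (L y)))" 
      "B (L (L y)) (L y) = B y (L (L (L y)))" "B (L (L y)) (L (L y)) = B y (L (L (L (L y))))"
      by (simp_all add: sa)
    then show ?thesis by (simp add: B_simps cub lin algebra_simps)
  qed
  finally show ?thesis using B_self_nonneg[of "L y"] B_self_nonneg[of "L y - L (L y)"] by linarith
qed

subsection \<open>Primitive idempotents\<close>

lemma continuous_on_J [continuous_intros]:
  "continuous_on S f \<Longrightarrow> continuous_on S g \<Longrightarrow> continuous_on S (\<lambda>x. f x \<odot> g x)"
  using bilinear_J bounded_bilinear.continuous_on[of J] by (auto simp: bilinear_conv_bounded_bilinear)

lemma continuous_on_B [continuous_intros]:
  "continuous_on S f \<Longrightarrow> continuous_on S g \<Longrightarrow> continuous_on S (\<lambda>x. B (f x) (g x))"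
  using bilinear_B bounded_bilinear.continuous_on[of B] by (auto simp: bilinear_conv_bounded_bilinear)

text \<open>The minimum of a positive continuous function on the compact unit sphere; it will make
  the unit sphere of \<open>B\<close> bounded.\<close>

lemma B_coercive: "\<exists>m>0. \<forall>x. m * (norm x)\<^sup>2 \<le> B x x"
proof -
  obtain b :: 'a where "b \<in> Basis" using nonempty_Basis by blast
  then have ne: "sphere (0::'a) 1 \<noteq> {}" by (auto intro!: exI[of _ b])
  have "continuous_on (sphere 0 1) (\<lambda>x. B x x)" by (intro continuous_intros)
  from continuous_attains_inf[OF compact_sphere ne this]
  obtain x0 where x0: "norm x0 = 1" and min: "\<And>x. norm x = 1 \<Longrightarrow> B x0 x0 \<le> B x x" by auto
  have "B x0 x0 * (norm x)\<^sup>2 \<le> B x x" for x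
  proof (cases "x = 0")
    case False
    have "B x x = (norm x)\<^sup>2 * B ((1 / norm x) *\<^sub>R x) ((1 / norm x) *\<^sub>R x)"
      using False by (simp add: B_simps power2_eq_square)
    with min[of "(1 / norm x) *\<^sub>R x"] False show ?thesis
      by (simp add: mult.commute[of "B x0 x0"] mult_left_mono)
  qed (simp add: B_simps)
  moreover have "x0 \<noteq> 0" using x0 by auto
  then have "B x0 x0 > 0" by (rule B_pos)
  ultimately show ?thesis by blast
qed

text \<open>Associativity and symmetry of \<open>B\<close> make the trilinear form
  \<open>B (x \<odot> y) z\<close> symmetric.\<close>

lemma cubic_form_swap:
  "B (x \<odot> v) x = B (x \<odot> x) v" "B (v \<odot> x) x = B (x \<odot> x) v"
proof -
  show *: "B (x \<odot> v) x = B (x \<odot> x) v" by (rule trans[OF B_assoc B_commute])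
  show "B (v \<odot> x) x = B (x \<odot> x) v" by (subst J_commute) (rule *)
qed

lemma cubic_form_expand:
  "B ((x + t *\<^sub>R v) \<odot> (x + t *\<^sub>R v)) (x + t *\<^sub>R v) =
    B (x \<odot> x) x + 3 * t * B (x \<odot> x) v + 3 * t\<^sup>2 * B (v \<odot> v) x + t ^ 3 * B (v \<odot> v) v"
proof -
  have "B ((x + t *\<^sub>R v) \<odot> (x + t *\<^sub>R v)) (x + t *\<^sub>R v) =
    B (x \<odot> x) x + t * B (x \<odot> x) v + t * B (x \<odot> v) x + t * B (v \<odot> x) x +
    t * t * B (x \<odot> v) v + t * t * B (v \<odot> x) v + t * t * B (v \<odot> v) x + t * t * t * B (v \<odot> v) v"
    unfolding J_simps B_simps real_scaleR_def by (simp only: algebra_simps)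
  then show ?thesis
    unfolding cubic_form_swap(1)[of x v] cubic_form_swap(1)[of v x] cubic_form_swap(2)[of x v] cubic_form_swap(2)[of v x]
    by (simp add: power2_eq_square power3_eq_cube)
qed

text \<open>The critical points of the cubic form \<open>B (x \<odot> x) x\<close> on the unit sphere of the Peirce
  space \<open>{x. c \<odot> x = x}\<close> are proportional to idempotents, and \<open>c\<close> itself is not a local maximum
  unless the Peirce space is a line. This makes the spectral theorem unnecessary.\<close>

lemma primitive_Peirce1:
  assumes prim: "primitive_idempotent J c" and w: "c \<odot> w = w"
  shows "\<exists>k. w = k *\<^sub>R c"
proof (rule ccontr)
  assume nw: "\<nexists>k. w = k *\<^sub>R c"
  have c: "c \<odot> c = c" and c0: "c \<noteq> 0" using prim by (auto simp: primitive_idempotent_def idempotent_def)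
  have Bc: "B c c > 0" by (rule B_pos[OF c0])
  define f where "f x = B (x \<odot> x) x" for x
  define S where "S = {x. c \<odot> x = x \<and> B x x = 1}"
  have cube: "f (r *\<^sub>R x) = r ^ 3 * f x" for r x
    by (simp add: f_def J_simps B_simps power3_eq_cube)
  obtain m where m: "m > 0" "\<And>x. m * (norm x)\<^sup>2 \<le> B x x" using B_coercive by blast
  have "S \<subseteq> cball 0 (sqrt (1/m))"
  proof
    fix x assume "x \<in> S"
    with m(2)[of x] have "(norm x)\<^sup>2 \<le> 1/m" using m(1) by (simp add: S_def field_simps)
    then show "x \<in> cball 0 (sqrt (1/m))" by (simp add: real_le_rsqrt)
  qed
  then have "bounded S" using bounded_subset bounded_cball by blast
  moreover have "closed S" unfolding S_def
    by (intro closed_Collect_conj closed_Collect_eq continuous_intros)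
  ultimately have cS: "compact S" by (simp add: compact_eq_bounded_closed)
  define c1 where "c1 = (1 / sqrt (B c c)) *\<^sub>R c"
  have c1: "c1 \<in> S" using Bc by (simp add: S_def c1_def J_simps B_simps c)
  have "f c1 > 0" using Bc by (simp add: c1_def cube) (simp add: f_def c)
  have "continuous_on S f" unfolding f_def by (intro continuous_intros)
  from continuous_attains_sup[OF cS _ this] c1
  obtain x where x: "x \<in> S" and max: "\<And>y. y \<in> S \<Longrightarrow> f y \<le> f x" by auto
  define l where "l = f x"
  have l: "l > 0" using max[OF c1] \<open>f c1 > 0\<close> by (simp add: l_def)
  have xA: "c \<odot> x = x" and Bx: "B x x = 1" using x by (auto simp: S_def)
  have crit: "B (x \<odot> x) v = 0" if v: "c \<odot> v = v" "B x v = 0" for v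
  proof -
    define n where "n = B v v"
    \<comment> \<open>Normalising x + t v costs a factor s^3 with s = sqrt (1 + t^2 n). As s \<ge>
      1, passing to s^4 gives a polynomial in t and changes only terms of order t^2, so
      \<open>g\<close> is minimal at 0 with the derivative sought.\<close>
    define g where "g t = l * (1 + t\<^sup>2 * n)\<^sup>2 - (l + 3 * t * B (x \<odot> x) v + 3 * t\<^sup>2 * B (v \<odot> v) x + t ^ 3 * f v)" for t
    have n: "n \<ge> 0" by (simp add: n_def B_self_nonneg)
    have "f (x + t *\<^sub>R v) \<le> l * (1 + t\<^sup>2 * n)\<^sup>2" for t
    proof -
      define s where "s = sqrt (1 + t\<^sup>2 * n)"
      have s1: "s \<ge> 1" using n by (simp add: s_def)
      have s2: "s\<^sup>2 = 1 + t\<^sup>2 * n" using n by (simp add: s_def)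
      define z where "z = x + t *\<^sub>R v"
      have cz: "c \<odot> z = z" using xA v by (simp add: z_def J_simps)
      have "B z z = B x x + 2 * t * B x v + t\<^sup>2 * B v v"
        by (simp add: z_def B_simps B_commute[of v x] power2_eq_square algebra_simps)
      then have Bz: "B z z = s\<^sup>2" by (simp add: s2 n_def v Bx)
      have "B ((1/s) *\<^sub>R z) ((1/s) *\<^sub>R z) = 1"
        using s1 by (simp add: B_simps Bz power2_eq_square)
      then have "(1/s) *\<^sub>R z \<in> S" by (simp add: S_def J_simps cz)
      then have "f ((1/s) *\<^sub>R z) \<le> l" unfolding l_def by (rule max)
      then have "f z \<le> l * s ^ 3" using s1 by (simp add: cube field_simps)
      then have "f (x + t *\<^sub>R v) \<le> l * s ^ 3" by (simp add: z_def)
      also have "\<dots> \<le> l * s ^ 4" using s1 l by (intro mult_left_mono power_increasing) auto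
      also have "s ^ 4 = (1 + t\<^sup>2 * n)\<^sup>2" unfolding s2[symmetric] by simp
      finally show ?thesis .
    qed
    moreover have "f (x + t *\<^sub>R v) = l + 3 * t * B (x \<odot> x) v + 3 * t\<^sup>2 * B (v \<odot> v) x + t ^ 3 * f v" for t
      unfolding f_def l_def by (rule cubic_form_expand)
    ultimately have "g 0 \<le> g t" for t by (simp add: g_def)
    moreover have "DERIV g 0 :> - 3 * B (x \<odot> x) v"
      unfolding g_def by (rule derivative_eq_intros refl | simp)+
    ultimately show ?thesis using DERIV_local_min[of g "- 3 * B (x \<odot> x) v" 0 1] by auto
  qed
  define v where "v = x \<odot> x - l *\<^sub>R x"
  have vA: "c \<odot> v = v" using Peirce1_mult[OF c xA xA] xA by (simp add: v_def J_simps)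
  have "B x (x \<odot> x) = l" unfolding l_def f_def by (rule B_commute)
  then have xv: "B x v = 0" using Bx by (simp add: v_def B_simps)
  have "B v v = B (x \<odot> x) v - l * B x v" by (subst (1) v_def) (simp add: B_simps)
  then have "B v v = 0" using crit[OF vA xv] xv by simp
  then have xx: "x \<odot> x = l *\<^sub>R x" by (simp add: B_self_eq_0 v_def)
  \<comment> \<open>The critical point rescaled to an idempotent below \<open>c\<close>; then c = u
    + (c - u) is an orthogonal decomposition, and primitivity forces u = c.\<close>
  define u where "u = (1/l) *\<^sub>R x"
  have u: "u \<odot> u = u" "c \<odot> u = u" "u \<odot> c = u" "u \<noteq> 0"
    using l Bx J_commute[of u c] by (auto simp: u_def J_simps xx xA B_simps)
  have "idempotent J u" "idempotent J (c - u)" "J u (c - u) = 0"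
    using u c by (simp_all add: idempotent_def J_simps)
  then have "\<exists>a b. idempotent J a \<and> idempotent J b \<and> a \<noteq> 0 \<and> b \<noteq> 0 \<and> J a b = 0 \<and> c = a + b" if "c - u \<noteq> 0"
    using u(4) that by (intro exI[of _ u] exI[of _ "c - u"]) auto
  then have "c - u = 0" using prim unfolding primitive_idempotent_def by blast
  then have xc: "x = l *\<^sub>R c" using l by (simp add: u_def)
  define y0 where "y0 = w - (B w c / B c c) *\<^sub>R c"
  have y0: "y0 \<noteq> 0" "c \<odot> y0 = y0" "B c y0 = 0"
    using nw Bc by (auto simp: y0_def J_simps B_simps w c B_commute[of c w])
  define y1 where "y1 = (1 / sqrt (B y0 y0)) *\<^sub>R y0"
  have y1: "c \<odot> y1 = y1" "B c y1 = 0" "B y1 y1 = 1"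
    using y0 B_pos[OF y0(1)] by (simp_all add: y1_def J_simps B_simps)
  define y where "y = (if f y1 \<ge> 0 then y1 else - y1)"
  have fm: "f (- z) = - f z" for z by (simp add: f_def J_simps B_simps)
  have y: "c \<odot> y = y" "B c y = 0" "B y y = 1" "f y \<ge> 0"
    using y1 fm[of y1] by (auto simp: y_def J_simps B_simps)
  \<comment> \<open>The unit vector at the 3-4-5 angle between x and y. The cubic form there is (64
    + 108)/125 of the maximum \<open>l\<close> plus a nonnegative term, the sign of y having been
    chosen for that, so it exceeds the maximum.\<close>
  define x' where "x' = (4/5) *\<^sub>R x + (3/5) *\<^sub>R y"
  have Bxy: "B x y = 0" "B y x = 0" using y(2) B_commute[of y x] by (simp_all add: xc B_simps)
  have "x' \<in> S" using xA y Bx Bxy by (simp add: S_def x'_def J_simps B_simps)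
  then have "f x' \<le> l" unfolding l_def by (rule max)
  moreover have "f x' = (172/125) * l + (27/125) * f y"
  proof -
    have xy: "x \<odot> y = l *\<^sub>R y" "y \<odot> x = l *\<^sub>R y" 
      using y(1) J_commute[of y c] by (simp_all add: xc J_simps)
    have yyx: "B (y \<odot> y) x = l" 
      unfolding cubic_form_swap(1)[of y x, symmetric] xy(2) using y(3) by (simp only: B_simps real_scaleR_def mult_1_right)
    have sq: "((4/5) *\<^sub>R x) \<odot> ((4/5) *\<^sub>R x) = ((16/25) * l) *\<^sub>R x"
      unfolding J_simps xx scaleR_scaleR by simp
    have "f x' = (16/25) * l * (4/5) + 3 * (3/5)\<^sup>2 * ((4/5) * l) + (3/5) ^ 3 * f y"
      unfolding f_def x'_def cubic_form_expand sq
      by (simp only: B_simps real_scaleR_def Bx Bxy yyx mult_zero_right add_0_right mult_1_right)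
    then show ?thesis by (simp add: power2_eq_square power3_eq_cube)
  qed
  ultimately show False using l y(4) by linarith
qed

end

section \<open>Supporting functionals and tangent half-spaces of the cone of squares\<close>

context euclidean_jordan
begin

text \<open>Fourier duality refers to the ambient inner product, the algebra only to
  \<open>B\<close>; \<open>R\<close> translates between the two.\<close>

lemma B_Riesz:
  obtains R where "linear R" "bij R" "\<And>x w. x \<bullet> R w = B x w"
proof -
  define R where "R w = (\<Sum>b\<in>Basis. B b w *\<^sub>R b)" for w
  have lin: "linear R"
    by (rule linearI) (simp_all add: R_def B_simps scaleR_add_left sum.distrib scaleR_sum_right)
  have inner: "x \<bullet> R w = B x w" for x w
  proof -
    have "B x w = B (\<Sum>b\<in>Basis. (x \<bullet> b) *\<^sub>R b) w" by (simp add: euclidean_representation)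
    also have "\<dots> = (\<Sum>b\<in>Basis. (x \<bullet> b) * B b w)"
      using bilinear_B by (simp add: linear_sum[of "\<lambda>y. B y w"] bilinear_def B_simps)
    also have "\<dots> = x \<bullet> R w" by (simp add: R_def inner_sum_right mult.commute)
    finally show ?thesis by simp
  qed
  have "inj R"
  proof (rule injI)
    fix v w assume "R v = R w"
    then have "B z v = B z w" for z by (metis inner)
    then show "v = w" by (intro B_ext) (simp add: B_commute[of v] B_commute[of w])
  qed
  then have "bij R" using lin by (simp add: bij_def linear_injective_imp_surjective)
  with lin inner show ?thesis using that by blast
qed

text \<open>The square map is a submersion at \<open>y + \<epsilon>e\<close> for small \<open>\<epsilon> > 0\<close>.\<close>

lemma square_in_closure_interior: "y \<odot> y \<in> closure (interior (range (\<lambda>x. x \<odot> x)))"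
proof -
  define L where "L = J y"
  have linL: "linear L" using bilinear_J by (simp add: L_def bilinear_def)
  have sub: "subspace (range L)" using linear_subspace_image[OF linL subspace_UNIV] by simp
  \<comment> \<open>Multiplication by y is self-adjoint for \<open>B\<close>, so its kernel meets
    its range only in 0. The lower bound \<open>m\<close> on the range then excludes the eigenvalue
    -r for 0 < r < m, since an eigenvector would lie in the range; hence the derivative of the
    square map at y + r e is injective.\<close>
  have "\<forall>x\<in>range L. L x = 0 \<longrightarrow> x = 0"
  proof (intro ballI impI)
    fix x assume "x \<in> range L" "L x = 0"
    then obtain z where z: "x = L z" by blast
    have "B x x = B z (L x)" by (simp add: z L_def B_assoc)
    then show "x = 0" using \<open>L x = 0\<close> by (simp add: B_self_eq_0 B_simps)
  qed
  then obtain m where m: "m > 0" "\<And>x. x \<in> range L \<Longrightarrow> norm (L x) \<ge> m * norm x"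
    using injective_imp_isometric[OF closed_subspace[OF sub] sub, of L] linL
    by (auto simp: linear_conv_bounded_linear)
  have int: "(y + r *\<^sub>R e) \<odot> (y + r *\<^sub>R e) \<in> interior (range (\<lambda>x. x \<odot> x))" if r: "0 < r" "r < m" for r
  proof -
    define f' where "f' h = 2 *\<^sub>R ((y + r *\<^sub>R e) \<odot> h)" for h
    have lin': "linear f'" by (rule linearI) (simp_all add: f'_def J_simps algebra_simps)
    have "inj f'"
      unfolding linear_injective_0[OF lin']
    proof (intro allI impI)
      fix h assume "f' h = 0"
      then have h: "L h = - (r *\<^sub>R h)" by (simp add: f'_def J_simps unit_left L_def add_eq_0_iff2)
      have "L ((- (1/r)) *\<^sub>R h) = (- (1/r)) *\<^sub>R L h" by (rule linear_scale[OF linL])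
      then have "h = L ((- (1/r)) *\<^sub>R h)" using r by (simp add: h)
      then have "h \<in> range L" by blast
      from m(2)[OF this] have "m * norm h \<le> r * norm h" using r by (simp add: h)
      then show "h = 0" using r by (auto simp: mult_le_cancel_right)
    qed
    then have "surj f'" using lin' by (simp add: linear_injective_imp_surjective)
    then obtain g' where g': "linear g'" "f' \<circ> g' = id" using linear_surjective_right_inverse[OF lin'] by blast
    have "(\<lambda>x. x \<odot> x) (y + r *\<^sub>R e) \<in> interior ((\<lambda>x. x \<odot> x) ` UNIV)"
    proof (rule sussmann_open_mapping[of UNIV])
      show "((\<lambda>x. x \<odot> x) has_derivative f') (at (y + r *\<^sub>R e))"
      proof -
        have "((\<lambda>x. x \<odot> x) has_derivative (\<lambda>h. (y + r *\<^sub>R e) \<odot> h + h \<odot> (y + r *\<^sub>R e))) (at (y + r *\<^sub>R e))"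
          using bilinear_J unfolding bilinear_conv_bounded_bilinear
          by (rule bounded_bilinear.FDERIV) (rule has_derivative_ident)+
        moreover have "f' = (\<lambda>h. (y + r *\<^sub>R e) \<odot> h + h \<odot> (y + r *\<^sub>R e))"
          unfolding f'_def scaleR_2 by (intro ext arg_cong2[where f="(+)"] refl J_commute)
        ultimately show ?thesis by simp
      qed
    qed (use g' in \<open>auto simp: linear_conv_bounded_linear intro!: continuous_intros\<close>)
    then show ?thesis by simp
  qed
  show ?thesis
    unfolding closure_sequential
  proof (intro exI conjI allI)
    \<comment> \<open>The offset 2 keeps every \<open>r n\<close> strictly below
      \<open>m\<close>.\<close>
    define r where "r n = m / (real n + 2)" for n :: nat
    show "(y + r n *\<^sub>R e) \<odot> (y + r n *\<^sub>R e) \<in> interior (range (\<lambda>x. x \<odot> x))" for n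
      by (rule int) (use m in \<open>auto simp: r_def divide_less_eq\<close>)
    have r0: "r \<longlonglongrightarrow> 0" unfolding r_def by real_asymp
    have "(\<lambda>n. (y + r n *\<^sub>R e) \<odot> (y + r n *\<^sub>R e)) \<longlonglongrightarrow> (y + 0 *\<^sub>R e) \<odot> (y + 0 *\<^sub>R e)"
      using bilinear_J by (intro bounded_bilinear.tendsto[of J] tendsto_intros r0) (auto simp: bilinear_conv_bounded_bilinear)
    then show "(\<lambda>n. (y + r n *\<^sub>R e) \<odot> (y + r n *\<^sub>R e)) \<longlonglongrightarrow> y \<odot> y" by simp
  qed
qed

text \<open>A supporting functional \<open>B \<cdot> w\<close> of the cone at \<open>e - c\<close> satisfies \<open>(e - c) \<odot> w = 0\<close>, by
  Cauchy--Schwarz for the form \<open>B (y \<odot> z) w\<close>; hence \<open>w\<close> lies on the line through \<open>c\<close>,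
  and the tangent cone is a half-space.\<close>

lemma tangent_halfspace:
  fixes \<Omega> :: "'a set"
  assumes \<Omega>: "\<Omega> = interior (range (\<lambda>x. x \<odot> x))" and conv: "convex \<Omega>"
    and cone: "\<And>x r. x \<in> \<Omega> \<Longrightarrow> r > 0 \<Longrightarrow> r *\<^sub>R x \<in> \<Omega>"
    and c: "c \<odot> c = c" "c \<noteq> 0" and line: "\<And>w. c \<odot> w = w \<Longrightarrow> \<exists>k. w = k *\<^sub>R c"
  shows "B \<eta> c > 0 \<Longrightarrow> \<forall>\<^sub>F t in at_top. \<eta> + t *\<^sub>R (e - c) \<in> \<Omega>"
    and "B \<eta> c < 0 \<Longrightarrow> \<eta> + t *\<^sub>R (e - c) \<notin> \<Omega>"
proof -
  define \<xi> where "\<xi> = e - c"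
  have \<xi>c: "B \<xi> c = 0"
    using B_assoc[of c e c] J_commute[of c e] by (simp add: \<xi>_def B_simps unit_left c)
  have \<xi>2: "\<xi> \<odot> \<xi> = \<xi>" by (simp add: \<xi>_def J_simps unit_left unit_right c)
  have sq: "x \<odot> x \<in> closure \<Omega>" for x unfolding \<Omega> by (rule square_in_closure_interior)
  have \<xi>cl: "\<xi> \<in> closure \<Omega>" using sq[of \<xi>] by (simp add: \<xi>2)
  have op: "open \<Omega>" by (simp add: \<Omega>)
  have ne: "\<Omega> \<noteq> {}" using \<xi>cl by auto
  \<comment> \<open>The boundary point \<xi> is replaced by a nearby \<open>u n\<close> in \<Omega>:
    openness at x absorbs the error, and adding a positive multiple of \<open>u n\<close> stays in
    the convex cone.\<close>
  have mono: "x + s *\<^sub>R \<xi> \<in> \<Omega>" if x: "x \<in> \<Omega>" and s: "s \<ge> 0" for x s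
  proof -
    obtain u where u: "\<And>n. u n \<in> \<Omega>" "u \<longlonglongrightarrow> \<xi>" using \<xi>cl unfolding closure_sequential by blast
    have "(\<lambda>n. x + s *\<^sub>R (\<xi> - u n)) \<longlonglongrightarrow> x + s *\<^sub>R (\<xi> - \<xi>)" by (intro tendsto_intros u)
    then have "\<forall>\<^sub>F n in sequentially. x + s *\<^sub>R (\<xi> - u n) \<in> \<Omega>"
      using x op by (simp add: tendsto_def)
    then obtain n where n: "x + s *\<^sub>R (\<xi> - u n) \<in> \<Omega>" by (meson eventually_sequentially order_refl)
    show ?thesis
    proof (cases "s = 0")
      case False
      have "2 *\<^sub>R ((1/2) *\<^sub>R (x + s *\<^sub>R (\<xi> - u n)) + (1/2) *\<^sub>R (s *\<^sub>R u n)) \<in> \<Omega>"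
        by (intro cone convexD[OF conv] n u) (use False s in auto)
      then show ?thesis by (simp add: scaleR_add_right scaleR_diff_right)
    qed (use x in simp)
  qed
  show "\<eta> + t *\<^sub>R (e - c) \<notin> \<Omega>" if "B \<eta> c < 0"
  proof
    assume "\<eta> + t *\<^sub>R (e - c) \<in> \<Omega>"
    then obtain y where "\<eta> + t *\<^sub>R \<xi> = y \<odot> y" unfolding \<Omega> \<xi>_def using interior_subset by blast
    then have "B (\<eta> + t *\<^sub>R \<xi>) c \<ge> 0" using idempotent_psd[OF c(1), of y] by simp
    then show False using that \<xi>c by (simp add: B_simps)
  qed
  show "\<forall>\<^sub>F t in at_top. \<eta> + t *\<^sub>R (e - c) \<in> \<Omega>" if pos: "B \<eta> c > 0"
  proof (cases "\<exists>t\<ge>0. \<eta> + t *\<^sub>R \<xi> \<in> \<Omega>")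
    case True
    then obtain t where t: "\<eta> + t *\<^sub>R \<xi> \<in> \<Omega>" by blast
    show ?thesis
    proof (rule eventually_at_top_linorderI[of t])
      fix s assume "t \<le> s"
      with mono[OF t, of "s - t"] show "\<eta> + s *\<^sub>R (e - c) \<in> \<Omega>"
        by (simp add: \<xi>_def scaleR_diff_left algebra_simps)
    qed
  next
    case False
    \<comment> \<open>The union of the translates of \<Omega> backwards along \<xi>. If the ray from
      \<eta> in direction \<xi> misses \<Omega>, then \<eta> lies outside this convex set and a
      hyperplane separates the two.\<close>
    define K where "K = {x - t *\<^sub>R \<xi> | x t. x \<in> \<Omega> \<and> t \<ge> 0}"
    have "convex K"
    proof (rule convexI)
      fix k k' and u v :: real assume "k \<in> K" "k' \<in> K" and uv: "0 \<le> u" "0 \<le> v" "u + v = 1"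
      then obtain x t x' t' where x: "x \<in> \<Omega>" "t \<ge> 0" "k = x - t *\<^sub>R \<xi>" "x' \<in> \<Omega>" "t' \<ge> 0" "k' = x' - t' *\<^sub>R \<xi>"
        unfolding K_def by blast
      have "u *\<^sub>R k + v *\<^sub>R k' = (u *\<^sub>R x + v *\<^sub>R x') - (u * t + v * t') *\<^sub>R \<xi>"
        by (simp add: x algebra_simps)
      moreover have "u *\<^sub>R x + v *\<^sub>R x' \<in> \<Omega>" by (rule convexD[OF conv]) (use x uv in auto)
      moreover have "u * t + v * t' \<ge> 0" using x uv by simp
      ultimately show "u *\<^sub>R k + v *\<^sub>R k' \<in> K" unfolding K_def by blast
    qed
    moreover have "{\<eta>} \<inter> K = {}"
    proof -
      have "\<eta> \<noteq> x - t *\<^sub>R \<xi>" if "x \<in> \<Omega>" "t \<ge> 0" for x t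
        using False that by auto
      then show ?thesis unfolding K_def by blast
    qed
    moreover have "K \<noteq> {}" using ne unfolding K_def by (auto intro: exI[of _ 0])
    ultimately obtain a b where a: "a \<noteq> 0" "a \<bullet> \<eta> \<le> b" "\<And>k. k \<in> K \<Longrightarrow> a \<bullet> k \<ge> b"
      using separating_hyperplane_sets[of "{\<eta>}" K] by auto
    have ab: "a \<bullet> x - t * (a \<bullet> \<xi>) \<ge> a \<bullet> \<eta>" if "x \<in> \<Omega>" "t \<ge> 0" for x t
      using a(2) a(3)[of "x - t *\<^sub>R \<xi>"] that unfolding K_def by (force simp: inner_diff_right)
    have apos: "a \<bullet> x \<ge> 0" if x: "x \<in> \<Omega>" for x
    proof (rule ccontr)
      assume "\<not> a \<bullet> x \<ge> 0"
      define r where "r = (\<bar>a \<bullet> \<eta>\<bar> + 1) / (- (a \<bullet> x))"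
      have "r > 0" 
        using \<open>\<not> a \<bullet> x \<ge> 0\<close> unfolding r_def by (intro divide_pos_pos) simp_all
      with ab[OF cone[OF x, of r], of 0] have "r * (a \<bullet> x) \<ge> a \<bullet> \<eta>" by simp
      moreover have "r * (a \<bullet> x) = - (\<bar>a \<bullet> \<eta>\<bar> + 1)" using \<open>\<not> a \<bullet> x \<ge> 0\<close> by (simp add: r_def)
      ultimately show False by linarith
    qed
    have a\<eta>: "a \<bullet> \<eta> \<le> 0"
    proof (rule ccontr)
      assume n: "\<not> a \<bullet> \<eta> \<le> 0"
      obtain x where x: "x \<in> \<Omega>" using ne by blast
      have ax: "a \<bullet> x > 0" using ab[OF x, of 0] n by simp
      have "a \<bullet> (((a \<bullet> \<eta>) / (2 * (a \<bullet> x))) *\<^sub>R x) \<ge> a \<bullet> \<eta>"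
        using ab[OF cone[OF x], of "(a \<bullet> \<eta>) / (2 * (a \<bullet> x))" 0] n ax by simp
      then show False using n ax by simp
    qed
    have cl: "a \<bullet> x \<ge> 0" if "x \<in> closure \<Omega>" for x
    proof -
      have "closure \<Omega> \<subseteq> {x. a \<bullet> x \<ge> 0}"
        by (rule closure_minimal) (use apos in \<open>auto intro: closed_halfspace_ge\<close>)
      then show ?thesis using that by blast
    qed
    \<comment> \<open>\<open>K\<close> extends indefinitely in direction -\<xi>, so a functional
      bounded below on \<open>K\<close> cannot be positive at \<xi>.\<close>
    have a\<xi>: "a \<bullet> \<xi> = 0"
    proof (rule ccontr)
      assume "a \<bullet> \<xi> \<noteq> 0"
      then have p: "a \<bullet> \<xi> > 0" using cl[OF \<xi>cl] by simp
      obtain x where x: "x \<in> \<Omega>" using ne by blast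
      define t where "t = (\<bar>a \<bullet> x\<bar> + \<bar>a \<bullet> \<eta>\<bar> + 1) / (a \<bullet> \<xi>)"
      have "t \<ge> 0" "t * (a \<bullet> \<xi>) = \<bar>a \<bullet> x\<bar> + \<bar>a \<bullet> \<eta>\<bar> + 1" using p by (simp_all add: t_def)
      with ab[OF x, of t] show False by linarith
    qed
    obtain R where R: "linear R" "bij R" "\<And>x w. x \<bullet> R w = B x w" using B_Riesz by blast
    obtain w where w: "a = R w" using R(2) by (metis bij_pointE)
    have aB: "a \<bullet> x = B x w" for x by (simp add: w inner_commute[of "R w"] R)
    have "B (\<xi> \<odot> z) w = 0" for z
    proof (rule ccontr)
      assume n: "B (\<xi> \<odot> z) w \<noteq> 0"
      \<comment> \<open>The quadratic term vanishes because B \<xi> w = 0, and this t gives the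
        remaining affine expression the value -1.\<close>
      define t where "t = - (B (z \<odot> z) w + 1) / (2 * B (\<xi> \<odot> z) w)"
      have "0 \<le> B ((z + t *\<^sub>R \<xi>) \<odot> (z + t *\<^sub>R \<xi>)) w" using cl[OF sq] by (simp add: aB)
      also have "\<dots> = B (z \<odot> z) w + 2 * t * B (\<xi> \<odot> z) w + t * t * B \<xi> w"
        using J_commute[of z \<xi>] by (simp add: J_simps B_simps \<xi>2 algebra_simps)
      also have "B \<xi> w = 0" using a\<xi> by (simp add: aB)
      finally show False using n by (simp add: t_def field_simps)
    qed
    then have "B z (\<xi> \<odot> w) = B z 0" for z by (simp add: B_assoc B_simps)
    then have "\<xi> \<odot> w = 0" by (intro B_ext) (metis B_commute)
    then have "c \<odot> w = w" by (simp add: \<xi>_def J_simps unit_left)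
    then obtain k where k: "w = k *\<^sub>R c" using line by blast
    have "k * B c c \<ge> 0" using cl[OF sq[of c]] by (simp add: aB k B_simps c)
    moreover have "k \<noteq> 0" using a(1) w k by (auto simp: linear_0[OF R(1)])
    ultimately have "k > 0" using B_pos[OF c(2)] by (simp add: zero_le_mult_iff)
    then show ?thesis using a\<eta> pos by (simp add: aB k B_simps mult_le_0_iff)
  qed
qed

text \<open>One energy identity yields both claims: a solution of \<psi>' = D \<psi> has constant
  \<open>B \<psi> \<psi>\<close> because \<open>D\<close> is skew. By the Leibniz rule the defect of
  multiplicativity is such a solution, and it vanishes at time 0; likewise an orbit that reaches 0
  must have started at 0.\<close>

lemma exp_derivation:
  assumes D: "linear D" and der: "\<And>x y. D (x \<odot> y) = D x \<odot> y + x \<odot> D y"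
    and skew: "\<And>x y. B (D x) y = - B x (D y)"
  shows exp_derivation_mult: "exp_linear D t (x \<odot> y) = exp_linear D t x \<odot> exp_linear D t y"
    and bij_exp_derivation: "bij (exp_linear D t)"
proof -
  let ?E = "exp_linear D"
  note dE = exp_linear_has_vector_derivative[OF D]
  have B_const: "B (\<psi> t) (\<psi> t) = B (\<psi> 0) (\<psi> 0)" if \<psi>: "\<And>t. (\<psi> has_vector_derivative D (\<psi> t)) (at t)" for \<psi> t
  proof -
    have "((\<lambda>t. B (\<psi> t) (\<psi> t)) has_vector_derivative B (\<psi> t) (D (\<psi> t)) + B (D (\<psi> t)) (\<psi> t)) (at t)" for t
      using bilinear_B by (intro bounded_bilinear.has_vector_derivative \<psi>) (simp add: bilinear_conv_bounded_bilinear)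
    then have "DERIV (\<lambda>t. B (\<psi> t) (\<psi> t)) t :> 0" for t
      unfolding has_real_derivative_iff_has_vector_derivative by (simp add: skew)
    then show ?thesis using DERIV_isconst_all[of "\<lambda>t. B (\<psi> t) (\<psi> t)" t 0] by blast
  qed
  define \<psi> where "\<psi> t = ?E t (x \<odot> y) - ?E t x \<odot> ?E t y" for t
  have "(\<psi> has_vector_derivative D (\<psi> t)) (at t)" for t
  proof -
    have "((\<lambda>t. ?E t x \<odot> ?E t y) has_vector_derivative ?E t x \<odot> D (?E t y) + D (?E t x) \<odot> ?E t y) (at t)"
      using bilinear_J by (intro bounded_bilinear.has_vector_derivative dE) (simp add: bilinear_conv_bounded_bilinear)
    from has_vector_derivative_diff[OF dE[of "x \<odot> y" t] this]
    show ?thesis unfolding \<psi>_def by (simp add: linear_diff[OF D] der add.commute)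
  qed
  from B_const[of \<psi>, OF this, of t] have "B (\<psi> t) (\<psi> t) = 0" by (simp add: \<psi>_def D B_simps)
  then show "?E t (x \<odot> y) = ?E t x \<odot> ?E t y" by (simp add: B_self_eq_0 \<psi>_def)
  have lin: "linear (?E t)" by (rule linear_exp_linear[OF D])
  have "inj (?E t)"
    unfolding linear_injective_0[OF lin]
  proof (intro allI impI)
    fix z assume "?E t z = 0"
    with B_const[of "\<lambda>s. ?E s z", OF dE, of t] show "z = 0" by (simp add: D B_simps B_self_eq_0)
  qed
  then show "bij (?E t)" using lin by (simp add: bij_def linear_injective_imp_surjective)
qed

end

subsection \<open>Coordinate orthants\<close>

text \<open>Supplies the factors that witness reducibility. Membership in the dual cone is tested on
  the basis vectors in \<open>S\<close>, and diagonal maps act transitively.\<close>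

lemma symmetric_cone_in_orthant:
  fixes S :: "'a::euclidean_space set"
  assumes S: "S \<subseteq> Basis"
  shows "symmetric_cone_in (span S) {x \<in> span S. \<forall>b\<in>S. x \<bullet> b > 0}"
proof -
  define V where "V = span S"
  define \<Omega> where "\<Omega> = {x \<in> V. \<forall>b\<in>S. x \<bullet> b > 0}"
  have V: "V = {x. \<forall>b\<in>Basis. b \<notin> S \<longrightarrow> x \<bullet> b = 0}" unfolding V_def by (rule span_substd_basis[OF S])
  have finS: "finite S" using S finite_Basis finite_subset by blast
  have inner: "x \<bullet> y = (\<Sum>b\<in>S. (x \<bullet> b) * (y \<bullet> b))" if "x \<in> V" for x y
  proof -
    have "x \<bullet> y = (\<Sum>b\<in>Basis. (x \<bullet> b) * (y \<bullet> b))" by (rule euclidean_inner)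
    also have "\<dots> = (\<Sum>b\<in>S. (x \<bullet> b) * (y \<bullet> b))"
      by (rule sum.mono_neutral_right) (use S that V in auto)
    finally show ?thesis .
  qed
  have open1: "open (\<Inter>b\<in>S. {x. 0 < x \<bullet> b})"
    by (intro open_INT finS ballI open_Collect_less continuous_intros)
  have open2: "openin (top_of_set V) \<Omega>"
  proof -
    have "\<Omega> = V \<inter> (\<Inter>b\<in>S. {x. 0 < x \<bullet> b})" by (auto simp: \<Omega>_def)
    then show ?thesis using open1 by (metis openin_open)
  qed
  have conv: "convex \<Omega>"
  proof (rule convexI)
    fix x y and u v :: real assume *: "x \<in> \<Omega>" "y \<in> \<Omega>" "0 \<le> u" "0 \<le> v" "u + v = 1"
    have "(u *\<^sub>R x + v *\<^sub>R y) \<bullet> b > 0" if "b \<in> S" for b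
    proof -
      have p: "x \<bullet> b > 0" "y \<bullet> b > 0" using * that by (auto simp: \<Omega>_def)
      show ?thesis
      proof (cases "u = 0")
        case True then show ?thesis using p * by simp
      next
        case False
        then have "u * (x \<bullet> b) > 0" "v * (y \<bullet> b) \<ge> 0" using p * by auto
        then show ?thesis by (simp add: inner_add_left)
      qed
    qed
    then show "u *\<^sub>R x + v *\<^sub>R y \<in> \<Omega>"
      using * by (auto simp: \<Omega>_def V_def intro: span_add span_scale)
  qed
  have sc: "c *\<^sub>R x \<in> \<Omega>" if "x \<in> \<Omega>" "c > 0" for x c
    using that by (auto simp: \<Omega>_def V_def span_scale)
  define s where "s = \<Sum>S"
  have sb: "s \<bullet> b = 1" if "b \<in> S" for b
  proof -
    have "s \<bullet> b = (\<Sum>i\<in>S. if i = b then 1 else 0)"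
      unfolding s_def inner_sum_left
      by (rule sum.cong[OF refl], subst inner_Basis) (use S that in auto)
    then show ?thesis using that finS by simp
  qed
  have sV: "s \<in> V" unfolding s_def V_def by (intro span_sum span_base)
  have clos: "closure \<Omega> \<subseteq> V \<inter> (\<Inter>b\<in>S. {x. 0 \<le> x \<bullet> b})"
  proof (rule closure_minimal)
    show "\<Omega> \<subseteq> V \<inter> (\<Inter>b\<in>S. {x. 0 \<le> x \<bullet> b})" by (auto simp: \<Omega>_def intro: less_imp_le)
    have "closed V" unfolding V_def by (rule closed_subspace[OF subspace_span])
    moreover have "closed (\<Inter>b\<in>S. {x. 0 \<le> x \<bullet> b})"
      by (intro closed_INT ballI closed_Collect_le continuous_intros)
    ultimately show "closed (V \<inter> (\<Inter>b\<in>S. {x. 0 \<le> x \<bullet> b}))" by (rule closed_Int)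
  qed
  have dual: "open_dual_cone_in V \<Omega> = \<Omega>"
  proof (intro set_eqI iffI)
    fix y assume y: "y \<in> open_dual_cone_in V \<Omega>"
    have "y \<bullet> b > 0" if b: "b \<in> S" for b
    proof -
      \<comment> \<open>The vector b need not lie in \<Omega>, its other coordinates being 0; it is
        approached by adding small multiples of the interior point \<open>s\<close>.\<close>
      have "b \<in> closure \<Omega>"
        unfolding closure_sequential
      proof (intro exI conjI allI)
        show "b + (1 / real (Suc n)) *\<^sub>R s \<in> \<Omega>" for n
        proof -
          have "b \<bullet> b' \<ge> 0" if "b' \<in> S" for b'
            using S b that inner_Basis[of b b'] by (simp add: subset_iff)
          then have "(b + (1 / real (Suc n)) *\<^sub>R s) \<bullet> b' > 0" if "b' \<in> S" for b'
            using that by (simp add: inner_add_left sb add_nonneg_pos)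
          moreover have "b + (1 / real (Suc n)) *\<^sub>R s \<in> V"
            using sV span_base[OF b] unfolding V_def by (intro span_add span_scale)
          ultimately show ?thesis by (simp add: \<Omega>_def)
        qed
        have "(\<lambda>n. b + inverse (real (Suc n)) *\<^sub>R s) \<longlonglongrightarrow> b + 0 *\<^sub>R s"
          by (intro tendsto_intros LIMSEQ_inverse_real_of_nat)
        then show "(\<lambda>n. b + (1 / real (Suc n)) *\<^sub>R s) \<longlonglongrightarrow> b" by (simp add: inverse_eq_divide)
      qed
      moreover have "b \<noteq> 0" using S b by auto
      ultimately have "b \<bullet> y > 0" using y by (auto simp: open_dual_cone_in_def)
      then show ?thesis by (simp add: inner_commute)
    qed
    then show "y \<in> \<Omega>" using y by (simp add: \<Omega>_def open_dual_cone_in_def)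
  next
    fix y assume y: "y \<in> \<Omega>"
    have "x \<bullet> y > 0" if x: "x \<in> closure \<Omega>" "x \<noteq> 0" for x
    proof -
      have xV: "x \<in> V" and nn: "\<And>b. b \<in> S \<Longrightarrow> 0 \<le> x \<bullet> b" using clos x by auto
      obtain b where b: "b \<in> S" "x \<bullet> b \<noteq> 0"
        using xV x(2) unfolding V by (metis (mono_tags, lifting) euclidean_eq_iff inner_zero_left mem_Collect_eq)
      have yb: "y \<bullet> b > 0" if "b \<in> S" for b using y that by (simp add: \<Omega>_def)
      have "x \<bullet> b > 0" using nn[OF b(1)] b(2) by simp
      then have "0 < (\<Sum>b\<in>S. (x \<bullet> b) * (y \<bullet> b))"
        by (intro sum_pos2[OF finS b(1)] mult_pos_pos mult_nonneg_nonneg nn less_imp_le[OF yb] yb b(1))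
      then show ?thesis by (subst inner[OF xV])
    qed
    then show "y \<in> open_dual_cone_in V \<Omega>" using y by (auto simp: open_dual_cone_in_def \<Omega>_def)
  qed
  have hom: "homogeneous_in V \<Omega>"
    unfolding homogeneous_in_def
  proof (intro ballI)
    fix x y assume x: "x \<in> \<Omega>" and y: "y \<in> \<Omega>"
    \<comment> \<open>The value 1 off \<open>S\<close> keeps the diagonal map invertible on the
      whole space.\<close>
    define d where "d b = (if b \<in> S then (y \<bullet> b) / (x \<bullet> b) else 1)" for b
    have d: "d b > 0" for b using x y by (auto simp: d_def \<Omega>_def)
    define g where "g f z = (\<Sum>b\<in>Basis. (f b * (z \<bullet> b)) *\<^sub>R b)" for f and z :: 'a
    have gb: "g f z \<bullet> b = f b * (z \<bullet> b)" if "b \<in> Basis" for f z b using that by (simp add: g_def)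
    have lin: "linear (g f)" for f
      by (rule linearI) (simp_all add: g_def inner_add_left algebra_simps sum.distrib scaleR_sum_right)
    have inv: "g (\<lambda>b. 1 / d b) (g d z) = z" "g d (g (\<lambda>b. 1 / d b) z) = z" for z
      by (rule euclidean_eqI; use d in \<open>simp add: gb less_imp_neq[symmetric]\<close>)+
    have pres: "g f z \<in> V" if "z \<in> V" for f z using that by (simp add: V gb)
    have pres': "g f z \<in> \<Omega>" if "z \<in> \<Omega>" "\<And>b. f b > 0" for f z
      using that pres S by (auto simp: \<Omega>_def gb subset_iff)
    have "bij_betw (g d) V V"
      by (rule bij_betw_byWitness[where f'="g (\<lambda>b. 1 / d b)"]) (use inv pres in auto)
    moreover have "g d ` \<Omega> = \<Omega>"
    proof
      show "g d ` \<Omega> \<subseteq> \<Omega>" using pres' d by auto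
      show "\<Omega> \<subseteq> g d ` \<Omega>"
      proof
        fix z assume "z \<in> \<Omega>"
        then have "g (\<lambda>b. 1 / d b) z \<in> \<Omega>" by (rule pres') (use d in simp)
        then show "z \<in> g d ` \<Omega>" using inv(2)[of z] by (metis image_eqI)
      qed
    qed
    moreover have "g d x = y"
    proof (rule euclidean_eqI)
      fix b :: 'a assume b: "b \<in> Basis"
      show "g d x \<bullet> b = y \<bullet> b"
        using x y b by (cases "b \<in> S") (auto simp: gb d_def \<Omega>_def V)
    qed
    ultimately show "\<exists>g. linear g \<and> bij_betw g V V \<and> g ` \<Omega> = \<Omega> \<and> g x = y" using lin by blast
  qed
  show ?thesis
    using open2 conv sc dual hom
    by (auto simp: symmetric_cone_in_def open_convex_cone_in_def V_def \<Omega>_def)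
qed

text \<open>Splits off one coordinate: the orthant is the sum of a half-line and the orthant of the
  other coordinates, and \<open>T\<close> only transports this. Dimension at least 2 makes both
  factors proper.\<close>

lemma simplicial_cone_reducible:
  fixes T :: "'a::euclidean_space \<Rightarrow> 'a"
  assumes T: "linear T" "bij T" and \<Omega>: "\<Omega> = T ` {x. \<forall>b\<in>Basis. x \<bullet> b > 0}" and dim: "DIM('a) \<ge> 2"
  shows "\<not> irreducible_cone \<Omega>"
proof -
  obtain b0 :: 'a where b0: "b0 \<in> Basis" using nonempty_Basis by blast
  define S where "S = Basis - {b0}"
  let ?V1 = "span {b0}" and ?V2 = "span S"
  let ?O1 = "{x \<in> span {b0}. \<forall>b\<in>{b0}. x \<bullet> b > 0}" and ?O2 = "{x \<in> span S. \<forall>b\<in>S. x \<bullet> b > 0}"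
  define U where "U z = T (fst z + snd z)" for z :: "'a \<times> 'a"
  have V1: "?V1 = {x. \<forall>b\<in>Basis. b \<notin> {b0} \<longrightarrow> x \<bullet> b = 0}" by (rule span_substd_basis) (use b0 in auto)
  have V2: "?V2 = {x. \<forall>b\<in>Basis. b \<notin> S \<longrightarrow> x \<bullet> b = 0}" by (rule span_substd_basis) (auto simp: S_def)
  have s1: "symmetric_cone_in ?V1 ?O1" by (rule symmetric_cone_in_orthant) (use b0 in auto)
  have s2: "symmetric_cone_in ?V2 ?O2" by (rule symmetric_cone_in_orthant) (auto simp: S_def)
  have "independent {b0}" "independent S"
    by (rule independent_mono[OF independent_Basis]; use b0 in \<open>auto simp: S_def\<close>)+
  then have d: "dim ?V1 < DIM('a)" "dim ?V2 < DIM('a)"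
    using dim b0 by (auto simp: dim_eq_card_independent S_def)
  have linU: "linear U" by (rule linearI) (simp_all add: U_def linear_add[OF T(1)] linear_scale[OF T(1)] algebra_simps)
  define P where "P x = (x \<bullet> b0) *\<^sub>R b0" for x
  have PV: "P x \<in> ?V1" "x - P x \<in> ?V2" for x
    unfolding V1 V2 using b0 by (auto simp: P_def S_def inner_diff_left inner_Basis)
  have P1: "P x = x" if "x \<in> ?V1" for x
    by (rule euclidean_eqI) (use that b0 in \<open>auto simp: P_def V1 inner_Basis\<close>)
  have P2: "P x = 0" if "x \<in> ?V2" for x
    using that b0 unfolding V2 by (auto simp: P_def S_def)
  have Padd: "P (x + y) = P x + P y" for x y by (simp add: P_def inner_add_left scaleR_add_left)
  have "inj_on U (?V1 \<times> ?V2)"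
  proof (rule inj_onI, clarify)
    fix x y x' y' assume *: "x \<in> ?V1" "y \<in> ?V2" "x' \<in> ?V1" "y' \<in> ?V2" "U (x, y) = U (x', y')"
    then have eq: "x + y = x' + y'" using T(2) by (simp add: U_def bij_def inj_eq)
    then have "P (x + y) = P (x' + y')" by simp
    then have "x = x'" using * by (simp add: Padd P1 P2)
    then show "x = x' \<and> y = y'" using eq by simp
  qed
  moreover have "U ` (?V1 \<times> ?V2) = UNIV"
  proof (rule set_eqI, rule iffI)
    fix z
    obtain x where "z = T x" using T(2) by (metis bij_pointE)
    then have "z = U (P x, x - P x)" by (simp add: U_def)
    then show "z \<in> U ` (?V1 \<times> ?V2)" using PV by blast
  qed simp
  ultimately have bijU: "bij_betw U (?V1 \<times> ?V2) UNIV" by (simp add: bij_betw_def)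
  have "U ` (?O1 \<times> ?O2) = \<Omega>"
  proof (rule set_eqI, rule iffI)
    fix z assume "z \<in> U ` (?O1 \<times> ?O2)"
    then obtain x y where *: "x \<in> ?O1" "y \<in> ?O2" "z = T (x + y)" by (auto simp: U_def)
    have "(x + y) \<bullet> b > 0" if b: "b \<in> Basis" for b
    proof (cases "b = b0")
      case True
      then have "y \<bullet> b = 0" using *(2) b unfolding V2 by (auto simp: S_def)
      then show ?thesis using *(1) True by (simp add: inner_add_left)
    next
      case False
      then have "x \<bullet> b = 0" using *(1) b unfolding V1 by auto
      then show ?thesis using *(2) b False by (simp add: inner_add_left S_def)
    qed
    then show "z \<in> \<Omega>" unfolding \<Omega> using * by blast
  next
    fix z assume "z \<in> \<Omega>"
    then obtain x where x: "\<And>b. b \<in> Basis \<Longrightarrow> x \<bullet> b > 0" "z = T x" unfolding \<Omega> by blast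
    have "P x \<in> ?O1" using PV(1) x b0 by (auto simp: P_def)
    moreover have "x - P x \<in> ?O2"
    proof -
      have "0 < (x - P x) \<bullet> b" if "b \<in> S" for b
        using that x b0 by (auto simp: P_def S_def inner_diff_left inner_Basis)
      then show ?thesis using PV(2) by blast
    qed
    moreover have "z = U (P x, x - P x)" by (simp add: U_def x)
    ultimately show "z \<in> U ` (?O1 \<times> ?O2)" by blast
  qed
  with s1 s2 d linU bijU show ?thesis unfolding irreducible_cone_def by blast
qed

lemma interior_orthant: "interior {x::'a::euclidean_space. \<forall>b\<in>Basis. 0 \<le> x \<bullet> b} = {x. \<forall>b\<in>Basis. 0 < x \<bullet> b}"
proof
  show "interior {x::'a. \<forall>b\<in>Basis. 0 \<le> x \<bullet> b} \<subseteq> {x. \<forall>b\<in>Basis. 0 < x \<bullet> b}"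
  proof (intro subsetI CollectI ballI)
    fix x b :: 'a assume x: "x \<in> interior {x. \<forall>b\<in>Basis. 0 \<le> x \<bullet> b}" and b: "b \<in> Basis"
    have "x \<in> interior {x. b \<bullet> x \<ge> 0}"
      by (rule subsetD[OF interior_mono x]) (use b in \<open>auto simp: inner_commute\<close>)
    moreover have "interior {x. b \<bullet> x \<ge> 0} = {x. b \<bullet> x > 0}"
      by (rule interior_halfspace_ge) (use b in auto)
    ultimately show "0 < x \<bullet> b" by (simp add: inner_commute)
  qed
  have "{x::'a. \<forall>b\<in>Basis. 0 < x \<bullet> b} = (\<Inter>b\<in>Basis. {x. 0 < x \<bullet> b})" by auto
  moreover have "open (\<Inter>b\<in>Basis. {x::'a. 0 < x \<bullet> b})"
    by (intro open_INT finite_Basis ballI open_Collect_less continuous_intros)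
  ultimately show "{x::'a. \<forall>b\<in>Basis. 0 < x \<bullet> b} \<subseteq> interior {x. \<forall>b\<in>Basis. 0 \<le> x \<bullet> b}"
    by (intro interior_maximal) (auto simp: less_imp_le)
qed

section \<open>The Peirce dichotomy: a simplicial cone or a turning tangent half-space\<close>

context euclidean_jordan
begin

text \<open>The polynomial (t - 1/2) (t - t^2) is a multiple of Peirce's cubic, so the difference of
  the two sides satisfies the eigenvalue equation for 1/2.\<close>

lemma Peirce_half_trivial:
  assumes c: "c \<odot> c = c" and half: "\<And>x. c \<odot> x = (1/2) *\<^sub>R x \<Longrightarrow> x = 0"
  shows "c \<odot> (c \<odot> y) = c \<odot> y"
proof -
  have "c \<odot> (c \<odot> (c \<odot> y)) = (3/2) *\<^sub>R (c \<odot> (c \<odot> y)) - (1/2) *\<^sub>R (c \<odot> y)"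
    using arg_cong[OF idempotent_cubic[OF c, of y], of "\<lambda>u. (1/2) *\<^sub>R u"] by (simp add: scaleR_diff_right)
  then have "c \<odot> (c \<odot> y - c \<odot> (c \<odot> y)) = (1/2) *\<^sub>R (c \<odot> y - c \<odot> (c \<odot> y))"
    unfolding J_simps using scaleR_add_left[of 1 "1/2" "c \<odot> (c \<odot> y)"] by (simp add: algebra_simps)
  from half[OF this] show ?thesis by simp
qed

lemma linear_J: "linear (J x)" "linear (\<lambda>x. J x y)"
  using bilinear_J by (auto simp: bilinear_def)

text \<open>Each frame element then acts as a projection, by primitivity onto a line, and these
  projections add up to the identity. So the frame is a basis in which the product is coordinatewise
  and the squares form the closed orthant.\<close>

lemma simplicial_of_trivial_Peirce_half:
  assumes frame: "jordan_frame J e C"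
    and half: "\<And>c x. c \<in> C \<Longrightarrow> c \<odot> x = (1/2) *\<^sub>R x \<Longrightarrow> x = 0"
  obtains T :: "'a \<Rightarrow> 'a" where "linear T" "bij T"
    "interior (range (\<lambda>x. x \<odot> x)) = T ` {x. \<forall>b\<in>Basis. x \<bullet> b > 0}" "card C = DIM('a)"
proof -
  have finC: "finite C" and prim: "\<And>c. c \<in> C \<Longrightarrow> primitive_idempotent J c"
    and orth: "\<And>c d. c \<in> C \<Longrightarrow> d \<in> C \<Longrightarrow> c \<noteq> d \<Longrightarrow> c \<odot> d = 0" and sumC: "\<Sum>C = e"
    using frame by (auto simp: jordan_frame_def)
  have idem: "c \<odot> c = c" "c \<noteq> 0" if "c \<in> C" for c
    using prim[OF that] by (auto simp: primitive_idempotent_def idempotent_def)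
  have line: "\<exists>k. c \<odot> y = k *\<^sub>R c" if "c \<in> C" for c y
    by (rule primitive_Peirce1[OF prim[OF that] Peirce_half_trivial[OF idem(1)[OF that] half[OF that]]])
  have span: "span C = UNIV"
  proof (rule set_eqI, rule iffI)
    fix y
    have "y = (\<Sum>c\<in>C. c \<odot> y)" using linear_sum[OF linear_J(2), of id C y] by (simp add: sumC unit_left)
    moreover have "(\<Sum>c\<in>C. c \<odot> y) \<in> span C"
      by (rule span_sum) (metis line span_base span_scale)
    ultimately show "y \<in> span C" by simp
  qed simp
  have sumJ: "c \<odot> (\<Sum>d\<in>C. u d *\<^sub>R d) = u c *\<^sub>R c" if c: "c \<in> C" for c u
  proof -
    have "c \<odot> (\<Sum>d\<in>C. u d *\<^sub>R d) = (\<Sum>d\<in>C. if d = c then u c *\<^sub>R c else 0)"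
      unfolding linear_sum[OF linear_J(1)]
      by (rule sum.cong) (use c orth idem in \<open>auto simp: J_simps\<close>)
    then show ?thesis using c finC by simp
  qed
  have ind: "independent C"
  proof
    assume "dependent C"
    then obtain u v where u: "v \<in> C" "u v \<noteq> 0" "(\<Sum>v\<in>C. u v *\<^sub>R v) = 0"
      using dependent_finite[OF finC] by blast
    have "u v *\<^sub>R v = 0" using sumJ[OF u(1), of u] u(3) by (simp add: J_simps)
    then show False using u idem by simp
  qed
  have card: "card C = DIM('a)"
    using dim_span_eq_card_independent[OF ind] span by simp
  then obtain h where h: "bij_betw h (Basis :: 'a set) C"
    using finite_same_card_bij[of "Basis :: 'a set" C] finC by auto
  have hC: "h b \<in> C" if "b \<in> Basis" for b using h that by (auto simp: bij_betw_def)
  define T where "T x = (\<Sum>b\<in>Basis. (x \<bullet> b) *\<^sub>R h b)" for x :: 'a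
  have lin: "linear T" by (rule linearI) (simp_all add: T_def inner_add_left scaleR_add_left sum.distrib scaleR_sum_right)
  have hT: "h b \<odot> T x = (x \<bullet> b) *\<^sub>R h b" if b: "b \<in> Basis" for b x
  proof -
    have "h b \<odot> T x = (\<Sum>b'\<in>Basis. if b' = b then (x \<bullet> b) *\<^sub>R h b else 0)"
      unfolding T_def linear_sum[OF linear_J(1)]
    proof (rule sum.cong)
      fix b' :: 'a assume b': "b' \<in> Basis"
      show "h b \<odot> ((x \<bullet> b') *\<^sub>R h b') = (if b' = b then (x \<bullet> b) *\<^sub>R h b else 0)"
        using h b b' orth[OF hC[OF b] hC[OF b']] idem[OF hC[OF b]]
        by (auto simp: J_simps bij_betw_def inj_on_eq_iff)
    qed simp
    then show ?thesis using b by simp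
  qed
  have TT: "T x \<odot> T x = T (\<Sum>b\<in>Basis. (x \<bullet> b)\<^sup>2 *\<^sub>R b)" for x
  proof -
    have "T x \<odot> T x = (\<Sum>b\<in>Basis. ((x \<bullet> b) *\<^sub>R h b) \<odot> T x)"
      by (subst (1) T_def) (rule linear_sum[OF linear_J(2)])
    also have "\<dots> = (\<Sum>b\<in>Basis. (x \<bullet> b)\<^sup>2 *\<^sub>R h b)"
      by (rule sum.cong) (simp_all add: J_simps hT power2_eq_square)
    finally show ?thesis by (simp add: T_def)
  qed
  have "inj T"
    unfolding linear_injective_0[OF lin]
  proof (intro allI impI, rule euclidean_eqI)
    fix x b :: 'a assume "T x = 0" "b \<in> Basis"
    then show "x \<bullet> b = 0 \<bullet> b" using hT[of b x] idem[OF hC] by (simp add: J_simps)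
  qed
  then have bij: "bij T" using lin by (simp add: bij_def linear_injective_imp_surjective)
  have "range (\<lambda>x. x \<odot> x) = T ` {x. \<forall>b\<in>Basis. 0 \<le> x \<bullet> b}"
  proof (rule set_eqI, rule iffI)
    fix z assume "z \<in> range (\<lambda>x. x \<odot> x)"
    then obtain y where y: "z = y \<odot> y" by blast
    obtain x where "y = T x" using bij by (metis bij_pointE)
    with y have "z = T x \<odot> T x" by simp
    then show "z \<in> T ` {x. \<forall>b\<in>Basis. 0 \<le> x \<bullet> b}" unfolding TT by auto
  next
    fix z assume "z \<in> T ` {x. \<forall>b\<in>Basis. 0 \<le> x \<bullet> b}"
    then obtain x where x: "\<And>b. b \<in> Basis \<Longrightarrow> 0 \<le> x \<bullet> b" "z = T x" by blast
    have "(\<Sum>b\<in>Basis. ((\<Sum>b\<in>Basis. sqrt (x \<bullet> b) *\<^sub>R b) \<bullet> b)\<^sup>2 *\<^sub>R b) = x"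
      by (rule euclidean_eqI) (use x in simp)
    then have "z = T (\<Sum>b\<in>Basis. sqrt (x \<bullet> b) *\<^sub>R b) \<odot> T (\<Sum>b\<in>Basis. sqrt (x \<bullet> b) *\<^sub>R b)"
      unfolding TT x(2) by (rule arg_cong[OF sym])
    then show "z \<in> range (\<lambda>x. x \<odot> x)" by blast
  qed
  then have "interior (range (\<lambda>x. x \<odot> x)) = T ` {x. \<forall>b\<in>Basis. 0 < x \<bullet> b}"
    using interior_injective_linear_image[OF lin \<open>inj T\<close>] by (simp add: interior_orthant)
  then show ?thesis using that lin bij card by blast
qed

text \<open>The witnesses reduce the curve of directions to a planar problem: \<open>p1\<close>
  normalises the directions, \<open>p2\<close> reads off a slope, scaled so that the intermediate
  value theorem yields all of [0, 1], and \<open>w\<close> is a direction invisible to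
  \<open>p1\<close> along which tubes can be sliced.\<close>

lemma tangent_halfspace_curve:
  fixes \<Omega> :: "'a set"
  assumes \<Omega>: "\<Omega> = interior (range (\<lambda>x. x \<odot> x))" and conv: "convex \<Omega>"
    and cone: "\<And>x r. x \<in> \<Omega> \<Longrightarrow> r > 0 \<Longrightarrow> r *\<^sub>R x \<in> \<Omega>"
    and prim: "primitive_idempotent J c" and x: "c \<odot> x = (1/2) *\<^sub>R x" "x \<noteq> 0"
  shows "\<exists>p1 p2 w M. p1 \<bullet> w = 0 \<and> p2 \<bullet> w = 1 \<and>
    (\<forall>a\<in>{0..1}. \<exists>v \<xi>. p1 \<bullet> v = 1 \<and> p2 \<bullet> v = a \<and> norm v \<le> M \<and>
      (\<forall>\<eta>. \<eta> \<bullet> v > 0 \<longrightarrow> (\<forall>\<^sub>F t in at_top. \<eta> + t *\<^sub>R \<xi> \<in> \<Omega>)) \<and>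
      (\<forall>\<eta> t. \<eta> \<bullet> v < 0 \<longrightarrow> \<eta> + t *\<^sub>R \<xi> \<notin> \<Omega>))"
proof -
  have c: "c \<odot> c = c" "c \<noteq> 0" using prim by (auto simp: primitive_idempotent_def idempotent_def)
  define D where "D y = c \<odot> (x \<odot> y) - x \<odot> (c \<odot> y)" for y
  have lin: "linear D" by (rule linearI) (simp_all add: D_def J_simps scaleR_diff_right)
  have der: "D (y \<odot> z) = D y \<odot> z + y \<odot> D z" for y z
    unfolding D_def by (rule commutator_derivation)
  have skew: "B (D y) z = - B y (D z)" for y z by (simp add: D_def B_simps B_assoc)
  \<comment> \<open>Here c \<odot> (x \<odot> c) = x/4 and x \<odot> (c \<odot> c) = x/2, so the
    curve leaves \<open>c\<close> along -x, which is no multiple of \<open>c\<close>.\<close>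
  have Dc: "D c = (- (1/4)) *\<^sub>R x"
    by (simp add: D_def c J_commute[of x c] x J_simps flip: scaleR_diff_left)
  define E where "E t = exp_linear D t" for t
  have Emult: "E t (y \<odot> z) = E t y \<odot> E t z" for t y z
    unfolding E_def by (rule exp_derivation_mult[OF lin der skew])
  have Ebij: "bij (E t)" for t unfolding E_def by (rule bij_exp_derivation[OF lin der skew])
  have Elin: "linear (E t)" for t unfolding E_def by (rule linear_exp_linear[OF lin])
  define ct where "ct t = E t c" for t
  have ct0: "ct 0 = c" by (simp add: ct_def E_def lin)
  have ct_idem: "ct t \<odot> ct t = ct t" for t unfolding ct_def Emult[symmetric] c ..
  have ct_ne: "ct t \<noteq> 0" for t
    using Ebij[of t] c(2) linear_0[OF Elin[of t]] unfolding ct_def bij_def by (metis injD)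
  have ct_line: "\<exists>k. w = k *\<^sub>R ct t" if w: "ct t \<odot> w = w" for t w
  proof -
    obtain w' where w': "w = E t w'" using Ebij[of t] by (metis bij_pointE)
    have "E t (c \<odot> w') = E t w'" using w by (simp add: Emult ct_def w')
    then have "c \<odot> w' = w'" using Ebij[of t] by (simp add: bij_def inj_eq)
    then obtain k where "w' = k *\<^sub>R c" using primitive_Peirce1[OF prim] by blast
    then show ?thesis by (auto simp: w' ct_def linear_scale[OF Elin])
  qed
  note tangent = tangent_halfspace[OF \<Omega> conv cone ct_idem ct_ne ct_line]
  obtain R where R: "linear R" "bij R" and BR: "\<And>y w. y \<bullet> R w = B y w" using B_Riesz by blast
  have Rinj: "R y = R z \<longleftrightarrow> y = z" for y z using R(2) by (simp add: bij_def inj_eq)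
  have R0: "R 0 = 0" by (rule linear_0[OF R(1)])
  have bR: "bounded_linear R" using R(1) by (simp add: linear_conv_bounded_linear)
  define v where "v t = R (ct t)" for t
  have dv: "(v has_vector_derivative R (D (ct t))) (at t)" for t
    unfolding v_def ct_def E_def by (intro bounded_linear.has_vector_derivative[OF bR] exp_linear_has_vector_derivative lin)
  have contv: "continuous_on S v" for S
    by (intro continuous_at_imp_continuous_on ballI has_vector_derivative_continuous[OF dv])
  define v0 where "v0 = R c"
  define n where "n = v0 \<bullet> v0"
  have v0: "v 0 = v0" by (simp add: v_def v0_def ct0)
  have "v0 \<noteq> 0" unfolding v0_def using Rinj[of c 0] R0 c by simp
  then have n: "n > 0" by (simp add: n_def)
  \<comment> \<open>The part of -R x orthogonal to the initial direction \<open>v0\<close>; it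
    therefore pairs positively with the initial velocity -R x/4. It is nonzero because x and c
    belong to the different eigenvalues 1/2 and 1.\<close>
  define q where "q = ((R x \<bullet> v0) / n) *\<^sub>R v0 - R x"
  have qv0: "q \<bullet> v0 = 0" using n by (simp add: q_def inner_diff_left n_def)
  have q: "q \<noteq> 0"
  proof
    assume "q = 0"
    then have "R x = R (((R x \<bullet> v0) / n) *\<^sub>R c)" by (simp add: q_def v0_def linear_scale[OF R(1)])
    then have xc: "x = ((R x \<bullet> v0) / n) *\<^sub>R c" unfolding Rinj .
    then have "c \<odot> x = x" using c by (metis J_simps(4))
    with x have "(1/2) *\<^sub>R x = 1 *\<^sub>R x" by simp
    then show False using x(2) unfolding scaleR_cancel_right by simp
  qed
  have qRx: "q \<bullet> R x = - (q \<bullet> q)"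
  proof -
    have "R x = ((R x \<bullet> v0) / n) *\<^sub>R v0 - q" by (simp add: q_def)
    then have "q \<bullet> R x = q \<bullet> (((R x \<bullet> v0) / n) *\<^sub>R v0 - q)" by (rule arg_cong)
    then show ?thesis by (simp add: inner_diff_right qv0)
  qed
  define p1 where "p1 = (1/n) *\<^sub>R v0"
  define a1 where "a1 t = p1 \<bullet> v t" for t
  define a2 where "a2 t = q \<bullet> v t" for t
  have ca: "continuous_on S a1" "continuous_on S a2" for S
    unfolding a1_def a2_def by (intro continuous_intros contv)+
  have a1_0: "a1 0 = 1" using n by (simp add: a1_def p1_def v0 n_def)
  have a2_0: "a2 0 = 0" by (simp add: a2_def v0 qv0)
  have "DERIV a2 0 :> q \<bullet> R (D c)"
  proof -
    have "((\<lambda>t. q \<bullet> v t) has_vector_derivative q \<bullet> R (D (ct 0))) (at 0)"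
      by (rule bounded_linear.has_vector_derivative[OF bounded_linear_inner_right dv])
    then show ?thesis unfolding a2_def[abs_def] has_real_derivative_iff_has_vector_derivative ct0 .
  qed
  moreover have "q \<bullet> R (D c) > 0" using q unfolding Dc linear_scale[OF R(1)] by (simp add: qRx)
  ultimately obtain d where d: "d > 0" "\<And>h. 0 < h \<Longrightarrow> h < d \<Longrightarrow> a2 0 < a2 (0 + h)"
    using DERIV_pos_inc_right by blast
  have "isCont a1 0" using ca(1)[of UNIV] by (simp add: continuous_on_eq_continuous_at)
  then obtain d' where d': "d' > 0" "\<And>t. \<bar>t\<bar> < d' \<Longrightarrow> \<bar>a1 t - 1\<bar> < 1/2"
    unfolding continuous_at_eps_delta dist_real_def a1_0 by (metis diff_zero half_gt_zero_iff zero_less_one)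
  \<comment> \<open>Up to this time the \<open>p1\<close>-coordinate exceeds 1/2, so the slope is
    continuous and normalising at most doubles the length; at \<open>t1\<close> itself the slope is
    positive.\<close>
  define t1 where "t1 = min d d' / 2"
  have t1: "0 < t1" "t1 < d" "t1 < d'" using d d' by (auto simp: t1_def)
  have a1: "a1 t > 1/2" if "0 \<le> t" "t \<le> t1" for t 
  proof -
    have "\<bar>t\<bar> < d'" using that t1 by auto
    from d'(2)[OF this] show ?thesis by linarith
  qed
  define s where "s t = a2 t / a1 t" for t
  have cs: "continuous_on {0..t1} s"
    unfolding s_def using a1 by (intro continuous_intros ca) force
  have s1: "s t1 > 0" using d(2)[of t1] t1 a1[of t1] a2_0 by (simp add: s_def)
  have s0: "s 0 = 0" by (simp add: s_def a2_0)
  have "compact (v ` {0..t1})" by (intro compact_continuous_image contv compact_Icc)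
  then have "bounded (v ` {0..t1})" by (rule compact_imp_bounded)
  then obtain M where "\<forall>x\<in>v ` {0..t1}. norm x \<le> M" unfolding bounded_iff by blast
  then have M: "norm (v t) \<le> M" if "t \<in> {0..t1}" for t using that by blast
  show ?thesis
  proof (rule exI[of _ p1], rule exI[of _ "(1 / s t1) *\<^sub>R q"], rule exI[of _ "(s t1 / (q \<bullet> q)) *\<^sub>R q"],
      rule exI[of _ "2 * M"], intro conjI ballI)
    show "p1 \<bullet> ((s t1 / (q \<bullet> q)) *\<^sub>R q) = 0" using qv0 by (simp add: p1_def inner_commute)
    show "((1 / s t1) *\<^sub>R q) \<bullet> ((s t1 / (q \<bullet> q)) *\<^sub>R q) = 1" using s1 q by simp
    fix a :: real assume a: "a \<in> {0..1}"
    have "s 0 \<le> a * s t1" "a * s t1 \<le> s t1" using a s1 by (auto simp: s0 mult_left_le_one_le)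
    then obtain t where t: "0 \<le> t" "t \<le> t1" "s t = a * s t1"
      using IVT'[of s 0 "a * s t1" t1] cs t1 by auto
    note a1t = a1[OF t(1,2)]
    have pos: "\<eta> \<bullet> ((1 / a1 t) *\<^sub>R v t) = B \<eta> (ct t) / a1 t" for \<eta> by (simp add: v_def BR)
    show "\<exists>v \<xi>. p1 \<bullet> v = 1 \<and> ((1 / s t1) *\<^sub>R q) \<bullet> v = a \<and> norm v \<le> 2 * M \<and>
      (\<forall>\<eta>. \<eta> \<bullet> v > 0 \<longrightarrow> (\<forall>\<^sub>F t in at_top. \<eta> + t *\<^sub>R \<xi> \<in> \<Omega>)) \<and>
      (\<forall>\<eta> t. \<eta> \<bullet> v < 0 \<longrightarrow> \<eta> + t *\<^sub>R \<xi> \<notin> \<Omega>)"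
    proof (rule exI[of _ "(1 / a1 t) *\<^sub>R v t"], rule exI[of _ "e - ct t"], intro conjI allI impI)
      show "p1 \<bullet> ((1 / a1 t) *\<^sub>R v t) = 1" using a1t by (simp add: a1_def[symmetric])
      show "((1 / s t1) *\<^sub>R q) \<bullet> ((1 / a1 t) *\<^sub>R v t) = a"
      proof -
        have "((1 / s t1) *\<^sub>R q) \<bullet> ((1 / a1 t) *\<^sub>R v t) = s t / s t1" by (simp add: a2_def s_def[of t])
        then show ?thesis using t(3) s1 by simp
      qed
      have "norm ((1 / a1 t) *\<^sub>R v t) = (1 / a1 t) * norm (v t)" using a1t by simp
      also have "\<dots> \<le> 2 * M"
        using a1t M[of t] t by (intro mult_mono) (auto simp: divide_le_eq)
      finally show "norm ((1 / a1 t) *\<^sub>R v t) \<le> 2 * M" .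
      show "\<forall>\<^sub>F s in at_top. \<eta> + s *\<^sub>R (e - ct t) \<in> \<Omega>" if "\<eta> \<bullet> ((1 / a1 t) *\<^sub>R v t) > 0" for \<eta>
        by (rule tangent(1)) (use that[unfolded pos] a1t in \<open>auto simp: zero_less_divide_iff\<close>)
      show "\<eta> + s *\<^sub>R (e - ct t) \<notin> \<Omega>" if "\<eta> \<bullet> ((1 / a1 t) *\<^sub>R v t) < 0" for \<eta> s
        by (rule tangent(2)) (use that[unfolded pos] a1t in \<open>auto simp: divide_less_0_iff\<close>)
    qed
  qed
qed

end

text \<open>Collects what the analysis uses of the cone. If no frame element had a Peirce space for
  1/2, the cone would be simplicial with dimension equal to the rank, hence at least 2, and so
  reducible.\<close>

lemma irreducible_symmetric_cone_tangents:
  fixes \<Omega> :: "'a::euclidean_space set"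
  assumes "symmetric_cone \<Omega>" "irreducible_cone \<Omega>" "has_cone_rank \<Omega> r" "r \<ge> 2"
  shows "\<exists>p1 p2 w M. p1 \<bullet> w = 0 \<and> p2 \<bullet> w = 1 \<and>
    (\<forall>a\<in>{0..1}. \<exists>v \<xi>. p1 \<bullet> v = 1 \<and> p2 \<bullet> v = a \<and> norm v \<le> M \<and>
      (\<forall>\<eta>. \<eta> \<bullet> v > 0 \<longrightarrow> (\<forall>\<^sub>F t in at_top. \<eta> + t *\<^sub>R \<xi> \<in> \<Omega>)) \<and>
      (\<forall>\<eta> t. \<eta> \<bullet> v < 0 \<longrightarrow> \<eta> + t *\<^sub>R \<xi> \<notin> \<Omega>))"
proof -
  obtain J e C where J: "euclidean_jordan_algebra J e" and \<Omega>: "\<Omega> = interior (range (\<lambda>x. J x x))"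
    and C: "jordan_frame J e C" and r: "card C = r"
    using assms(3) unfolding has_cone_rank_def by blast
  obtain B where "euclidean_jordan J e B"
    using J unfolding euclidean_jordan_algebra_def euclidean_jordan_def by blast
  then interpret euclidean_jordan J e B .
  have conv: "convex \<Omega>" and cone: "\<And>x r. x \<in> \<Omega> \<Longrightarrow> r > 0 \<Longrightarrow> r *\<^sub>R x \<in> \<Omega>"
    using assms(1) by (auto simp: symmetric_cone_def symmetric_cone_in_def open_convex_cone_in_def)
  show ?thesis
  proof (cases "\<exists>c\<in>C. \<exists>x. J c x = (1/2) *\<^sub>R x \<and> x \<noteq> 0")
    case True
    then obtain c x where "c \<in> C" "J c x = (1/2) *\<^sub>R x" "x \<noteq> 0" by blast
    with C show ?thesis by (intro tangent_halfspace_curve[OF \<Omega> conv cone]) (auto simp: jordan_frame_def)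
  next
    case False
    then have "\<And>c x. c \<in> C \<Longrightarrow> J c x = (1/2) *\<^sub>R x \<Longrightarrow> x = 0" by blast
    then show ?thesis
    proof (rule simplicial_of_trivial_Peirce_half[OF C])
      fix T :: "'a \<Rightarrow> 'a"
      assume T: "linear T" "bij T" and eq: "interior (range (\<lambda>x. J x x)) = T ` {x. \<forall>b\<in>Basis. x \<bullet> b > 0}"
        and card: "card C = DIM('a)"
      have "DIM('a) \<ge> 2" using card r assms(4) by simp
      then have "\<not> irreducible_cone \<Omega>" by (intro simplicial_cone_reducible[OF T]) (simp only: \<Omega> eq)
      with assms(2) show ?thesis by blast
    qed
  qed
qed

subsection \<open>A Kakeya configuration of thin parallelograms\<close>

text \<open>The lines \<open>y = a x + b\<close> are indexed by \<open>N\<close>-digit strings \<open>d\<close> in base \<open>N\<close>, with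
  \<open>a x + b = \<Sum> d k (x - k/N) / N ^ k\<close>. Near \<open>x = k/N\<close> the \<open>k\<close>-th digit has almost no influence,
  so the lines are compressed for all \<open>x\<close> in \<open>{0..1}\<close>, while for \<open>x \<ge> 2\<close> all weights
  \<open>x - k/N\<close> are at least \<open>1\<close> and decreasing, so that the lines are ordered lexicographically.\<close>

definition digit_pos :: "nat \<Rightarrow> (nat \<Rightarrow> nat) \<Rightarrow> real \<Rightarrow> real" where
  "digit_pos N d x = (\<Sum>k=1..N. real (d k) / real N ^ k * (x - real k / real N))"

text \<open>The largest total contribution of the digits after position k at weight 1, as a
  telescoping sum.\<close>

lemma sum_digits_telescope:
  assumes "N \<ge> 1" "k \<le> N"
  shows "(\<Sum>l=Suc k..N. (real N - 1) / real N ^ l) = 1 / real N ^ k - 1 / real N ^ N"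
proof -
  have "(real N - 1) / real N ^ l = - (1 / real N ^ l) - - (1 / real N ^ (l - 1))" if "l \<in> {Suc k..N}" for l
    using that assms by (cases l) (auto simp: field_simps)
  then have "(\<Sum>l=Suc k..N. (real N - 1) / real N ^ l) = (\<Sum>l=Suc k..N. - (1 / real N ^ l) - - (1 / real N ^ (l - 1)))"
    by (rule sum.cong[OF refl])
  also have "\<dots> = - (1 / real N ^ N) - - (1 / real N ^ k)"
    by (rule sum_telescope'') (use assms in simp)
  finally show ?thesis by simp
qed

text \<open>For x between (k - 1)/N and k/N, digit k has weight at most 1/N in modulus and the later
  ones at most 1, so the digits from k on move the position by at most 2/N^k. The first k - 1 digits
  allow at most N^(k-1) positions, each accounting for an interval of length 3/N^k.\<close>

lemma digit_pos_compressed: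
  assumes N: "N \<ge> 1" and x: "0 \<le> x" "x \<le> 1"
  shows "emeasure lborel (\<Union>d\<in>{1..N} \<rightarrow>\<^sub>E {..<N}. {digit_pos N d x ..< digit_pos N d x + 1 / real N ^ N}) \<le> ennreal (3 / real N)"
proof -
  \<comment> \<open>The ceiling is 0 at x = 0 whereas digit positions start at 1; the correction
    keeps k in \<open>{1..N}\<close>.\<close>
  define k where "k = nat \<lceil>real N * x\<rceil> + (if x = 0 then 1 else 0)"
  have "real k \<ge> 1" "real k \<le> real N" "real N * x \<le> real k" "real k - 1 \<le> real N * x"
  proof -
    have c: "real (nat \<lceil>real N * x\<rceil>) = of_int \<lceil>real N * x\<rceil>" using x by simp
    have 1: "of_int \<lceil>real N * x\<rceil> \<ge> real N * x" "of_int \<lceil>real N * x\<rceil> < real N * x + 1" by linarith+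
    have 2: "\<lceil>real N * x\<rceil> \<le> int N" using x N by (simp add: ceiling_le_iff mult_left_le)
    have 3: "\<lceil>real N * x\<rceil> \<ge> 1" if "x \<noteq> 0"
      using that x N by (simp add: one_le_ceiling)
    show "real k \<ge> 1" unfolding k_def using 3 by (cases "x = 0") (auto simp: c)
    show "real k \<le> real N" unfolding k_def using 2 N by (cases "x = 0") (auto simp: c)
    show "real N * x \<le> real k" "real k - 1 \<le> real N * x" unfolding k_def using 1 by (cases "x = 0"; simp add: c; linarith)+
  qed
  then have k: "k \<ge> 1" "k \<le> N" and xk: "x \<le> real k / real N" "real k / real N - 1 / real N \<le> x"
    using N by (auto simp: field_simps)
  define P where "P d = (\<Sum>l=1..<k. real (d l) / real N ^ l * (x - real l / real N))" for d :: "nat \<Rightarrow> nat"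
  define PP where "PP = P ` ({1..<k} \<rightarrow>\<^sub>E {..<N})"
  have finPP: "finite PP" unfolding PP_def by (intro finite_imageI finite_PiE) auto
  have "card PP \<le> card ({1..<k} \<rightarrow>\<^sub>E {..<N})" unfolding PP_def by (intro card_image_le finite_PiE) auto
  also have "\<dots> = N ^ (k - 1)" by (simp add: card_PiE)
  finally have cardPP: "card PP \<le> N ^ (k - 1)" .
  \<comment> \<open>All weights from position k on are nonpositive, so the shift goes to the left
    only: two units N^-k to the left for the digits, one to the right for the thickness
    N^-N.\<close>
  have sub: "{digit_pos N d x ..< digit_pos N d x + 1 / real N ^ N} \<subseteq> (\<Union>p\<in>PP. {p - 2 / real N ^ k .. p + 1 / real N ^ k})"
    if d: "d \<in> {1..N} \<rightarrow>\<^sub>E {..<N}" for d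
  proof -
    have dl: "0 \<le> real (d l)" "real (d l) \<le> real N - 1" if "l \<in> {1..N}" for l
      using PiE_mem[OF d that] N by auto
    have split: "{1..N} = {1..<k} \<union> {k} \<union> {Suc k..N}" using k by auto
    have Pd: "P d \<in> PP"
    proof -
      have "P d = P (restrict d {1..<k})" unfolding P_def by (rule sum.cong) auto
      moreover have "restrict d {1..<k} \<in> {1..<k} \<rightarrow>\<^sub>E {..<N}" using d k by auto
      ultimately show ?thesis unfolding PP_def by blast
    qed
    define T1 where "T1 = real (d k) / real N ^ k * (x - real k / real N)"
    define T2 where "T2 = (\<Sum>l=Suc k..N. real (d l) / real N ^ l * (x - real l / real N))"
    have pos: "digit_pos N d x = P d + T1 + T2"
      unfolding digit_pos_def split P_def T1_def T2_def
      by (subst sum.union_disjoint; (subst sum.union_disjoint)?) auto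
    have T1: "T1 \<le> 0" "T1 \<ge> - (1 / real N ^ k)"
    proof -
      show "T1 \<le> 0" unfolding T1_def by (rule mult_nonneg_nonpos) (use xk in auto)
      have "real (d k) * (real k / real N - x) \<le> real N * (1 / real N)"
        by (rule mult_mono) (use dl[of k] k xk N in auto)
      then have "real (d k) * (real k / real N - x) \<le> 1" using N by simp
      then have "real (d k) * (real k / real N - x) / real N ^ k \<le> 1 / real N ^ k"
        by (intro divide_right_mono) auto
      moreover have "T1 = - (real (d k) * (real k / real N - x) / real N ^ k)"
        unfolding T1_def by (subst minus_diff_eq[of "real k / real N" x, symmetric]) (simp only: mult_minus_right times_divide_eq_left)
      ultimately show "T1 \<ge> - (1 / real N ^ k)" by simp
    qed
    have T2: "T2 \<le> 0" "T2 \<ge> - (1 / real N ^ k)"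
    proof -
      have xl: "x - real l / real N \<le> 0" "x - real l / real N \<ge> -1" if "l \<in> {Suc k..N}" for l
      proof -
        have "real k / real N \<le> real l / real N" "real l / real N \<le> 1"
          using that N by (auto simp: divide_le_eq intro!: divide_right_mono)
        then show "x - real l / real N \<le> 0" "x - real l / real N \<ge> -1" using xk x by linarith+
      qed
      show "T2 \<le> 0" unfolding T2_def by (rule sum_nonpos, rule mult_nonneg_nonpos) (use xl in auto)
      have "- T2 \<le> (\<Sum>l=Suc k..N. (real N - 1) / real N ^ l)"
        unfolding T2_def sum_negf[symmetric]
      proof (rule sum_mono)
        fix l assume l: "l \<in> {Suc k..N}"
        have "real (d l) / real N ^ l * (real l / real N - x) \<le> (real N - 1) / real N ^ l * 1"
          by (rule mult_mono) (use dl[of l] l xl[OF l] k N in \<open>auto intro: divide_right_mono\<close>)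
        then show "- (real (d l) / real N ^ l * (x - real l / real N)) \<le> (real N - 1) / real N ^ l"
          by (simp only: mult_minus_right[symmetric] minus_diff_eq mult_1_right)
      qed
      also have "\<dots> \<le> 1 / real N ^ k" using sum_digits_telescope[OF N k(2)] by simp
      finally show "T2 \<ge> - (1 / real N ^ k)" by simp
    qed
    have "1 / real N ^ N \<le> 1 / real N ^ k" using N k by (intro divide_left_mono power_increasing) auto
    then have "{digit_pos N d x ..< digit_pos N d x + 1 / real N ^ N} \<subseteq> {P d - 2 / real N ^ k .. P d + 1 / real N ^ k}"
      unfolding pos using T1 T2 by (auto simp: field_simps)
    then show ?thesis using Pd by blast
  qed
  have "emeasure lborel (\<Union>d\<in>{1..N} \<rightarrow>\<^sub>E {..<N}. {digit_pos N d x ..< digit_pos N d x + 1 / real N ^ N})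
      \<le> emeasure lborel (\<Union>p\<in>PP. {p - 2 / real N ^ k .. p + 1 / real N ^ k})"
    by (rule emeasure_mono) (use sub finPP in auto)
  also have "\<dots> \<le> (\<Sum>p\<in>PP. emeasure lborel {p - 2 / real N ^ k .. p + 1 / real N ^ k})"
    by (rule emeasure_subadditive_finite) (use finPP in auto)
  also have "\<dots> = (\<Sum>p\<in>PP. ennreal (3 / real N ^ k))"
  proof (rule sum.cong[OF refl])
    fix p
    have "p - 2 / real N ^ k \<le> p + 1 / real N ^ k" by (simp add: field_simps)
    then show "emeasure lborel {p - 2 / real N ^ k .. p + 1 / real N ^ k} = ennreal (3 / real N ^ k)"
      by (simp add: add_divide_distrib[symmetric])
  qed
  also have "\<dots> = ennreal (real (card PP) * (3 / real N ^ k))"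
    by (simp add: ennreal_of_nat_eq_real_of_nat ennreal_mult[symmetric])
  also have "\<dots> \<le> ennreal (real (N ^ (k - 1)) * (3 / real N ^ k))"
    using cardPP by (intro ennreal_leI mult_right_mono) (auto simp only: of_nat_le_iff, auto)
  also have "real (N ^ (k - 1)) * (3 / real N ^ k) = 3 / real N"
    using k N by (cases k) (auto simp: field_simps)
  finally show ?thesis .
qed

text \<open>With t = x - k/N \<ge> 1, the first differing digit gains at least t/N^k. The later
  weights lie between 0 and t, so the later digits lose at most t (1/N^k - 1/N^N). The surplus t/N^N
  is at least one thickness.\<close>

lemma digit_pos_separated:
  assumes N: "N \<ge> 1" and x: "2 \<le> x" and d: "d \<in> {1..N} \<rightarrow>\<^sub>E {..<N}" and d': "d' \<in> {1..N} \<rightarrow>\<^sub>E {..<N}"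
    and k: "k \<in> {1..N}" and eq: "\<And>l. l \<in> {1..<k} \<Longrightarrow> d l = d' l" and less: "d' k < d k"
  shows "digit_pos N d x \<ge> digit_pos N d' x + 1 / real N ^ N"
proof -
  have dl: "real (d l) - real (d' l) \<ge> - (real N - 1)" if "l \<in> {1..N}" for l
  proof -
    have "real (d' l) \<le> real N - 1" using PiE_mem[OF d' that] N by auto
    then show ?thesis by linarith
  qed
  have split: "{1..N} = {1..<k} \<union> {k} \<union> {Suc k..N}" using k by auto
  define t where "t = x - real k / real N"
  have "real k / real N \<le> 1" using k N by simp
  then have t: "t \<ge> 1" using x by (simp add: t_def)
  define D where "D l = (real (d l) - real (d' l)) / real N ^ l * (x - real l / real N)" for l
  have "digit_pos N d x - digit_pos N d' x = (\<Sum>l=1..N. D l)"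
    unfolding digit_pos_def sum_subtractf[symmetric] D_def
    by (rule sum.cong) (auto simp: diff_divide_distrib left_diff_distrib)
  also have "\<dots> = (\<Sum>l=1..<k. D l) + D k + (\<Sum>l=Suc k..N. D l)"
    unfolding split by (subst sum.union_disjoint; (subst sum.union_disjoint)?) auto
  also have "(\<Sum>l=1..<k. D l) = 0" by (rule sum.neutral) (use eq in \<open>auto simp: D_def\<close>)
  finally have s: "digit_pos N d x - digit_pos N d' x = D k + (\<Sum>l=Suc k..N. D l)" by simp
  have "D k \<ge> 1 / real N ^ k * t"
    unfolding D_def t_def[symmetric] using less t by (intro mult_right_mono divide_right_mono) auto
  moreover have "(\<Sum>l=Suc k..N. D l) \<ge> - (\<Sum>l=Suc k..N. (real N - 1) / real N ^ l) * t"
    unfolding sum_negf[symmetric] sum_distrib_right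
  proof (rule sum_mono)
    fix l assume l: "l \<in> {Suc k..N}"
    have xl: "0 \<le> x - real l / real N" "x - real l / real N \<le> t"
    proof -
      have "real k / real N \<le> real l / real N" "real l / real N \<le> 1"
        using l N by (auto simp: divide_le_eq intro!: divide_right_mono)
      then show "0 \<le> x - real l / real N" "x - real l / real N \<le> t" using x by (simp_all add: t_def)
    qed
    have "- (real N - 1) / real N ^ l * t \<le> - (real N - 1) / real N ^ l * (x - real l / real N)"
      by (rule mult_left_mono_neg) (use xl N in \<open>auto simp: divide_nonpos_nonneg\<close>)
    also have "\<dots> \<le> D l"
      unfolding D_def using dl[of l] l k xl by (intro mult_right_mono divide_right_mono) auto
    finally show "- ((real N - 1) / real N ^ l) * t \<le> D l" by (simp only: minus_divide_left)
  qed
  moreover have "(\<Sum>l=Suc k..N. (real N - 1) / real N ^ l) = 1 / real N ^ k - 1 / real N ^ N"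
    by (rule sum_digits_telescope) (use k N in auto)
  moreover have "1 / real N ^ N * t \<ge> 1 / real N ^ N * 1" by (rule mult_left_mono) (use t in auto)
  ultimately show ?thesis using s by (simp add: algebra_simps)
qed

text \<open>The first differing position decides the order; it lies in \<open>{1..N}\<close> because
  both strings are \<open>undefined\<close> elsewhere.\<close>

lemma digit_pos_disjoint:
  assumes N: "N \<ge> 1" and x: "2 \<le> x" and d: "d \<in> {1..N} \<rightarrow>\<^sub>E {..<N}" and d': "d' \<in> {1..N} \<rightarrow>\<^sub>E {..<N}" and ne: "d \<noteq> d'"
  shows "{digit_pos N d x ..< digit_pos N d x + 1 / real N ^ N} \<inter> {digit_pos N d' x ..< digit_pos N d' x + 1 / real N ^ N} = {}"
proof -
  define k where "k = (LEAST l. d l \<noteq> d' l)"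
  have "\<exists>l. d l \<noteq> d' l" using ne by auto
  then have k: "d k \<noteq> d' k" unfolding k_def by (rule LeastI_ex)
  have eq: "d l = d' l" if "l < k" for l using not_less_Least[of l "\<lambda>l. d l \<noteq> d' l"] that k_def by auto
  have kN: "k \<in> {1..N}"
  proof (rule ccontr)
    assume n: "k \<notin> {1..N}"
    have "d k = undefined" "d' k = undefined" by (rule PiE_arb[OF d n], rule PiE_arb[OF d' n])
    with k show False by simp
  qed
  show ?thesis
  proof (cases "d' k < d k")
    case True
    from digit_pos_separated[OF N x d d' kN eq True] show ?thesis by auto
  next
    case False
    then have "d k < d' k" using k by simp
    from digit_pos_separated[OF N x d' d kN eq[symmetric] this] show ?thesis by auto
  qed
qed

text \<open>There are N^N lines, thickened by \<delta> = 1/N^N so that their total thickness is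
  exactly 1. This is the length of the union where the strips are disjoint, against 3/N where they
  are compressed.\<close>

lemma Kakeya_lines:
  assumes N: "N \<ge> (1::nat)"
  obtains I :: "(nat \<Rightarrow> nat) set" and \<delta> :: real and a b :: "(nat \<Rightarrow> nat) \<Rightarrow> real"
  where "finite I" "\<delta> > 0" "\<delta> \<le> 1" "real (card I) * \<delta> = 1" "\<And>i. i \<in> I \<Longrightarrow> a i \<in> {0..1}" "\<And>i. i \<in> I \<Longrightarrow> b i \<in> {-1..0}"
    "\<And>x. 0 \<le> x \<Longrightarrow> x \<le> 1 \<Longrightarrow> emeasure lborel (\<Union>i\<in>I. {a i * x + b i ..< a i * x + b i + \<delta>}) \<le> ennreal (3 / real N)"
    "\<And>x. 2 \<le> x \<Longrightarrow> disjoint_family_on (\<lambda>i. {a i * x + b i ..< a i * x + b i + \<delta>}) I"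
proof -
  define I where "I = {1..N} \<rightarrow>\<^sub>E {..<N}"
  define a where "a d = (\<Sum>k=1..N. real (d k) / real N ^ k)" for d :: "nat \<Rightarrow> nat"
  define b where "b d = - (\<Sum>k=1..N. real (d k) / real N ^ k * (real k / real N))" for d :: "nat \<Rightarrow> nat"
  have ab: "a d * x + b d = digit_pos N d x" for d x
    by (simp add: a_def b_def digit_pos_def sum_distrib_right right_diff_distrib sum_subtractf)
  have a01: "a d \<in> {0..1}" and b01: "b d \<in> {-1..0}" if d: "d \<in> I" for d
  proof -
    have dl: "real (d l) \<le> real N - 1" if "l \<in> {1..N}" for l
      using PiE_mem[OF d[unfolded I_def] that] N by auto
    have "a d \<le> (\<Sum>l=Suc 0..N. (real N - 1) / real N ^ l)"
      unfolding a_def One_nat_def by (rule sum_mono) (use dl in \<open>auto intro!: divide_right_mono\<close>)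
    also have "\<dots> \<le> 1" using sum_digits_telescope[OF N, of 0] by simp
    finally have a1: "a d \<le> 1" .
    moreover have "a d \<ge> 0" unfolding a_def by (rule sum_nonneg) auto
    ultimately show "a d \<in> {0..1}" by simp
    have "- b d \<le> a d"
      unfolding b_def a_def minus_minus
      by (rule sum_mono, rule mult_left_le) (use N in \<open>auto simp: divide_le_eq\<close>)
    moreover have "- b d \<ge> 0" unfolding b_def minus_minus by (rule sum_nonneg) auto
    ultimately show "b d \<in> {-1..0}" using a1 by simp
  qed
  show ?thesis
  proof (rule that[of I "1 / real N ^ N" a b])
    show "finite I" unfolding I_def by (intro finite_PiE) auto
    show "real (card I) * (1 / real N ^ N) = 1" using N by (simp add: I_def card_PiE)
    show "1 / real N ^ N \<le> 1" "1 / real N ^ N > 0" using N by auto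
    show "emeasure lborel (\<Union>i\<in>I. {a i * x + b i..<a i * x + b i + 1 / real N ^ N}) \<le> ennreal (3 / real N)"
      if "0 \<le> x" "x \<le> 1" for x
      unfolding ab I_def by (rule digit_pos_compressed[OF N that])
    show "disjoint_family_on (\<lambda>i. {a i * x + b i..<a i * x + b i + 1 / real N ^ N}) I" if "2 \<le> x" for x
      unfolding ab disjoint_family_on_def I_def by (intro ballI impI digit_pos_disjoint[OF N that])
  qed (use a01 b01 in auto)
qed

subsection \<open>Tubes\<close>

text \<open>Averaging the translates of \<open>A\<close> along \<open>w\<close> and applying Fubini
  reduces a volume to lengths of slices, without a choice of coordinates adapted to
  \<open>w\<close>.\<close>

lemma emeasure_slices:
  fixes A :: "'a::euclidean_space set" and S :: "real set"
  assumes [measurable]: "A \<in> sets borel" "S \<in> sets borel"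
  shows "emeasure lborel S * emeasure lborel A = (\<integral>\<^sup>+x. emeasure lborel {s \<in> S. x + s *\<^sub>R w \<in> A} \<partial>lborel)"
proof -
  have slice: "emeasure lborel {s \<in> S. x + s *\<^sub>R w \<in> A} = (\<integral>\<^sup>+s. indicator S s * indicator A (x + s *\<^sub>R w) \<partial>lborel)" for x
  proof -
    have "emeasure lborel {s \<in> S. x + s *\<^sub>R w \<in> A} = (\<integral>\<^sup>+s. indicator {s \<in> S. x + s *\<^sub>R w \<in> A} s \<partial>lborel)"
      by (subst nn_integral_indicator) auto
    also have "\<dots> = (\<integral>\<^sup>+s. indicator S s * indicator A (x + s *\<^sub>R w) \<partial>lborel)"
      by (rule nn_integral_cong) (auto simp: indicator_def)
    finally show ?thesis .
  qed
  have "(\<integral>\<^sup>+x. emeasure lborel {s \<in> S. x + s *\<^sub>R w \<in> A} \<partial>lborel) =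
      (\<integral>\<^sup>+s. \<integral>\<^sup>+x. indicator S s * indicator A (x + s *\<^sub>R w) \<partial>lborel \<partial>(lborel :: real measure))"
    unfolding slice by (rule lborel_pair.Fubini'[symmetric]) measurable
  also have "\<dots> = (\<integral>\<^sup>+s. indicator S s * emeasure lborel A \<partial>(lborel :: real measure))"
  proof (rule nn_integral_cong)
    fix s :: real
    have "(\<integral>\<^sup>+x. indicator S s * indicator A (x + s *\<^sub>R w) \<partial>lborel) = indicator S s * (\<integral>\<^sup>+x. indicator A (s *\<^sub>R w + x) \<partial>lborel)"
      by (subst nn_integral_cmult) (auto simp: add.commute)
    also have "(\<integral>\<^sup>+x. indicator A (s *\<^sub>R w + x) \<partial>lborel) = emeasure lborel A"
      by (subst nn_integral_lborel_translate) auto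
    finally show "(\<integral>\<^sup>+x. indicator S s * indicator A (x + s *\<^sub>R w) \<partial>lborel) = indicator S s * emeasure lborel A" .
  qed
  also have "\<dots> = emeasure lborel S * emeasure lborel A"
    by (subst nn_integral_multc) auto
  finally show ?thesis ..
qed

lemma emeasure_lborel_shift:
  assumes [measurable]: "U \<in> sets borel"
  shows "emeasure lborel {s::real. c + s \<in> U} = emeasure lborel U"
proof -
  have "emeasure lborel U = emeasure (distr lborel borel ((+) c)) U" by (simp add: lborel_distr_plus)
  also have "\<dots> = emeasure lborel ((+) c -` U \<inter> space lborel)" by (rule emeasure_distr) auto
  finally show ?thesis by (simp add: vimage_def)
qed

text \<open>A cylinder over a parallelogram of height \<delta> along the line of slope
  \<open>a\<close> and intercept \<open>b\<close> in the coordinates \<open>p1\<close>,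
  \<open>p2\<close>. The transversal cut-off measures x - (p1 \<bullet> x) v because this is
  invariant under translation along v when p1 \<bullet> v = 1, which makes
  \<open>tube_translate\<close> an equivalence.\<close>

definition tube :: "'a::euclidean_space \<Rightarrow> 'a \<Rightarrow> real \<Rightarrow> real \<Rightarrow> 'a \<Rightarrow> real \<Rightarrow> real \<Rightarrow> real set \<Rightarrow> 'a set" where
  "tube p1 p2 \<delta> K v a b X = {x. p1 \<bullet> x \<in> X \<and> p2 \<bullet> x - a * (p1 \<bullet> x) - b \<in> {0..<\<delta>} \<and> norm (x - (p1 \<bullet> x) *\<^sub>R v) \<le> K}"

lemma tube_measurable [measurable]: "X \<in> sets borel \<Longrightarrow> tube p1 p2 \<delta> K v a b X \<in> sets borel"
proof -
  assume [measurable]: "X \<in> sets borel"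
  have "{x. p1 \<bullet> x \<in> X \<and> p2 \<bullet> x - a * (p1 \<bullet> x) - b \<in> {0..<\<delta>} \<and> norm (x - (p1 \<bullet> x) *\<^sub>R v) \<le> K} \<in> sets borel"
    by measurable
  then show ?thesis by (simp add: tube_def)
qed

lemma tube_translate:
  assumes "p1 \<bullet> v = 1" "p2 \<bullet> v = a"
  shows "x + s *\<^sub>R v \<in> tube p1 p2 \<delta> K v a b X \<longleftrightarrow>
    p1 \<bullet> x + s \<in> X \<and> x \<in> tube p1 p2 \<delta> K v a b UNIV"
  using assms by (simp add: tube_def inner_add_right algebra_simps)

lemma tube_bounded:
  assumes "norm v \<le> M" "X \<subseteq> {0..3}" "x \<in> tube p1 p2 \<delta> K v a b X"
  shows "norm x \<le> 3 * M + K"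
proof -
  have p: "0 \<le> p1 \<bullet> x" "p1 \<bullet> x \<le> 3" "norm (x - (p1 \<bullet> x) *\<^sub>R v) \<le> K" using assms by (auto simp: tube_def)
  have "norm x \<le> norm ((p1 \<bullet> x) *\<^sub>R v) + norm (x - (p1 \<bullet> x) *\<^sub>R v)"
    using norm_triangle_ineq[of "(p1 \<bullet> x) *\<^sub>R v" "x - (p1 \<bullet> x) *\<^sub>R v"] by simp
  also have "norm ((p1 \<bullet> x) *\<^sub>R v) \<le> 3 * M" using p assms(1) by (auto intro!: mult_mono)
  finally show ?thesis using p by linarith
qed

text \<open>Translation by 2 v carries one tube onto the other.\<close>

lemma tube_measure_eq:
  assumes "p1 \<bullet> v = 1" "p2 \<bullet> v = a"
  shows "emeasure lborel (tube p1 p2 \<delta> K v a b {2..3}) = emeasure lborel (tube p1 p2 \<delta> K v a b {0..1})"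
proof -
  have "emeasure lborel (tube p1 p2 \<delta> K v a b {2..3}) = (\<integral>\<^sup>+x. indicator (tube p1 p2 \<delta> K v a b {2..3}) x \<partial>lborel)"
    by simp
  also have "\<dots> = (\<integral>\<^sup>+x. indicator (tube p1 p2 \<delta> K v a b {2..3}) (2 *\<^sub>R v + x) \<partial>lborel)"
    by (rule nn_integral_lborel_translate[symmetric]) auto
  also have "\<dots> = (\<integral>\<^sup>+x. indicator (tube p1 p2 \<delta> K v a b {0..1}) x \<partial>lborel)"
  proof (rule nn_integral_cong)
    fix x
    have "2 *\<^sub>R v + x \<in> tube p1 p2 \<delta> K v a b {2..3} \<longleftrightarrow> x \<in> tube p1 p2 \<delta> K v a b {0..1}"
      using tube_translate[OF assms, of x 2 \<delta> K b "{2..3}"] tube_translate[OF assms, of x 0 \<delta> K b "{0..1}"]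
      by (auto simp: add.commute)
    then show "indicator (tube p1 p2 \<delta> K v a b {2..3}) (2 *\<^sub>R v + x) = (indicator (tube p1 p2 \<delta> K v a b {0..1}) x :: ennreal)"
      by (simp add: indicator_def)
  qed
  finally show ?thesis by simp
qed

text \<open>A shift along \<open>w\<close> changes \<open>p2\<close> at unit speed and fixes
  \<open>p1\<close>, so slices in direction \<open>w\<close> reproduce the planar strips at the
  abscissa p1 \<bullet> x. The cut-off, the lower bound and the bounding ball are fixed before N;
  only the compressed measure depends on \<epsilon>.\<close>

lemma Kakeya_tubes:
  fixes p1 p2 w :: "'a::euclidean_space" and v :: "real \<Rightarrow> 'a"
  assumes w: "p1 \<bullet> w = 0" "p2 \<bullet> w = 1"
    and v: "\<And>a. a \<in> {0..1} \<Longrightarrow> p1 \<bullet> v a = 1 \<and> p2 \<bullet> v a = a \<and> norm (v a) \<le> M"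
  obtains K c C :: real where "c > 0"
    "\<And>\<epsilon>. \<epsilon> > 0 \<Longrightarrow> \<exists>(I :: (nat \<Rightarrow> nat) set) a b \<delta>. finite I \<and> (\<forall>i\<in>I. a i \<in> {0..1}) \<and>
       disjoint_family_on (\<lambda>i. tube p1 p2 \<delta> K (v (a i)) (a i) (b i) {2..3}) I \<and>
       emeasure lborel (\<Union>i\<in>I. tube p1 p2 \<delta> K (v (a i)) (a i) (b i) {2..3}) \<ge> ennreal c \<and>
       emeasure lborel (\<Union>i\<in>I. tube p1 p2 \<delta> K (v (a i)) (a i) (b i) {0..1}) \<le> ennreal \<epsilon>"
proof -
  have "p1 \<bullet> v 0 = 1" using v[of 0] by simp
  then have p1: "p1 \<noteq> 0" by auto
  have M: "M \<ge> 0" using order_trans[OF norm_ge_zero, of "v 0" M] v[of 0] by simp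
  \<comment> \<open>The functional \<open>p1\<close> equals 5/2 at \<open>x0\<close> and varies by
    at most 1/2 on the ball of radius \<open>r\<close>, so the ball lies over
    \<open>{2..3}\<close>.\<close>
  define x0 where "x0 = ((5/2) / (p1 \<bullet> p1)) *\<^sub>R p1"
  define r where "r = 1 / (2 * norm p1)"
  have r: "r > 0" using p1 by (simp add: r_def)
  define \<rho> where "\<rho> = norm x0 + r"
  have D: "2 \<le> p1 \<bullet> x \<and> p1 \<bullet> x \<le> 3 \<and> norm x \<le> \<rho>" if "x \<in> ball x0 r" for x
  proof -
    have d: "norm (x - x0) < r" using that by (simp add: dist_norm norm_minus_commute)
    have "p1 \<bullet> x = 5/2 + p1 \<bullet> (x - x0)" using p1 by (simp add: x0_def inner_diff_right)
    moreover have "\<bar>p1 \<bullet> (x - x0)\<bar> \<le> norm p1 * r"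
      using Cauchy_Schwarz_ineq2[of p1 "x - x0"] d by (meson less_imp_le mult_left_mono norm_ge_zero order_trans)
    moreover have "norm p1 * r = 1/2" using p1 by (simp add: r_def)
    ultimately show ?thesis using d norm_triangle_ineq[of "x - x0" x0] by (auto simp: \<rho>_def)
  qed
  \<comment> \<open>Over \<open>{2..3}\<close> all strips have heights between -1 and 4, so shifts
    by at most \<open>L\<close> take any point of the ball to each of them.\<close>
  define L where "L = norm p2 * \<rho> + 5"
  have \<rho>: "\<rho> > 0" using r by (simp add: \<rho>_def add_nonneg_pos)
  have L: "L > 0" using \<rho> by (simp add: L_def add_nonneg_pos)
  \<comment> \<open>Large enough for the transversal cut-off to hold at all these shifted
    points.\<close>
  define K where "K = \<rho> + L * norm w + 3 * M"
  define m where "m = measure lborel (ball x0 r)"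
  have m: "m > 0" using r by (simp add: m_def content_ball_pos)
  have me: "emeasure lborel (ball x0 r) = ennreal m"
    using emeasure_bounded_finite[OF bounded_ball[of x0 r]] by (simp add: m_def emeasure_eq_ennreal_measure)
  define Rad where "Rad = 3 * M + K + norm w"
  define mR where "mR = measure lborel (cball (0::'a) Rad)"
  have mR: "emeasure lborel (cball (0::'a) Rad) = ennreal mR"
    using emeasure_bounded_finite[OF bounded_cball[of "0::'a" Rad]] by (simp add: mR_def emeasure_eq_ennreal_measure)
  show ?thesis
  proof (rule that[of "m / (2 * L)" K])
    show "m / (2 * L) > 0" using m L by simp
    fix \<epsilon> :: real assume \<epsilon>: "\<epsilon> > 0"
    obtain N0 :: nat where "3 * mR / \<epsilon> < real N0" using reals_Archimedean2 by blast
    then obtain N :: nat where N: "N \<ge> 1" "3 * mR / \<epsilon> < real N"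
      using that[of "Suc N0"] by simp
    obtain I :: "(nat \<Rightarrow> nat) set" and \<delta> :: real and a b :: "(nat \<Rightarrow> nat) \<Rightarrow> real" where I: "finite I" and \<delta>: "\<delta> > 0" "\<delta> \<le> 1" and card: "real (card I) * \<delta> = 1"
      and a: "\<And>i. i \<in> I \<Longrightarrow> a i \<in> {0..1}" and b: "\<And>i. i \<in> I \<Longrightarrow> b i \<in> {-1..0}"
      and compressed: "\<And>x. 0 \<le> x \<Longrightarrow> x \<le> 1 \<Longrightarrow> emeasure lborel (\<Union>i\<in>I. {a i * x + b i ..< a i * x + b i + \<delta>}) \<le> ennreal (3 / real N)"
      and disj: "\<And>x. 2 \<le> x \<Longrightarrow> disjoint_family_on (\<lambda>i. {a i * x + b i ..< a i * x + b i + \<delta>}) I"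
      by (rule Kakeya_lines[OF N(1)], rule that; (assumption | blast))
    define R where "R X i = tube p1 p2 \<delta> K (v (a i)) (a i) (b i) X" for X i
    have Rm [measurable]: "R X i \<in> sets borel" if "X \<in> sets borel" for X i
      unfolding R_def using that by measurable
    have Rmem: "x \<in> R X i \<longleftrightarrow> p1 \<bullet> x \<in> X \<and> p2 \<bullet> x \<in> {a i * (p1 \<bullet> x) + b i ..< a i * (p1 \<bullet> x) + b i + \<delta>} \<and> norm (x - (p1 \<bullet> x) *\<^sub>R v (a i)) \<le> K" for x X i
      unfolding R_def tube_def by auto
    have 1: "disjoint_family_on (R {2..3}) I"
      unfolding disjoint_family_on_def
    proof (intro ballI impI)
      fix i j assume ij: "i \<in> I" "j \<in> I" "i \<noteq> j"
      show "R {2..3} i \<inter> R {2..3} j = {}"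
      proof (rule ccontr)
        assume "R {2..3} i \<inter> R {2..3} j \<noteq> {}"
        then obtain x where x: "x \<in> R {2..3} i" "x \<in> R {2..3} j" by blast
        then have "2 \<le> p1 \<bullet> x" by (simp add: Rmem)
        from disjoint_family_onD[OF disj[OF this] ij] x show False unfolding Rmem by blast
      qed
    qed
    have 2: "emeasure lborel (\<Union>i\<in>I. R {2..3} i) \<ge> ennreal (m / (2 * L))"
    proof -
      let ?G = "\<Union>i\<in>I. R {2..3} i"
      have Gm: "?G \<in> sets borel" using I by (intro sets.finite_UN) auto
      \<comment> \<open>Through a point of the ball the strips are disjoint with total length 1, and
        the whole of it is reached with |s| \<le> L.\<close>
      have slice: "emeasure lborel {s \<in> {-L..L}. x + s *\<^sub>R w \<in> ?G} \<ge> indicator (ball x0 r) x" for x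
      proof (cases "x \<in> ball x0 r")
        case True
        note x = D[OF True]
        define U where "U = (\<Union>i\<in>I. {a i * (p1 \<bullet> x) + b i ..< a i * (p1 \<bullet> x) + b i + \<delta>})"
        have "emeasure lborel U = (\<Sum>i\<in>I. emeasure lborel {a i * (p1 \<bullet> x) + b i ..< a i * (p1 \<bullet> x) + b i + \<delta>})"
          unfolding U_def by (rule sum_emeasure[symmetric]) (use disj[of "p1 \<bullet> x"] x I in auto)
        also have "\<dots> = (\<Sum>i\<in>I. ennreal \<delta>)" using \<delta> by (intro sum.cong) auto
        also have "\<dots> = 1" using card \<delta> by (simp add: ennreal_of_nat_eq_real_of_nat ennreal_mult[symmetric])
        finally have "emeasure lborel U = 1" .
        moreover have "emeasure lborel {s. (p2 \<bullet> x) + s \<in> U} = emeasure lborel U"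
        proof -
          have Um: "U \<in> sets borel" unfolding U_def using I by (intro sets.finite_UN) auto
          then show ?thesis by (rule emeasure_lborel_shift)
        qed
        moreover have "{s. (p2 \<bullet> x) + s \<in> U} \<subseteq> {s \<in> {-L..L}. x + s *\<^sub>R w \<in> ?G}"
        proof (intro subsetI)
          fix s assume "s \<in> {s. (p2 \<bullet> x) + s \<in> U}"
          then obtain i where i: "i \<in> I" and s: "(p2 \<bullet> x) + s \<in> {a i * (p1 \<bullet> x) + b i ..< a i * (p1 \<bullet> x) + b i + \<delta>}"
            unfolding U_def by blast
          have "0 \<le> a i * (p1 \<bullet> x)" using a[OF i] x by simp
          moreover have "a i * (p1 \<bullet> x) \<le> 1 * 3" by (rule mult_mono) (use a[OF i] x in auto)
          ultimately have "\<bar>(p2 \<bullet> x) + s\<bar> \<le> 5" using s b[OF i] \<delta> by auto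
          moreover have "\<bar>p2 \<bullet> x\<bar> \<le> norm p2 * \<rho>"
            using Cauchy_Schwarz_ineq2[of p2 x] x by (meson mult_left_mono norm_ge_zero order_trans)
          ultimately have sL: "\<bar>s\<bar> \<le> L" unfolding L_def by linarith
          have "norm (x + s *\<^sub>R w - (p1 \<bullet> x) *\<^sub>R v (a i)) \<le> norm x + \<bar>s\<bar> * norm w + \<bar>p1 \<bullet> x\<bar> * norm (v (a i))"
            by (intro norm_triangle_le_diff norm_triangle_le add_mono) auto
          also have "\<dots> \<le> \<rho> + L * norm w + 3 * M"
            using x sL v[OF a[OF i]] by (intro add_mono mult_mono) auto
          finally have "x + s *\<^sub>R w \<in> R {2..3} i"
            using x s w by (simp add: Rmem inner_add_right K_def)
          then show "s \<in> {s \<in> {-L..L}. x + s *\<^sub>R w \<in> ?G}" using i sL by auto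
        qed
        moreover have "{s \<in> {-L..L}. x + s *\<^sub>R w \<in> ?G} \<in> sets borel" using Gm by measurable
        ultimately have "emeasure lborel {s \<in> {-L..L}. x + s *\<^sub>R w \<in> ?G} \<ge> 1"
          using emeasure_mono[of "{s. (p2 \<bullet> x) + s \<in> U}" "{s \<in> {-L..L}. x + s *\<^sub>R w \<in> ?G}" lborel] by simp
        then show ?thesis using True by simp
      qed simp
      have "ennreal m = (\<integral>\<^sup>+x. indicator (ball x0 r) x \<partial>lborel)" by (simp add: me)
      also have "\<dots> \<le> (\<integral>\<^sup>+x. emeasure lborel {s \<in> {-L..L}. x + s *\<^sub>R w \<in> ?G} \<partial>lborel)"
        by (rule nn_integral_mono) (rule slice)
      also have "\<dots> = emeasure lborel {-L..L} * emeasure lborel ?G"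
        using Gm by (intro emeasure_slices[symmetric]) auto
      also have "emeasure lborel {-L..L} = ennreal (2 * L)" using L by simp
      finally have "ennreal m \<le> ennreal (2 * L) * emeasure lborel ?G" .
      then have "ennreal m / ennreal (2 * L) \<le> emeasure lborel ?G"
        using L by (intro divide_le_posI_ennreal) (auto simp: mult.commute)
      then show ?thesis using L m by (simp add: divide_ennreal)
    qed
    have 3: "emeasure lborel (\<Union>i\<in>I. R {0..1} i) \<le> ennreal \<epsilon>"
    proof -
      let ?E = "\<Union>i\<in>I. R {0..1} i"
      have Em: "?E \<in> sets borel" using I by (intro sets.finite_UN) auto
      \<comment> \<open>A nonempty slice puts x within \<open>norm w\<close> of a tube, hence in the
        ball of radius \<open>Rad\<close>; the slice itself is covered by the compressed
        strips.\<close>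
      have slice: "emeasure lborel {s \<in> {0..1}. x + s *\<^sub>R w \<in> ?E} \<le> ennreal (3 / real N) * indicator (cball 0 Rad) x" for x
      proof (cases "{s \<in> {0..1}. x + s *\<^sub>R w \<in> ?E} = {}")
        case False
        then obtain s i where s: "0 \<le> s" "s \<le> 1" "i \<in> I" "x + s *\<^sub>R w \<in> R {0..1} i" by auto
        have "norm (x + s *\<^sub>R w) \<le> 3 * M + K"
          by (rule tube_bounded[OF _ _ s(4)[unfolded R_def]]) (use v[OF a[OF s(3)]] in auto)
        moreover have "norm x \<le> norm (x + s *\<^sub>R w) + norm (s *\<^sub>R w)"
          using norm_triangle_ineq4[of "x + s *\<^sub>R w" "s *\<^sub>R w"] by simp
        moreover have "norm (s *\<^sub>R w) \<le> norm w" using s by (simp add: mult_left_le_one_le)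
        ultimately have xb: "x \<in> cball 0 Rad" by (simp add: Rad_def)
        have px: "0 \<le> p1 \<bullet> x" "p1 \<bullet> x \<le> 1" using s(4) w by (auto simp: Rmem inner_add_right)
        define U where "U = (\<Union>i\<in>I. {a i * (p1 \<bullet> x) + b i ..< a i * (p1 \<bullet> x) + b i + \<delta>})"
        have Um: "U \<in> sets borel" unfolding U_def using I by (intro sets.finite_UN) auto
        have "emeasure lborel {s \<in> {0..1}. x + s *\<^sub>R w \<in> ?E} \<le> emeasure lborel {s. (p2 \<bullet> x) + s \<in> U}"
        proof (rule emeasure_mono)
          show "{s \<in> {0..1}. x + s *\<^sub>R w \<in> ?E} \<subseteq> {s. (p2 \<bullet> x) + s \<in> U}"
            using w by (auto simp: Rmem inner_add_right U_def)
          show "{s. (p2 \<bullet> x) + s \<in> U} \<in> sets lborel" using Um by simp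
        qed
        also have "emeasure lborel {s. (p2 \<bullet> x) + s \<in> U} = emeasure lborel U"
          by (rule emeasure_lborel_shift[OF Um])
        also have "\<dots> \<le> ennreal (3 / real N)" unfolding U_def by (rule compressed[OF px])
        finally show ?thesis using xb by simp
      next
        case True
        then show ?thesis by (simp only: emeasure_empty) simp
      qed
      have "emeasure lborel ?E = emeasure lborel {0..1::real} * emeasure lborel ?E" by simp
      also have "\<dots> = (\<integral>\<^sup>+x. emeasure lborel {s \<in> {0..1}. x + s *\<^sub>R w \<in> ?E} \<partial>lborel)"
        using Em by (intro emeasure_slices) auto
      also have "\<dots> \<le> (\<integral>\<^sup>+x. ennreal (3 / real N) * indicator (cball (0::'a) Rad) x \<partial>lborel)"
        by (rule nn_integral_mono) (rule slice)
      also have "\<dots> = ennreal (3 / real N * mR)"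
        by (subst nn_integral_cmult_indicator) (auto simp: mR ennreal_mult[symmetric] mR_def)
      also have "\<dots> \<le> ennreal \<epsilon>"
        using N \<epsilon> by (intro ennreal_leI) (simp add: field_simps)
      finally show ?thesis .
    qed
    show "\<exists>(I :: (nat \<Rightarrow> nat) set) a b \<delta>. finite I \<and> (\<forall>i\<in>I. a i \<in> {0..1}) \<and>
       disjoint_family_on (\<lambda>i. tube p1 p2 \<delta> K (v (a i)) (a i) (b i) {2..3}) I \<and>
       emeasure lborel (\<Union>i\<in>I. tube p1 p2 \<delta> K (v (a i)) (a i) (b i) {2..3}) \<ge> ennreal (m / (2 * L)) \<and>
       emeasure lborel (\<Union>i\<in>I. tube p1 p2 \<delta> K (v (a i)) (a i) (b i) {0..1}) \<le> ennreal \<epsilon>"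
      using I a 1 2 3 unfolding R_def by blast
  qed
qed

subsection \<open>Half-space multipliers away from the diagonal\<close>

text \<open>The jump of a half-space multiplier is recovered from the kernel \<open>1 / s\<close> truncated to
  \<open>{1 / m .. m}\<close>, because \<open>Si (2 \<pi> u m) - Si (2 \<pi> u / m)\<close> tends to \<open>(\<pi> / 2) sgn u\<close>.\<close>

lemma truncated_sine_integral:
  fixes u :: real and m :: nat
  assumes m: "m \<ge> 1"
  shows "(LINT s|lborel. indicator {1 / real m .. real m} s / s * sin (2 * pi * s * u)) = Si (2 * pi * u * real m) - Si (2 * pi * u / real m)"
proof -
  define F where "F s = Si (2 * pi * u * s)" for s
  have le: "1 / real m \<le> real m"
    using m mult_mono[of 1 "real m" 1 "real m"] by (simp add: divide_le_eq)
  have "(LINT s|lborel. (2 * pi * u * sinc (2 * pi * u * s)) * indicator {1 / real m .. real m} s) = F (real m) - F (1 / real m)"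
  proof (rule integral_FTC_Icc_real[OF le])
    fix s
    show "DERIV F s :> 2 * pi * u * sinc (2 * pi * u * s)"
      unfolding F_def by (rule DERIV_chain2[OF DERIV_Si, THEN DERIV_cong]) (auto intro!: derivative_eq_intros)
    show "isCont (\<lambda>s. 2 * pi * u * sinc (2 * pi * u * s)) s"
      by (intro continuous_intros isCont_o2[OF _ isCont_sinc])
  qed
  moreover have "(2 * pi * u * sinc (2 * pi * u * s)) * indicator {1 / real m .. real m} s =
      indicator {1 / real m .. real m} s / s * sin (2 * pi * s * u)" for s
  proof (cases "s \<in> {1 / real m .. real m}")
    case True
    have "0 < 1 / real m" using m by simp
    then have "s > 0" using True by (meson atLeastAtMost_iff less_le_trans)
    then show ?thesis using True by (auto simp: mult_ac)
  qed simp
  ultimately show ?thesis by (simp add: F_def)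
qed

lemma Si_0 [simp]: "Si 0 = 0"
  using Si_neg[of 0] by simp

lemma Si_tendsto_sgn:
  "(\<lambda>m. Si (2 * pi * u * real m) - Si (2 * pi * u / real m)) \<longlonglongrightarrow> pi / 2 * sgn u"
proof -
  have pos: "(\<lambda>m. Si (2 * pi * u * real m)) \<longlonglongrightarrow> pi / 2" if "u > 0" for u
    by (rule filterlim_compose[OF Si_at_top]) (use that in real_asymp)
  have "(\<lambda>m. Si (2 * pi * u * real m)) \<longlonglongrightarrow> pi / 2 * sgn u"
  proof (cases u "0::real" rule: linorder_cases)
    case less
    have "(\<lambda>m. - Si (2 * pi * (- u) * real m)) \<longlonglongrightarrow> - (pi / 2)"
      by (intro tendsto_minus pos) (use less in auto)
    moreover have "- Si (2 * pi * (- u) * real m) = Si (2 * pi * u * real m)" for m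
    proof (cases "m = 0")
      case True then show ?thesis by simp
    next
      case False
      have "0 \<le> 2 * pi * (- u) * real m" using less by (intro mult_nonneg_nonneg) auto
      from Si_neg[OF this] show ?thesis by simp
    qed
    ultimately show ?thesis using less by simp
  next
    case equal
    then show ?thesis by simp
  next
    case greater
    then show ?thesis using pos[of u] by simp
  qed
  moreover have "(\<lambda>m. Si (2 * pi * u / real m)) \<longlonglongrightarrow> Si 0"
    by (rule isCont_tendsto_compose[OF isCont_Si]) real_asymp
  ultimately have "(\<lambda>m. Si (2 * pi * u * real m) - Si (2 * pi * u / real m)) \<longlonglongrightarrow> pi / 2 * sgn u - Si 0"
    by (rule tendsto_diff)
  then show ?thesis by simp
qed

lemma fi_translate:
  fixes f :: "'a::euclidean_space \<Rightarrow> complex"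
  assumes [measurable]: "f \<in> borel_measurable borel"
  shows "fi (\<lambda>x. f (c + x)) \<xi> = cis (2 * pi * (c \<bullet> \<xi>)) * fi f \<xi>"
proof -
  have "fi f \<xi> = (LINT y|lborel. f (c + y) * cis (- (2 * pi * ((c + y) \<bullet> \<xi>))))"
    unfolding fi_def by (rule integral_lborel_translate[symmetric]) measurable
  also have "\<dots> = (LINT y|lborel. cis (- (2 * pi * (c \<bullet> \<xi>))) * (f (c + y) * cis (- (2 * pi * (y \<bullet> \<xi>)))))"
  proof (rule Bochner_Integration.integral_cong[OF refl])
    fix y
    have "cis (- (2 * pi * ((c + y) \<bullet> \<xi>))) = cis (- (2 * pi * (c \<bullet> \<xi>))) * cis (- (2 * pi * (y \<bullet> \<xi>)))"
      by (simp add: cis_mult inner_add_left algebra_simps)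
    then show "f (c + y) * cis (- (2 * pi * ((c + y) \<bullet> \<xi>))) = cis (- (2 * pi * (c \<bullet> \<xi>))) * (f (c + y) * cis (- (2 * pi * (y \<bullet> \<xi>))))"
      by (simp only: mult_ac)
  qed
  also have "\<dots> = cis (- (2 * pi * (c \<bullet> \<xi>))) * fi (\<lambda>x. f (c + x)) \<xi>"
    unfolding fi_def by (rule integral_mult_right_zero)
  finally show ?thesis by (simp add: cis_mult mult.assoc[symmetric])
qed

lemma fi_modulate:
  "fi (\<lambda>x. cis (2 * pi * (x \<bullet> \<zeta>)) * f x) \<xi> = fi f (\<xi> - \<zeta>)"
  unfolding fi_def
proof (rule Bochner_Integration.integral_cong[OF refl])
  fix y
  have "cis (2 * pi * (y \<bullet> \<zeta>)) * cis (- (2 * pi * (y \<bullet> \<xi>))) = cis (- (2 * pi * (y \<bullet> (\<xi> - \<zeta>))))"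
    by (simp add: cis_mult inner_diff_right algebra_simps)
  then show "cis (2 * pi * (y \<bullet> \<zeta>)) * f y * cis (- (2 * pi * (y \<bullet> \<xi>))) = f y * cis (- (2 * pi * (y \<bullet> (\<xi> - \<zeta>))))"
    by (simp only: mult_ac)
qed

lemma integrable_complex_indicator:
  assumes "A \<in> sets M" "emeasure M A < \<infinity>"
  shows "integrable M (indicator A :: _ \<Rightarrow> complex)"
proof -
  have "integrable M (\<lambda>x. complex_of_real (indicator A x))" using assms by (intro integrable_of_real) simp
  also have "(\<lambda>x. complex_of_real (indicator A x)) = indicator A" by (auto simp: indicator_def)
  finally show ?thesis .
qed

lemma Parseval_lborel:
  fixes f g :: "'a::euclidean_space \<Rightarrow> complex"
  assumes f: "integrable lborel f" "f \<in> L2 lborel" and g: "integrable lborel g" "g \<in> L2 lborel"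
  shows "ip lborel (fi f) (fi g) = ip lborel f g"
proof -
  have m: "f \<in> borel_measurable borel" "g \<in> borel_measurable borel" using f g by auto
  have "has_fourier_L2 f (fi f)" "has_fourier_L2 g (fi g)"
    using has_fourier_L2_integrable[of f] has_fourier_L2_integrable[of g] f g m
    by (simp_all add: fourier_integral_borel L2_lebesgue_borel_iff integrable_completion)
  then have "ip lebesgue (fi f) (fi g) = ip lebesgue f g" by (rule has_fourier_L2_ip)
  then show ?thesis unfolding ip_def using m by (simp add: integral_completion)
qed

text \<open>The number \<open>F s\<close> is the measure of the points of \<open>R'\<close> that s v
  carries into \<open>R\<close>. It is supported in 1 \<le> s \<le> 3 with total mass |R'|, so its
  pairing with 1/s is at least |R'|/3. On the Fourier side the pairing becomes, up to a factor of
  modulus 1, pi times the integral of \<Phi> against the sign of \<eta> \<bullet> v, and the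
  half-space indicator is half of 1 plus this sign.\<close>

lemma halfspace_lower_bound:
  fixes v p1 :: "'a::euclidean_space" and R R' :: "'a set"
  assumes [measurable]: "R \<in> sets borel" "R' \<in> sets borel"
    and fin: "emeasure lborel R < \<infinity>" "emeasure lborel R' < \<infinity>"
    and v: "p1 \<bullet> v = 1"
    and R': "\<And>x. x \<in> R' \<Longrightarrow> p1 \<bullet> x \<in> {0..1}"
    and RR': "\<And>x s. x \<in> R' \<Longrightarrow> x + s *\<^sub>R v \<in> R \<longleftrightarrow> p1 \<bullet> x + s \<in> {2..3}"
  defines "\<Phi> \<equiv> \<lambda>\<eta>. fi (indicator R) \<eta> * cnj (fi (indicator R') \<eta>)"
  shows "integrable lborel \<Phi>"
    and "measure lborel R' / (6 * pi) \<le> norm (LINT \<eta>|lborel. indicator {\<eta>. \<eta> \<bullet> v > 0} \<eta> * \<Phi> \<eta>)"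
proof -
  let ?f = "indicator R :: 'a \<Rightarrow> complex" and ?g = "indicator R' :: 'a \<Rightarrow> complex"
  have v0: "v \<noteq> 0" using v by auto
  have f: "integrable lborel ?f" "?f \<in> L2 lborel" and g: "integrable lborel ?g" "?g \<in> L2 lborel"
    using fin by (auto intro: integrable_complex_indicator)
  have \<Phi>m[measurable]: "\<Phi> \<in> borel_measurable borel" unfolding \<Phi>_def by measurable
  show \<Phi>: "integrable lborel \<Phi>"
    unfolding \<Phi>_def by (rule ip_integrable[OF Plancherel_lborel(1)[OF f] Plancherel_lborel(1)[OF g]])
  define F where "F s = ip lborel (\<lambda>x. ?f (s *\<^sub>R v + x)) ?g" for s
  have F_FT: "F s = (LINT \<eta>|lborel. \<Phi> \<eta> * cis (2 * pi * s * (\<eta> \<bullet> v)))" for s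
  proof -
    have "F s = ip lborel (fi (\<lambda>x. ?f (s *\<^sub>R v + x))) (fi ?g)"
      unfolding F_def
      by (rule Parseval_lborel[symmetric]) (use f g in \<open>auto intro: integrable_lborel_translate L2_translate\<close>)
    also have "\<dots> = (LINT \<eta>|lborel. \<Phi> \<eta> * cis (2 * pi * s * (\<eta> \<bullet> v)))"
      unfolding ip_def \<Phi>_def fi_translate[OF borel_measurable_indicator[OF assms(1)]]
      by (rule Bochner_Integration.integral_cong) (auto simp: mult_ac inner_commute)
    finally show ?thesis .
  qed
  have F_eq: "F s = (LINT x|lborel. indicator R' x * indicator {2..3} (p1 \<bullet> x + s))" for s
    unfolding F_def ip_def
    by (rule Bochner_Integration.integral_cong) (auto simp: indicator_def RR' add.commute)
  \<comment> \<open>Moving \<open>R'\<close> backwards cannot bring \<open>p1\<close> into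
    \<open>{2..3}\<close>. This one-sidedness lets the odd part of \<open>F\<close> carry all of its
    mass.\<close>
  have F_neg: "F (- s) = 0" if "s > 0" for s
    unfolding F_eq by (rule integral_eq_zero_AE) (use that R' in \<open>fastforce simp: indicator_def\<close>)
  have F_real: "F s = of_real (measure lborel {x \<in> R'. p1 \<bullet> x + s \<in> {2..3}})" for s
  proof -
    have "F s = (LINT x|lborel. complex_of_real (indicator {x \<in> R'. p1 \<bullet> x + s \<in> {2..3}} x))"
      unfolding F_eq by (rule Bochner_Integration.integral_cong) (auto simp: indicator_def)
    then show ?thesis by simp
  qed
  define G where "G s = measure lborel {x \<in> R'. p1 \<bullet> x + s \<in> {2..3}}" for s
  have G_em: "emeasure lborel {x \<in> R'. p1 \<bullet> x + s \<in> {2..3}} = ennreal (G s)" for s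
  proof -
    have "emeasure lborel {x \<in> R'. p1 \<bullet> x + s \<in> {2..3}} \<le> emeasure lborel R'" by (rule emeasure_mono) auto
    then have "emeasure lborel {x \<in> R'. p1 \<bullet> x + s \<in> {2..3}} \<noteq> \<infinity>" using fin by (auto simp: top_unique)
    then show ?thesis unfolding G_def by (intro emeasure_eq_ennreal_measure) auto
  qed
  have Gm[measurable]: "G \<in> borel_measurable borel"
  proof -
    have "(\<lambda>s. enn2real (\<integral>\<^sup>+x. indicator R' x * indicator {2..3} (p1 \<bullet> x + s) \<partial>lborel)) \<in> borel_measurable borel"
      by measurable
    moreover have "enn2real (\<integral>\<^sup>+x. indicator R' x * indicator {2..3} (p1 \<bullet> x + s) \<partial>lborel) = G s" for s
    proof -
      have "(\<integral>\<^sup>+x. indicator R' x * indicator {2..3} (p1 \<bullet> x + s) \<partial>lborel) = (\<integral>\<^sup>+x. indicator {x \<in> R'. p1 \<bullet> x + s \<in> {2..3}} x \<partial>lborel)"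
        by (rule nn_integral_cong) (auto simp: indicator_def)
      also have "\<dots> = ennreal (G s)" unfolding G_em[symmetric] by (rule nn_integral_indicator) measurable
      finally show ?thesis by (simp add: G_def)
    qed
    ultimately show ?thesis by simp
  qed
  have G_total: "(\<integral>\<^sup>+s. ennreal (G s) \<partial>lborel) = ennreal (measure lborel R')"
  proof -
    have "(\<integral>\<^sup>+s. ennreal (G s) \<partial>lborel) = (\<integral>\<^sup>+s. \<integral>\<^sup>+x. indicator R' x * indicator {2..3} (p1 \<bullet> x + s) \<partial>lborel \<partial>(lborel::real measure))"
    proof (rule nn_integral_cong)
      fix s
      have "ennreal (G s) = (\<integral>\<^sup>+x. indicator {x \<in> R'. p1 \<bullet> x + s \<in> {2..3}} x \<partial>lborel)"
        unfolding G_em[symmetric] by (rule nn_integral_indicator[symmetric]) measurable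
      also have "\<dots> = (\<integral>\<^sup>+x. indicator R' x * indicator {2..3} (p1 \<bullet> x + s) \<partial>lborel)"
        by (rule nn_integral_cong) (auto simp: indicator_def)
      finally show "ennreal (G s) = (\<integral>\<^sup>+x. indicator R' x * indicator {2..3} (p1 \<bullet> x + s) \<partial>lborel)" .
    qed
    also have "\<dots> = (\<integral>\<^sup>+x. \<integral>\<^sup>+s. indicator R' x * indicator {2..3} (p1 \<bullet> x + s) \<partial>(lborel::real measure) \<partial>lborel)"
      by (rule lborel_pair.Fubini') measurable
    also have "\<dots> = (\<integral>\<^sup>+x. indicator R' x \<partial>lborel)"
    proof (rule nn_integral_cong)
      fix x :: 'a
      have "(\<integral>\<^sup>+s. indicator {2..3} (p1 \<bullet> x + s) \<partial>lborel) = (\<integral>\<^sup>+s. indicator {2..3::real} s \<partial>lborel)"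
        by (rule nn_integral_lborel_translate) auto
      then show "(\<integral>\<^sup>+s. indicator R' x * indicator {2..3} (p1 \<bullet> x + s) \<partial>(lborel::real measure)) = indicator R' x"
        by (subst nn_integral_cmult) auto
    qed
    also have "\<dots> = ennreal (measure lborel R')" using fin by (simp add: emeasure_eq_ennreal_measure less_top[symmetric])
    finally show ?thesis .
  qed
  have G0: "G s = 0" if "s \<notin> {1..3}" for s
  proof -
    have "{x \<in> R'. p1 \<bullet> x + s \<in> {2..3}} = {}" using that R' by fastforce
    then show ?thesis by (simp only: G_def measure_empty)
  qed
  have Gi: "integrable lborel G"
    using G_total by (intro integrableI_nonneg) (auto simp: G_def)
  have G_int: "(LINT s|lborel. G s) = measure lborel R'"
    using G_total by (subst integral_eq_nn_integral) (auto simp: G_def)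
  define S where "S = (LINT \<eta>|lborel. \<Phi> \<eta> * of_real (sgn (\<eta> \<bullet> v)))"
  have lower: "measure lborel R' / 3 \<le> pi * norm S"
  proof -
    define H where "H m u = Si (2 * pi * u * real m) - Si (2 * pi * u / real m)" for m :: nat and u
    have Hm[measurable]: "H m \<in> borel_measurable borel" for m unfolding H_def by measurable
    define k where "k m s = complex_of_real (indicator {1 / real m .. real m} s / s)" for m :: nat and s :: real
    have ki: "integrable lborel (k m)" if "m \<ge> 1" for m
    proof -
      have "integrable lborel (\<lambda>s. real m * indicator {1 / real m .. real m} s)"
        by (intro integrable_mult_right integrable_real_indicator) (auto simp: emeasure_lborel_Icc_eq)
      then show ?thesis
      proof (rule Bochner_Integration.integrable_bound)
        show "AE s in lborel. norm (k m s) \<le> norm (real m * indicator {1 / real m .. real m} s)"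
        proof (rule AE_I2)
          fix s :: real
          show "norm (k m s) \<le> norm (real m * indicator {1 / real m .. real m} s)"
          proof (cases "s \<in> {1 / real m .. real m}")
            case True
            have "0 < 1 / real m" using that by simp
            then have "s > 0" using True by (meson atLeastAtMost_iff less_le_trans)
            then show ?thesis using True that by (simp add: k_def norm_divide field_simps)
          qed (simp add: k_def)
        qed
        show "k m \<in> borel_measurable lborel" unfolding k_def by measurable
      qed
    qed
    have main: "(LINT s|lborel. indicator {1 / real m .. real m} s / s * G s) = norm (2 * (LINT \<eta>|lborel. \<Phi> \<eta> * of_real (H m (\<eta> \<bullet> v))))"
      if m: "m \<ge> 1" for m
    proof -
      \<comment> \<open>Subtracting the vanishing value at -s leaves twice the odd part, which is
        the source of the sine.\<close>
      have W: "of_real (G s) = 2 * \<i> * (LINT \<eta>|lborel. \<Phi> \<eta> * of_real (sin (2 * pi * s * (\<eta> \<bullet> v))))" if s: "s > 0" for s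
      proof -
        have int: "integrable lborel (\<lambda>\<eta>. \<Phi> \<eta> * cis (2 * pi * s * (\<eta> \<bullet> v)))" for s
          by (rule integrable_cis_mult[OF \<Phi>]) measurable
        have "of_real (G s) = F s - F (- s)" using F_neg[OF s] by (simp add: F_real G_def)
        also have "\<dots> = (LINT \<eta>|lborel. \<Phi> \<eta> * cis (2 * pi * s * (\<eta> \<bullet> v)) - \<Phi> \<eta> * cis (2 * pi * (- s) * (\<eta> \<bullet> v)))"
          unfolding F_FT by (rule Bochner_Integration.integral_diff[symmetric]) (rule int)+
        also have "\<dots> = (LINT \<eta>|lborel. 2 * \<i> * (\<Phi> \<eta> * of_real (sin (2 * pi * s * (\<eta> \<bullet> v)))))"
          by (rule Bochner_Integration.integral_cong) (auto simp: complex_eq_iff algebra_simps)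
        finally show ?thesis by simp
      qed
      have tens: "integrable (lborel \<Otimes>\<^sub>M lborel) (\<lambda>(s, \<eta>). k m s * \<Phi> \<eta> * of_real (sin (2 * pi * s * (\<eta> \<bullet> v))))"
        by (rule integrable_tensor[OF ki[OF m] \<Phi>]) auto
      have "complex_of_real (LINT s|lborel. indicator {1 / real m .. real m} s / s * G s) = (LINT s|lborel. k m s * of_real (G s))"
        unfolding k_def of_real_mult[symmetric] by (rule integral_complex_of_real[symmetric])
      also have "\<dots> = (LINT s|lborel. 2 * \<i> * (LINT \<eta>|lborel. k m s * \<Phi> \<eta> * of_real (sin (2 * pi * s * (\<eta> \<bullet> v)))))"
      proof (rule Bochner_Integration.integral_cong[OF refl])
        fix s :: real
        show "k m s * of_real (G s) = 2 * \<i> * (LINT \<eta>|lborel. k m s * \<Phi> \<eta> * of_real (sin (2 * pi * s * (\<eta> \<bullet> v))))"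
        proof (cases "s > 0")
          case True
          have "(LINT \<eta>|lborel. k m s * \<Phi> \<eta> * of_real (sin (2 * pi * s * (\<eta> \<bullet> v)))) =
              k m s * (LINT \<eta>|lborel. \<Phi> \<eta> * of_real (sin (2 * pi * s * (\<eta> \<bullet> v))))"
            unfolding mult.assoc[of "k m s"] by (rule integral_mult_right_zero)
          then show ?thesis unfolding W[OF True] by (simp only: mult_ac)
        next
          case False
          have "0 < 1 / real m" using m by simp
          then have "s \<notin> {1 / real m .. real m}" using False by (meson atLeastAtMost_iff less_le_trans)
          then have "k m s = 0" by (simp add: k_def)
          then show ?thesis by simp
        qed
      qed
      also have "\<dots> = 2 * \<i> * (LINT s|lborel. LINT \<eta>|lborel. k m s * \<Phi> \<eta> * of_real (sin (2 * pi * s * (\<eta> \<bullet> v))))"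
        by (rule integral_mult_right_zero)
      also have "(LINT s|lborel. LINT \<eta>|lborel. k m s * \<Phi> \<eta> * of_real (sin (2 * pi * s * (\<eta> \<bullet> v))))
         = (LINT \<eta>|lborel. LINT s|lborel. k m s * \<Phi> \<eta> * of_real (sin (2 * pi * s * (\<eta> \<bullet> v))))"
        by (rule lborel_pair.Fubini_integral[OF tens, symmetric])
      also have "\<dots> = (LINT \<eta>|lborel. \<Phi> \<eta> * of_real (H m (\<eta> \<bullet> v)))"
      proof (rule Bochner_Integration.integral_cong[OF refl])
        fix \<eta> :: 'a
        have "(LINT s|lborel. k m s * \<Phi> \<eta> * of_real (sin (2 * pi * s * (\<eta> \<bullet> v))))
          = (LINT s|lborel. \<Phi> \<eta> * complex_of_real (indicator {1 / real m .. real m} s / s * sin (2 * pi * s * (\<eta> \<bullet> v))))"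
          by (rule Bochner_Integration.integral_cong) (auto simp: k_def mult_ac)
        also have "\<dots> = \<Phi> \<eta> * complex_of_real (LINT s|lborel. indicator {1 / real m .. real m} s / s * sin (2 * pi * s * (\<eta> \<bullet> v)))"
          unfolding integral_mult_right_zero integral_complex_of_real ..
        finally show "(LINT s|lborel. k m s * \<Phi> \<eta> * of_real (sin (2 * pi * s * (\<eta> \<bullet> v)))) = \<Phi> \<eta> * of_real (H m (\<eta> \<bullet> v))"
          unfolding truncated_sine_integral[OF m] H_def .
      qed
      finally have eq: "complex_of_real (LINT s|lborel. indicator {1 / real m .. real m} s / s * G s) =
          2 * \<i> * (LINT \<eta>|lborel. \<Phi> \<eta> * of_real (H m (\<eta> \<bullet> v)))" .
      have "0 \<le> (LINT s|lborel. indicator {1 / real m .. real m} s / s * G s)"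
      proof (rule integral_nonneg_AE, rule AE_I2)
        fix s :: real
        show "0 \<le> indicator {1 / real m .. real m} s / s * G s"
        proof (cases "s > 0")
          case False
          have "0 < 1 / real m" using m by simp
          then have "s \<notin> {1 / real m .. real m}" using False by (meson atLeastAtMost_iff less_le_trans)
          then show ?thesis by simp
        qed (simp add: G_def)
      qed
      then show ?thesis using arg_cong[OF eq, of norm] by (simp add: norm_mult)
    qed
    \<comment> \<open>For m \<ge> 3 the truncation interval contains \<open>{1..3}\<close>, so the
      truncated kernel is at least 1/3 on the support of \<open>G\<close>.\<close>
    have ev: "measure lborel R' / 3 \<le> norm (2 * (LINT \<eta>|lborel. \<Phi> \<eta> * of_real (H m (\<eta> \<bullet> v))))" if m: "m \<ge> 3" for m
    proof -
      have sub: "1 / real m \<le> 1" "3 \<le> real m" using m by auto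
      have le: "G s / 3 \<le> indicator {1 / real m .. real m} s / s * G s" for s
      proof (cases "s \<in> {1..3}")
        case True
        then have "s \<in> {1 / real m .. real m}" using sub unfolding atLeastAtMost_iff by linarith
        then have "indicator {1 / real m .. real m} s / s * G s = G s / s" by simp
        moreover have "G s / 3 \<le> G s / s" using True by (intro divide_left_mono) (auto simp: G_def)
        ultimately show ?thesis by (simp only:)
      qed (simp add: G0)
      have i2: "integrable lborel (\<lambda>s. indicator {1 / real m .. real m} s / s * G s)"
      proof (rule Bochner_Integration.integrable_bound[OF Gi])
        show "AE s in lborel. norm (indicator {1 / real m .. real m} s / s * G s) \<le> norm (G s)"
        proof (rule AE_I2)
          fix s
          show "norm (indicator {1 / real m .. real m} s / s * G s) \<le> norm (G s)"
          proof (cases "s \<in> {1..3}")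
            case True
            then have "\<bar>indicator {1 / real m .. real m} s / s\<bar> \<le> 1" by (auto simp: indicator_def)
            from mult_right_mono[OF this abs_ge_zero[of "G s"]] show ?thesis
              unfolding real_norm_def abs_mult by (simp only: mult_1_left)
          qed (simp add: G0)
        qed
      qed measurable
      have "measure lborel R' / 3 = (LINT s|lborel. G s / 3)" using G_int by simp
      also have "\<dots> \<le> (LINT s|lborel. indicator {1 / real m .. real m} s / s * G s)"
        by (rule integral_mono[OF _ i2 le]) (use Gi in simp)
      finally show ?thesis using main[of m] m by simp
    qed
    obtain Bd where Bd: "\<And>T. \<bar>Si T\<bar> \<le> Bd" using bounded_Si by blast
    have "(\<lambda>m. LINT \<eta>|lborel. \<Phi> \<eta> * of_real (H m (\<eta> \<bullet> v))) \<longlonglongrightarrow> (LINT \<eta>|lborel. \<Phi> \<eta> * of_real (pi / 2 * sgn (\<eta> \<bullet> v)))"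
    proof (rule integral_dominated_convergence[where w="\<lambda>\<eta>. norm (\<Phi> \<eta>) * (2 * Bd)"])
      show "integrable lborel (\<lambda>\<eta>. norm (\<Phi> \<eta>) * (2 * Bd))" using \<Phi> by simp
      show "AE \<eta> in lborel. (\<lambda>m. \<Phi> \<eta> * of_real (H m (\<eta> \<bullet> v))) \<longlonglongrightarrow> \<Phi> \<eta> * of_real (pi / 2 * sgn (\<eta> \<bullet> v))"
        unfolding H_def by (intro AE_I2 tendsto_intros Si_tendsto_sgn)
      show "AE \<eta> in lborel. norm (\<Phi> \<eta> * of_real (H m (\<eta> \<bullet> v))) \<le> norm (\<Phi> \<eta>) * (2 * Bd)" for m
      proof (rule AE_I2)
        fix \<eta>
        have "\<bar>H m (\<eta> \<bullet> v)\<bar> \<le> 2 * Bd"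
          unfolding H_def using Bd[of "2 * pi * (\<eta> \<bullet> v) * real m"] Bd[of "2 * pi * (\<eta> \<bullet> v) / real m"] by linarith
        then show "norm (\<Phi> \<eta> * of_real (H m (\<eta> \<bullet> v))) \<le> norm (\<Phi> \<eta>) * (2 * Bd)"
          by (simp add: norm_mult mult_left_mono)
      qed
    qed measurable
    also have "(LINT \<eta>|lborel. \<Phi> \<eta> * of_real (pi / 2 * sgn (\<eta> \<bullet> v))) = of_real (pi / 2) * S"
      unfolding S_def integral_mult_right_zero[symmetric]
      by (rule Bochner_Integration.integral_cong) (auto simp: mult_ac)
    finally have "(\<lambda>m. norm (2 * (LINT \<eta>|lborel. \<Phi> \<eta> * of_real (H m (\<eta> \<bullet> v))))) \<longlonglongrightarrow> norm (2 * (of_real (pi / 2) * S))"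
      by (intro tendsto_intros)
    then have "measure lborel R' / 3 \<le> norm (2 * (of_real (pi / 2) * S))"
      by (rule LIMSEQ_le_const) (use ev in blast)
    then show ?thesis by (simp add: norm_mult)
  qed
  \<comment> \<open>The boundary hyperplane is a null set; off it the indicator equals half of 1
    plus the sign.\<close>
  have "AE \<eta> in lborel. \<eta> \<bullet> v \<noteq> 0"
  proof -
    have "{\<eta>. v \<bullet> \<eta> = 0} \<in> null_sets lebesgue"
      using negligible_hyperplane[of v 0] v0 by (simp add: negligible_iff_null_sets)
    then have "AE \<eta> in lebesgue. \<eta> \<notin> {\<eta>. v \<bullet> \<eta> = 0}" by (rule AE_not_in)
    then show ?thesis by (simp add: AE_lebesgue_iff inner_commute)
  qed
  then have "AE \<eta> in lborel. indicator {\<eta>. \<eta> \<bullet> v > 0} \<eta> * \<Phi> \<eta> = (1/2) * (\<Phi> \<eta> + \<Phi> \<eta> * of_real (sgn (\<eta> \<bullet> v)))"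
    by eventually_elim (auto simp: indicator_def sgn_if)
  then have "(LINT \<eta>|lborel. indicator {\<eta>. \<eta> \<bullet> v > 0} \<eta> * \<Phi> \<eta>) = (LINT \<eta>|lborel. (1/2) * (\<Phi> \<eta> + \<Phi> \<eta> * of_real (sgn (\<eta> \<bullet> v))))"
    by (intro integral_cong_AE) auto
  also have "\<dots> = (1/2) * ((LINT \<eta>|lborel. \<Phi> \<eta>) + S)"
  proof -
    have "integrable lborel (\<lambda>\<eta>. \<Phi> \<eta> * of_real (sgn (\<eta> \<bullet> v)))"
      by (rule Bochner_Integration.integrable_bound[OF \<Phi>]) (auto simp: norm_mult sgn_if)
    then show ?thesis unfolding S_def using \<Phi> by simp
  qed
  \<comment> \<open>The constant half of the indicator contributes the overlap of \<open>R\<close>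
    and \<open>R'\<close>, which is empty since their \<open>p1\<close>-ranges are disjoint.\<close>
  also have "(LINT \<eta>|lborel. \<Phi> \<eta>) = F 0" unfolding F_FT by simp
  also have "F 0 = 0"
    unfolding F_eq by (rule integral_eq_zero_AE) (use R' in \<open>fastforce simp: indicator_def\<close>)
  finally have nrm: "norm (LINT \<eta>|lborel. indicator {\<eta>. \<eta> \<bullet> v > 0} \<eta> * \<Phi> \<eta>) = norm S / 2"
    by (simp only: norm_mult add_0_left) simp
  show "measure lborel R' / (6 * pi) \<le> norm (LINT \<eta>|lborel. indicator {\<eta>. \<eta> \<bullet> v > 0} \<eta> * \<Phi> \<eta>)"
    unfolding nrm using lower by (simp add: field_simps)
qed

subsection \<open>Comparison of Lebesgue norms on sets of finite measure\<close>

text \<open>Below the height L the first term dominates, above it the larger exponent does. With L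
  free this plays the role of Hoelder's inequality: tuned to a norm it gives boundedness, taken
  large or small it gives smallness.\<close>

lemma powr_interpolate:
  fixes x L s r :: real
  assumes "0 \<le> x" "0 < L" "0 < s" "s \<le> r"
  shows "x powr s \<le> L powr s + L powr (s - r) * x powr r"
proof (cases "x \<le> L")
  case True
  then have "x powr s \<le> L powr s" using assms by (intro powr_mono2) auto
  then show ?thesis by (simp add: add_increasing2)
next
  case False
  then have "x powr s = x powr (s - r) * x powr r" using assms by (simp add: powr_add[symmetric])
  also have "\<dots> \<le> L powr (s - r) * x powr r"
    using assms False by (intro mult_right_mono powr_mono2') auto
  finally show ?thesis by (simp add: add_increasing)
qed

lemma nn_integral_powr_interpolate:
  fixes g :: "'a \<Rightarrow> complex"
  assumes [measurable]: "g \<in> borel_measurable M" "B \<in> sets M" and "0 < L" "0 < s" "s \<le> r"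
  shows "(\<integral>\<^sup>+x. ennreal (norm (g x) powr s) * indicator B x \<partial>M) \<le>
    ennreal (L powr s) * emeasure M B + ennreal (L powr (s - r)) * (\<integral>\<^sup>+x. ennreal (norm (g x) powr r) \<partial>M)"
proof -
  have "(\<integral>\<^sup>+x. ennreal (norm (g x) powr s) * indicator B x \<partial>M) \<le>
      (\<integral>\<^sup>+x. ennreal (L powr s) * indicator B x + ennreal (L powr (s - r)) * ennreal (norm (g x) powr r) \<partial>M)"
  proof (rule nn_integral_mono)
    fix x
    have "ennreal (norm (g x) powr s) \<le> ennreal (L powr s + L powr (s - r) * norm (g x) powr r)"
      using powr_interpolate[of "norm (g x)" L s r] assms by (intro ennreal_leI) auto
    then show "ennreal (norm (g x) powr s) * indicator B x \<le> ennreal (L powr s) * indicator B x + ennreal (L powr (s - r)) * ennreal (norm (g x) powr r)"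
      by (cases "x \<in> B") (simp_all add: ennreal_plus ennreal_mult)
  qed
  also have "\<dots> = ennreal (L powr s) * emeasure M B + ennreal (L powr (s - r)) * (\<integral>\<^sup>+x. ennreal (norm (g x) powr r) \<partial>M)"
    by (subst nn_integral_add) (auto simp: nn_integral_cmult)
  finally show ?thesis .
qed

lemma Lp_norm_finite_le_iff:
  fixes f :: "'a::euclidean_space \<Rightarrow> complex"
  assumes P: "P > 0" and A: "A \<ge> 0"
  shows "Lp_norm (ennreal P) f \<le> ennreal A \<longleftrightarrow> (\<integral>\<^sup>+x. ennreal (norm (f x) powr P) \<partial>lebesgue) \<le> ennreal (A powr P)"
proof -
  define I where "I = (\<integral>\<^sup>+x. ennreal (norm (f x) powr P) \<partial>lebesgue)"
  have n: "Lp_norm (ennreal P) f = (if I = \<infinity> then \<infinity> else ennreal (enn2real I powr (1 / P)))"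
    using P by (simp add: Lp_norm_def I_def Let_def)
  show ?thesis
  proof (cases "I = \<infinity>")
    case True
    then show ?thesis unfolding n I_def[symmetric] by (auto simp: top_unique)
  next
    case False
    then obtain i where i: "I = ennreal i" "i \<ge> 0" by (cases I) auto
    have "i powr (1 / P) \<le> A \<longleftrightarrow> i \<le> A powr P"
    proof
      assume "i powr (1 / P) \<le> A"
      then have "(i powr (1 / P)) powr P \<le> A powr P" using P by (intro powr_mono2) auto
      then show "i \<le> A powr P" using P i by (simp add: powr_powr)
    next
      assume "i \<le> A powr P"
      then have "i powr (1 / P) \<le> (A powr P) powr (1 / P)" using P i by (intro powr_mono2) auto
      then show "i powr (1 / P) \<le> A" using P A by (simp add: powr_powr)
    qed
    then show ?thesis unfolding n I_def[symmetric] using i A by simp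
  qed
qed

lemma Lp_norm_top_le_iff:
  fixes f :: "'a::euclidean_space \<Rightarrow> complex"
  assumes [measurable]: "f \<in> borel_measurable lebesgue" and A: "A \<ge> 0"
  shows "Lp_norm top f \<le> ennreal A \<longleftrightarrow> (AE x in lebesgue. norm (f x) \<le> A)"
proof -
  have n: "Lp_norm top f = esssup lebesgue (\<lambda>x. ennreal (norm (f x)))" by (simp add: Lp_norm_def)
  show ?thesis
  proof
    assume "Lp_norm top f \<le> ennreal A"
    then have *: "esssup lebesgue (\<lambda>x. ennreal (norm (f x))) \<le> ennreal A" by (simp add: n)
    have "AE x in lebesgue. ennreal (norm (f x)) \<le> esssup lebesgue (\<lambda>x. ennreal (norm (f x)))"
      by (rule esssup_AE)
    then show "AE x in lebesgue. norm (f x) \<le> A"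
    proof eventually_elim
      case (elim x)
      then have "ennreal (norm (f x)) \<le> ennreal A" using * by (rule order_trans)
      then show ?case using A by simp
    qed
  next
    assume "AE x in lebesgue. norm (f x) \<le> A"
    then have "AE x in lebesgue. ennreal (norm (f x)) \<le> ennreal A"
      by eventually_elim (rule ennreal_leI)
    then show "Lp_norm top f \<le> ennreal A" unfolding n by (intro esssup_I) measurable
  qed
qed

lemma ennreal_exponent_cases:
  assumes "1 \<le> (p::ennreal)"
  obtains "p = top" | P where "p = ennreal P" "P \<ge> 1"
  using assms by (cases p) (auto simp: ennreal_1[symmetric] simp del: ennreal_1)

lemma nn_integral_indicator_norm2:
  assumes "f \<in> L2 lebesgue" "E \<in> sets lebesgue"
  shows "(\<integral>\<^sup>+x. ennreal (norm (f x) powr 2) * indicator E x \<partial>lebesgue) = ennreal (sqnorm lebesgue (\<lambda>x. indicator E x * f x))"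
proof -
  have "(\<integral>\<^sup>+x. ennreal (norm (f x) powr 2) * indicator E x \<partial>lebesgue) = (\<integral>\<^sup>+x. ennreal ((norm (indicator E x * f x))\<^sup>2) \<partial>lebesgue)"
    by (rule nn_integral_cong) (auto simp: indicator_def)
  then show ?thesis using nn_integral_L2[OF L2_indicator_mult[OF assms]] by simp
qed

text \<open>At the height L = \<open>norm2 lebesgue g\<close> both interpolation terms are multiples
  of L^Q, with coefficients b and 1, whence the constant \<open>K\<close>. A height must be
  positive, so norm 0 is treated apart.\<close>

lemma Lp_norm_le_norm2:
  fixes B :: "'a::euclidean_space set"
  assumes q: "1 \<le> q" "q \<le> 2" and B: "B \<in> sets lebesgue" "emeasure lebesgue B < \<infinity>"
  shows "\<exists>K\<ge>0. \<forall>g\<in>L2 lebesgue. Lp_norm q (\<lambda>x. indicator B x * g x) \<le> ennreal (K * norm2 lebesgue g)"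
proof -
  have "q \<noteq> top" using q by (auto simp: top_unique)
  obtain Q where Q: "q = ennreal Q" "Q \<ge> 1" by (rule ennreal_exponent_cases[OF q(1)]) (use \<open>q \<noteq> top\<close> in auto)
  have Q2: "Q \<le> 2" using q(2) Q by (simp flip: ennreal_numeral)
  define b where "b = measure lebesgue B"
  have b: "emeasure lebesgue B = ennreal b" using B by (simp add: b_def emeasure_eq_ennreal_measure)
  have b0: "b \<ge> 0" by (simp add: b_def)
  define K where "K = (b + 1) powr (1 / Q)"
  have KQ: "K powr Q = b + 1" using Q b0 by (simp add: K_def powr_powr)
  show ?thesis
  proof (rule exI[of _ K], intro conjI ballI)
    show "K \<ge> 0" by (simp add: K_def)
    fix g :: "'a \<Rightarrow> complex" assume g: "g \<in> L2 lebesgue"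
    define L where "L = norm2 lebesgue g"
    have L0: "L \<ge> 0" by (simp add: L_def)
    have eq: "(\<integral>\<^sup>+x. ennreal (norm (indicator B x * g x) powr Q) \<partial>lebesgue) = (\<integral>\<^sup>+x. ennreal (norm (g x) powr Q) * indicator B x \<partial>lebesgue)"
      by (rule nn_integral_cong) (use Q in \<open>auto simp: indicator_def\<close>)
    have "(\<integral>\<^sup>+x. ennreal (norm (g x) powr Q) * indicator B x \<partial>lebesgue) \<le> ennreal ((K * L) powr Q)"
    proof (cases "L = 0")
      case True
      then have "AE x in lebesgue. g x = 0" using sqnorm_zero_AE[OF g] by (simp add: L_def norm2_def)
      then have "(\<integral>\<^sup>+x. ennreal (norm (g x) powr Q) * indicator B x \<partial>lebesgue) = (\<integral>\<^sup>+x. 0 \<partial>(lebesgue :: 'a measure))"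
        by (intro nn_integral_cong_AE) (auto elim!: eventually_mono)
      then show ?thesis by simp
    next
      case False
      then have L: "L > 0" using L0 by simp
      have "(\<integral>\<^sup>+x. ennreal (norm (g x) powr 2) \<partial>lebesgue) = ennreal (L\<^sup>2)"
        using nn_integral_L2[OF g] by (simp add: L_def norm2_power2)
      then have "(\<integral>\<^sup>+x. ennreal (norm (g x) powr Q) * indicator B x \<partial>lebesgue) \<le> ennreal (L powr Q) * ennreal b + ennreal (L powr (Q - 2)) * ennreal (L\<^sup>2)"
        using nn_integral_powr_interpolate[OF L2_meas[OF g] B(1) L, of Q 2] Q Q2 by (simp add: b)
      also have "\<dots> = ennreal (L powr Q * b + L powr (Q - 2) * L\<^sup>2)"
        using b0 by (simp add: ennreal_mult ennreal_plus)
      also have "L powr (Q - 2) * L\<^sup>2 = L powr Q" using L by (simp add: powr_diff)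
      also have "L powr Q * b + L powr Q = (K * L) powr Q"
        using L by (simp add: powr_mult KQ K_def[symmetric] algebra_simps)
      finally show ?thesis .
    qed
    then show "Lp_norm q (\<lambda>x. indicator B x * g x) \<le> ennreal (K * norm2 lebesgue g)"
      unfolding Q(1) L_def[symmetric] using Q L0 by (subst Lp_norm_finite_le_iff) (auto simp: eq K_def)
  qed
qed

text \<open>Interpolation between the exponents 2 and P at the height A, which again makes both
  terms multiples of A^2, with coefficients b and 1.\<close>

lemma norm2_le_Lp_norm:
  fixes B :: "'a::euclidean_space set"
  assumes p: "2 \<le> p" and B: "B \<in> sets lebesgue" "emeasure lebesgue B < \<infinity>"
  shows "\<exists>K\<ge>0. \<forall>f A. f \<in> borel_measurable lebesgue \<longrightarrow> (\<lambda>x. f x * indicator B x) \<in> L2 lebesgue \<longrightarrow> A \<ge> 0 \<longrightarrow>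
    Lp_norm p f \<le> ennreal A \<longrightarrow> norm2 lebesgue (\<lambda>x. f x * indicator B x) \<le> K * A"
proof -
  define b where "b = measure lebesgue B"
  have b: "emeasure lebesgue B = ennreal b" using B by (simp add: b_def emeasure_eq_ennreal_measure)
  have b0: "b \<ge> 0" by (simp add: b_def)
  have "1 \<le> p" using p by (metis one_le_numeral order_trans)
  show ?thesis
  proof (rule exI[of _ "sqrt (b + 1)"], intro conjI allI impI)
    show "sqrt (b + 1) \<ge> 0" using b0 by simp
    fix f :: "'a \<Rightarrow> complex" and A :: real
    assume fm: "f \<in> borel_measurable lebesgue" and fB: "(\<lambda>x. f x * indicator B x) \<in> L2 lebesgue" and A: "A \<ge> 0"
      and f: "Lp_norm p f \<le> ennreal A"
    have eq: "ennreal (sqnorm lebesgue (\<lambda>x. f x * indicator B x)) = (\<integral>\<^sup>+x. ennreal (norm (f x) powr 2) * indicator B x \<partial>lebesgue)"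
      unfolding nn_integral_L2[OF fB, symmetric] by (rule nn_integral_cong) (auto simp: indicator_def)
    have "(\<integral>\<^sup>+x. ennreal (norm (f x) powr 2) * indicator B x \<partial>lebesgue) \<le> ennreal (A\<^sup>2 * (b + 1))"
    proof (cases rule: ennreal_exponent_cases[OF \<open>1 \<le> p\<close>])
      case 1
      then have "AE x in lebesgue. norm (f x) \<le> A" using f fm A by (simp add: Lp_norm_top_le_iff)
      then have "(\<integral>\<^sup>+x. ennreal (norm (f x) powr 2) * indicator B x \<partial>lebesgue) \<le> (\<integral>\<^sup>+x. ennreal (A\<^sup>2) * indicator B x \<partial>lebesgue)"
        by (intro nn_integral_mono_AE) (auto elim!: eventually_mono intro!: mult_right_mono ennreal_leI power_mono)
      also have "\<dots> = ennreal (A\<^sup>2 * b)" using B by (simp add: nn_integral_cmult_indicator b ennreal_mult b0)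
      also have "\<dots> \<le> ennreal (A\<^sup>2 * (b + 1))" by (intro ennreal_leI mult_left_mono) auto
      finally show ?thesis .
    next
      case (2 P)
      then have P2: "P \<ge> 2" using p by (simp flip: ennreal_numeral)
      have I: "(\<integral>\<^sup>+x. ennreal (norm (f x) powr P) \<partial>lebesgue) \<le> ennreal (A powr P)"
        using f P2 A unfolding 2(1) by (simp add: Lp_norm_finite_le_iff)
      show ?thesis
      proof (cases "A = 0")
        case True
        then have "(\<integral>\<^sup>+x. ennreal (norm (f x) powr P) \<partial>lebesgue) = 0" using I by simp
        moreover have "(\<lambda>x. ennreal (norm (f x) powr P)) \<in> borel_measurable lebesgue" using fm by measurable
        ultimately have "AE x in lebesgue. ennreal (norm (f x) powr P) = 0" by (simp add: nn_integral_0_iff_AE)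
        then have "AE x in lebesgue. f x = 0" by eventually_elim simp
        then have "(\<integral>\<^sup>+x. ennreal (norm (f x) powr 2) * indicator B x \<partial>lebesgue) = (\<integral>\<^sup>+x. 0 \<partial>(lebesgue :: 'a measure))"
          by (intro nn_integral_cong_AE) (auto elim!: eventually_mono)
        then show ?thesis by simp
      next
        case False
        then have A': "A > 0" using A by simp
        have "(\<integral>\<^sup>+x. ennreal (norm (f x) powr 2) * indicator B x \<partial>lebesgue) \<le>
            ennreal (A powr 2) * ennreal b + ennreal (A powr (2 - P)) * (\<integral>\<^sup>+x. ennreal (norm (f x) powr P) \<partial>lebesgue)"
          using nn_integral_powr_interpolate[OF fm B(1) A', of 2 P] P2 by (simp add: b)
        also have "\<dots> \<le> ennreal (A powr 2) * ennreal b + ennreal (A powr (2 - P)) * ennreal (A powr P)"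
          by (intro add_left_mono mult_left_mono I) auto
        also have "\<dots> = ennreal (A powr 2 * b + A powr (2 - P) * A powr P)"
          using b0 by (simp add: ennreal_mult ennreal_plus)
        also have "A powr (2 - P) * A powr P = A powr 2" using A' by (simp add: powr_add[symmetric])
        finally show ?thesis using A' by (simp add: algebra_simps)
      qed
    qed
    then have "sqnorm lebesgue (\<lambda>x. f x * indicator B x) \<le> A\<^sup>2 * (b + 1)"
      unfolding eq[symmetric] using b0 by simp
    then have "norm2 lebesgue (\<lambda>x. f x * indicator B x) \<le> sqrt (A\<^sup>2 * (b + 1))"
      unfolding norm2_def by (rule real_sqrt_le_mono)
    then show "norm2 lebesgue (\<lambda>x. f x * indicator B x) \<le> sqrt (b + 1) * A"
      using A by (simp add: real_sqrt_mult mult.commute)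
  qed
qed

lemma exists_powr_small:
  assumes "e > 0" "r > (0::real)" shows "\<exists>L>0. L powr (- r) * c < (e::real)"
proof -
  have "((\<lambda>L. L powr (- r) * c) \<longlongrightarrow> 0 * c) at_top"
    by (intro tendsto_intros tendsto_neg_powr) (use assms in \<open>auto intro: filterlim_ident\<close>)
  then have "\<forall>\<^sub>F L in at_top. L powr (- r) * c < e" using assms by (intro order_tendstoD) auto
  then have "\<forall>\<^sub>F L in at_top. 0 < L \<and> L powr (- r) * c < e"
    using eventually_gt_at_top[of 0] by eventually_elim simp
  then show ?thesis by (auto simp: eventually_at_top_linorder)
qed

text \<open>For finite q, L is first taken so large that the values above it contribute less than
  k/2, using only the bound A; then \<epsilon> = k/(2 L^2) controls the values below L on
  \<open>E\<close>. Both choices are uniform in \<open>g\<close> and \<open>E\<close>.\<close>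

lemma Lp_bound_imp_small_norm2:
  assumes q: "2 < q" and A: "A \<ge> 0" and k: "k > 0"
  shows "\<exists>\<epsilon>>0. \<forall>(g :: 'a::euclidean_space \<Rightarrow> complex) E. g \<in> L2 lebesgue \<longrightarrow> Lp_norm q g \<le> ennreal A \<longrightarrow>
    E \<in> sets lebesgue \<longrightarrow> emeasure lebesgue E \<le> ennreal \<epsilon> \<longrightarrow> sqnorm lebesgue (\<lambda>x. indicator E x * g x) < k"
proof -
  have "1 \<le> q" using q by (metis less_imp_le one_le_numeral order_trans)
  then show ?thesis
  proof (cases rule: ennreal_exponent_cases)
    case 1
    show ?thesis
    proof (rule exI[of _ "k / (2 * (A\<^sup>2 + 1))"], intro conjI allI impI)
      show pos: "k / (2 * (A\<^sup>2 + 1)) > 0" using k by (simp add: add_nonneg_pos)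
      fix g :: "'a \<Rightarrow> complex" and E :: "'a set"
      assume g: "g \<in> L2 lebesgue" "Lp_norm q g \<le> ennreal A" and E: "E \<in> sets lebesgue" "emeasure lebesgue E \<le> ennreal (k / (2 * (A\<^sup>2 + 1)))"
      have "AE x in lebesgue. norm (g x) \<le> A" using g 1 A by (simp add: Lp_norm_top_le_iff L2_meas)
      then have "(\<integral>\<^sup>+x. ennreal (norm (g x) powr 2) * indicator E x \<partial>lebesgue) \<le> (\<integral>\<^sup>+x. ennreal (A\<^sup>2) * indicator E x \<partial>lebesgue)"
        by (intro nn_integral_mono_AE) (auto elim!: eventually_mono intro!: mult_right_mono ennreal_leI power_mono)
      also have "\<dots> = ennreal (A\<^sup>2) * emeasure lebesgue E" using E by (simp add: nn_integral_cmult_indicator)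
      also have "\<dots> \<le> ennreal (A\<^sup>2) * ennreal (k / (2 * (A\<^sup>2 + 1)))" by (intro mult_left_mono E) auto
      also have "\<dots> = ennreal (A\<^sup>2 * (k / (2 * (A\<^sup>2 + 1))))"
        by (rule ennreal_mult[symmetric]) (simp, rule less_imp_le[OF pos])
      finally have "sqnorm lebesgue (\<lambda>x. indicator E x * g x) \<le> A\<^sup>2 * (k / (2 * (A\<^sup>2 + 1)))"
        unfolding nn_integral_indicator_norm2[OF g(1) E(1)]
        by (simp only: ennreal_le_iff[OF mult_nonneg_nonneg[OF zero_le_power2 less_imp_le[OF pos]]])
      also have "\<dots> < k"
      proof -
        have "A\<^sup>2 * k < k * (2 * (A\<^sup>2 + 1))" using k by (simp add: algebra_simps add_pos_nonneg)
        moreover have "0 < 2 * (A\<^sup>2 + 1)" by (simp add: add_nonneg_pos)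
        ultimately show ?thesis by (simp add: divide_less_eq)
      qed
      finally show "sqnorm lebesgue (\<lambda>x. indicator E x * g x) < k" .
    qed
  next
    case (2 Q)
    then have Q: "Q > 2" using q by (simp add: ennreal_less_iff flip: ennreal_numeral)
    obtain L where L: "L > 0" "L powr (- (Q - 2)) * A powr Q < k / 2"
      using exists_powr_small[of "k / 2" "Q - 2" "A powr Q"] k Q by auto
    show ?thesis
    proof (rule exI[of _ "k / (2 * L\<^sup>2)"], intro conjI allI impI)
      show pos: "k / (2 * L\<^sup>2) > 0" using k L by simp
      fix g :: "'a \<Rightarrow> complex" and E :: "'a set"
      assume g: "g \<in> L2 lebesgue" "Lp_norm q g \<le> ennreal A" and E: "E \<in> sets lebesgue" "emeasure lebesgue E \<le> ennreal (k / (2 * L\<^sup>2))"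
      have I: "(\<integral>\<^sup>+x. ennreal (norm (g x) powr Q) \<partial>lebesgue) \<le> ennreal (A powr Q)"
        using g Q A unfolding 2(1) by (simp add: Lp_norm_finite_le_iff)
      have "(\<integral>\<^sup>+x. ennreal (norm (g x) powr 2) * indicator E x \<partial>lebesgue) \<le>
          ennreal (L powr 2) * emeasure lebesgue E + ennreal (L powr (2 - Q)) * (\<integral>\<^sup>+x. ennreal (norm (g x) powr Q) \<partial>lebesgue)"
        using nn_integral_powr_interpolate[OF L2_meas[OF g(1)] E(1) L(1), of 2 Q] Q by simp
      also have "\<dots> \<le> ennreal (L\<^sup>2) * ennreal (k / (2 * L\<^sup>2)) + ennreal (L powr (2 - Q)) * ennreal (A powr Q)"
        using L by (intro add_mono mult_mono E I) auto
      also have "\<dots> = ennreal (L\<^sup>2 * (k / (2 * L\<^sup>2)) + L powr (2 - Q) * A powr Q)"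
      proof -
        have "L\<^sup>2 * (k / (2 * L\<^sup>2)) \<ge> 0" "L powr (2 - Q) * A powr Q \<ge> 0"
          using pos k by (auto intro!: mult_nonneg_nonneg)
        then show ?thesis using less_imp_le[OF pos] by (simp only: ennreal_plus ennreal_mult zero_le_power2 powr_ge_zero)
      qed
      finally have "sqnorm lebesgue (\<lambda>x. indicator E x * g x) \<le> L\<^sup>2 * (k / (2 * L\<^sup>2)) + L powr (2 - Q) * A powr Q"
        unfolding nn_integral_indicator_norm2[OF g(1) E(1)]
        by (simp only: ennreal_le_iff[OF add_nonneg_nonneg[OF mult_nonneg_nonneg[OF zero_le_power2 less_imp_le[OF pos]]
          mult_nonneg_nonneg[OF powr_ge_zero powr_ge_zero]]])
      also have "\<dots> < k" using L by simp
      finally show "sqnorm lebesgue (\<lambda>x. indicator E x * g x) < k" .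
    qed
  qed
qed

text \<open>The dual estimate, with the exponent 2 now the larger one: a high L makes the values
  above it negligible by the quadratic bound, and a small support handles the rest.\<close>

lemma small_support_imp_small_Lp_norm:
  assumes p: "1 \<le> p" "p < 2" and A: "A \<ge> 0" and k: "k > 0"
  shows "\<exists>\<epsilon>>0. \<forall>(g :: 'a::euclidean_space \<Rightarrow> complex) E. g \<in> L2 lebesgue \<longrightarrow> sqnorm lebesgue g \<le> A \<longrightarrow>
    E \<in> sets lebesgue \<longrightarrow> emeasure lebesgue E \<le> ennreal \<epsilon> \<longrightarrow> Lp_norm p (\<lambda>x. indicator E x * g x) \<le> ennreal k"
proof -
  have "p \<noteq> top" using p by auto
  obtain P where P: "p = ennreal P" "P \<ge> 1" by (rule ennreal_exponent_cases[OF p(1)]) (use \<open>p \<noteq> top\<close> in auto)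
  have P2: "P < 2" using p(2) P by (simp add: ennreal_less_iff flip: ennreal_numeral)
  have kP: "k powr P > 0" using k by simp
  obtain L where L: "L > 0" "L powr (- (2 - P)) * A < k powr P / 2"
    using exists_powr_small[of "k powr P / 2" "2 - P" A] kP P2 by auto
  show ?thesis
  proof (rule exI[of _ "k powr P / (2 * L powr P)"], intro conjI allI impI)
    show pos: "k powr P / (2 * L powr P) > 0" using kP L by simp
    fix g :: "'a \<Rightarrow> complex" and E :: "'a set"
    assume g: "g \<in> L2 lebesgue" "sqnorm lebesgue g \<le> A" and E: "E \<in> sets lebesgue" "emeasure lebesgue E \<le> ennreal (k powr P / (2 * L powr P))"
    have I: "(\<integral>\<^sup>+x. ennreal (norm (g x) powr 2) \<partial>lebesgue) \<le> ennreal A"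
      using nn_integral_L2[OF g(1)] g(2) by (simp add: ennreal_leI)
    have "(\<integral>\<^sup>+x. ennreal (norm (indicator E x * g x) powr P) \<partial>lebesgue) = (\<integral>\<^sup>+x. ennreal (norm (g x) powr P) * indicator E x \<partial>lebesgue)"
      by (rule nn_integral_cong) (use P in \<open>auto simp: indicator_def\<close>)
    also have "\<dots> \<le> ennreal (L powr P) * emeasure lebesgue E + ennreal (L powr (P - 2)) * (\<integral>\<^sup>+x. ennreal (norm (g x) powr 2) \<partial>lebesgue)"
      using nn_integral_powr_interpolate[OF L2_meas[OF g(1)] E(1) L(1), of P 2] P P2 by simp
    also have "\<dots> \<le> ennreal (L powr P) * ennreal (k powr P / (2 * L powr P)) + ennreal (L powr (P - 2)) * ennreal A"
      by (intro add_mono mult_mono E I) auto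
    also have "\<dots> = ennreal (L powr P * (k powr P / (2 * L powr P)) + L powr (P - 2) * A)"
      using pos A by (simp add: ennreal_mult[symmetric] less_imp_le del: ennreal_plus flip: ennreal_plus)
    also have "\<dots> \<le> ennreal (k powr P)" using L by (intro ennreal_leI) simp
    finally show "Lp_norm p (\<lambda>x. indicator E x * g x) \<le> ennreal k"
      unfolding P(1) using P k by (subst Lp_norm_finite_le_iff) auto
  qed
qed

text \<open>Here the support is fixed and the norm is small, so L is small: the values below it
  contribute at most k/2 on all of \<open>B\<close>, and the norm bound is then chosen to make the
  term L^(1-Q) t^Q equal to k/2.\<close>

lemma small_Lp_norm_imp_small_L1:
  fixes B :: "'a::euclidean_space set"
  assumes q: "1 \<le> q" and B: "B \<in> sets lebesgue" "emeasure lebesgue B < \<infinity>" and k: "k > 0"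
  shows "\<exists>\<tau>>0. \<forall>g. g \<in> borel_measurable lebesgue \<longrightarrow> Lp_norm q g \<le> ennreal \<tau> \<longrightarrow>
    (\<integral>\<^sup>+x. ennreal (norm (g x)) * indicator B x \<partial>lebesgue) \<le> ennreal k"
proof -
  define b where "b = measure lebesgue B"
  have b: "emeasure lebesgue B = ennreal b" using B by (simp add: b_def emeasure_eq_ennreal_measure)
  have b0: "b \<ge> 0" by (simp add: b_def)
  show ?thesis
    using q
  proof (cases rule: ennreal_exponent_cases)
    case 1
    show ?thesis
    proof (rule exI[of _ "k / (b + 1)"], intro conjI allI impI)
      show pos: "k / (b + 1) > 0" using k b0 by simp
      fix g :: "'a \<Rightarrow> complex" assume g: "g \<in> borel_measurable lebesgue" "Lp_norm q g \<le> ennreal (k / (b + 1))"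
      then have "AE x in lebesgue. norm (g x) \<le> k / (b + 1)" using pos unfolding 1 by (subst (asm) Lp_norm_top_le_iff) auto
      then have "(\<integral>\<^sup>+x. ennreal (norm (g x)) * indicator B x \<partial>lebesgue) \<le> (\<integral>\<^sup>+x. ennreal (k / (b + 1)) * indicator B x \<partial>lebesgue)"
        by (intro nn_integral_mono_AE) (auto elim!: eventually_mono intro!: mult_right_mono ennreal_leI)
      also have "\<dots> = ennreal (k / (b + 1) * b)" using B pos by (simp add: nn_integral_cmult_indicator b b0 less_imp_le ennreal_mult[symmetric])
      also have "\<dots> \<le> ennreal k" using k b0 by (intro ennreal_leI) (simp add: field_simps)
      finally show "(\<integral>\<^sup>+x. ennreal (norm (g x)) * indicator B x \<partial>lebesgue) \<le> ennreal k" .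
    qed
  next
    case (2 Q)
    define L where "L = k / (2 * (b + 1))"
    have L: "L > 0" using k b0 by (simp add: L_def)
    define t where "t = (k / 2 * L powr (Q - 1)) powr (1 / Q)"
    have t: "t > 0" using k L by (simp add: t_def)
    have tQ: "t powr Q = k / 2 * L powr (Q - 1)" using 2 k L by (simp add: t_def powr_powr)
    show ?thesis
    proof (rule exI[of _ t], intro conjI allI impI)
      show "t > 0" by (rule t)
      fix g :: "'a \<Rightarrow> complex" assume g: "g \<in> borel_measurable lebesgue" "Lp_norm q g \<le> ennreal t"
      have I: "(\<integral>\<^sup>+x. ennreal (norm (g x) powr Q) \<partial>lebesgue) \<le> ennreal (t powr Q)"
        using g(2) 2 t unfolding 2(1) by (subst (asm) Lp_norm_finite_le_iff) auto
      have "(\<integral>\<^sup>+x. ennreal (norm (g x)) * indicator B x \<partial>lebesgue) = (\<integral>\<^sup>+x. ennreal (norm (g x) powr 1) * indicator B x \<partial>lebesgue)"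
        by simp
      also have "\<dots> \<le> ennreal (L powr 1) * ennreal b + ennreal (L powr (1 - Q)) * (\<integral>\<^sup>+x. ennreal (norm (g x) powr Q) \<partial>lebesgue)"
        using nn_integral_powr_interpolate[OF g(1) B(1) L, of 1 Q] 2 unfolding b by simp
      also have "\<dots> \<le> ennreal (L powr 1) * ennreal b + ennreal (L powr (1 - Q)) * ennreal (t powr Q)"
        by (intro add_left_mono mult_left_mono I) auto
      also have "\<dots> = ennreal (L * b + L powr (1 - Q) * t powr Q)"
        using b0 L by (simp add: ennreal_mult[symmetric] less_imp_le del: ennreal_plus flip: ennreal_plus)
      also have "L powr (1 - Q) * t powr Q = k / 2"
      proof -
        have "L powr (1 - Q) * L powr (Q - 1) = 1" using L by (simp add: powr_add[symmetric])
        then show ?thesis unfolding tQ by (simp add: mult.left_commute)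
      qed
      also have "L * b + k / 2 \<le> k" using k b0 by (simp add: L_def field_simps)
      finally show "(\<integral>\<^sup>+x. ennreal (norm (g x)) * indicator B x \<partial>lebesgue) \<le> ennreal k"
        by (simp add: ennreal_leI)
    qed
  qed
qed

text \<open>Adding 1 makes the bound at least 1, so that a single number serves all exponents
  including \<infinity>.\<close>

lemma Lp_norm_bounded_support:
  fixes G :: "'a::euclidean_space set"
  assumes p: "1 \<le> p" and G: "G \<in> sets lebesgue" "emeasure lebesgue G < \<infinity>"
    and f: "f \<in> borel_measurable lebesgue" "\<And>x. norm (f x) \<le> indicator G x"
  shows "Lp_norm p f \<le> ennreal (measure lebesgue G + 1)"
proof -
  have g: "emeasure lebesgue G = ennreal (measure lebesgue G)" using G by (simp add: emeasure_eq_ennreal_measure)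
  show ?thesis
    using p
  proof (cases rule: ennreal_exponent_cases)
    case 1
    have "norm (f x) \<le> measure lebesgue G + 1" for x
      using f(2)[of x] by (cases "x \<in> G") (auto intro: order_trans add_nonneg_pos less_imp_le)
    then show ?thesis unfolding 1 by (subst Lp_norm_top_le_iff[OF f(1)]) auto
  next
    case (2 P)
    have "(\<integral>\<^sup>+x. ennreal (norm (f x) powr P) \<partial>lebesgue) \<le> (\<integral>\<^sup>+x. indicator G x \<partial>lebesgue)"
    proof (rule nn_integral_mono)
      fix x
      show "ennreal (norm (f x) powr P) \<le> indicator G x"
      proof (cases "x \<in> G")
        case True
        then have "norm (f x) powr P \<le> 1 powr P" using f(2)[of x] 2 by (intro powr_mono2) auto
        then show ?thesis using True by (simp add: ennreal_le_1)
      next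
        case False
        then show ?thesis using f(2)[of x] by simp
      qed
    qed
    also have "\<dots> = ennreal (measure lebesgue G)" using G g by simp
    also have "\<dots> \<le> ennreal ((measure lebesgue G + 1) powr P)"
    proof (rule ennreal_leI)
      have "measure lebesgue G \<le> (measure lebesgue G + 1) powr 1" by simp
      also have "\<dots> \<le> (measure lebesgue G + 1) powr P" using 2 by (intro powr_mono) auto
      finally show "measure lebesgue G \<le> (measure lebesgue G + 1) powr P" .
    qed
    finally show ?thesis unfolding 2(1) using 2 by (subst Lp_norm_finite_le_iff) auto
  qed
qed

subsection \<open>Test functions\<close>

text \<open>The functions are added one at a time, each with the sign that makes its cross term with
  the sum so far nonnegative; a deterministic substitute for averaging over random signs.\<close>

lemma greedy_signs:
  assumes "finite I" "\<And>i. i \<in> I \<Longrightarrow> h i \<in> L2 M"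
  shows "\<exists>\<sigma>. (\<forall>i. norm (\<sigma> i :: complex) = 1) \<and> (\<Sum>i\<in>I. sqnorm M (h i)) \<le> sqnorm M (\<lambda>x. \<Sum>i\<in>I. \<sigma> i * h i x)"
  using assms
proof (induction I)
  case empty
  then show ?case by (intro exI[of _ "\<lambda>_. 1"]) (simp add: sqnorm_def)
next
  case (insert j I)
  then obtain \<sigma> where \<sigma>: "\<And>i. norm (\<sigma> i :: complex) = 1"
    and le: "(\<Sum>i\<in>I. sqnorm M (h i)) \<le> sqnorm M (\<lambda>x. \<Sum>i\<in>I. \<sigma> i * h i x)" by auto
  define H where "H x = (\<Sum>i\<in>I. \<sigma> i * h i x)" for x
  have H: "H \<in> L2 M" unfolding H_def by (intro L2_sum L2_cmult insert.prems) auto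
  have hj: "h j \<in> L2 M" using insert by auto
  define s where "s = (if Re (ip M (h j) H) \<ge> 0 then 1 else -1 :: complex)"
  have s: "norm s = 1" by (simp add: s_def)
  have "sqnorm M (\<lambda>x. s * h j x + H x) = sqnorm M (h j) + sqnorm M H + 2 * Re (s * ip M (h j) H)"
    using s hj H by (simp add: sqnorm_add sqnorm_cmult ip_cmult_left L2_cmult)
  moreover have "Re (s * ip M (h j) H) \<ge> 0" by (auto simp: s_def)
  ultimately have "sqnorm M (h j) + (\<Sum>i\<in>I. sqnorm M (h i)) \<le> sqnorm M (\<lambda>x. s * h j x + H x)"
    using le[folded H_def] by linarith
  moreover have "(\<lambda>x. \<Sum>i\<in>insert j I. (\<sigma>(j := s)) i * h i x) = (\<lambda>x. s * h j x + H x)"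
  proof
    fix x
    have "(\<Sum>i\<in>I. (\<sigma>(j := s)) i * h i x) = H x"
      unfolding H_def by (rule sum.cong) (use insert in auto)
    then show "(\<Sum>i\<in>insert j I. (\<sigma>(j := s)) i * h i x) = s * h j x + H x" using insert by simp
  qed
  ultimately have "(\<Sum>i\<in>insert j I. sqnorm M (h i)) \<le> sqnorm M (\<lambda>x. \<Sum>i\<in>insert j I. (\<sigma>(j := s)) i * h i x)"
    using insert.hyps by simp
  then show ?case using \<sigma> s by (intro exI[of _ "\<sigma>(j := s)"]) auto
qed

text \<open>Modulation by \<open>n \<xi>\<close> translates \<open>\<Omega>\<close> by \<open>-n \<xi>\<close> on the Fourier side, and these translates
  converge to the half-space \<open>{\<eta>. \<eta> \<bullet> v > 0}\<close>.\<close>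

lemma modulated_lower_bound:
  fixes v p1 \<xi> :: "'a::euclidean_space" and R R' \<Omega> :: "'a set"
  assumes \<Omega>: "open \<Omega>"
    and tangent: "\<And>\<eta>. \<eta> \<bullet> v > 0 \<Longrightarrow> \<forall>\<^sub>F t in at_top. \<eta> + t *\<^sub>R \<xi> \<in> \<Omega>" "\<And>\<eta> t. \<eta> \<bullet> v < 0 \<Longrightarrow> \<eta> + t *\<^sub>R \<xi> \<notin> \<Omega>"
    and Rm[measurable]: "R \<in> sets borel" "R' \<in> sets borel"
    and fin: "emeasure lborel R < \<infinity>" "emeasure lborel R' < \<infinity>"
    and v: "p1 \<bullet> v = 1"
    and R': "\<And>x. x \<in> R' \<Longrightarrow> p1 \<bullet> x \<in> {0..1}"
    and RR': "\<And>x s. x \<in> R' \<Longrightarrow> x + s *\<^sub>R v \<in> R \<longleftrightarrow> p1 \<bullet> x + s \<in> {2..3}"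
  shows "\<forall>\<^sub>F n in sequentially. measure lborel R' / (12 * pi) \<le>
    norm (ip lebesgue (set_multiplier \<Omega> (\<lambda>x. cis (2 * pi * (x \<bullet> (real n *\<^sub>R \<xi>))) * indicator R x))
      (\<lambda>x. cis (2 * pi * (x \<bullet> (real n *\<^sub>R \<xi>))) * indicator R' x))"
proof (cases "measure lborel R' = 0")
  case True
  then show ?thesis by simp
next
  case False
  define \<Phi> where "\<Phi> \<eta> = fi (indicator R) \<eta> * cnj (fi (indicator R') \<eta>)" for \<eta>
  have \<Phi>: "integrable lborel \<Phi>"
    and lower: "measure lborel R' / (6 * pi) \<le> norm (LINT \<eta>|lborel. indicator {\<eta>. \<eta> \<bullet> v > 0} \<eta> * \<Phi> \<eta>)"
    unfolding \<Phi>_def using halfspace_lower_bound[OF Rm fin v R' RR'] by auto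
  have \<Omega>m[measurable]: "\<Omega> \<in> sets borel" using \<Omega> by auto
  have \<Omega>L: "\<Omega> \<in> sets lebesgue" using \<Omega> by auto
  have \<Phi>m[measurable]: "\<Phi> \<in> borel_measurable borel" using \<Phi> by auto
  define e where "e n x = cis (2 * pi * (x \<bullet> (real n *\<^sub>R \<xi>)))" for n and x :: 'a
  have mod: "has_fourier_L2 (\<lambda>x. e n x * indicator A x) (\<lambda>\<eta>. fi (indicator A) (\<eta> - real n *\<^sub>R \<xi>))"
    if [measurable]: "A \<in> sets borel" and "emeasure lborel A < \<infinity>" for A n
  proof -
    have em[measurable]: "e n \<in> borel_measurable borel" unfolding e_def by measurable
    have i: "integrable lborel (\<lambda>x. e n x * indicator A x)"
      by (rule Bochner_Integration.integrable_bound[OF integrable_complex_indicator[of A lborel]])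
         (use that in \<open>auto simp: e_def norm_mult\<close>)
    have m: "(\<lambda>x. e n x * indicator A x) \<in> borel_measurable borel" by measurable
    have "(\<lambda>x. e n x * indicator A x) \<in> L2 lborel"
      by (rule L2_bounded_mult) (use that in \<open>auto simp: e_def\<close>)
    then have "has_fourier_L2 (\<lambda>x. e n x * indicator A x) (fourier_integral (\<lambda>x. e n x * indicator A x))"
      using i m by (intro has_fourier_L2_integrable) (simp_all add: L2_lebesgue_borel_iff integrable_completion)
    moreover have "fourier_integral (\<lambda>x. e n x * indicator A x) = (\<lambda>\<eta>. fi (indicator A) (\<eta> - real n *\<^sub>R \<xi>))"
      unfolding fourier_integral_borel[OF m] unfolding e_def by (rule ext) (rule fi_modulate)
    ultimately show ?thesis by simp
  qed
  have eq: "ip lebesgue (set_multiplier \<Omega> (\<lambda>x. e n x * indicator R x)) (\<lambda>x. e n x * indicator R' x)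
      = (LINT \<eta>|lborel. indicator \<Omega> (\<eta> + real n *\<^sub>R \<xi>) * \<Phi> \<eta>)" for n
  proof -
    have "ip lebesgue (set_multiplier \<Omega> (\<lambda>x. e n x * indicator R x)) (\<lambda>x. e n x * indicator R' x)
      = (LINT \<eta>|lebesgue. indicator \<Omega> \<eta> * \<Phi> (\<eta> - real n *\<^sub>R \<xi>))"
      unfolding ip_set_multiplier[OF \<Omega>L mod[OF Rm(1) fin(1)] mod[OF Rm(2) fin(2)]] unfolding ip_def \<Phi>_def
      by (simp add: mult.assoc)
    also have "\<dots> = (LINT \<eta>|lborel. indicator \<Omega> \<eta> * \<Phi> (\<eta> - real n *\<^sub>R \<xi>))"
      by (rule integral_completion) measurable
    also have "\<dots> = (LINT \<eta>|lborel. indicator \<Omega> (real n *\<^sub>R \<xi> + \<eta>) * \<Phi> (real n *\<^sub>R \<xi> + \<eta> - real n *\<^sub>R \<xi>))"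
      by (rule integral_lborel_translate[symmetric]) measurable
    finally show ?thesis by (simp add: add.commute)
  qed
  have "AE \<eta> in lborel. \<eta> \<bullet> v \<noteq> 0"
  proof -
    have "v \<noteq> 0" using v by auto
    then have "{\<eta>. v \<bullet> \<eta> = 0} \<in> null_sets lebesgue"
      using negligible_hyperplane[of v 0] by (simp add: negligible_iff_null_sets)
    then have "AE \<eta> in lebesgue. \<eta> \<notin> {\<eta>. v \<bullet> \<eta> = 0}" by (rule AE_not_in)
    then show ?thesis by (simp add: AE_lebesgue_iff inner_commute)
  qed
  then have pointwise: "AE \<eta> in lborel. (\<lambda>n. indicator \<Omega> (\<eta> + real n *\<^sub>R \<xi>) * \<Phi> \<eta>) \<longlonglongrightarrow> indicator {\<eta>. \<eta> \<bullet> v > 0} \<eta> * \<Phi> \<eta>"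
  proof eventually_elim
    case (elim \<eta>)
    have "\<forall>\<^sub>F n in sequentially. (\<eta> + real n *\<^sub>R \<xi> \<in> \<Omega>) = (\<eta> \<bullet> v > 0)"
    proof (cases "\<eta> \<bullet> v > 0")
      case True
      from eventually_compose_filterlim[OF tangent(1)[OF this] filterlim_real_sequentially]
      show ?thesis by eventually_elim (use True in simp)
    next
      case False
      then show ?thesis using tangent(2) elim by (intro always_eventually allI) auto
    qed
    then have "\<forall>\<^sub>F n in sequentially. indicator \<Omega> (\<eta> + real n *\<^sub>R \<xi>) * \<Phi> \<eta> = indicator {\<eta>. \<eta> \<bullet> v > 0} \<eta> * \<Phi> \<eta>"
      by eventually_elim (auto simp: indicator_def)
    then show ?case by (rule tendsto_eventually)
  qed
  have "(\<lambda>n. LINT \<eta>|lborel. indicator \<Omega> (\<eta> + real n *\<^sub>R \<xi>) * \<Phi> \<eta>) \<longlonglongrightarrow> (LINT \<eta>|lborel. indicator {\<eta>. \<eta> \<bullet> v > 0} \<eta> * \<Phi> \<eta>)"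
  proof (rule integral_dominated_convergence[where w="\<lambda>\<eta>. norm (\<Phi> \<eta>)"])
    show "AE \<eta> in lborel. norm (indicator \<Omega> (\<eta> + real n *\<^sub>R \<xi>) * \<Phi> \<eta>) \<le> norm (\<Phi> \<eta>)" for n
      by (rule AE_I2) (auto simp: indicator_def)
  qed (use \<Phi> pointwise in auto)
  then have lim: "(\<lambda>n. norm (LINT \<eta>|lborel. indicator \<Omega> (\<eta> + real n *\<^sub>R \<xi>) * \<Phi> \<eta>)) \<longlonglongrightarrow>
      norm (LINT \<eta>|lborel. indicator {\<eta>. \<eta> \<bullet> v > 0} \<eta> * \<Phi> \<eta>)" by (rule tendsto_norm)
  have "measure lborel R' > 0" using False by (simp add: less_le)
  \<comment> \<open>Halving the constant creates the strict inequality that passes from the limit to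
    all large n.\<close>
  then have "measure lborel R' / (12 * pi) < measure lborel R' / (6 * pi)" by (intro divide_strict_left_mono) auto
  also note lower
  finally have "\<forall>\<^sub>F n in sequentially. measure lborel R' / (12 * pi) <
      norm (LINT \<eta>|lborel. indicator \<Omega> (\<eta> + real n *\<^sub>R \<xi>) * \<Phi> \<eta>)" by (rule order_tendstoD(1)[OF lim])
  then show ?thesis unfolding eq[symmetric] e_def by (rule eventually_mono) (rule less_imp_le)
qed

text \<open>If m is the measure of one tube in \<open>R'\<close>, Cauchy--Schwarz gives (m/(12
  pi))^2 at most m times the squared norm on \<open>E\<close> of the image, that is a squared norm
  of at least m/(144 pi^2); summing over the tubes turns m into \<open>c\<close>. Radius and
  \<kappa> are produced before \<epsilon>, as the contradiction will require.\<close>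

lemma Kakeya_test_functions:
  fixes \<Omega> :: "'a::euclidean_space set"
  assumes \<Omega>: "open \<Omega>" and w: "p1 \<bullet> w = 0" "p2 \<bullet> w = 1"
    and tangents: "\<And>a. a \<in> {0..1} \<Longrightarrow> \<exists>v \<xi>. p1 \<bullet> v = 1 \<and> p2 \<bullet> v = a \<and> norm v \<le> M \<and>
      (\<forall>\<eta>. \<eta> \<bullet> v > 0 \<longrightarrow> (\<forall>\<^sub>F t in at_top. \<eta> + t *\<^sub>R \<xi> \<in> \<Omega>)) \<and>
      (\<forall>\<eta> t. \<eta> \<bullet> v < 0 \<longrightarrow> \<eta> + t *\<^sub>R \<xi> \<notin> \<Omega>)"
  obtains \<rho> \<kappa> :: real where "\<kappa> > 0"
    "\<And>\<epsilon>. \<epsilon> > 0 \<Longrightarrow> \<exists>f E. f \<in> borel_measurable borel \<and> (\<forall>x. norm (f x :: complex) \<le> indicator (cball 0 \<rho>) x) \<and>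
       E \<in> sets borel \<and> E \<subseteq> cball 0 \<rho> \<and> emeasure lborel E \<le> ennreal \<epsilon> \<and>
       \<kappa> \<le> sqnorm lebesgue (\<lambda>x. indicator E x * set_multiplier \<Omega> f x)"
proof -
  have \<Omega>L: "\<Omega> \<in> sets lebesgue" using \<Omega> by auto
  have "\<forall>a. \<exists>v \<xi>. a \<in> {0..1} \<longrightarrow> p1 \<bullet> v = 1 \<and> p2 \<bullet> v = a \<and> norm v \<le> M \<and>
      (\<forall>\<eta>. \<eta> \<bullet> v > 0 \<longrightarrow> (\<forall>\<^sub>F t in at_top. \<eta> + t *\<^sub>R \<xi> \<in> \<Omega>)) \<and> (\<forall>\<eta> t. \<eta> \<bullet> v < 0 \<longrightarrow> \<eta> + t *\<^sub>R \<xi> \<notin> \<Omega>)"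
    using tangents by blast
  from choice[OF this] obtain v where "\<forall>a. \<exists>\<xi>. a \<in> {0..1} \<longrightarrow> p1 \<bullet> v a = 1 \<and> p2 \<bullet> v a = a \<and> norm (v a) \<le> M \<and>
      (\<forall>\<eta>. \<eta> \<bullet> v a > 0 \<longrightarrow> (\<forall>\<^sub>F t in at_top. \<eta> + t *\<^sub>R \<xi> \<in> \<Omega>)) \<and> (\<forall>\<eta> t. \<eta> \<bullet> v a < 0 \<longrightarrow> \<eta> + t *\<^sub>R \<xi> \<notin> \<Omega>)" ..
  from choice[OF this] obtain \<xi> where v\<xi>: "\<And>a. a \<in> {0..1} \<Longrightarrow> p1 \<bullet> v a = 1 \<and> p2 \<bullet> v a = a \<and> norm (v a) \<le> M \<and>
      (\<forall>\<eta>. \<eta> \<bullet> v a > 0 \<longrightarrow> (\<forall>\<^sub>F t in at_top. \<eta> + t *\<^sub>R \<xi> a \<in> \<Omega>)) \<and> (\<forall>\<eta> t. \<eta> \<bullet> v a < 0 \<longrightarrow> \<eta> + t *\<^sub>R \<xi> a \<notin> \<Omega>)" by blast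
  have vM: "p1 \<bullet> v a = 1 \<and> p2 \<bullet> v a = a \<and> norm (v a) \<le> M" if "a \<in> {0..1}" for a using v\<xi>[OF that] by blast
  obtain c K where c: "c > 0" and tubes: "\<And>\<epsilon>. \<epsilon> > 0 \<Longrightarrow> \<exists>(I :: (nat \<Rightarrow> nat) set) a b \<delta>. finite I \<and> (\<forall>i\<in>I. a i \<in> {0..1}) \<and>
       disjoint_family_on (\<lambda>i. tube p1 p2 \<delta> K (v (a i)) (a i) (b i) {2..3}) I \<and>
       emeasure lborel (\<Union>i\<in>I. tube p1 p2 \<delta> K (v (a i)) (a i) (b i) {2..3}) \<ge> ennreal c \<and>
       emeasure lborel (\<Union>i\<in>I. tube p1 p2 \<delta> K (v (a i)) (a i) (b i) {0..1}) \<le> ennreal \<epsilon>"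
    by (rule Kakeya_tubes[OF w vM]) blast+
  define \<rho> where "\<rho> = 3 * M + K"
  show ?thesis
  proof (rule that[of "c / (144 * pi\<^sup>2)" \<rho>])
    show "c / (144 * pi\<^sup>2) > 0" using c by simp
    fix \<epsilon> :: real assume "\<epsilon> > 0"
    from tubes[OF this] obtain I :: "(nat \<Rightarrow> nat) set" and a b \<delta> where I: "finite I" and a: "\<And>i. i \<in> I \<Longrightarrow> a i \<in> {0..1}"
      and disj: "disjoint_family_on (\<lambda>i. tube p1 p2 \<delta> K (v (a i)) (a i) (b i) {2..3}) I"
      and large: "emeasure lborel (\<Union>i\<in>I. tube p1 p2 \<delta> K (v (a i)) (a i) (b i) {2..3}) \<ge> ennreal c"
      and small: "emeasure lborel (\<Union>i\<in>I. tube p1 p2 \<delta> K (v (a i)) (a i) (b i) {0..1}) \<le> ennreal \<epsilon>"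
      by blast
    define R where "R i = tube p1 p2 \<delta> K (v (a i)) (a i) (b i) {2..3}" for i
    define R' where "R' i = tube p1 p2 \<delta> K (v (a i)) (a i) (b i) {0..1}" for i
    define E where "E = (\<Union>i\<in>I. R' i)"
    have Rm[measurable]: "R i \<in> sets borel" "R' i \<in> sets borel" for i unfolding R_def R'_def by auto
    have Em[measurable]: "E \<in> sets borel" unfolding E_def using I by (intro sets.finite_UN) auto
    have EL: "E \<in> sets lebesgue" by (simp add: Em sets_completionI_sets)
    have sub: "R i \<subseteq> cball 0 \<rho>" "R' i \<subseteq> cball 0 \<rho>" if "i \<in> I" for i
      using tube_bounded[of "v (a i)" M "{2..3}" _ p1 p2 \<delta> K "a i" "b i"]
        tube_bounded[of "v (a i)" M "{0..1}" _ p1 p2 \<delta> K "a i" "b i"] vM[OF a[OF that]]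
      by (auto simp: R_def R'_def \<rho>_def)
    have fin: "emeasure lborel (R i) < \<infinity>" "emeasure lborel (R' i) < \<infinity>" if "i \<in> I" for i
      using sub[OF that] by (meson bounded_cball bounded_subset emeasure_bounded_finite)+
    have "\<forall>\<^sub>F n in sequentially. measure lborel (R' i) / (12 * pi) \<le>
        norm (ip lebesgue (set_multiplier \<Omega> (\<lambda>x. cis (2 * pi * (x \<bullet> (real n *\<^sub>R \<xi> (a i)))) * indicator (R i) x))
          (\<lambda>x. cis (2 * pi * (x \<bullet> (real n *\<^sub>R \<xi> (a i)))) * indicator (R' i) x))" if i: "i \<in> I" for i
    proof (rule modulated_lower_bound[OF \<Omega> _ _ Rm fin[OF i]])
      note va = v\<xi>[OF a[OF i]]
      show "p1 \<bullet> v (a i) = 1" using va by blast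
      show "\<forall>\<^sub>F t in at_top. \<eta> + t *\<^sub>R \<xi> (a i) \<in> \<Omega>" if "\<eta> \<bullet> v (a i) > 0" for \<eta> using va that by blast
      show "\<eta> + t *\<^sub>R \<xi> (a i) \<notin> \<Omega>" if "\<eta> \<bullet> v (a i) < 0" for \<eta> t using va that by blast
      fix x assume x: "x \<in> R' i"
      then show "p1 \<bullet> x \<in> {0..1}" by (simp add: R'_def tube_def)
      have "x \<in> tube p1 p2 \<delta> K (v (a i)) (a i) (b i) UNIV" using x by (simp add: R'_def tube_def)
      moreover have "p2 \<bullet> v (a i) = a i" "p1 \<bullet> v (a i) = 1" using va by blast+
      ultimately show "x + s *\<^sub>R v (a i) \<in> R i \<longleftrightarrow> p1 \<bullet> x + s \<in> {2..3}" for s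
        unfolding R_def by (subst tube_translate) auto
    qed
    \<comment> \<open>There are finitely many tubes, so one modulation parameter n serves them
      all.\<close>
    then have "\<forall>\<^sub>F n in sequentially. \<forall>i\<in>I. measure lborel (R' i) / (12 * pi) \<le>
        norm (ip lebesgue (set_multiplier \<Omega> (\<lambda>x. cis (2 * pi * (x \<bullet> (real n *\<^sub>R \<xi> (a i)))) * indicator (R i) x))
          (\<lambda>x. cis (2 * pi * (x \<bullet> (real n *\<^sub>R \<xi> (a i)))) * indicator (R' i) x))"
      using I by (intro eventually_ball_finite) auto
    from eventually_happens'[OF sequentially_bot this] obtain n where n: "\<And>i. i \<in> I \<Longrightarrow> measure lborel (R' i) / (12 * pi) \<le>
        norm (ip lebesgue (set_multiplier \<Omega> (\<lambda>x. cis (2 * pi * (x \<bullet> (real n *\<^sub>R \<xi> (a i)))) * indicator (R i) x))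
          (\<lambda>x. cis (2 * pi * (x \<bullet> (real n *\<^sub>R \<xi> (a i)))) * indicator (R' i) x))"
      by blast
    define e where "e i x = cis (2 * pi * (x \<bullet> (real n *\<^sub>R \<xi> (a i))))" for i x
    have em[measurable]: "e i \<in> borel_measurable borel" for i unfolding e_def by measurable
    have ne: "norm (e i x) = 1" for i x by (simp add: e_def)
    define f where "f i x = e i x * indicator (R i) x" for i x
    define g where "g i x = e i x * indicator (R' i) x" for i x
    have fL: "f i \<in> L2 lebesgue" and gL: "g i \<in> L2 lebesgue" if "i \<in> I" for i
    proof -
      have m: "f i \<in> borel_measurable borel" "g i \<in> borel_measurable borel" unfolding f_def g_def by measurable
      have "f i \<in> L2 lborel" "g i \<in> L2 lborel"
        unfolding f_def g_def by (rule L2_bounded_mult; use fin[OF that] ne in auto)+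
      then show "f i \<in> L2 lebesgue" "g i \<in> L2 lebesgue" using m by (auto simp: L2_lebesgue_borel_iff)
    qed
    have SL: "set_multiplier \<Omega> (f i) \<in> L2 lebesgue" if "i \<in> I" for i
      by (rule set_multiplier_L2[OF \<Omega>L fL[OF that]])
    define h where "h i x = indicator E x * set_multiplier \<Omega> (f i) x" for i x
    have hL: "h i \<in> L2 lebesgue" if "i \<in> I" for i
      unfolding h_def by (rule L2_indicator_mult[OF SL[OF that] EL])
    have h_lower: "measure lborel (R' i) / (144 * pi\<^sup>2) \<le> sqnorm lebesgue (h i)" if i: "i \<in> I" for i
    proof (cases "measure lborel (R' i) = 0")
      case False
      define m where "m = measure lborel (R' i)"
      have m: "m > 0" using False by (simp add: m_def less_le)
      have sg: "sqnorm lebesgue (g i) = m"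
      proof -
        have "sqnorm lebesgue (g i) = sqnorm lebesgue (indicator (R' i))"
          unfolding sqnorm_def g_def by (simp add: norm_mult ne)
        also have "\<dots> = m" by (subst sqnorm_indicator) (auto simp: m_def sets_completionI_sets)
        finally show ?thesis .
      qed
      \<comment> \<open>The test function \<open>g i\<close> lives on \<open>R' i\<close>, a part of
        \<open>E\<close>, so the cut-off to \<open>E\<close> leaves the pairing unchanged.\<close>
      have "ip lebesgue (set_multiplier \<Omega> (f i)) (g i) = ip lebesgue (h i) (g i)"
        unfolding ip_def h_def g_def
        by (rule Bochner_Integration.integral_cong) (use i in \<open>auto simp: indicator_def E_def\<close>)
      then have "m / (12 * pi) \<le> norm (ip lebesgue (h i) (g i))"
        using n[OF i] unfolding m_def f_def[symmetric] g_def[symmetric] by (simp add: f_def[abs_def] g_def[abs_def] e_def)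
      also have "\<dots> \<le> norm2 lebesgue (h i) * norm2 lebesgue (g i)"
        by (rule Cauchy_Schwarz[OF hL[OF i] gL[OF i]])
      finally have "(m / (12 * pi))\<^sup>2 \<le> (norm2 lebesgue (h i) * norm2 lebesgue (g i))\<^sup>2"
        using m by (intro power_mono) auto
      also have "\<dots> = sqnorm lebesgue (h i) * m"
        by (simp add: power_mult_distrib norm2_power2 sg)
      finally show ?thesis unfolding m_def[symmetric] using m by (simp add: power2_eq_square field_simps)
    qed simp
    from greedy_signs[where h=h and M=lebesgue, OF I(1) hL] obtain \<sigma> where \<sigma>: "\<And>i. norm (\<sigma> i :: complex) = 1"
      and greedy: "(\<Sum>i\<in>I. sqnorm lebesgue (h i)) \<le> sqnorm lebesgue (\<lambda>x. \<Sum>i\<in>I. \<sigma> i * h i x)"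
      by blast
    define F where "F x = (\<Sum>i\<in>I. \<sigma> i * f i x)" for x
    have FL: "F \<in> L2 lebesgue" unfolding F_def by (intro L2_sum L2_cmult fL)
    have Fm: "F \<in> borel_measurable borel" unfolding F_def f_def by measurable
    \<comment> \<open>The tubes \<open>R i\<close> are disjoint, so at most one summand is nonzero
      at each point.\<close>
    have Fb: "norm (F x) \<le> indicator (cball 0 \<rho>) x" for x
    proof -
      have "norm (F x) \<le> (\<Sum>i\<in>I. indicator (R i) x)"
        unfolding F_def by (rule sum_norm_le) (simp add: f_def norm_mult \<sigma> ne indicator_def)
      also have "\<dots> = indicator (\<Union>i\<in>I. R i) x"
        by (rule indicator_UN_disjoint[OF I disj[folded R_def], symmetric])
      also have "\<dots> \<le> indicator (cball 0 \<rho>) x"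
      proof -
        have "(\<Union>i\<in>I. R i) \<subseteq> cball 0 \<rho>" using sub(1) by blast
        from subsetD[OF this, of x] show ?thesis
          unfolding indicator_def by (cases "x \<in> (\<Union>i\<in>I. R i)") (simp_all del: mem_cball mem_cball_0 UN_iff)
      qed
      finally show ?thesis .
    qed
    have "AE x in lebesgue. set_multiplier \<Omega> F x = (\<Sum>i\<in>I. \<sigma> i * set_multiplier \<Omega> (f i) x)"
      unfolding F_def[abs_def] by (rule set_multiplier_sum_AE[OF \<Omega>L fL])
    then have "AE x in lebesgue. (\<Sum>i\<in>I. \<sigma> i * h i x) = indicator E x * set_multiplier \<Omega> F x"
      by eventually_elim (simp add: h_def sum_distrib_left mult_ac)
    then have SF: "sqnorm lebesgue (\<lambda>x. \<Sum>i\<in>I. \<sigma> i * h i x) = sqnorm lebesgue (\<lambda>x. indicator E x * set_multiplier \<Omega> F x)"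
      using hL set_multiplier_L2[OF \<Omega>L FL] EL by (intro sqnorm_cong_AE) (auto intro!: L2_meas L2_indicator_mult)
    \<comment> \<open>The lower bound concerns the disjoint \<open>R i\<close>. It passes to the
      \<open>R' i\<close> tube by tube, as a sum of measures; the union of the \<open>R' i\<close>
      is small.\<close>
    have "c \<le> (\<Sum>i\<in>I. measure lborel (R' i))"
    proof -
      have "ennreal c \<le> emeasure lborel (\<Union>i\<in>I. R i)" using large by (simp add: R_def)
      also have "\<dots> = (\<Sum>i\<in>I. emeasure lborel (R i))"
        by (rule sum_emeasure[symmetric]) (use disj I in \<open>auto simp: R_def[abs_def]\<close>)
      also have "\<dots> = (\<Sum>i\<in>I. emeasure lborel (R' i))"
        by (rule sum.cong[OF refl]) (use vM[OF a] in \<open>simp add: R_def R'_def tube_measure_eq\<close>)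
      also have "\<dots> = (\<Sum>i\<in>I. ennreal (measure lborel (R' i)))"
        by (rule sum.cong[OF refl]) (use fin in \<open>simp add: emeasure_eq_ennreal_measure less_top[symmetric]\<close>)
      also have "\<dots> = ennreal (\<Sum>i\<in>I. measure lborel (R' i))" by (rule sum_ennreal) auto
      finally show ?thesis by (simp add: sum_nonneg)
    qed
    then have "c / (144 * pi\<^sup>2) \<le> (\<Sum>i\<in>I. measure lborel (R' i) / (144 * pi\<^sup>2))"
      unfolding sum_divide_distrib[symmetric] by (intro divide_right_mono) auto
    also have "\<dots> \<le> (\<Sum>i\<in>I. sqnorm lebesgue (h i))" by (rule sum_mono) (rule h_lower)
    also note greedy
    also note SF
    finally have low: "c / (144 * pi\<^sup>2) \<le> sqnorm lebesgue (\<lambda>x. indicator E x * set_multiplier \<Omega> F x)" .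
    have Esub: "E \<subseteq> cball 0 \<rho>" using sub unfolding E_def by blast
    have Esmall: "emeasure lborel E \<le> ennreal \<epsilon>" using small unfolding E_def R'_def .
    show "\<exists>f E. f \<in> borel_measurable borel \<and> (\<forall>x. norm (f x :: complex) \<le> indicator (cball 0 \<rho>) x) \<and>
       E \<in> sets borel \<and> E \<subseteq> cball 0 \<rho> \<and> emeasure lborel E \<le> ennreal \<epsilon> \<and>
       c / (144 * pi\<^sup>2) \<le> sqnorm lebesgue (\<lambda>x. indicator E x * set_multiplier \<Omega> f x)"
      using Fm Fb Em Esub Esmall low by blast
  qed
qed

subsection \<open>The two implications\<close>

lemma local_fourier_multiplier_sufficient:
  fixes \<Omega> :: "'a::euclidean_space set"
  assumes \<Omega>: "\<Omega> \<in> sets lebesgue" and q: "1 \<le> q" "q \<le> 2" and p: "2 \<le> p"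
  shows "local_fourier_multiplier p q \<Omega>"
  unfolding local_fourier_multiplier_def
proof (intro allI impI)
  fix B :: "'a set" assume B: "bounded B \<and> B \<in> sets lebesgue"
  have Bfin: "emeasure lebesgue B < \<infinity>"
    using bounded_set_imp_lmeasurable[of B] B by (simp add: fmeasurable_def)
  obtain K where K: "K \<ge> 0" "\<And>g. g \<in> L2 lebesgue \<Longrightarrow> Lp_norm q (\<lambda>x. indicator B x * g x) \<le> ennreal (K * norm2 lebesgue g)"
    using Lp_norm_le_norm2[OF q _ Bfin] B by auto
  obtain K' where K'0: "K' \<ge> 0" and K'1: "\<forall>f A. f \<in> borel_measurable lebesgue \<longrightarrow> (\<lambda>x. f x * indicator B x) \<in> L2 lebesgue \<longrightarrow> A \<ge> 0 \<longrightarrow>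
      Lp_norm p f \<le> ennreal A \<longrightarrow> norm2 lebesgue (\<lambda>x. f x * indicator B x) \<le> K' * A"
    using norm2_le_Lp_norm[OF p conjunct2[OF B] Bfin] by auto
  note K' = K'0 K'1[rule_format]
  show "\<exists>C\<ge>0. \<forall>f\<in>Lp_space p. (\<lambda>y. f y * indicator B y) \<in> Lp_space 2 \<longrightarrow>
      Lp_norm q (localized_multiplier \<Omega> B f) \<le> ennreal C * Lp_norm p f"
  proof (intro exI[of _ "K * K'"] conjI ballI impI)
    show "K * K' \<ge> 0" using K K' by simp
    fix f :: "'a \<Rightarrow> complex" assume f: "f \<in> Lp_space p" and fB: "(\<lambda>y. f y * indicator B y) \<in> Lp_space 2"
    have fm: "f \<in> borel_measurable lebesgue" and "Lp_norm p f < \<infinity>" using f by (auto simp: Lp_space_def)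
    then obtain A where A: "Lp_norm p f = ennreal A" "A \<ge> 0" by (cases "Lp_norm p f") auto
    have fL: "(\<lambda>y. f y * indicator B y) \<in> L2 lebesgue" using fB by (simp add: Lp_space_2)
    let ?S = "set_multiplier \<Omega> (\<lambda>y. f y * indicator B y)"
    have "K * norm2 lebesgue ?S \<le> K * (K' * A)"
      using norm2_set_multiplier[OF \<Omega> fL] K'(2)[OF fm fL A(2)] A(1) K(1) by (intro mult_left_mono) auto
    then have S: "ennreal (K * norm2 lebesgue ?S) \<le> ennreal (K * K') * ennreal A"
      using K K' A by (simp add: ennreal_mult[symmetric] ennreal_leI mult.assoc)
    have "Lp_norm q (localized_multiplier \<Omega> B f) \<le> ennreal (K * norm2 lebesgue ?S)"
      unfolding localized_multiplier_def by (rule K(2)[OF set_multiplier_L2[OF \<Omega> fL]])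
    also note S
    finally show "Lp_norm q (localized_multiplier \<Omega> B f) \<le> ennreal (K * K') * Lp_norm p f" by (simp add: A)
  qed
qed

text \<open>The order of choices matters: the operator bound \<open>C\<close> belongs to the fixed
  ball, \<epsilon> is then computed from \<open>C\<close>, the volume of the ball and \<kappa>, and
  only afterwards are \<open>f\<close> and \<open>E\<close> taken.\<close>

lemma local_fourier_multiplier_necessary:
  fixes \<Omega> :: "'a::euclidean_space set"
  assumes \<Omega>: "open \<Omega>" and mult: "local_fourier_multiplier p q \<Omega>" and p: "1 \<le> p" and q: "1 \<le> q"
    and \<kappa>: "\<kappa> > 0"
    and test: "\<And>\<epsilon>. \<epsilon> > 0 \<Longrightarrow> \<exists>f E. f \<in> borel_measurable borel \<and> (\<forall>x. norm (f x :: complex) \<le> indicator (cball 0 \<rho>) x) \<and>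
       E \<in> sets borel \<and> E \<subseteq> cball 0 \<rho> \<and> emeasure lborel E \<le> ennreal \<epsilon> \<and>
       \<kappa> \<le> sqnorm lebesgue (\<lambda>x. indicator E x * set_multiplier \<Omega> f x)"
  shows "q \<le> 2 \<and> 2 \<le> p"
proof -
  have \<Omega>L: "\<Omega> \<in> sets lebesgue" using \<Omega> by auto
  define B where "B = cball (0::'a) \<rho>"
  have B: "bounded B" "B \<in> sets lebesgue" by (auto simp: B_def)
  have Bfin: "emeasure lebesgue B < \<infinity>"
    using emeasure_bounded_finite[OF bounded_cball[of "0::'a" \<rho>]] by (simp add: B_def)
  obtain C where C: "C \<ge> 0" "\<And>f. f \<in> Lp_space p \<Longrightarrow> (\<lambda>y. f y * indicator B y) \<in> Lp_space 2 \<Longrightarrow>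
      Lp_norm q (localized_multiplier \<Omega> B f) \<le> ennreal C * Lp_norm p f"
  proof -
    have "\<exists>C::real. C \<ge> 0 \<and> (\<forall>f \<in> Lp_space p. (\<lambda>y. f y * indicator B y) \<in> Lp_space 2 \<longrightarrow>
       Lp_norm q (localized_multiplier \<Omega> B f) \<le> ennreal C * Lp_norm p f)"
      using mult[unfolded local_fourier_multiplier_def, rule_format, of B] B by simp
    then obtain C where "C \<ge> 0" "\<forall>f \<in> Lp_space p. (\<lambda>y. f y * indicator B y) \<in> Lp_space 2 \<longrightarrow>
       Lp_norm q (localized_multiplier \<Omega> B f) \<le> ennreal C * Lp_norm p f" by (elim exE conjE)
    then show thesis by (intro that[of C]) simp_all
  qed
  have loc: "localized_multiplier \<Omega> B f = (\<lambda>x. indicator B x * set_multiplier \<Omega> f x)"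
    "(\<lambda>y. f y * indicator B y) = f" if "\<And>x. x \<notin> B \<Longrightarrow> f x = 0" for f
  proof -
    show "(\<lambda>y. f y * indicator B y) = f"
    proof
      show "f y * indicator B y = f y" for y by (cases "y \<in> B") (simp_all add: that)
    qed
    then show "localized_multiplier \<Omega> B f = (\<lambda>x. indicator B x * set_multiplier \<Omega> f x)"
      by (simp add: localized_multiplier_def)
  qed
  define m where "m = measure lebesgue B + 1"
  have m: "m > 0" by (simp add: m_def add_nonneg_pos)
  have bounded_fun: "f \<in> L2 lebesgue" "sqnorm lebesgue f \<le> m" "Lp_norm p f \<le> ennreal m" "\<And>x. x \<notin> B \<Longrightarrow> f x = 0"
    if fm: "f \<in> borel_measurable borel" and fb: "\<And>x. norm (f x :: complex) \<le> indicator (cball 0 \<rho>) x" for f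
  proof -
    have fmL: "f \<in> borel_measurable lebesgue" by (rule borel_imp_lebesgue[OF fm])
    have iL: "(indicator B :: 'a \<Rightarrow> complex) \<in> L2 lebesgue" using B Bfin by auto
    have le: "AE x in lebesgue. norm (f x) \<le> norm (indicator B x :: complex)"
    proof (rule AE_I2)
      show "norm (f x) \<le> norm (indicator B x :: complex)" for x
        using fb[of x] by (cases "x \<in> B") (simp_all add: B_def)
    qed
    show "f \<in> L2 lebesgue" by (rule L2_bound[OF iL fmL le])
    have "sqnorm lebesgue f \<le> sqnorm lebesgue (indicator B)" by (rule sqnorm_mono[OF iL fmL le])
    then show "sqnorm lebesgue f \<le> m" using B by (simp add: sqnorm_indicator m_def)
    show "Lp_norm p f \<le> ennreal m"
      unfolding m_def by (rule Lp_norm_bounded_support[OF p B(2) Bfin fmL]) (use fb in \<open>simp add: B_def\<close>)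
    show "f x = 0" if "x \<notin> B" for x using fb[of x] that by (simp add: B_def)
  qed
  have "\<not> 2 < q"
  proof
    assume q2: "2 < q"
    have "C * m \<ge> 0" using C m by simp
    from Lp_bound_imp_small_norm2[OF q2 this \<kappa>]
    obtain \<epsilon> where \<epsilon>: "\<epsilon> > 0" and sm: "\<And>(g :: 'a \<Rightarrow> complex) E. g \<in> L2 lebesgue \<Longrightarrow> Lp_norm q g \<le> ennreal (C * m) \<Longrightarrow>
      E \<in> sets lebesgue \<Longrightarrow> emeasure lebesgue E \<le> ennreal \<epsilon> \<Longrightarrow> sqnorm lebesgue (\<lambda>x. indicator E x * g x) < \<kappa>" by blast
    obtain f E where f: "f \<in> borel_measurable borel" "\<And>x. norm (f x :: complex) \<le> indicator (cball 0 \<rho>) x"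
      and E: "E \<in> sets borel" "E \<subseteq> cball 0 \<rho>" "emeasure lborel E \<le> ennreal \<epsilon>"
      and low: "\<kappa> \<le> sqnorm lebesgue (\<lambda>x. indicator E x * set_multiplier \<Omega> f x)"
      using test[OF \<epsilon>] by blast
    note bf = bounded_fun[OF f]
    have EL: "E \<in> sets lebesgue" using E by (simp add: sets_completionI_sets)
    have "f \<in> Lp_space p" using bf borel_imp_lebesgue[OF f(1)] by (auto simp: Lp_space_def intro: le_less_trans)
    moreover have "(\<lambda>y. f y * indicator B y) \<in> Lp_space 2" using loc(2)[OF bf(4)] bf(1) by (simp add: Lp_space_2)
    ultimately have "Lp_norm q (\<lambda>x. indicator B x * set_multiplier \<Omega> f x) \<le> ennreal C * Lp_norm p f"
      using C(2)[of f] loc(1)[OF bf(4)] by simp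
    also have "\<dots> \<le> ennreal C * ennreal m" by (intro mult_left_mono bf) auto
    also have "\<dots> = ennreal (C * m)" using C m by (simp add: ennreal_mult)
    finally have "sqnorm lebesgue (\<lambda>x. indicator E x * (indicator B x * set_multiplier \<Omega> f x)) < \<kappa>"
      using E by (intro sm L2_indicator_mult set_multiplier_L2 \<Omega>L bf(1) B EL) auto
    moreover have "(\<lambda>x. indicator E x * (indicator B x * set_multiplier \<Omega> f x)) = (\<lambda>x. indicator E x * set_multiplier \<Omega> f x)"
      using E(2) unfolding B_def[symmetric] by (intro ext) (auto simp: indicator_def)
    ultimately show False using low by simp
  qed
  moreover have "\<not> p < 2"
  proof
    assume p2: "p < 2"
    obtain \<tau> where \<tau>: "\<tau> > 0" and L1: "\<And>g. g \<in> borel_measurable lebesgue \<Longrightarrow> Lp_norm q g \<le> ennreal \<tau> \<Longrightarrow>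
      (\<integral>\<^sup>+x. ennreal (norm (g x)) * indicator B x \<partial>lebesgue) \<le> ennreal (\<kappa> / 2)"
      using small_Lp_norm_imp_small_L1[OF q B(2) Bfin, of "\<kappa> / 2"] \<kappa> by auto
    \<comment> \<open>Chosen backwards: the target \<kappa>/2 for the L1 norm of \<open>S h\<close>
      on the ball gives \<tau>, and \<tau> gives the bound \<open>k\<close> for the L^p norm of h.
      Using C + 1 covers C = 0.\<close>
    define k where "k = \<tau> / (C + 1)"
    have k: "k > 0" "C * k \<le> \<tau>" using \<tau> C by (auto simp: k_def field_simps)
    from small_support_imp_small_Lp_norm[OF p p2 less_imp_le[OF m] k(1)]
    obtain \<epsilon> where \<epsilon>: "\<epsilon> > 0" and sm: "\<And>(g :: 'a \<Rightarrow> complex) E. g \<in> L2 lebesgue \<Longrightarrow> sqnorm lebesgue g \<le> m \<Longrightarrow>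
      E \<in> sets lebesgue \<Longrightarrow> emeasure lebesgue E \<le> ennreal \<epsilon> \<Longrightarrow> Lp_norm p (\<lambda>x. indicator E x * g x) \<le> ennreal k" by blast
    obtain f E where f: "f \<in> borel_measurable borel" "\<And>x. norm (f x :: complex) \<le> indicator (cball 0 \<rho>) x"
      and E: "E \<in> sets borel" "E \<subseteq> cball 0 \<rho>" "emeasure lborel E \<le> ennreal \<epsilon>"
      and low: "\<kappa> \<le> sqnorm lebesgue (\<lambda>x. indicator E x * set_multiplier \<Omega> f x)"
      using test[OF \<epsilon>] by blast
    note bf = bounded_fun[OF f]
    have EL: "E \<in> sets lebesgue" using E by (simp add: sets_completionI_sets)
    let ?S = "set_multiplier \<Omega> f"
    have SL: "?S \<in> L2 lebesgue" by (rule set_multiplier_L2[OF \<Omega>L bf(1)])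
    have "(norm2 lebesgue ?S)\<^sup>2 \<le> (norm2 lebesgue f)\<^sup>2"
      by (intro power_mono norm2_set_multiplier[OF \<Omega>L bf(1)]) auto
    then have Sm: "sqnorm lebesgue ?S \<le> m" using bf(2) by (simp add: norm2_power2)
    define h where "h x = indicator E x * ?S x" for x
    have hL: "h \<in> L2 lebesgue" unfolding h_def by (rule L2_indicator_mult[OF SL EL])
    have h0: "h x = 0" if "x \<notin> B" for x using that E(2) unfolding B_def[symmetric] by (auto simp: h_def indicator_def)
    have hp: "Lp_norm p h \<le> ennreal k" unfolding h_def[abs_def] by (rule sm[OF SL Sm EL]) (use E in simp)
    have "h \<in> Lp_space p" using hp L2_meas[OF hL] by (auto simp: Lp_space_def intro: le_less_trans)
    moreover have "(\<lambda>y. h y * indicator B y) \<in> Lp_space 2" using loc(2)[OF h0] hL by (simp add: Lp_space_2)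
    ultimately have "Lp_norm q (\<lambda>x. indicator B x * set_multiplier \<Omega> h x) \<le> ennreal C * Lp_norm p h"
      using C(2)[of h] loc(1)[OF h0] by simp
    also have "\<dots> \<le> ennreal C * ennreal k" by (intro mult_left_mono hp) auto
    also have "\<dots> = ennreal (C * k)" using C k by (simp add: ennreal_mult)
    also have "\<dots> \<le> ennreal \<tau>" using k by (intro ennreal_leI)
    finally have "Lp_norm q (\<lambda>x. indicator B x * set_multiplier \<Omega> h x) \<le> ennreal \<tau>" .
    moreover have ShL: "set_multiplier \<Omega> h \<in> L2 lebesgue" by (rule set_multiplier_L2[OF \<Omega>L hL])
    ultimately have "(\<integral>\<^sup>+x. ennreal (norm (indicator B x * set_multiplier \<Omega> h x)) * indicator B x \<partial>lebesgue) \<le> ennreal (\<kappa> / 2)"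
      by (intro L1 L2_meas L2_indicator_mult B)
    \<comment> \<open>Self-adjointness pairs \<open>S h\<close> with \<open>f\<close>, which is
      bounded by 1 and supported in \<open>B\<close>; so the small L1 norm of \<open>S h\<close> on
      \<open>B\<close> bounds the squared norm of h, which is at least \<kappa>.\<close>
    moreover have "ip lebesgue h h = ip lebesgue f (set_multiplier \<Omega> h)"
    proof -
      have "ip lebesgue h h = ip lebesgue ?S h"
        unfolding ip_def by (rule Bochner_Integration.integral_cong) (auto simp: h_def indicator_def)
      also have "\<dots> = ip lebesgue f (set_multiplier \<Omega> h)"
        by (rule set_multiplier_selfadjoint[OF \<Omega>L bf(1) hL])
      finally show ?thesis .
    qed
    then have "sqnorm lebesgue h = norm (ip lebesgue f (set_multiplier \<Omega> h))" by (metis ip_self norm_of_real abs_of_nonneg sqnorm_nonneg)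
    moreover have "ennreal (norm (ip lebesgue f (set_multiplier \<Omega> h))) \<le>
       (\<integral>\<^sup>+x. ennreal (norm (indicator B x * set_multiplier \<Omega> h x)) * indicator B x \<partial>lebesgue)"
    proof -
      have "ennreal (norm (ip lebesgue f (set_multiplier \<Omega> h))) \<le> (\<integral>\<^sup>+x. ennreal (norm (f x * cnj (set_multiplier \<Omega> h x))) \<partial>lebesgue)"
        unfolding ip_def by (rule integral_norm_bound_ennreal[OF ip_integrable[OF bf(1) ShL]])
      also have "\<dots> \<le> (\<integral>\<^sup>+x. ennreal (norm (indicator B x * set_multiplier \<Omega> h x)) * indicator B x \<partial>lebesgue)"
      proof (rule nn_integral_mono)
        fix x
        show "ennreal (norm (f x * cnj (set_multiplier \<Omega> h x))) \<le> ennreal (norm (indicator B x * set_multiplier \<Omega> h x)) * indicator B x"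
        proof (cases "x \<in> B")
          case True
          have "norm (f x) \<le> 1" using f(2)[of x] by (rule order_trans) (simp add: indicator_def)
          then have "norm (f x) * norm (set_multiplier \<Omega> h x) \<le> norm (set_multiplier \<Omega> h x)"
            by (intro mult_left_le_one_le) auto
          then show ?thesis using True by (simp add: norm_mult ennreal_leI)
        next
          case False
          then show ?thesis using bf(4)[OF False] by simp
        qed
      qed
      finally show ?thesis .
    qed
    ultimately have "ennreal (sqnorm lebesgue h) \<le> ennreal (\<kappa> / 2)" by (metis order_trans)
    then have "sqnorm lebesgue h \<le> \<kappa> / 2" using \<kappa> by simp
    then show False using low \<kappa> by (simp add: h_def[abs_def])
  qed
  ultimately show ?thesis by (simp add: not_less)
qed

theorem theorem9:
  fixes \<Omega> :: "(real ^ 'n) set" and r :: nat and p q :: ennreal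
  assumes "symmetric_cone \<Omega>" and "irreducible_cone \<Omega>"
    and "has_cone_rank \<Omega> r" and "r \<ge> 2"
    and "1 \<le> p" and "p \<le> \<infinity>" and "1 \<le> q" and "q \<le> \<infinity>"
  shows "local_fourier_multiplier p q \<Omega> \<longleftrightarrow> 1 \<le> q \<and> q \<le> 2 \<and> 2 \<le> p \<and> p \<le> \<infinity>"
proof
  have op: "open \<Omega>"
    using assms(1) by (simp add: symmetric_cone_def symmetric_cone_in_def open_convex_cone_in_def)
  show "1 \<le> q \<and> q \<le> 2 \<and> 2 \<le> p \<and> p \<le> \<infinity>" if mult: "local_fourier_multiplier p q \<Omega>"
  proof -
    obtain p1 p2 w M where w: "p1 \<bullet> w = 0" "p2 \<bullet> w = 1" and tangents: "\<And>a. a \<in> {0..1} \<Longrightarrow> \<exists>v \<xi>. p1 \<bullet> v = 1 \<and> p2 \<bullet> v = a \<and> norm v \<le> M \<and>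
      (\<forall>\<eta>. \<eta> \<bullet> v > 0 \<longrightarrow> (\<forall>\<^sub>F t in at_top. \<eta> + t *\<^sub>R \<xi> \<in> \<Omega>)) \<and>
      (\<forall>\<eta> t. \<eta> \<bullet> v < 0 \<longrightarrow> \<eta> + t *\<^sub>R \<xi> \<notin> \<Omega>)"
      using irreducible_symmetric_cone_tangents[OF assms(1-4)] by (elim exE conjE) (rule that, assumption+, erule (1) bspec)
    have "q \<le> 2 \<and> 2 \<le> p"
      by (rule Kakeya_test_functions[OF op w tangents])
         (assumption, rule local_fourier_multiplier_necessary[OF op mult assms(5,7)])
    with assms show ?thesis by simp
  qed
  show "local_fourier_multiplier p q \<Omega>" if "1 \<le> q \<and> q \<le> 2 \<and> 2 \<le> p \<and> p \<le> \<infinity>"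
    using that op by (intro local_fourier_multiplier_sufficient) auto
qed

end
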